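(* Let $\mathbf q$ be a matrix of super-type $\mathbf A_r(q|\mathbb J)$, where $r\ge 2$, $\emptyset\neq\mathbb J\subseteq\mathbb I=\{1,\dots,r\}$ and $q$ has even order $N=2n>2$, with $q_{ij}=1$ for all $j\neq i,i+1$. Then the bosonization $\mathfrak B_{\mathbf q}\rtimes\Bbbk[G]$ of the Nichols algebra $\mathfrak B_{\mathbf q}$ is a unimodular Hopf algebra if and only if $q_{ii}=-1$ for all $i$ (i.e. $\mathbb J=\mathbb I$) and $r$ is even.
   Context: $\Bbbk$ is an algebraically closed field of characteristic zero. Super-type: let $r\ge2$, $\mathbb I=\{1,\dots,r\}$, $\mathbb J\subseteq\mathbb I$ non-empty, $q\in\Bbbk^\times$ of even order $N=2n>2$. For $\mathbf q=(q_{ij})\in(\Bbbk^\times)^{r\times r}$ put $\widetilde q_{ij}=q_{ij}q_{ji}$ for $i\ne j$. $\mathbf q$ is of super-type $\mathbf A_r(q|\mathbb J)$ if: (1) $q_{rr}^2\widetilde q_{r-1,r}=q$; (2) $\widetilde q_{ij}=1$ if $|i-j|\ge2$; (3) if $i\in\mathbb J$ then $q_{ii}=-1$ and $\widetilde q_{i-1,i}=\widetilde q_{i,i+1}^{\,-1}$; (4) if $i\notin\mathbb J$ then $q_{ii}=q^{\pm1}$ and $\widetilde q_{i-1,i}=q_{ii}^{-1}=\widetilde q_{i,i+1}$ (equalities involving indices outside $\mathbb I$ are omitted). Let $G=\langle g_1,\dots,g_r\mid g_i^N=1,\ g_ig_j=g_jg_i\rangle\cong(\mathbb Z/N)^r$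 and $\Lambda=(\mathbb Z/N)^r$ with standard generators $\alpha_1,\dots,\alpha_r$. $\Bbbk[G]=(\Bbbk G)^*$ has the basis $\delta_{\mathbf j}$, $\mathbf j\in\Lambda$, dual to the basis $g_{\mathbf j}=g_1^{j_1}\cdots g_r^{j_r}$ of $\Bbbk G$. $\mathfrak B_{\mathbf q}$ is the (finite-dimensional) Nichols algebra of the braided vector space with basis $x_1,\dots,x_r$ and braiding $c(x_i\otimes x_j)=q_{ij}x_j\otimes x_i$. The bosonization $\mathfrak B_{\mathbf q}\rtimes\Bbbk[G]$ is the Hopf algebra generated by $\mathfrak B_{\mathbf q}$ and $\Bbbk[G]$ (with underlying space $\mathfrak B_{\mathbf q}\otimes\Bbbk[G]$), with $\delta_{\mathbf i}x_j=x_j\delta_{\mathbf i-\alpha_j}$ and $\Delta(x_i)=x_i\otimes1+\gamma_i\otimes x_i$, where $\gamma_i=\sum_{\mathbf j\in\Lambda}\big(\prod_k q_{ik}^{j_k}\big)\delta_{\mathbf j}$. A finite-dimensional Hopf algebra is unimodular if its left and right integrals coincide. *)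

theory Defs
  imports
    "HOL-Algebra.QuotRing"
    "HOL-Algebra.Elementary_Groups"
    "HOL-Algebra.Product_Groups"
    "HOL-Library.Poly_Mapping"
    "Jordan_Normal_Form.VS_Connect"
begin

section \<open>Algebras over a field and their tensor products\<close>

text \<open>The base field is a type; a vector space, algebra, etc. over it is a record over
  \<^const>\<open>class_ring\<close>, the base field seen as a ring record.\<close>

definition k_algebra :: "('k::field, 'a, 'm) module_scheme \<Rightarrow> bool" where
  "k_algebra A \<longleftrightarrow> ring A \<and> vectorspace class_ring A \<and>
     (\<forall>c. \<forall>x\<in>carrier A. \<forall>y\<in>carrier A.
        (c \<odot>\<^bsub>A\<^esub> x) \<otimes>\<^bsub>A\<^esub> y = c \<odot>\<^bsub>A\<^esub> (x \<otimes>\<^bsub>A\<^esub> y) \<and>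
        x \<otimes>\<^bsub>A\<^esub> (c \<odot>\<^bsub>A\<^esub> y) = c \<odot>\<^bsub>A\<^esub> (x \<otimes>\<^bsub>A\<^esub> y))"

definition alg_hom ::
    "('k::field, 'a, 'm) module_scheme \<Rightarrow> ('k, 'b, 'n) module_scheme \<Rightarrow> ('a \<Rightarrow> 'b) set" where
  "alg_hom A B = Ring.ring_hom A B \<inter> LinearCombinations.module_hom class_ring A B"

definition base_algebra :: "('k::field, 'k) module" where
  "base_algebra = \<lparr>carrier = UNIV, mult = (*), one = 1, zero = 0, add = (+), smult = (*)\<rparr>"

definition quotient_algebra ::
    "('k::field, 'a, 'm) module_scheme \<Rightarrow> 'a set \<Rightarrow> ('k, 'a set) module" where
  "quotient_algebra A I =
     ring.extend (A Quot I) (module.fields (\<lambda>c X. \<Union>x\<in>X. I +>\<^bsub>A\<^esub> (c \<odot>\<^bsub>A\<^esub> x)))"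

definition pm_scale :: "'k::field \<Rightarrow> ('b \<Rightarrow>\<^sub>0 'k) \<Rightarrow> ('b \<Rightarrow>\<^sub>0 'k)" where
  "pm_scale c f = Poly_Mapping.map ((*) c) f"

definition bilin_ext ::
    "('a \<Rightarrow> 'b \<Rightarrow> ('c \<Rightarrow>\<^sub>0 'k)) \<Rightarrow> ('a \<Rightarrow>\<^sub>0 'k) \<Rightarrow> ('b \<Rightarrow>\<^sub>0 'k) \<Rightarrow> ('c \<Rightarrow>\<^sub>0 'k::field)" where
  "bilin_ext m f g = (\<Sum>x\<in>Poly_Mapping.keys f. \<Sum>y\<in>Poly_Mapping.keys g.
     pm_scale (Poly_Mapping.lookup f x * Poly_Mapping.lookup g y) (m x y))"

text \<open>The free vector space on the set \<open>S\<close>, with the product that on basis elements is \<open>m\<close>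
  and with the basis element \<open>e\<close> as unit.\<close>

definition basis_algebra ::
    "'b set \<Rightarrow> ('b \<Rightarrow> 'b \<Rightarrow> ('b \<Rightarrow>\<^sub>0 'k)) \<Rightarrow> 'b \<Rightarrow> ('k::field, 'b \<Rightarrow>\<^sub>0 'k) module" where
  "basis_algebra S m e =
     \<lparr>carrier = {f. Poly_Mapping.keys f \<subseteq> S}, mult = bilin_ext m,
      one = Poly_Mapping.single e 1, zero = 0, add = (+), smult = pm_scale\<rparr>"

text \<open>The tensor product of the algebras \<open>A\<close> and \<open>B\<close>: the free vector space on
  \<open>A \<times> B\<close> modulo the bilinearity relations, with \<open>(a \<otimes> b)(c \<otimes> d) = ac \<otimes> bd\<close>.\<close>

definition formal_sums ::
    "('k::field, 'a, 'm) module_scheme \<Rightarrow> ('k, 'b, 'n) module_scheme \<Rightarrow>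
     ('k, ('a \<times> 'b) \<Rightarrow>\<^sub>0 'k) module" where
  "formal_sums A B = basis_algebra (carrier A \<times> carrier B)
     (\<lambda>(a, b) (c, d). Poly_Mapping.single (a \<otimes>\<^bsub>A\<^esub> c, b \<otimes>\<^bsub>B\<^esub> d) 1) (\<one>\<^bsub>A\<^esub>, \<one>\<^bsub>B\<^esub>)"

definition bilinearity_relations ::
    "('k::field, 'a, 'm) module_scheme \<Rightarrow> ('k, 'b, 'n) module_scheme \<Rightarrow>
     (('a \<times> 'b) \<Rightarrow>\<^sub>0 'k) set" where
  "bilinearity_relations A B = LinearCombinations.module.span class_ring (formal_sums A B)
     ({Poly_Mapping.single (a \<oplus>\<^bsub>A\<^esub> a', b) 1
         - Poly_Mapping.single (a, b) 1 - Poly_Mapping.single (a', b) 1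
        | a a' b. a \<in> carrier A \<and> a' \<in> carrier A \<and> b \<in> carrier B} \<union>
      {Poly_Mapping.single (a, b \<oplus>\<^bsub>B\<^esub> b') 1
         - Poly_Mapping.single (a, b) 1 - Poly_Mapping.single (a, b') 1
        | a b b'. a \<in> carrier A \<and> b \<in> carrier B \<and> b' \<in> carrier B} \<union>
      {Poly_Mapping.single (c \<odot>\<^bsub>A\<^esub> a, b) 1 - Poly_Mapping.single (a, b) c
        | c a b. a \<in> carrier A \<and> b \<in> carrier B} \<union>
      {Poly_Mapping.single (a, c \<odot>\<^bsub>B\<^esub> b) 1 - Poly_Mapping.single (a, b) c
        | c a b. a \<in> carrier A \<and> b \<in> carrier B})"

definition tensor_product ::
    "('k::field, 'a, 'm) module_scheme \<Rightarrow> ('k, 'b, 'n) module_scheme \<Rightarrow>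
     ('k, (('a \<times> 'b) \<Rightarrow>\<^sub>0 'k) set) module" where
  "tensor_product A B = quotient_algebra (formal_sums A B) (bilinearity_relations A B)"

definition tensor_class ::
    "('k::field, 'a, 'm) module_scheme \<Rightarrow> ('k, 'b, 'n) module_scheme \<Rightarrow>
     (('a \<times> 'b) \<Rightarrow>\<^sub>0 'k) \<Rightarrow> (('a \<times> 'b) \<Rightarrow>\<^sub>0 'k) set" where
  "tensor_class A B t = bilinearity_relations A B +>\<^bsub>formal_sums A B\<^esub> t"

definition pure_tensor ::
    "('k::field, 'a, 'm) module_scheme \<Rightarrow> ('k, 'b, 'n) module_scheme \<Rightarrow>
     'a \<Rightarrow> 'b \<Rightarrow> (('a \<times> 'b) \<Rightarrow>\<^sub>0 'k) set" where
  "pure_tensor A B a b = tensor_class A B (Poly_Mapping.single (a, b) 1)"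

text \<open>The linear map \<open>A \<otimes> B \<rightarrow> W\<close> sending \<open>a \<otimes> b\<close> to \<open>\<beta> a b\<close>.
  For \<open>\<beta>\<close> bilinear the value below is the same for all representatives of \<open>X\<close>;
  only such \<open>\<beta>\<close> are used.\<close>

definition tensor_lift ::
    "('k::field, 'c, 'm) module_scheme \<Rightarrow> ('a \<Rightarrow> 'b \<Rightarrow> 'c) \<Rightarrow> (('a \<times> 'b) \<Rightarrow>\<^sub>0 'k) set \<Rightarrow> 'c" where
  "tensor_lift W \<beta> X = (THE w. \<forall>t\<in>X.
     w = (\<Oplus>\<^bsub>W\<^esub>p\<in>Poly_Mapping.keys t. Poly_Mapping.lookup t p \<odot>\<^bsub>W\<^esub> \<beta> (fst p) (snd p)))"

definition tensor_map ::
    "('k::field, 'c, 'm) module_scheme \<Rightarrow> ('k, 'd, 'n) module_scheme \<Rightarrow> ('a \<Rightarrow> 'c) \<Rightarrow> ('b \<Rightarrow> 'd) \<Rightarrow>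
     (('a \<times> 'b) \<Rightarrow>\<^sub>0 'k) set \<Rightarrow> (('c \<times> 'd) \<Rightarrow>\<^sub>0 'k) set" where
  "tensor_map C D f g = tensor_lift (tensor_product C D) (\<lambda>a b. pure_tensor C D (f a) (g b))"

text \<open>The canonical isomorphism \<open>(A \<otimes> B) \<otimes> C \<cong> A \<otimes> (B \<otimes> C)\<close>.\<close>

definition tensor_assoc ::
    "('k::field, 'a, 'm) module_scheme \<Rightarrow> ('k, 'b, 'n) module_scheme \<Rightarrow>
     ('k, 'c, 'l) module_scheme \<Rightarrow>
     (((('a \<times> 'b) \<Rightarrow>\<^sub>0 'k) set \<times> 'c) \<Rightarrow>\<^sub>0 'k) set \<Rightarrow>
     (('a \<times> (('b \<times> 'c) \<Rightarrow>\<^sub>0 'k) set) \<Rightarrow>\<^sub>0 'k) set" where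
  "tensor_assoc A B C =
     tensor_lift (tensor_product A (tensor_product B C))
       (\<lambda>u c. tensor_lift (tensor_product A (tensor_product B C))
          (\<lambda>a b. pure_tensor A (tensor_product B C) a (pure_tensor B C b c)) u)"


section \<open>Hopf algebras and integrals\<close>

record (overloaded) ('k::zero, 'a) coalg = "('k, 'a) module" +
  comult :: "'a \<Rightarrow> (('a \<times> 'a) \<Rightarrow>\<^sub>0 'k) set"
  counit :: "'a \<Rightarrow> 'k"

definition hopf_algebra :: "('k::field, 'a, 'm) coalg_scheme \<Rightarrow> bool" where
  "hopf_algebra H \<longleftrightarrow>
     k_algebra H \<and>
     comult H \<in> alg_hom H (tensor_product H H) \<and>
     counit H \<in> alg_hom H base_algebra \<and>
     (\<forall>h\<in>carrier H.
        tensor_assoc H H H (tensor_map (tensor_product H H) H (comult H) id (comult H h)) =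
        tensor_map H (tensor_product H H) id (comult H) (comult H h)) \<and>
     (\<forall>h\<in>carrier H.
        tensor_lift H (\<lambda>a b. counit H a \<odot>\<^bsub>H\<^esub> b) (comult H h) = h \<and>
        tensor_lift H (\<lambda>a b. counit H b \<odot>\<^bsub>H\<^esub> a) (comult H h) = h) \<and>
     (\<exists>S \<in> LinearCombinations.module_hom class_ring H H. \<forall>h\<in>carrier H.
        tensor_lift H (\<lambda>a b. S a \<otimes>\<^bsub>H\<^esub> b) (comult H h) = counit H h \<odot>\<^bsub>H\<^esub> \<one>\<^bsub>H\<^esub> \<and>
        tensor_lift H (\<lambda>a b. a \<otimes>\<^bsub>H\<^esub> S b) (comult H h) = counit H h \<odot>\<^bsub>H\<^esub> \<one>\<^bsub>H\<^esub>)"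

definition left_integrals :: "('k::field, 'a, 'm) coalg_scheme \<Rightarrow> 'a set" where
  "left_integrals H =
     {t \<in> carrier H. \<forall>h\<in>carrier H. h \<otimes>\<^bsub>H\<^esub> t = counit H h \<odot>\<^bsub>H\<^esub> t}"

definition right_integrals :: "('k::field, 'a, 'm) coalg_scheme \<Rightarrow> 'a set" where
  "right_integrals H =
     {t \<in> carrier H. \<forall>h\<in>carrier H. t \<otimes>\<^bsub>H\<^esub> h = counit H h \<odot>\<^bsub>H\<^esub> t}"

definition unimodular_hopf_algebra :: "('k::field, 'a, 'm) coalg_scheme \<Rightarrow> bool" where
  "unimodular_hopf_algebra H \<longleftrightarrow>
     hopf_algebra H \<and> vectorspace.fin_dim class_ring H \<and> left_integrals H = right_integrals H"


section \<open>Nichols algebras of diagonal type\<close>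

text \<open>The tensor algebra of the vector space with basis \<open>x\<^sub>1, \<dots>, x\<^sub>r\<close>; the word
  \<open>[i\<^sub>1, \<dots>, i\<^sub>m]\<close> stands for the monomial \<open>x\<^bsub>i\<^sub>1\<^esub> \<cdots> x\<^bsub>i\<^sub>m\<^esub>\<close>.\<close>

definition tensor_alg :: "nat \<Rightarrow> ('k::field, nat list \<Rightarrow>\<^sub>0 'k) module" where
  "tensor_alg r = basis_algebra (lists {1..r}) (\<lambda>u v. Poly_Mapping.single (u @ v) 1) []"

text \<open>The braiding \<open>c (x\<^sub>i \<otimes> x\<^sub>j) = Q i j x\<^sub>j \<otimes> x\<^sub>i\<close>, extended to the tensor algebra:
  \<open>c (u \<otimes> v) = (braid_scalar Q u v) v \<otimes> u\<close>.\<close>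

definition braid_scalar :: "(nat \<Rightarrow> nat \<Rightarrow> 'k::field) \<Rightarrow> nat list \<Rightarrow> nat list \<Rightarrow> 'k" where
  "braid_scalar Q u v = (\<Prod>i\<leftarrow>u. \<Prod>j\<leftarrow>v. Q i j)"

definition braided_mult_words ::
    "(nat \<Rightarrow> nat \<Rightarrow> 'k::field) \<Rightarrow> nat list \<times> nat list \<Rightarrow> nat list \<times> nat list \<Rightarrow>
     (nat list \<times> nat list) \<Rightarrow>\<^sub>0 'k" where
  "braided_mult_words Q = (\<lambda>(u, u') (v, v').
     Poly_Mapping.single (u @ v, u' @ v') (braid_scalar Q u' v))"

definition braided_square ::
    "(nat \<Rightarrow> nat \<Rightarrow> 'k::field) \<Rightarrow> nat \<Rightarrow> ('k, (nat list \<times> nat list) \<Rightarrow>\<^sub>0 'k) module" where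
  "braided_square Q r =
     basis_algebra (lists {1..r} \<times> lists {1..r}) (braided_mult_words Q) ([], [])"

text \<open>The braided comultiplication of the tensor algebra: the algebra map into its braided
  tensor square with \<open>x\<^sub>i \<mapsto> x\<^sub>i \<otimes> 1 + 1 \<otimes> x\<^sub>i\<close>.\<close>

primrec word_comult ::
    "(nat \<Rightarrow> nat \<Rightarrow> 'k::field) \<Rightarrow> nat list \<Rightarrow> (nat list \<times> nat list) \<Rightarrow>\<^sub>0 'k" where
  "word_comult Q [] = Poly_Mapping.single ([], []) 1"
| "word_comult Q (i # w) = bilin_ext (braided_mult_words Q)
     (Poly_Mapping.single ([i], []) 1 + Poly_Mapping.single ([], [i]) 1) (word_comult Q w)"

definition braided_comult ::
    "(nat \<Rightarrow> nat \<Rightarrow> 'k::field) \<Rightarrow> (nat list \<Rightarrow>\<^sub>0 'k) \<Rightarrow> (nat list \<times> nat list) \<Rightarrow>\<^sub>0 'k" where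
  "braided_comult Q f =
     (\<Sum>w\<in>Poly_Mapping.keys f. pm_scale (Poly_Mapping.lookup f w) (word_comult Q w))"

definition homogeneous_part :: "nat \<Rightarrow> (nat list \<Rightarrow>\<^sub>0 'k::field) \<Rightarrow> (nat list \<Rightarrow>\<^sub>0 'k)" where
  "homogeneous_part m f = (\<Sum>w\<in>{w \<in> Poly_Mapping.keys f. length w = m}.
     Poly_Mapping.single w (Poly_Mapping.lookup f w))"

text \<open>The homogeneous Hopf ideals of the tensor algebra in degrees at least two. Invariance
  under the antipode need not be demanded: the quotient by a homogeneous biideal in positive
  degrees is a connected graded braided bialgebra.\<close>

definition graded_hopf_ideals ::
    "(nat \<Rightarrow> nat \<Rightarrow> 'k::field) \<Rightarrow> nat \<Rightarrow> (nat list \<Rightarrow>\<^sub>0 'k) set set" where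
  "graded_hopf_ideals Q r = {I. ideal I (tensor_alg r) \<and>
     (\<forall>f\<in>I. \<forall>w\<in>Poly_Mapping.keys f. 2 \<le> length w) \<and>
     (\<forall>f\<in>I. \<forall>m. homogeneous_part m f \<in> I) \<and>
     (\<forall>f\<in>I. braided_comult Q f \<in> LinearCombinations.module.span class_ring (braided_square Q r)
        ({bilin_ext (\<lambda>u v. Poly_Mapping.single (u, v) 1) g h
            | g h. g \<in> I \<and> h \<in> carrier (tensor_alg r)} \<union>
         {bilin_ext (\<lambda>u v. Poly_Mapping.single (u, v) 1) h g
            | g h. g \<in> I \<and> h \<in> carrier (tensor_alg r)}))}"

text \<open>The sum of all these ideals is again one of them, so it is the largest one.\<close>

definition nichols_ideal ::
    "(nat \<Rightarrow> nat \<Rightarrow> 'k::field) \<Rightarrow> nat \<Rightarrow> (nat list \<Rightarrow>\<^sub>0 'k) set" where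
  "nichols_ideal Q r = LinearCombinations.module.span class_ring (tensor_alg r) (\<Union> (graded_hopf_ideals Q r))"

definition nichols_algebra ::
    "(nat \<Rightarrow> nat \<Rightarrow> 'k::field) \<Rightarrow> nat \<Rightarrow> ('k, (nat list \<Rightarrow>\<^sub>0 'k) set) module" where
  "nichols_algebra Q r = quotient_algebra (tensor_alg r) (nichols_ideal Q r)"

definition monomial ::
    "(nat \<Rightarrow> nat \<Rightarrow> 'k::field) \<Rightarrow> nat \<Rightarrow> nat list \<Rightarrow> (nat list \<Rightarrow>\<^sub>0 'k) set" where
  "monomial Q r w = nichols_ideal Q r +>\<^bsub>tensor_alg r\<^esub> Poly_Mapping.single w 1"


section \<open>The bosonization by the function algebra of \<open>(\<int>/N)\<^sup>r\<close>\<close>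

definition Lam :: "nat \<Rightarrow> nat \<Rightarrow> (nat \<Rightarrow> int) monoid" where
  "Lam N r = product_group {1..r} (\<lambda>_. integer_mod_group N)"

definition word_degree :: "nat \<Rightarrow> nat \<Rightarrow> nat list \<Rightarrow> nat \<Rightarrow> int" where
  "word_degree N r w = (\<lambda>k\<in>{1..r}. int (count_list w k) mod int N)"

text \<open>The value at \<open>a\<close> of the character \<open>\<gamma>\<^bsub>i\<^sub>1\<^esub> \<cdots> \<gamma>\<^bsub>i\<^sub>m\<^esub>\<close> for the word
  \<open>[i\<^sub>1, \<dots>, i\<^sub>m]\<close>. It depends on \<open>a\<close> only modulo \<open>N\<close> if all entries of \<open>Q\<close> are \<open>N\<close>-th
  roots of unity.\<close>

definition gamma_word ::
    "(nat \<Rightarrow> nat \<Rightarrow> 'k::field) \<Rightarrow> nat \<Rightarrow> nat list \<Rightarrow> (nat \<Rightarrow> int) \<Rightarrow> 'k" where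
  "gamma_word Q r w a = (\<Prod>i\<leftarrow>w. \<Prod>k\<in>{1..r}. Q i k ^ nat (a k))"

text \<open>Since the \<open>\<delta>\<^sub>j\<close> form a basis of the function algebra, every element of the bosonization
  is uniquely \<open>\<Sum>\<^sub>j F\<^sub>j \<delta>\<^sub>j\<close> with \<open>F\<^sub>j\<close> in the Nichols algebra. It is encoded as the function
  \<open>F\<close> on \<open>Lam N r\<close>.

  The product is \<open>(x \<delta>\<^sub>i)(w \<delta>\<^sub>j) = x w \<delta>\<^bsub>i - deg w\<^esub> \<delta>\<^sub>j\<close> for a monomial \<open>w\<close>, which is nonzero
  only if \<open>i = j + deg w\<close>.

  The coproduct is \<open>\<Delta>(x \<delta>\<^sub>j) = \<Sum> x\<^sup>(\<^sup>1\<^sup>) \<gamma> \<delta>\<^sub>a \<otimes> x\<^sup>(\<^sup>2\<^sup>) \<delta>\<^sub>b\<close>, summed over \<open>a + b = j\<close> and over the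
  braided coproduct \<open>x\<^sup>(\<^sup>1\<^sup>) \<otimes> x\<^sup>(\<^sup>2\<^sup>)\<close> of \<open>x\<close>, where \<open>\<gamma>\<close> is the product of the \<open>\<gamma>\<^sub>i\<close> over the letters
  of \<open>x\<^sup>(\<^sup>2\<^sup>)\<close>, so that \<open>\<gamma> \<delta>\<^sub>a = \<gamma>(a) \<delta>\<^sub>a\<close>. On generators this gives
  \<open>\<Delta>(x\<^sub>i) = x\<^sub>i \<otimes> 1 + \<gamma>\<^sub>i \<otimes> x\<^sub>i\<close> and \<open>\<Delta>(\<delta>\<^sub>j) = \<Sum>\<^bsub>a + b = j\<^esub> \<delta>\<^sub>a \<otimes> \<delta>\<^sub>b\<close>.

  Product, coproduct and counit are computed on representatives in the tensor algebra. The
  result does not depend on their choice because the Nichols ideal is a coideal, is graded by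
  \<open>Lam N r\<close>, and has no constant terms.\<close>

definition rep :: "(nat list \<Rightarrow>\<^sub>0 'k::field) set \<Rightarrow> (nat list \<Rightarrow>\<^sub>0 'k)" where
  "rep X = (SOME f. f \<in> X)"

definition bosonization_algebra ::
    "(nat \<Rightarrow> nat \<Rightarrow> 'k::field) \<Rightarrow> nat \<Rightarrow> nat \<Rightarrow>
     ('k, (nat \<Rightarrow> int) \<Rightarrow> (nat list \<Rightarrow>\<^sub>0 'k) set) module" where
  "bosonization_algebra Q r N =
     (let B = nichols_algebra Q r; L = Lam N r in
      \<lparr>carrier = carrier L \<rightarrow>\<^sub>E carrier B,
       mult = (\<lambda>F G. \<lambda>j\<in>carrier L. \<Oplus>\<^bsub>B\<^esub>w\<in>Poly_Mapping.keys (rep (G j)).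
          Poly_Mapping.lookup (rep (G j)) w \<odot>\<^bsub>B\<^esub>
            (F (j \<otimes>\<^bsub>L\<^esub> word_degree N r w) \<otimes>\<^bsub>B\<^esub> monomial Q r w)),
       one = (\<lambda>j\<in>carrier L. \<one>\<^bsub>B\<^esub>),
       zero = (\<lambda>j\<in>carrier L. \<zero>\<^bsub>B\<^esub>),
       add = (\<lambda>F G. \<lambda>j\<in>carrier L. F j \<oplus>\<^bsub>B\<^esub> G j),
       smult = (\<lambda>c F. \<lambda>j\<in>carrier L. c \<odot>\<^bsub>B\<^esub> F j)\<rparr>)"

text \<open>The element \<open>x \<delta>\<^sub>a\<close>.\<close>

definition times_delta ::
    "(nat \<Rightarrow> nat \<Rightarrow> 'k::field) \<Rightarrow> nat \<Rightarrow> nat \<Rightarrow> (nat list \<Rightarrow>\<^sub>0 'k) set \<Rightarrow> (nat \<Rightarrow> int) \<Rightarrow>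
     (nat \<Rightarrow> int) \<Rightarrow> (nat list \<Rightarrow>\<^sub>0 'k) set" where
  "times_delta Q r N x a =
     (\<lambda>j\<in>carrier (Lam N r). if j = a then x else \<zero>\<^bsub>nichols_algebra Q r\<^esub>)"

definition bosonization ::
    "(nat \<Rightarrow> nat \<Rightarrow> 'k::field) \<Rightarrow> nat \<Rightarrow> nat \<Rightarrow>
     ('k, (nat \<Rightarrow> int) \<Rightarrow> (nat list \<Rightarrow>\<^sub>0 'k) set) coalg" where
  "bosonization Q r N =
     (let A = bosonization_algebra Q r N; L = Lam N r in
      module.extend A (coalg.fields
        (\<lambda>F. tensor_class A A
           (\<Sum>a\<in>carrier L. \<Sum>b\<in>carrier L.
              let D = braided_comult Q (rep (F (a \<otimes>\<^bsub>L\<^esub> b))) in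
              \<Sum>(u, v)\<in>Poly_Mapping.keys D.
                Poly_Mapping.single
                  (times_delta Q r N (monomial Q r u) a, times_delta Q r N (monomial Q r v) b)
                  (Poly_Mapping.lookup D (u, v) * gamma_word Q r v a)))
        (\<lambda>F. Poly_Mapping.lookup (rep (F \<one>\<^bsub>L\<^esub>)) [])))"


section \<open>Super-type \<open>A\<close>\<close>

definition has_mult_order :: "'k::field \<Rightarrow> nat \<Rightarrow> bool" where
  "has_mult_order q N \<longleftrightarrow> 0 < N \<and> q ^ N = 1 \<and> (\<forall>m. 0 < m \<and> m < N \<longrightarrow> q ^ m \<noteq> 1)"

definition qtilde :: "(nat \<Rightarrow> nat \<Rightarrow> 'k::field) \<Rightarrow> nat \<Rightarrow> nat \<Rightarrow> 'k" where
  "qtilde Q i j = Q i j * Q j i"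

definition super_type_A ::
    "nat \<Rightarrow> 'k::field \<Rightarrow> nat set \<Rightarrow> (nat \<Rightarrow> nat \<Rightarrow> 'k) \<Rightarrow> bool" where
  "super_type_A r q J Q \<longleftrightarrow>
     (\<forall>i\<in>{1..r}. \<forall>j\<in>{1..r}. Q i j \<noteq> 0) \<and>
     (Q r r)\<^sup>2 * qtilde Q (r - 1) r = q \<and>
     (\<forall>i\<in>{1..r}. \<forall>j\<in>{1..r}. i + 2 \<le> j \<or> j + 2 \<le> i \<longrightarrow> qtilde Q i j = 1) \<and>
     (\<forall>i\<in>{1..r}. i \<in> J \<longrightarrow> Q i i = -1 \<and>
        (1 < i \<and> i < r \<longrightarrow> qtilde Q (i - 1) i = inverse (qtilde Q i (i + 1)))) \<and>
     (\<forall>i\<in>{1..r}. i \<notin> J \<longrightarrow> (Q i i = q \<or> Q i i = inverse q) \<and>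
        (1 < i \<longrightarrow> qtilde Q (i - 1) i = inverse (Q i i)) \<and>
        (i < r \<longrightarrow> qtilde Q i (i + 1) = inverse (Q i i)))"

end

theory Submission
  imports Defs
begin

text \<open>The Nichols ideal is the set of tensors all of whose iterated skew derivations have no constant
  term. So \<open>f\<close> vanishes in the Nichols algebra as soon as its constant term and all its skew
  derivatives do, and any nonzero homogeneous \<open>t\<close> annihilated by the generators on the right is the
  unique such element up to scalars, is annihilated on the left as well, and its skew derivatives
  span the whole algebra. In super-type A such a \<open>t\<close> is the product of the powers \<open>y_lm ^ (N_lm - 1)\<close>
  of the root vectors \<open>y_lm\<close>, where \<open>N_lm\<close> is \<open>2\<close> if \<open>J\<close> meets \<open>{l..m}\<close> in an odd number of
  points, and \<open>N\<close> otherwise. If \<open>\<beta>\<close> is the degree of \<open>t\<close>, the left integrals of the bosonization are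
  spanned by \<open>t \<delta>\<^bsub>-\<beta>\<^esub>\<close> and the right ones by \<open>t \<delta>\<^sub>0\<close>, so that unimodularity means \<open>\<beta> = 0\<close> modulo \<open>N\<close>.
  With \<open>p\<^sub>a = (-1)\<close> to the number of elements of \<open>J\<close> in \<open>{1..a}\<close>, the coefficient of \<open>\<beta>\<close> at \<open>k\<close> is
  \<open>-(p\<^sub>0 + \<dots> + p\<^bsub>k-1\<^esub>)(p\<^sub>k + \<dots> + p\<^sub>r)\<close> modulo \<open>N\<close>; as \<open>N > 2\<close>, these all vanish only if the signs
  \<open>p\<^sub>a\<close> alternate and \<open>p\<^sub>r = 1\<close>.\<close>

section \<open>Linear extension of maps on a basis\<close>

text \<open>The Nichols ideal is given only as a largest ideal, so nothing can be computed from it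
  directly; derivations turn membership into a test on constant terms. No PBW basis and no dimension
  count enters: finite dimension, uniqueness of the integrals and the passage from right to left all
  come from one homogeneous element.

  The normalisation \<open>Q i j = 1\<close> for \<open>j\<close> other than \<open>i\<close> and
  \<open>i + 1\<close> makes the ordinary commutator the bracket for the inverse braiding. A root
  vector then has, in the Nichols algebra, a single right derivative, by its first letter, and its
  left derivatives vanish except by its last letter. This asymmetry is what lets the factors of
  \<open>t\<close> be stripped off one at a time to see that \<open>t\<close> is nonzero.

  The exponents come from the self-braiding of a root vector, which is \<open>-1\<close> or one of
  \<open>q\<close> and its inverse: \<open>N_lm\<close> is the least exponent at which its q-integer
  vanishes.

  The two kinds of integrals sit at different group elements because the idempotent at 0, where the
  counit lives, picks out the component at 0 when it multiplies from the right, but from the left it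
  first has to pass \<open>t\<close>, which shifts its index by the degree of
  \<open>t\<close>.\<close>

definition pm_lift :: "('a \<Rightarrow> ('b \<Rightarrow>\<^sub>0 'k)) \<Rightarrow> ('a \<Rightarrow>\<^sub>0 'k) \<Rightarrow> ('b \<Rightarrow>\<^sub>0 'k::field)" where
  "pm_lift \<phi> f = (\<Sum>x\<in>Poly_Mapping.keys f. pm_scale (Poly_Mapping.lookup f x) (\<phi> x))"

definition pm_linear :: "(('a \<Rightarrow>\<^sub>0 'k) \<Rightarrow> ('b \<Rightarrow>\<^sub>0 'k::field)) \<Rightarrow> bool" where
  "pm_linear \<phi> \<longleftrightarrow> (\<forall>f g. \<phi> (f + g) = \<phi> f + \<phi> g) \<and> (\<forall>c f. \<phi> (pm_scale c f) = pm_scale c (\<phi> f))"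

lemma lookup_pm_scale [simp]: "Poly_Mapping.lookup (pm_scale c f) x = c * Poly_Mapping.lookup f x"
  unfolding pm_scale_def by (simp add: map.rep_eq when_def)

lemma pm_scale_add: "pm_scale c (f + g) = pm_scale c f + pm_scale c g"
  by (rule poly_mapping_eqI) (simp add: lookup_add distrib_left)

lemma pm_scale_add_left: "pm_scale (c + d) f = pm_scale c f + pm_scale d f"
  by (rule poly_mapping_eqI) (simp add: lookup_add distrib_right)

lemma pm_scale_diff: "pm_scale c (f - g) = pm_scale c f - pm_scale c g"
  by (rule poly_mapping_eqI) (simp add: lookup_minus right_diff_distrib)

lemma pm_scale_diff_left: "pm_scale (c - d) f = pm_scale c f - pm_scale d f"
  by (rule poly_mapping_eqI) (simp add: lookup_minus left_diff_distrib)

lemma pm_scale_scale [simp]: "pm_scale c (pm_scale d f) = pm_scale (c * d) f"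
  by (rule poly_mapping_eqI) (simp add: mult.assoc)

lemma pm_scale_simps [simp]:
  "pm_scale c 0 = 0" "pm_scale 0 f = 0" "pm_scale 1 f = f" "pm_scale (- 1) f = - f"
  by (rule poly_mapping_eqI, simp)+

lemma pm_scale_uminus: "pm_scale (- c) f = - pm_scale c f" "pm_scale c (- f) = - pm_scale c f"
  by (rule poly_mapping_eqI, simp)+

lemma pm_scale_single [simp]: "pm_scale c (Poly_Mapping.single x d) = Poly_Mapping.single x (c * d)"
  by (rule poly_mapping_eqI) (simp add: lookup_single when_def)

lemma pm_scale_sum: "pm_scale c (sum f A) = (\<Sum>x\<in>A. pm_scale c (f x))"
  by (induction A rule: infinite_finite_induct) (auto simp: pm_scale_add)

lemma keys_pm_scale: "Poly_Mapping.keys (pm_scale c f) \<subseteq> Poly_Mapping.keys f"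
  by (metis in_keys_iff lookup_pm_scale mult_zero_right subsetI)

lemma keys_add_subset: "Poly_Mapping.keys f \<subseteq> S \<Longrightarrow> Poly_Mapping.keys g \<subseteq> S \<Longrightarrow> Poly_Mapping.keys (f + g) \<subseteq> S"
  by (rule order_trans[OF keys_add Un_least])

lemma keys_sum_subset: "(\<And>x. x \<in> A \<Longrightarrow> Poly_Mapping.keys (f x) \<subseteq> S) \<Longrightarrow> Poly_Mapping.keys (sum f A) \<subseteq> S"
proof (induction A rule: infinite_finite_induct)
  case (insert x A)
  then show ?case by (simp add: keys_add_subset)
qed auto

lemma pm_lift_superset:
  assumes "finite A" "Poly_Mapping.keys f \<subseteq> A"
  shows "pm_lift \<phi> f = (\<Sum>x\<in>A. pm_scale (Poly_Mapping.lookup f x) (\<phi> x))"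
  unfolding pm_lift_def by (rule sum.mono_neutral_left) (use assms in \<open>auto simp: not_in_keys_iff_lookup_eq_zero\<close>)

lemma pm_lift_add: "pm_lift \<phi> (f + g) = pm_lift \<phi> f + pm_lift \<phi> g"
proof -
  let ?A = "Poly_Mapping.keys f \<union> Poly_Mapping.keys g"
  have "pm_lift \<phi> (f + g) = (\<Sum>x\<in>?A. pm_scale (Poly_Mapping.lookup (f + g) x) (\<phi> x))"
    by (rule pm_lift_superset) (simp_all add: keys_add)
  also have "\<dots> = (\<Sum>x\<in>?A. pm_scale (Poly_Mapping.lookup f x) (\<phi> x)) + (\<Sum>x\<in>?A. pm_scale (Poly_Mapping.lookup g x) (\<phi> x))"
    by (simp add: lookup_add pm_scale_add_left sum.distrib)
  also have "\<dots> = pm_lift \<phi> f + pm_lift \<phi> g"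
    by (simp add: pm_lift_superset[of ?A f] pm_lift_superset[of ?A g])
  finally show ?thesis .
qed

lemma pm_lift_scale: "pm_lift \<phi> (pm_scale c f) = pm_scale c (pm_lift \<phi> f)"
  by (subst pm_lift_superset[of "Poly_Mapping.keys f"])
     (simp_all add: keys_pm_scale pm_lift_def pm_scale_sum)

lemma pm_linear_pm_lift: "pm_linear (pm_lift \<phi>)"
  by (simp add: pm_linear_def pm_lift_add pm_lift_scale)

lemma pm_linearD:
  assumes "pm_linear \<phi>"
  shows "\<phi> (f + g) = \<phi> f + \<phi> g" "\<phi> (pm_scale c f) = pm_scale c (\<phi> f)" "\<phi> 0 = 0"
    "\<phi> (f - g) = \<phi> f - \<phi> g" "\<phi> (- f) = - \<phi> f" "\<phi> (sum h A) = (\<Sum>x\<in>A. \<phi> (h x))"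
proof -
  show 1: "\<phi> (f + g) = \<phi> f + \<phi> g" "\<phi> (pm_scale c f) = pm_scale c (\<phi> f)" for f g c
    using assms by (auto simp: pm_linear_def)
  show 2: "\<phi> 0 = 0" using 1(2)[of 0 0] by simp
  show 3: "\<phi> (- f) = - \<phi> f" for f
    using 1(2)[of "-1" f] by simp
  show "\<phi> (f - g) = \<phi> f - \<phi> g" using 1(1)[of f "-g"] 3 by simp
  show "\<phi> (sum h A) = (\<Sum>x\<in>A. \<phi> (h x))"
    by (induction A rule: infinite_finite_induct) (auto simp: 1 2)
qed

lemmas pm_lift_linear = pm_linearD[OF pm_linear_pm_lift]

lemma pm_lift_single [simp]: "pm_lift \<phi> (Poly_Mapping.single x c) = pm_scale c (\<phi> x)"
  by (cases "c = 0") (auto simp: pm_lift_def)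

lemma pm_lift_zero [simp]: "pm_lift \<phi> 0 = 0"
  by (simp add: pm_lift_def)

lemma pm_expand: "f = (\<Sum>x\<in>Poly_Mapping.keys f. Poly_Mapping.single x (Poly_Mapping.lookup f x))"
proof (rule poly_mapping_eqI)
  fix k
  have "Poly_Mapping.lookup (\<Sum>x\<in>Poly_Mapping.keys f. Poly_Mapping.single x (Poly_Mapping.lookup f x)) k
      = (\<Sum>x\<in>Poly_Mapping.keys f. if x = k then Poly_Mapping.lookup f x else 0)"
    by (simp add: lookup_sum lookup_single when_def)
  also have "\<dots> = Poly_Mapping.lookup f k"
    by (simp add: not_in_keys_iff_lookup_eq_zero)
  finally show "Poly_Mapping.lookup f k = Poly_Mapping.lookup
    (\<Sum>x\<in>Poly_Mapping.keys f. Poly_Mapping.single x (Poly_Mapping.lookup f x)) k" by simp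
qed

lemma pm_linear_eq_pm_lift:
  assumes "pm_linear \<phi>"
  shows "\<phi> f = pm_lift (\<lambda>x. \<phi> (Poly_Mapping.single x 1)) f"
proof -
  have "\<phi> f = (\<Sum>x\<in>Poly_Mapping.keys f. \<phi> (pm_scale (Poly_Mapping.lookup f x) (Poly_Mapping.single x 1)))"
    by (subst pm_expand[of f]) (simp only: pm_linearD[OF assms] pm_scale_single mult_1_right)
  then show ?thesis by (simp only: pm_linearD[OF assms] pm_lift_def)
qed

lemma pm_lift_cong: "(\<And>x. x \<in> Poly_Mapping.keys f \<Longrightarrow> \<phi> x = \<psi> x) \<Longrightarrow> pm_lift \<phi> f = pm_lift \<psi> f"
  unfolding pm_lift_def by (rule sum.cong) auto

text \<open>The device behind most identities below: both sides are recognised as linear maps and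
  then compared on the basis elements that occur in \<open>f\<close>.\<close>

lemma pm_linear_eqI:
  assumes "pm_linear \<phi>" "pm_linear \<psi>"
    and "\<And>x. x \<in> Poly_Mapping.keys f \<Longrightarrow> \<phi> (Poly_Mapping.single x 1) = \<psi> (Poly_Mapping.single x 1)"
  shows "\<phi> f = \<psi> f"
  unfolding pm_linear_eq_pm_lift[OF assms(1), of f] pm_linear_eq_pm_lift[OF assms(2), of f]
  by (rule pm_lift_cong) (rule assms(3))

lemma pm_linear_id: "pm_linear (\<lambda>f. f)" by (simp add: pm_linear_def)

lemma pm_linear_comp: "pm_linear \<phi> \<Longrightarrow> pm_linear \<psi> \<Longrightarrow> pm_linear (\<lambda>f. \<phi> (\<psi> f))"
  by (simp add: pm_linear_def)

lemma pm_linear_add: "pm_linear \<phi> \<Longrightarrow> pm_linear \<psi> \<Longrightarrow> pm_linear (\<lambda>f. \<phi> f + \<psi> f)"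
  by (simp add: pm_linear_def pm_scale_add algebra_simps)

lemma pm_linear_scale: "pm_linear \<phi> \<Longrightarrow> pm_linear (\<lambda>f. pm_scale c (\<phi> f))"
  by (simp add: pm_linear_def pm_scale_add mult.commute)

lemma pm_lift_id [simp]: "pm_lift (\<lambda>x. Poly_Mapping.single x 1) f = f"
  using pm_linear_eq_pm_lift[OF pm_linear_id, of f] by simp

lemma pm_lift_pm_lift: "pm_lift \<phi> (pm_lift \<psi> f) = pm_lift (\<lambda>x. pm_lift \<phi> (\<psi> x)) f"
  by (rule pm_linear_eqI[where \<phi>="\<lambda>f. pm_lift \<phi> (pm_lift \<psi> f)" and \<psi>="pm_lift (\<lambda>x. pm_lift \<phi> (\<psi> x))"])
     (simp_all add: pm_linear_pm_lift pm_linear_def pm_lift_add pm_lift_scale)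

lemma lookup_pm_lift:
  "Poly_Mapping.lookup (pm_lift \<phi> f) y
   = (\<Sum>x\<in>Poly_Mapping.keys f. Poly_Mapping.lookup f x * Poly_Mapping.lookup (\<phi> x) y)"
  by (simp add: pm_lift_def lookup_sum)

lemma keys_pm_lift:
  assumes "Poly_Mapping.keys f \<subseteq> S" "\<And>x. x \<in> S \<Longrightarrow> Poly_Mapping.keys (\<phi> x) \<subseteq> S'"
  shows "Poly_Mapping.keys (pm_lift \<phi> f) \<subseteq> S'"
  unfolding pm_lift_def
  by (rule keys_sum_subset) (use assms in \<open>auto intro!: order_trans[OF keys_pm_scale]\<close>)

lemma pm_lift_fun_add: "pm_lift (\<lambda>x. \<phi> x + \<psi> x) f = pm_lift \<phi> f + pm_lift \<psi> f"
  by (simp add: pm_lift_def pm_scale_add sum.distrib)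

lemma pm_lift_fun_scale: "pm_lift (\<lambda>x. pm_scale c (\<phi> x)) f = pm_scale c (pm_lift \<phi> f)"
  by (simp add: pm_lift_def pm_scale_sum mult.commute)

lemma pm_lift_fun_zero [simp]: "pm_lift (\<lambda>x. 0) f = 0"
  by (simp add: pm_lift_def)

lemma pm_lift_linear_comp: "pm_linear \<psi> \<Longrightarrow> \<psi> (pm_lift \<phi> f) = pm_lift (\<lambda>x. \<psi> (\<phi> x)) f"
  by (simp add: pm_lift_def pm_linearD)

lemma bilin_ext_eq_pm_lift: "bilin_ext m f g = pm_lift (\<lambda>x. pm_lift (m x) g) f"
  by (simp add: bilin_ext_def pm_lift_def pm_scale_sum)

lemma pm_linear_bilin_ext_left: "pm_linear (\<lambda>f. bilin_ext m f g)"
  unfolding bilin_ext_eq_pm_lift by (rule pm_linear_pm_lift)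

lemma pm_linear_bilin_ext_right: "pm_linear (\<lambda>g. bilin_ext m f g)"
  unfolding bilin_ext_eq_pm_lift
  by (simp add: pm_linear_def pm_lift_add pm_lift_scale pm_lift_fun_add pm_lift_fun_scale)

lemmas bilin_ext_linear_left = pm_linearD[OF pm_linear_bilin_ext_left]
lemmas bilin_ext_linear_right = pm_linearD[OF pm_linear_bilin_ext_right]

lemma bilin_ext_single [simp]:
  "bilin_ext m (Poly_Mapping.single x c) (Poly_Mapping.single y d) = pm_scale (c * d) (m x y)"
  by (simp add: bilin_ext_eq_pm_lift)

lemma keys_bilin_ext:
  assumes "Poly_Mapping.keys f \<subseteq> S" "Poly_Mapping.keys g \<subseteq> S'"
    "\<And>x y. x \<in> S \<Longrightarrow> y \<in> S' \<Longrightarrow> Poly_Mapping.keys (m x y) \<subseteq> S''"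
  shows "Poly_Mapping.keys (bilin_ext m f g) \<subseteq> S''"
  unfolding bilin_ext_eq_pm_lift by (rule keys_pm_lift[OF assms(1)], rule keys_pm_lift[OF assms(2)], rule assms(3))

text \<open>Associativity is trilinear, so it is tested on basis triples. The restriction to a set
  \<open>S\<close> matters: the pairs in \<open>formal_sums\<close>, for instance, multiply
  associatively only inside the carriers.\<close>

lemma bilin_ext_assoc:
  assumes S: "Poly_Mapping.keys f \<subseteq> S" "Poly_Mapping.keys g \<subseteq> S" "Poly_Mapping.keys h \<subseteq> S"
    and assoc: "\<And>x y z. x \<in> S \<Longrightarrow> y \<in> S \<Longrightarrow> z \<in> S \<Longrightarrow>
       bilin_ext m (m x y) (Poly_Mapping.single z 1) = bilin_ext m (Poly_Mapping.single x 1) (m y z)"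
  shows "bilin_ext m (bilin_ext m f g) h = bilin_ext m f (bilin_ext m g h)"
proof (rule pm_linear_eqI[where \<phi>="\<lambda>f. bilin_ext m (bilin_ext m f g) h"
      and \<psi>="\<lambda>f. bilin_ext m f (bilin_ext m g h)"])
  fix x assume "x \<in> Poly_Mapping.keys f"
  then have x: "x \<in> S" using S by auto
  let ?x = "Poly_Mapping.single x (1::'b)"
  show "bilin_ext m (bilin_ext m ?x g) h = bilin_ext m ?x (bilin_ext m g h)"
  proof (rule pm_linear_eqI[where \<phi>="\<lambda>g. bilin_ext m (bilin_ext m ?x g) h"
        and \<psi>="\<lambda>g. bilin_ext m ?x (bilin_ext m g h)"])
    fix y assume "y \<in> Poly_Mapping.keys g"
    then have y: "y \<in> S" using S by auto
    let ?y = "Poly_Mapping.single y (1::'b)"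
    show "bilin_ext m (bilin_ext m ?x ?y) h = bilin_ext m ?x (bilin_ext m ?y h)"
    proof (rule pm_linear_eqI[where \<phi>="\<lambda>h. bilin_ext m (bilin_ext m ?x ?y) h"
        and \<psi>="\<lambda>h. bilin_ext m ?x (bilin_ext m ?y h)"])
      fix z assume "z \<in> Poly_Mapping.keys h"
      then have z: "z \<in> S" using S by auto
      show "bilin_ext m (bilin_ext m ?x ?y) (Poly_Mapping.single z 1)
          = bilin_ext m ?x (bilin_ext m ?y (Poly_Mapping.single z 1))"
        using assoc[OF x y z] by simp
    qed (simp_all add: pm_linear_def bilin_ext_linear_left bilin_ext_linear_right)
  qed (simp_all add: pm_linear_def bilin_ext_linear_left bilin_ext_linear_right)
qed (simp_all add: pm_linear_def bilin_ext_linear_left bilin_ext_linear_right)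

section \<open>Linear algebra in algebra records\<close>

text \<open>The counterpart of \<open>pm_lift\<close> with values in a record. It is the expression
  inside the definite description of \<open>tensor_lift\<close>, which is how values of
  \<open>tensor_lift\<close> get computed.\<close>

definition lin_ext :: "('k::field, 'a, 'm) module_scheme \<Rightarrow> ('b \<Rightarrow> 'a) \<Rightarrow> ('b \<Rightarrow>\<^sub>0 'k) \<Rightarrow> 'a" where
  "lin_ext W \<phi> t = (\<Oplus>\<^bsub>W\<^esub>p\<in>Poly_Mapping.keys t. Poly_Mapping.lookup t p \<odot>\<^bsub>W\<^esub> \<phi> p)"

definition bilinear ::
  "('k::field, 'a, 'm) module_scheme \<Rightarrow> ('k, 'b, 'n) module_scheme \<Rightarrow> ('k, 'c, 'l) module_scheme
    \<Rightarrow> ('a \<Rightarrow> 'b \<Rightarrow> 'c) \<Rightarrow> bool" where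
  "bilinear A B W \<beta> \<longleftrightarrow>
     (\<forall>b\<in>carrier B. (\<lambda>a. \<beta> a b) \<in> LinearCombinations.module_hom class_ring A W) \<and>
     (\<forall>a\<in>carrier A. \<beta> a \<in> LinearCombinations.module_hom class_ring B W)"

abbreviation lin_hom where "lin_hom A B \<equiv> LinearCombinations.module_hom class_ring A B"

lemma lin_homI:
  assumes "\<And>x. x \<in> carrier A \<Longrightarrow> f x \<in> carrier B"
    "\<And>x y. x \<in> carrier A \<Longrightarrow> y \<in> carrier A \<Longrightarrow> f (x \<oplus>\<^bsub>A\<^esub> y) = f x \<oplus>\<^bsub>B\<^esub> f y"
    "\<And>c x. x \<in> carrier A \<Longrightarrow> f (c \<odot>\<^bsub>A\<^esub> x) = c \<odot>\<^bsub>B\<^esub> f x"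
  shows "f \<in> lin_hom A B"
  using assms by (simp add: LinearCombinations.module_hom_def)

lemma lin_homD:
  assumes "f \<in> lin_hom A B"
  shows "x \<in> carrier A \<Longrightarrow> f x \<in> carrier B"
    "x \<in> carrier A \<Longrightarrow> y \<in> carrier A \<Longrightarrow> f (x \<oplus>\<^bsub>A\<^esub> y) = f x \<oplus>\<^bsub>B\<^esub> f y"
    "x \<in> carrier A \<Longrightarrow> f (c \<odot>\<^bsub>A\<^esub> x) = c \<odot>\<^bsub>B\<^esub> f x"
  using assms by (auto simp: LinearCombinations.module_hom_def)

lemma lin_hom_comp: "f \<in> lin_hom A B \<Longrightarrow> g \<in> lin_hom B C \<Longrightarrow> (\<lambda>x. g (f x)) \<in> lin_hom A C"
  by (rule lin_homI) (simp_all add: lin_homD)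

locale kalg =
  fixes A :: "('k::field, 'a, 'm) module_scheme" (structure)
  assumes k_algebra: "k_algebra A"
begin

sublocale ring A using k_algebra by (simp add: k_algebra_def)

lemma kmodule: "module class_ring A"
  using k_algebra by (simp add: k_algebra_def vectorspace_def)

lemma kvectorspace: "vectorspace class_ring A"
  using k_algebra by (simp add: k_algebra_def)

lemma smult_closed [simp, intro]: "x \<in> carrier A \<Longrightarrow> c \<odot> x \<in> carrier A"
  using module.smult_closed[OF kmodule] by simp

lemma smult_add_left: "x \<in> carrier A \<Longrightarrow> (c + d) \<odot> x = c \<odot> x \<oplus> d \<odot> x"
  using module.smult_l_distr[OF kmodule, of c d x] by simp

lemma smult_add_right: "x \<in> carrier A \<Longrightarrow> y \<in> carrier A \<Longrightarrow> c \<odot> (x \<oplus> y) = c \<odot> x \<oplus> c \<odot> y"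
  using module.smult_r_distr[OF kmodule, of c x y] by simp

lemma smult_smult: "x \<in> carrier A \<Longrightarrow> c \<odot> (d \<odot> x) = (c * d) \<odot> x"
  using module.smult_assoc1[OF kmodule, of c d x] by simp

lemma smult_one [simp]: "x \<in> carrier A \<Longrightarrow> 1 \<odot> x = x"
  using module.smult_one[OF kmodule, of x] by simp

lemma smult_zero_left [simp]: "x \<in> carrier A \<Longrightarrow> 0 \<odot> x = \<zero>"
  using module.smult_l_null[OF kmodule, of x] by simp

lemma smult_zero_right [simp]: "c \<odot> \<zero> = \<zero>"
  using module.smult_r_null[OF kmodule, of c] by simp

lemma smult_mult_left: "x \<in> carrier A \<Longrightarrow> y \<in> carrier A \<Longrightarrow> (c \<odot> x) \<otimes> y = c \<odot> (x \<otimes> y)"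
  and smult_mult_right: "x \<in> carrier A \<Longrightarrow> y \<in> carrier A \<Longrightarrow> x \<otimes> (c \<odot> y) = c \<odot> (x \<otimes> y)"
  using k_algebra by (simp_all add: k_algebra_def)

lemma smult_minus_one: "x \<in> carrier A \<Longrightarrow> (- 1) \<odot> x = \<ominus> x"
  using smult_add_left[of x "-1" 1] by (metis add.left_inverse minus_equality smult_closed smult_one smult_zero_left)

lemma minus_eq_zero_iff: "x \<in> carrier A \<Longrightarrow> y \<in> carrier A \<Longrightarrow> x \<ominus> y = \<zero> \<longleftrightarrow> x = y"
  by (metis a_minus_def minus_equality minus_minus r_neg a_inv_closed)

lemma smult_finsum: "f \<in> I \<rightarrow> carrier A \<Longrightarrow> c \<odot> (\<Oplus>i\<in>I. f i) = (\<Oplus>i\<in>I. c \<odot> f i)"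
proof (induction I rule: infinite_finite_induct)
  case (insert x F)
  then have "f x \<in> carrier A" "f \<in> F \<rightarrow> carrier A" "(\<lambda>i. c \<odot> f i) \<in> F \<rightarrow> carrier A" by auto
  with insert show ?case by (simp add: smult_add_right)
qed auto

lemma lin_ext_closed: "(\<And>p. p \<in> Poly_Mapping.keys t \<Longrightarrow> \<phi> p \<in> carrier A) \<Longrightarrow> lin_ext A \<phi> t \<in> carrier A"
  unfolding lin_ext_def by (rule finsum_closed) auto

lemma lin_ext_cong:
  "(\<And>p. p \<in> Poly_Mapping.keys t \<Longrightarrow> \<phi> p = \<psi> p) \<Longrightarrow> (\<And>p. p \<in> Poly_Mapping.keys t \<Longrightarrow> \<psi> p \<in> carrier A)
   \<Longrightarrow> lin_ext A \<phi> t = lin_ext A \<psi> t"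
  unfolding lin_ext_def by (rule finsum_cong') auto

lemma lin_ext_superset:
  assumes "finite T" "Poly_Mapping.keys t \<subseteq> T" "\<And>p. p \<in> T \<Longrightarrow> \<phi> p \<in> carrier A"
  shows "lin_ext A \<phi> t = (\<Oplus>p\<in>T. Poly_Mapping.lookup t p \<odot> \<phi> p)"
  unfolding lin_ext_def
  by (rule add.finprod_mono_neutral_cong_left)
     (use assms in \<open>auto simp: not_in_keys_iff_lookup_eq_zero\<close>)

lemma lin_ext_add:
  assumes "\<And>p. p \<in> Poly_Mapping.keys s \<union> Poly_Mapping.keys t \<Longrightarrow> \<phi> p \<in> carrier A"
  shows "lin_ext A \<phi> (s + t) = lin_ext A \<phi> s \<oplus> lin_ext A \<phi> t"
proof -
  let ?T = "Poly_Mapping.keys s \<union> Poly_Mapping.keys t"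
  have T: "finite ?T" by simp
  have "lin_ext A \<phi> (s + t) = (\<Oplus>p\<in>?T. Poly_Mapping.lookup (s + t) p \<odot> \<phi> p)"
    by (rule lin_ext_superset) (use assms keys_add[of s t] in auto)
  also have "\<dots> = (\<Oplus>p\<in>?T. Poly_Mapping.lookup s p \<odot> \<phi> p \<oplus> Poly_Mapping.lookup t p \<odot> \<phi> p)"
    by (rule finsum_cong') (use assms in \<open>auto simp: lookup_add smult_add_left\<close>)
  also have "\<dots> = (\<Oplus>p\<in>?T. Poly_Mapping.lookup s p \<odot> \<phi> p) \<oplus> (\<Oplus>p\<in>?T. Poly_Mapping.lookup t p \<odot> \<phi> p)"
    by (rule finsum_addf) (use assms in auto)
  also have "(\<Oplus>p\<in>?T. Poly_Mapping.lookup s p \<odot> \<phi> p) = lin_ext A \<phi> s"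
    by (rule lin_ext_superset[symmetric]) (use assms in auto)
  also have "(\<Oplus>p\<in>?T. Poly_Mapping.lookup t p \<odot> \<phi> p) = lin_ext A \<phi> t"
    by (rule lin_ext_superset[symmetric]) (use assms in auto)
  finally show ?thesis .
qed

lemma lin_ext_scale:
  assumes "\<And>p. p \<in> Poly_Mapping.keys t \<Longrightarrow> \<phi> p \<in> carrier A"
  shows "lin_ext A \<phi> (pm_scale c t) = c \<odot> lin_ext A \<phi> t"
proof -
  have "lin_ext A \<phi> (pm_scale c t) = (\<Oplus>p\<in>Poly_Mapping.keys t. Poly_Mapping.lookup (pm_scale c t) p \<odot> \<phi> p)"
    by (rule lin_ext_superset) (use assms keys_pm_scale[of c t] in auto)
  also have "\<dots> = (\<Oplus>p\<in>Poly_Mapping.keys t. c \<odot> (Poly_Mapping.lookup t p \<odot> \<phi> p))"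
    by (rule finsum_cong') (use assms in \<open>auto simp: smult_smult\<close>)
  also have "\<dots> = c \<odot> lin_ext A \<phi> t"
    unfolding lin_ext_def by (rule smult_finsum[symmetric]) (use assms in auto)
  finally show ?thesis .
qed

lemma lin_ext_zero [simp]: "lin_ext A \<phi> 0 = \<zero>"
  by (simp add: lin_ext_def)

lemma lin_ext_single [simp]: "\<phi> p \<in> carrier A \<Longrightarrow> lin_ext A \<phi> (Poly_Mapping.single p c) = c \<odot> \<phi> p"
  by (cases "c = 0") (auto simp: lin_ext_def)

lemma lin_ext_sum:
  assumes "\<And>i p. i \<in> I \<Longrightarrow> p \<in> Poly_Mapping.keys (h i) \<Longrightarrow> \<phi> p \<in> carrier A"
  shows "lin_ext A \<phi> (\<Sum>i\<in>I. h i) = (\<Oplus>i\<in>I. lin_ext A \<phi> (h i))"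
  using assms
proof (induction I rule: infinite_finite_induct)
  case (insert x F)
  have "lin_ext A \<phi> (h x + sum h F) = lin_ext A \<phi> (h x) \<oplus> lin_ext A \<phi> (sum h F)"
  proof (rule lin_ext_add)
    fix p assume "p \<in> Poly_Mapping.keys (h x) \<union> Poly_Mapping.keys (sum h F)"
    moreover have "Poly_Mapping.keys (sum h F) \<subseteq> (\<Union>i\<in>F. Poly_Mapping.keys (h i))"
      by (rule keys_sum_subset) auto
    ultimately show "\<phi> p \<in> carrier A" using insert.prems by auto
  qed
  moreover have "(\<lambda>i. lin_ext A \<phi> (h i)) \<in> F \<rightarrow> carrier A" "lin_ext A \<phi> (h x) \<in> carrier A"
    using insert.prems by (auto intro: lin_ext_closed)
  moreover have "lin_ext A \<phi> (sum h F) = (\<Oplus>i\<in>F. lin_ext A \<phi> (h i))"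
    using insert.prems by (intro insert.IH) blast
  ultimately show ?case using insert.hyps by simp
qed auto

lemma lin_ext_pm_lift:
  assumes "\<And>x p. x \<in> Poly_Mapping.keys t \<Longrightarrow> p \<in> Poly_Mapping.keys (\<psi> x) \<Longrightarrow> \<phi> p \<in> carrier A"
  shows "lin_ext A \<phi> (pm_lift \<psi> t) = lin_ext A (\<lambda>x. lin_ext A \<phi> (\<psi> x)) t"
proof -
  have "lin_ext A \<phi> (pm_lift \<psi> t)
      = (\<Oplus>x\<in>Poly_Mapping.keys t. lin_ext A \<phi> (pm_scale (Poly_Mapping.lookup t x) (\<psi> x)))"
    unfolding pm_lift_def by (rule lin_ext_sum) (meson assms keys_pm_scale subsetD)
  also have "\<dots> = (\<Oplus>x\<in>Poly_Mapping.keys t. Poly_Mapping.lookup t x \<odot> lin_ext A \<phi> (\<psi> x))"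
    by (rule finsum_cong') (use assms in \<open>auto simp: lin_ext_scale intro!: lin_ext_closed\<close>)
  finally show ?thesis by (simp add: lin_ext_def)
qed

lemma lin_ext_fun_zero [simp]: "lin_ext A (\<lambda>p. \<zero>) t = \<zero>"
  by (simp add: lin_ext_def)

end

lemma lin_hom_zero:
  assumes "kalg A" "kalg B" "f \<in> lin_hom A B"
  shows "f \<zero>\<^bsub>A\<^esub> = \<zero>\<^bsub>B\<^esub>"
proof -
  interpret A: kalg A by fact
  interpret B: kalg B by fact
  have "f (0 \<odot>\<^bsub>A\<^esub> \<zero>\<^bsub>A\<^esub>) = 0 \<odot>\<^bsub>B\<^esub> f \<zero>\<^bsub>A\<^esub>" by (rule lin_homD(3)[OF assms(3)]) simp
  then show ?thesis using lin_homD(1)[OF assms(3), of "\<zero>\<^bsub>A\<^esub>"] by simp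
qed

lemma lin_hom_finsum:
  assumes "kalg A" "kalg B" "f \<in> lin_hom A B" "h \<in> I \<rightarrow> carrier A"
  shows "f (\<Oplus>\<^bsub>A\<^esub>i\<in>I. h i) = (\<Oplus>\<^bsub>B\<^esub>i\<in>I. f (h i))"
  using assms(4)
proof (induction I rule: infinite_finite_induct)
  interpret A: kalg A by fact
  interpret B: kalg B by fact
  {
    case (infinite I)
    then show ?case by (simp add: lin_hom_zero[OF assms(1-3)])
  next
    case empty
    then show ?case by (simp add: lin_hom_zero[OF assms(1-3)])
  next
    case (insert x F)
    then have "(\<lambda>i. f (h i)) \<in> F \<rightarrow> carrier B" "f (h x) \<in> carrier B"
      using lin_homD(1)[OF assms(3)] by auto
    with insert show ?case by (simp add: lin_homD(2)[OF assms(3)] Pi_def)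
  }
qed

lemma lin_hom_lin_ext:
  assumes "kalg A" "kalg B" "f \<in> lin_hom A B" "\<And>p. p \<in> Poly_Mapping.keys t \<Longrightarrow> \<phi> p \<in> carrier A"
  shows "f (lin_ext A \<phi> t) = lin_ext B (\<lambda>p. f (\<phi> p)) t"
proof -
  interpret A: kalg A by fact
  interpret B: kalg B by fact
  have "f (lin_ext A \<phi> t) = (\<Oplus>\<^bsub>B\<^esub>p\<in>Poly_Mapping.keys t. f (Poly_Mapping.lookup t p \<odot>\<^bsub>A\<^esub> \<phi> p))"
    unfolding lin_ext_def by (rule lin_hom_finsum) (use assms in auto)
  also have "\<dots> = lin_ext B (\<lambda>p. f (\<phi> p)) t"
    unfolding lin_ext_def
    by (rule B.finsum_cong') (use assms lin_homD[OF assms(3)] in auto)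
  finally show ?thesis .
qed

lemma lin_hom_cong:
  assumes "kalg A" "f \<in> lin_hom A B" "\<And>x. x \<in> carrier A \<Longrightarrow> f x = g x"
  shows "g \<in> lin_hom A B"
proof -
  interpret A: kalg A by fact
  show ?thesis
    by (rule lin_homI) (simp_all add: lin_homD[OF assms(2)] flip: assms(3))
qed

lemma alg_homD:
  assumes "f \<in> alg_hom A B"
  shows "x \<in> carrier A \<Longrightarrow> f x \<in> carrier B" "f \<in> lin_hom A B"
    "x \<in> carrier A \<Longrightarrow> y \<in> carrier A \<Longrightarrow> f (x \<otimes>\<^bsub>A\<^esub> y) = f x \<otimes>\<^bsub>B\<^esub> f y" "f \<one>\<^bsub>A\<^esub> = \<one>\<^bsub>B\<^esub>"
  using assms by (auto simp: alg_hom_def Ring.ring_hom_def)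

lemma alg_homI:
  assumes "f \<in> lin_hom A B"
    "\<And>x y. x \<in> carrier A \<Longrightarrow> y \<in> carrier A \<Longrightarrow> f (x \<otimes>\<^bsub>A\<^esub> y) = f x \<otimes>\<^bsub>B\<^esub> f y" "f \<one>\<^bsub>A\<^esub> = \<one>\<^bsub>B\<^esub>"
  shows "f \<in> alg_hom A B"
  using assms lin_homD[OF assms(1)] by (auto simp: alg_hom_def Ring.ring_hom_def)

lemma alg_hom_comp: "f \<in> alg_hom A B \<Longrightarrow> g \<in> alg_hom B C \<Longrightarrow> (\<lambda>x. g (f x)) \<in> alg_hom A C"
  by (rule alg_homI) (simp_all add: alg_homD lin_hom_comp[OF alg_homD(2) alg_homD(2)])

lemma k_algebraI:
  assumes "ring A"
    and "\<And>c x. x \<in> carrier A \<Longrightarrow> c \<odot>\<^bsub>A\<^esub> x \<in> carrier A"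
    and "\<And>c d x. x \<in> carrier A \<Longrightarrow> (c + d) \<odot>\<^bsub>A\<^esub> x = c \<odot>\<^bsub>A\<^esub> x \<oplus>\<^bsub>A\<^esub> d \<odot>\<^bsub>A\<^esub> x"
    and "\<And>c x y. x \<in> carrier A \<Longrightarrow> y \<in> carrier A \<Longrightarrow> c \<odot>\<^bsub>A\<^esub> (x \<oplus>\<^bsub>A\<^esub> y) = c \<odot>\<^bsub>A\<^esub> x \<oplus>\<^bsub>A\<^esub> c \<odot>\<^bsub>A\<^esub> y"
    and "\<And>c d x. x \<in> carrier A \<Longrightarrow> (c * d) \<odot>\<^bsub>A\<^esub> x = c \<odot>\<^bsub>A\<^esub> (d \<odot>\<^bsub>A\<^esub> x)"
    and "\<And>x. x \<in> carrier A \<Longrightarrow> 1 \<odot>\<^bsub>A\<^esub> x = x"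
    and "\<And>c x y. x \<in> carrier A \<Longrightarrow> y \<in> carrier A \<Longrightarrow> (c \<odot>\<^bsub>A\<^esub> x) \<otimes>\<^bsub>A\<^esub> y = c \<odot>\<^bsub>A\<^esub> (x \<otimes>\<^bsub>A\<^esub> y)"
    and "\<And>c x y. x \<in> carrier A \<Longrightarrow> y \<in> carrier A \<Longrightarrow> x \<otimes>\<^bsub>A\<^esub> (c \<odot>\<^bsub>A\<^esub> y) = c \<odot>\<^bsub>A\<^esub> (x \<otimes>\<^bsub>A\<^esub> y)"
  shows "k_algebra (A :: ('k::field, 'a, 'm) module_scheme)"
proof -
  interpret ring A by fact
  have "module (class_ring :: 'k ring) A"
    by (rule moduleI) (use assms class_field in \<open>auto simp: field_def domain_def is_abelian_group\<close>)
  then show ?thesis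
    using assms class_field by (auto simp: k_algebra_def vectorspace_def)
qed

text \<open>The elements of the carrier with property \<open>P\<close> form a submodule containing
  \<open>S\<close>, hence containing its span.\<close>

lemma span_induct:
  assumes "module class_ring M" "x \<in> LinearCombinations.module.span class_ring M S"
    and "S \<subseteq> carrier M" "\<And>x. x \<in> S \<Longrightarrow> P x" "P \<zero>\<^bsub>M\<^esub>"
    and "\<And>x y. x \<in> carrier M \<Longrightarrow> y \<in> carrier M \<Longrightarrow> P x \<Longrightarrow> P y \<Longrightarrow> P (x \<oplus>\<^bsub>M\<^esub> y)"
    and "\<And>c x. x \<in> carrier M \<Longrightarrow> P x \<Longrightarrow> P (c \<odot>\<^bsub>M\<^esub> x)"
  shows "P (x :: 'b)" "x \<in> carrier M"
proof -
  interpret Module.module class_ring M by fact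
  have sub: "LinearCombinations.submodule class_ring {x \<in> carrier M. P x} M"
    using assms by (auto simp: LinearCombinations.submodule_def)
  have "span S \<subseteq> {x \<in> carrier M. P x}"
    by (rule span_is_subset[OF _ sub]) (use assms in auto)
  then show "P x" "x \<in> carrier M" using assms(2) by auto
qed

lemma span_closed:
  assumes "module class_ring M" "S \<subseteq> carrier M"
  defines "U \<equiv> LinearCombinations.module.span class_ring M S"
  shows "x \<in> S \<Longrightarrow> x \<in> U" "\<zero>\<^bsub>M\<^esub> \<in> U" "x \<in> U \<Longrightarrow> y \<in> U \<Longrightarrow> x \<oplus>\<^bsub>M\<^esub> y \<in> U"
    "x \<in> U \<Longrightarrow> c \<odot>\<^bsub>M\<^esub> x \<in> U" "U \<subseteq> carrier M"
proof -
  interpret Module.module class_ring M by fact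
  have "LinearCombinations.submodule class_ring U M"
    unfolding U_def using assms by (intro span_is_submodule)
  then show "\<zero>\<^bsub>M\<^esub> \<in> U" "x \<in> U \<Longrightarrow> y \<in> U \<Longrightarrow> x \<oplus>\<^bsub>M\<^esub> y \<in> U"
    "x \<in> U \<Longrightarrow> c \<odot>\<^bsub>M\<^esub> x \<in> U" "U \<subseteq> carrier M"
    by (auto simp: LinearCombinations.submodule_def)
  show "x \<in> S \<Longrightarrow> x \<in> U" unfolding U_def using in_own_span[OF assms(2)] by auto
qed

section \<open>Algebras with a given basis, quotient algebras\<close>

lemma basis_algebra_simps [simp]:
  "carrier (basis_algebra S m e) = {f. Poly_Mapping.keys f \<subseteq> S}"
  "mult (basis_algebra S m e) = bilin_ext m"
  "one (basis_algebra S m e) = Poly_Mapping.single e 1"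
  "zero (basis_algebra S m e) = 0"
  "add (basis_algebra S m e) = (+)"
  "smult (basis_algebra S m e) = pm_scale"
  by (simp_all add: basis_algebra_def)

lemma basis_algebra_abelian_group: "abelian_group (basis_algebra S m e)"
proof (rule abelian_groupI)
  fix x assume "x \<in> carrier (basis_algebra S m e)"
  then show "\<exists>y\<in>carrier (basis_algebra S m e). y \<oplus>\<^bsub>basis_algebra S m e\<^esub> x = \<zero>\<^bsub>basis_algebra S m e\<^esub>"
    by (intro bexI[of _ "- x"]) auto
qed (auto simp: add.assoc add.commute intro: keys_add_subset[THEN subsetD])

lemma basis_algebra_module: "module class_ring (basis_algebra S m e)"
  by (rule moduleI)
     (use class_field in \<open>auto simp: basis_algebra_abelian_group field_def domain_def
        pm_scale_add pm_scale_add_left intro: order_trans[OF keys_pm_scale, THEN subsetD]\<close>)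

lemma kalg_basis_algebra:
  assumes "e \<in> S" and m: "\<And>x y. x \<in> S \<Longrightarrow> y \<in> S \<Longrightarrow> Poly_Mapping.keys (m x y) \<subseteq> S"
    and assoc: "\<And>x y z. x \<in> S \<Longrightarrow> y \<in> S \<Longrightarrow> z \<in> S \<Longrightarrow>
       bilin_ext m (m x y) (Poly_Mapping.single z 1) = bilin_ext m (Poly_Mapping.single x 1) (m y z)"
    and unit: "\<And>x. x \<in> S \<Longrightarrow> m e x = Poly_Mapping.single x 1" "\<And>x. x \<in> S \<Longrightarrow> m x e = Poly_Mapping.single x 1"
  shows "kalg (basis_algebra S m e)"
proof
  let ?A = "basis_algebra S m e"
  have "ring ?A"
  proof (rule ringI)
    show "Group.monoid ?A"
    proof (rule monoidI)
      fix x y assume "x \<in> carrier ?A" "y \<in> carrier ?A"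
      then show "x \<otimes>\<^bsub>?A\<^esub> y \<in> carrier ?A" using keys_bilin_ext[of x S y S m S] m by auto
    next
      fix x y z assume "x \<in> carrier ?A" "y \<in> carrier ?A" "z \<in> carrier ?A"
      then show "x \<otimes>\<^bsub>?A\<^esub> y \<otimes>\<^bsub>?A\<^esub> z = x \<otimes>\<^bsub>?A\<^esub> (y \<otimes>\<^bsub>?A\<^esub> z)"
        using bilin_ext_assoc[of x S y z m] assoc by auto
    next
      fix x assume x: "x \<in> carrier ?A"
      have "pm_lift (m e) x = pm_lift (\<lambda>y. Poly_Mapping.single y 1) x"
        by (rule pm_lift_cong) (use x unit in auto)
      then show "\<one>\<^bsub>?A\<^esub> \<otimes>\<^bsub>?A\<^esub> x = x" by (simp add: bilin_ext_eq_pm_lift)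
      have "pm_lift (\<lambda>y. m y e) x = pm_lift (\<lambda>y. Poly_Mapping.single y 1) x"
        by (rule pm_lift_cong) (use x unit in auto)
      then show "x \<otimes>\<^bsub>?A\<^esub> \<one>\<^bsub>?A\<^esub> = x" by (simp add: bilin_ext_eq_pm_lift)
    qed (use \<open>e \<in> S\<close> in auto)
  qed (simp_all add: basis_algebra_abelian_group bilin_ext_linear_left bilin_ext_linear_right)
  then show "k_algebra ?A"
    using class_field basis_algebra_module
    by (auto simp: k_algebra_def vectorspace_def bilin_ext_linear_left bilin_ext_linear_right)
qed

lemma quotient_algebra_simps [simp]:
  "carrier (quotient_algebra A I) = a_rcosets\<^bsub>A\<^esub> I"
  "mult (quotient_algebra A I) = rcoset_mult A I"
  "one (quotient_algebra A I) = I +>\<^bsub>A\<^esub> \<one>\<^bsub>A\<^esub>"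
  "zero (quotient_algebra A I) = I"
  "add (quotient_algebra A I) = set_add A"
  "smult (quotient_algebra A I) = (\<lambda>c X. \<Union>x\<in>X. I +>\<^bsub>A\<^esub> (c \<odot>\<^bsub>A\<^esub> x))"
  by (simp_all add: quotient_algebra_def ring.extend_def module.fields_def FactRing_def)

locale kalg_ideal = kalg A + ideal I A for A :: "('k::field, 'a, 'm) module_scheme" (structure) and I
begin

abbreviation QA where "QA \<equiv> quotient_algebra A I"

text \<open>Ring ideals carry no closure under scalars by definition; it follows because scaling is
  multiplication by the ring element \<open>c \<odot> \<one>\<close>.\<close>

lemma smult_ideal: "x \<in> I \<Longrightarrow> c \<odot> x \<in> I"
proof -
  assume x: "x \<in> I"
  then have "c \<odot> x = (c \<odot> \<one>) \<otimes> x" using a_Hcarr by (simp add: smult_mult_left)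
  then show ?thesis using x I_l_closed by auto
qed

lemma coset_eq_iff:
  assumes "x \<in> carrier A" "y \<in> carrier A"
  shows "I +> x = I +> y \<longleftrightarrow> x \<ominus> y \<in> I"
  using assms quotient_eq_iff_same_a_r_cos[OF is_ideal] by auto

lemma coset_carrier: "carrier QA = (\<lambda>x. I +> x) ` carrier A"
  by (auto simp: A_RCOSETS_def RCOSETS_def a_r_coset_def)

lemma coset_closed: "x \<in> carrier A \<Longrightarrow> I +> x \<in> carrier QA"
  by (simp only: coset_carrier imageI)

lemma coset_add: "x \<in> carrier A \<Longrightarrow> y \<in> carrier A \<Longrightarrow> (I +> x) \<oplus>\<^bsub>QA\<^esub> (I +> y) = I +> (x \<oplus> y)"
  by (simp add: a_rcos_sum)

lemma coset_mult: "x \<in> carrier A \<Longrightarrow> y \<in> carrier A \<Longrightarrow> (I +> x) \<otimes>\<^bsub>QA\<^esub> (I +> y) = I +> (x \<otimes> y)"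
  by (simp add: rcoset_mult_add)

lemma coset_zero: "I +> \<zero> = \<zero>\<^bsub>QA\<^esub>"
  using a_coset_add_zero[OF a_subset] by simp

lemma mem_coset_iff: "x \<in> carrier A \<Longrightarrow> y \<in> I +> x \<longleftrightarrow> y \<in> carrier A \<and> y \<ominus> x \<in> I"
  using a_rcos_module a_elemrcos_carrier a_rcos_module_minus[OF ring_axioms] by blast

text \<open>The scalar action of \<open>quotient_algebra\<close> is a union over all
  representatives. It collapses to one coset because two representatives differ by an element of
  \<open>I\<close>, and scaling preserves \<open>I\<close>.\<close>

lemma coset_smult:
  assumes x: "x \<in> carrier A"
  shows "c \<odot>\<^bsub>QA\<^esub> (I +> x) = I +> (c \<odot> x)"
proof -
  have "I +> (c \<odot> y) = I +> (c \<odot> x)" if "y \<in> I +> x" for y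
  proof -
    have y: "y \<in> carrier A" "y \<ominus> x \<in> I" using that x by (auto simp: mem_coset_iff)
    have "(c \<odot> y) \<ominus> (c \<odot> x) = c \<odot> (y \<ominus> x)"
      using x y(1) by (simp add: a_minus_def smult_add_right smult_smult smult_minus_one[symmetric])
    with x y show ?thesis by (simp add: coset_eq_iff smult_ideal)
  qed
  then have "(\<Union>y\<in>I +> x. I +> (c \<odot> y)) = (\<Union>y\<in>I +> x. I +> (c \<odot> x))"
    by (rule SUP_cong[OF refl])
  moreover have "I +> x \<noteq> {}" using x a_rcos_self by auto
  ultimately show ?thesis by simp
qed

lemma quotient_kalg: "kalg QA"
proof
  note cs = coset_add coset_mult coset_smult coset_zero[symmetric] quotient_algebra_simps(3)
  note ring_simps = a_ac m_assoc l_distr r_distr l_neg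
  have "abelian_group QA"
  proof (rule abelian_groupI)
    fix X assume "X \<in> carrier QA"
    then obtain x where x: "x \<in> carrier A" "X = I +> x" unfolding coset_carrier by blast
    then have "(I +> \<ominus> x) \<oplus>\<^bsub>QA\<^esub> X = \<zero>\<^bsub>QA\<^esub>" by (simp add: cs l_neg del: quotient_algebra_simps)
    then show "\<exists>Y\<in>carrier QA. Y \<oplus>\<^bsub>QA\<^esub> X = \<zero>\<^bsub>QA\<^esub>"
      by (rule bexI) (rule coset_closed, use x in simp)
  qed (unfold coset_carrier, auto simp: cs ring_simps simp del: quotient_algebra_simps(1,2,4-6))
  then have "ring QA"
    by (intro ringI monoidI)
       (unfold coset_carrier, auto simp: cs ring_simps simp del: quotient_algebra_simps(1,2,4-6))
  then show "k_algebra QA"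
    by (rule k_algebraI)
       (unfold coset_carrier, auto simp del: quotient_algebra_simps
          simp: coset_add coset_mult coset_smult smult_add_left smult_add_right smult_smult
            smult_mult_left smult_mult_right)
qed

lemma coset_hom: "(\<lambda>x. I +> x) \<in> alg_hom A QA"
  by (rule alg_homI, rule lin_homI)
     (simp_all add: coset_add coset_mult coset_smult coset_closed del: quotient_algebra_simps
        add: quotient_algebra_simps(3))

end

lemma finsum_basis_algebra:
  assumes "\<And>i. i \<in> I \<Longrightarrow> Poly_Mapping.keys (f i) \<subseteq> S"
  shows "(\<Oplus>\<^bsub>basis_algebra S m e\<^esub>i\<in>I. f i) = sum f I"
proof -
  interpret abelian_group "basis_algebra S m e" by (rule basis_algebra_abelian_group)
  show ?thesis
    using assms
  proof (induction I rule: infinite_finite_induct)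
    case (insert x F)
    then have "f \<in> F \<rightarrow> carrier (basis_algebra S m e)" "f x \<in> carrier (basis_algebra S m e)" by auto
    with insert show ?case by (simp add: finsum_insert)
  qed (simp_all add: finsum_empty finsum_infinite)
qed

lemma lin_ext_basis_algebra:
  assumes "\<And>p. p \<in> Poly_Mapping.keys t \<Longrightarrow> Poly_Mapping.keys (\<phi> p) \<subseteq> S"
  shows "lin_ext (basis_algebra S m e) \<phi> t = pm_lift \<phi> t"
  unfolding lin_ext_def pm_lift_def
  by (subst finsum_basis_algebra) (auto intro: subsetD[OF assms] subsetD[OF keys_pm_scale])

section \<open>Tensor products of algebras\<close>

text \<open>The generators inside \<open>bilinearity_relations\<close>, named separately so that
  inductions over their span can treat the four kinds of relations case by case.\<close>

definition tensor_relations where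
  "tensor_relations A B =
     {Poly_Mapping.single (a \<oplus>\<^bsub>A\<^esub> a', b) 1
         - Poly_Mapping.single (a, b) 1 - Poly_Mapping.single (a', b) 1
        | a a' b. a \<in> carrier A \<and> a' \<in> carrier A \<and> b \<in> carrier B} \<union>
      {Poly_Mapping.single (a, b \<oplus>\<^bsub>B\<^esub> b') 1
         - Poly_Mapping.single (a, b) 1 - Poly_Mapping.single (a, b') 1
        | a b b'. a \<in> carrier A \<and> b \<in> carrier B \<and> b' \<in> carrier B} \<union>
      {Poly_Mapping.single (c \<odot>\<^bsub>A\<^esub> a, b) 1 - Poly_Mapping.single (a, b) c
        | c a b. a \<in> carrier A \<and> b \<in> carrier B} \<union>
      {Poly_Mapping.single (a, c \<odot>\<^bsub>B\<^esub> b) 1 - Poly_Mapping.single (a, b) c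
        | c a b. a \<in> carrier A \<and> b \<in> carrier B}"

locale tensor = A: kalg A + B: kalg B
  for A :: "('k::field, 'a, 'm) module_scheme" and B :: "('k, 'b, 'n) module_scheme"
begin

abbreviation "FS \<equiv> formal_sums A B"
abbreviation "BR \<equiv> bilinearity_relations A B"
abbreviation "TP \<equiv> tensor_product A B"
abbreviation "tcl \<equiv> tensor_class A B"
abbreviation "pt \<equiv> pure_tensor A B"

lemma BR_eq: "BR = LinearCombinations.module.span class_ring FS (tensor_relations A B)"
  by (simp add: bilinearity_relations_def tensor_relations_def)

lemma FS_kalg: "kalg FS"
  unfolding formal_sums_def
  by (rule kalg_basis_algebra) (auto simp: A.m_assoc B.m_assoc)

lemma FS_simps [simp]:
  "carrier FS = {f. Poly_Mapping.keys f \<subseteq> carrier A \<times> carrier B}"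
  "mult FS = bilin_ext (\<lambda>(a, b) (c, d). Poly_Mapping.single (a \<otimes>\<^bsub>A\<^esub> c, b \<otimes>\<^bsub>B\<^esub> d) 1)"
  "one FS = Poly_Mapping.single (\<one>\<^bsub>A\<^esub>, \<one>\<^bsub>B\<^esub>) 1"
  "zero FS = 0" "add FS = (+)" "smult FS = pm_scale"
  by (simp_all add: formal_sums_def)

lemma FS_module: "module class_ring FS"
  unfolding formal_sums_def by (rule basis_algebra_module)

lemma keys_diff_subset:
  "Poly_Mapping.keys f \<subseteq> S \<Longrightarrow> Poly_Mapping.keys g \<subseteq> S \<Longrightarrow> Poly_Mapping.keys (f - g) \<subseteq> S" for f g :: "'x \<Rightarrow>\<^sub>0 'k"
  using keys_add_subset[of f S "- g"] by simp

lemma tensor_relations_carrier: "tensor_relations A B \<subseteq> carrier FS"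
  unfolding tensor_relations_def FS_simps
  by (intro Un_least subsetI; elim CollectE exE conjE; hypsubst)
     (simp_all add: keys_diff_subset)

lemmas BR_closed = span_closed[OF FS_module tensor_relations_carrier, folded BR_eq, simplified FS_simps(4-6)]

lemma BR_induct [consumes 1, case_names relation zero add scale]:
  assumes "u \<in> BR" "\<And>g. g \<in> tensor_relations A B \<Longrightarrow> P g" "P 0"
    "\<And>s t. s \<in> carrier FS \<Longrightarrow> t \<in> carrier FS \<Longrightarrow> P s \<Longrightarrow> P t \<Longrightarrow> P (s + t)"
    "\<And>c t. t \<in> carrier FS \<Longrightarrow> P t \<Longrightarrow> P (pm_scale c t)"
  shows "P u"
  using span_induct(1)[OF FS_module assms(1)[unfolded BR_eq] tensor_relations_carrier, of P] assms(2-)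
  by simp

lemma BR_sum: "(\<And>i. i \<in> I \<Longrightarrow> f i \<in> BR) \<Longrightarrow> sum f I \<in> BR"
  by (induction I rule: infinite_finite_induct) (auto simp: BR_closed)

lemma BR_relations:
  "a \<in> carrier A \<Longrightarrow> a' \<in> carrier A \<Longrightarrow> b \<in> carrier B \<Longrightarrow>
     Poly_Mapping.single (a \<oplus>\<^bsub>A\<^esub> a', b) 1 - Poly_Mapping.single (a, b) 1 - Poly_Mapping.single (a', b) 1 \<in> BR"
  "a \<in> carrier A \<Longrightarrow> b \<in> carrier B \<Longrightarrow> b' \<in> carrier B \<Longrightarrow>
     Poly_Mapping.single (a, b \<oplus>\<^bsub>B\<^esub> b') 1 - Poly_Mapping.single (a, b) 1 - Poly_Mapping.single (a, b') 1 \<in> BR"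
  "a \<in> carrier A \<Longrightarrow> b \<in> carrier B \<Longrightarrow> Poly_Mapping.single (c \<odot>\<^bsub>A\<^esub> a, b) 1 - Poly_Mapping.single (a, b) c \<in> BR"
  "a \<in> carrier A \<Longrightarrow> b \<in> carrier B \<Longrightarrow> Poly_Mapping.single (a, c \<odot>\<^bsub>B\<^esub> b) 1 - Poly_Mapping.single (a, b) c \<in> BR"
  subgoal by (rule BR_closed(1), unfold tensor_relations_def, rule UnI1, rule UnI1, rule UnI1, rule CollectI)
      (intro exI conjI, rule refl)
  subgoal by (rule BR_closed(1), unfold tensor_relations_def, rule UnI1, rule UnI1, rule UnI2, rule CollectI)
      (intro exI conjI, rule refl)
  subgoal by (rule BR_closed(1), unfold tensor_relations_def, rule UnI1, rule UnI2, rule CollectI)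
      (intro exI conjI, rule refl)
  subgoal by (rule BR_closed(1), unfold tensor_relations_def, rule UnI2, rule CollectI)
      (intro exI conjI, rule refl)
  done

lemma tensor_relations_cases [consumes 1, case_names add_left add_right scale_left scale_right]:
  assumes "g \<in> tensor_relations A B"
  obtains
    a a' b where "a \<in> carrier A" "a' \<in> carrier A" "b \<in> carrier B"
      "g = Poly_Mapping.single (a \<oplus>\<^bsub>A\<^esub> a', b) 1 - Poly_Mapping.single (a, b) 1 - Poly_Mapping.single (a', b) 1"
  | a b b' where "a \<in> carrier A" "b \<in> carrier B" "b' \<in> carrier B"
      "g = Poly_Mapping.single (a, b \<oplus>\<^bsub>B\<^esub> b') 1 - Poly_Mapping.single (a, b) 1 - Poly_Mapping.single (a, b') 1"
  | c a b where "a \<in> carrier A" "b \<in> carrier B"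
      "g = Poly_Mapping.single (c \<odot>\<^bsub>A\<^esub> a, b) 1 - Poly_Mapping.single (a, b) c"
  | c a b where "a \<in> carrier A" "b \<in> carrier B"
      "g = Poly_Mapping.single (a, c \<odot>\<^bsub>B\<^esub> b) 1 - Poly_Mapping.single (a, b) c"
  using assms unfolding tensor_relations_def by (elim UnE CollectE exE conjE) metis+

lemma BR_mult_left:
  assumes "x \<in> carrier A" "y \<in> carrier B" "u \<in> BR"
  shows "Poly_Mapping.single (x, y) 1 \<otimes>\<^bsub>FS\<^esub> u \<in> BR"
  using assms(3)
proof (induction rule: BR_induct)
  case (relation g)
  then show "Poly_Mapping.single (x, y) 1 \<otimes>\<^bsub>FS\<^esub> g \<in> BR"
    by (cases rule: tensor_relations_cases)
       (use assms in \<open>simp_all add: bilin_ext_linear_right A.r_distr B.r_distr A.smult_mult_right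
          B.smult_mult_right BR_relations\<close>)
qed (simp_all add: BR_closed bilin_ext_linear_right)

lemma BR_mult_right:
  assumes "x \<in> carrier A" "y \<in> carrier B" "u \<in> BR"
  shows "u \<otimes>\<^bsub>FS\<^esub> Poly_Mapping.single (x, y) 1 \<in> BR"
  using assms(3)
proof (induction rule: BR_induct)
  case (relation g)
  then show "g \<otimes>\<^bsub>FS\<^esub> Poly_Mapping.single (x, y) 1 \<in> BR"
    by (cases rule: tensor_relations_cases)
       (use assms in \<open>simp_all add: bilin_ext_linear_left A.l_distr B.l_distr A.smult_mult_left
          B.smult_mult_left BR_relations\<close>)
qed (simp_all add: BR_closed bilin_ext_linear_left)

text \<open>A bilinearity relation times a basis pair is a relation of the same kind, and every
  formal sum is a combination of basis pairs, so the span of the relations absorbs products on both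
  sides.\<close>

lemma BR_ideal: "ideal BR FS"
proof -
  interpret F: kalg FS by (rule FS_kalg)
  have exp: "t = (\<Sum>p\<in>Poly_Mapping.keys t. pm_scale (Poly_Mapping.lookup t p) (Poly_Mapping.single p 1))"
    for t :: "('a \<times> 'b) \<Rightarrow>\<^sub>0 'k"
    using pm_expand[of t] by simp
  show ?thesis
  proof (rule idealI)
    have "- u \<in> BR" if "u \<in> BR" for u using BR_closed(4)[OF that, of "-1"] by simp
    then show "subgroup BR (add_monoid FS)"
      using BR_closed(2,3,5) F.smult_minus_one
      by (intro F.add.subgroupI) (force simp flip: F.smult_minus_one)+
  next
    fix u t assume u: "u \<in> BR" and t: "t \<in> carrier FS"
    have "bilin_ext (\<lambda>(a, b) (c, d). Poly_Mapping.single (a \<otimes>\<^bsub>A\<^esub> c, b \<otimes>\<^bsub>B\<^esub> d) 1)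
       (\<Sum>p\<in>Poly_Mapping.keys t. pm_scale (Poly_Mapping.lookup t p) (Poly_Mapping.single p 1)) u \<in> BR"
      unfolding bilin_ext_linear_left
      using BR_mult_left u t by (intro BR_sum BR_closed(4)) auto
    then show "t \<otimes>\<^bsub>FS\<^esub> u \<in> BR" by (simp only: exp[symmetric] FS_simps)
    have "bilin_ext (\<lambda>(a, b) (c, d). Poly_Mapping.single (a \<otimes>\<^bsub>A\<^esub> c, b \<otimes>\<^bsub>B\<^esub> d) 1) u
       (\<Sum>p\<in>Poly_Mapping.keys t. pm_scale (Poly_Mapping.lookup t p) (Poly_Mapping.single p 1)) \<in> BR"
      unfolding bilin_ext_linear_right
      using BR_mult_right u t by (intro BR_sum BR_closed(4)) auto
    then show "u \<otimes>\<^bsub>FS\<^esub> t \<in> BR" by (simp only: exp[symmetric] FS_simps)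
  qed (rule F.ring_axioms)
qed

lemma quot: "kalg_ideal FS BR"
  by (simp add: kalg_ideal_def FS_kalg BR_ideal)

lemma TP_kalg: "kalg TP"
  unfolding tensor_product_def by (rule kalg_ideal.quotient_kalg[OF quot])

lemma tcl_hom: "tcl \<in> alg_hom FS TP"
  unfolding tensor_product_def tensor_class_def by (rule kalg_ideal.coset_hom[OF quot])

lemma TP_carrier: "carrier TP = tcl ` carrier FS"
  unfolding tensor_product_def tensor_class_def by (rule kalg_ideal.coset_carrier[OF quot])

lemma FS_minus: "t \<in> carrier FS \<Longrightarrow> s \<ominus>\<^bsub>FS\<^esub> t = s - t"
proof -
  interpret F: kalg FS by (rule FS_kalg)
  assume "t \<in> carrier FS"
  then have "\<ominus>\<^bsub>FS\<^esub> t = pm_scale (- 1) t" using F.smult_minus_one[of t] by simp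
  then show ?thesis by (simp add: a_minus_def)
qed

lemma tcl_eqI: "s \<in> carrier FS \<Longrightarrow> t \<in> carrier FS \<Longrightarrow> s - t \<in> BR \<Longrightarrow> tcl s = tcl t"
  unfolding tensor_class_def by (simp only: kalg_ideal.coset_eq_iff[OF quot] FS_minus)

lemma pt_closed [simp, intro]: "a \<in> carrier A \<Longrightarrow> b \<in> carrier B \<Longrightarrow> pt a b \<in> carrier TP"
  unfolding pure_tensor_def by (rule alg_homD(1)[OF tcl_hom]) simp

lemma tcl_lin_ext:
  assumes "t \<in> carrier FS"
  shows "tcl t = lin_ext TP (\<lambda>p. pt (fst p) (snd p)) t"
proof -
  have "tcl (lin_ext FS (\<lambda>p. Poly_Mapping.single p 1) t) = lin_ext TP (\<lambda>p. pt (fst p) (snd p)) t"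
    unfolding pure_tensor_def prod.collapse
    by (rule lin_hom_lin_ext[OF FS_kalg TP_kalg alg_homD(2)[OF tcl_hom]]) (use assms in auto)
  moreover have "lin_ext FS (\<lambda>p. Poly_Mapping.single p 1) t = t"
    using assms unfolding formal_sums_def by (subst lin_ext_basis_algebra) auto
  ultimately show ?thesis by simp
qed

lemma pt_bilinear:
  "a \<in> carrier A \<Longrightarrow> a' \<in> carrier A \<Longrightarrow> b \<in> carrier B \<Longrightarrow> pt (a \<oplus>\<^bsub>A\<^esub> a') b = pt a b \<oplus>\<^bsub>TP\<^esub> pt a' b"
  "a \<in> carrier A \<Longrightarrow> b \<in> carrier B \<Longrightarrow> b' \<in> carrier B \<Longrightarrow> pt a (b \<oplus>\<^bsub>B\<^esub> b') = pt a b \<oplus>\<^bsub>TP\<^esub> pt a b'"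
  "a \<in> carrier A \<Longrightarrow> b \<in> carrier B \<Longrightarrow> pt (c \<odot>\<^bsub>A\<^esub> a) b = c \<odot>\<^bsub>TP\<^esub> pt a b"
  "a \<in> carrier A \<Longrightarrow> b \<in> carrier B \<Longrightarrow> pt a (c \<odot>\<^bsub>B\<^esub> b) = c \<odot>\<^bsub>TP\<^esub> pt a b"
proof -
  note h = lin_homD[OF alg_homD(2)[OF tcl_hom]]
  {
    assume "a \<in> carrier A" "a' \<in> carrier A" "b \<in> carrier B"
    then have "pt (a \<oplus>\<^bsub>A\<^esub> a') b = tcl (Poly_Mapping.single (a, b) 1 + Poly_Mapping.single (a', b) 1)"
      unfolding pure_tensor_def
      by (intro tcl_eqI) (use BR_relations(1)[of a a' b] in \<open>simp_all add: keys_add_subset diff_diff_add\<close>)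
    then show "pt (a \<oplus>\<^bsub>A\<^esub> a') b = pt a b \<oplus>\<^bsub>TP\<^esub> pt a' b"
      using h(2)[of "Poly_Mapping.single (a, b) 1" "Poly_Mapping.single (a', b) 1"] \<open>a \<in> _\<close> \<open>a' \<in> _\<close> \<open>b \<in> _\<close>
      by (simp add: pure_tensor_def)
  next
    assume "a \<in> carrier A" "b \<in> carrier B" "b' \<in> carrier B"
    then have "pt a (b \<oplus>\<^bsub>B\<^esub> b') = tcl (Poly_Mapping.single (a, b) 1 + Poly_Mapping.single (a, b') 1)"
      unfolding pure_tensor_def
      by (intro tcl_eqI) (use BR_relations(2)[of a b b'] in \<open>simp_all add: keys_add_subset diff_diff_add\<close>)
    then show "pt a (b \<oplus>\<^bsub>B\<^esub> b') = pt a b \<oplus>\<^bsub>TP\<^esub> pt a b'"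
      using h(2)[of "Poly_Mapping.single (a, b) 1" "Poly_Mapping.single (a, b') 1"] \<open>a \<in> _\<close> \<open>b' \<in> _\<close> \<open>b \<in> _\<close>
      by (simp add: pure_tensor_def)
  next
    assume ab: "a \<in> carrier A" "b \<in> carrier B"
    have s: "tcl (Poly_Mapping.single (a, b) c) = c \<odot>\<^bsub>TP\<^esub> pt a b"
      using h(3)[of "Poly_Mapping.single (a, b) 1" c] ab by (simp add: pure_tensor_def)
    show "pt (c \<odot>\<^bsub>A\<^esub> a) b = c \<odot>\<^bsub>TP\<^esub> pt a b"
      unfolding s[symmetric] unfolding pure_tensor_def
      by (intro tcl_eqI) (use ab BR_relations(3)[of a b c] in simp_all)
    show "pt a (c \<odot>\<^bsub>B\<^esub> b) = c \<odot>\<^bsub>TP\<^esub> pt a b"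
      unfolding s[symmetric] unfolding pure_tensor_def
      by (intro tcl_eqI) (use ab BR_relations(4)[of a b c] in simp_all)
  }
qed

text \<open>There is no case for scalar multiples: a multiple of a pure tensor is again pure, the
  scalar being absorbed by the left factor.\<close>

lemma TP_induct [consumes 1, case_names zero add pure]:
  assumes "X \<in> carrier TP" and zero: "P \<zero>\<^bsub>TP\<^esub>"
    and add: "\<And>X Y. X \<in> carrier TP \<Longrightarrow> Y \<in> carrier TP \<Longrightarrow> P X \<Longrightarrow> P Y \<Longrightarrow> P (X \<oplus>\<^bsub>TP\<^esub> Y)"
    and pure: "\<And>a b. a \<in> carrier A \<Longrightarrow> b \<in> carrier B \<Longrightarrow> P (pt a b)"
  shows "P X"
proof -
  interpret T: kalg TP by (rule TP_kalg)
  have smult: "P (c \<odot>\<^bsub>TP\<^esub> pt a b)" if "a \<in> carrier A" "b \<in> carrier B" for c a b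
    using pure[of "c \<odot>\<^bsub>A\<^esub> a" b] that by (simp add: pt_bilinear(3))
  obtain t where t: "t \<in> carrier FS" "X = tcl t" using assms(1) by (auto simp only: TP_carrier)
  have "P (\<Oplus>\<^bsub>TP\<^esub>p\<in>K. Poly_Mapping.lookup t p \<odot>\<^bsub>TP\<^esub> pt (fst p) (snd p))"
    if "finite K" "K \<subseteq> carrier A \<times> carrier B" for K
    using that
  proof (induction K rule: finite_induct)
    case (insert p F)
    then have "(\<lambda>p. Poly_Mapping.lookup t p \<odot>\<^bsub>TP\<^esub> pt (fst p) (snd p)) \<in> F \<rightarrow> carrier TP" by auto
    with insert show ?case
      by (auto simp: T.finsum_insert smult intro!: add T.finsum_closed)
  qed (use zero in simp)
  then show ?thesis using t tcl_lin_ext[OF t(1)] by (simp add: lin_ext_def)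
qed

lemma pt_mult:
  "a \<in> carrier A \<Longrightarrow> b \<in> carrier B \<Longrightarrow> c \<in> carrier A \<Longrightarrow> d \<in> carrier B \<Longrightarrow>
   pt a b \<otimes>\<^bsub>TP\<^esub> pt c d = pt (a \<otimes>\<^bsub>A\<^esub> c) (b \<otimes>\<^bsub>B\<^esub> d)"
  using alg_homD(3)[OF tcl_hom, of "Poly_Mapping.single (a, b) 1" "Poly_Mapping.single (c, d) 1"]
  by (simp add: pure_tensor_def)

lemma TP_one: "\<one>\<^bsub>TP\<^esub> = pt \<one>\<^bsub>A\<^esub> \<one>\<^bsub>B\<^esub>"
  using alg_homD(4)[OF tcl_hom] by (simp add: pure_tensor_def)

lemma pt_lin_left: "b \<in> carrier B \<Longrightarrow> (\<lambda>a. pt a b) \<in> lin_hom A TP"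
  and pt_lin_right: "a \<in> carrier A \<Longrightarrow> pt a \<in> lin_hom B TP"
  by (auto intro!: lin_homI simp: pt_bilinear)

lemma pt_is_bilinear: "bilinear A B TP pt"
  by (simp add: bilinear_def pt_lin_left pt_lin_right)

text \<open>The linear extension of a bilinear \<open>\<beta>\<close> vanishes on the bilinearity
  relations, so it is constant on each class. This is what makes the definite description in
  \<open>tensor_lift\<close> denote a value.\<close>

lemma tensor_lift_tcl:
  assumes W: "kalg W" and \<beta>: "bilinear A B W \<beta>" and t: "t \<in> carrier FS"
  shows "tensor_lift W \<beta> (tcl t) = lin_ext W (\<lambda>p. \<beta> (fst p) (snd p)) t"
proof -
  interpret W: kalg W by fact
  interpret kalg_ideal FS BR by (rule quot)
  let ?l = "lin_ext W (\<lambda>p. \<beta> (fst p) (snd p))"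
  note b1 = lin_homD[OF \<beta>[unfolded bilinear_def, THEN conjunct1, rule_format]]
  note b2 = lin_homD[OF \<beta>[unfolded bilinear_def, THEN conjunct2, rule_format]]
  have add: "?l (s + t) = ?l s \<oplus>\<^bsub>W\<^esub> ?l t" if "s \<in> carrier FS" "t \<in> carrier FS" for s t
    by (rule W.lin_ext_add) (use that b1(1) in auto)
  have scale: "?l (pm_scale c t) = c \<odot>\<^bsub>W\<^esub> ?l t" if "t \<in> carrier FS" for c t
    by (rule W.lin_ext_scale) (use that b1(1) in auto)
  have cl: "?l t \<in> carrier W" if "t \<in> carrier FS" for t
    by (rule W.lin_ext_closed) (use that b1(1) in auto)
  have sub: "?l (s - t) = ?l s \<ominus>\<^bsub>W\<^esub> ?l t" if "s \<in> carrier FS" "t \<in> carrier FS" for s t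
    using add[OF that(1), of "pm_scale (-1) t"] scale[OF that(2), of "-1"] that cl[OF that(2)]
    by (simp add: W.smult_minus_one a_minus_def)
  have z: "?l u = \<zero>\<^bsub>W\<^esub>" if "u \<in> BR" for u
    using that
  proof (induction rule: BR_induct)
    case (relation g)
    then show "?l g = \<zero>\<^bsub>W\<^esub>"
    proof (cases rule: tensor_relations_cases)
      case (add_left a a' b)
      then show ?thesis using b1[of b]
        by (simp add: sub keys_diff_subset) (simp add: a_minus_def W.minus_add W.a_assoc W.r_neg W.a_lcomm[of _ _ "\<ominus>\<^bsub>W\<^esub> _"] W.r_neg1 W.r_neg2)
    next
      case (add_right a b b')
      then show ?thesis using b2[of a]
        by (simp add: sub keys_diff_subset) (simp add: a_minus_def W.minus_add W.a_assoc W.r_neg W.a_lcomm[of _ _ "\<ominus>\<^bsub>W\<^esub> _"] W.r_neg1 W.r_neg2)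
    next
      case (scale_left c a b)
      then show ?thesis using b1[of b] by (simp add: sub W.minus_eq_zero_iff)
    next
      case (scale_right c a b)
      then show ?thesis using b2[of a] b1(1)[of b a] by (simp add: sub W.minus_eq_zero_iff)
    qed
  qed (simp_all add: add scale)
  have const: "?l s = ?l t" if "s \<in> tcl t" for s
  proof -
    have "s \<in> carrier FS" "s - t \<in> BR"
      using that unfolding tensor_class_def mem_coset_iff[OF t] FS_minus[OF t] by auto
    then show ?thesis using sub[of s t] z[of "s - t"] cl[of s] cl[of t] t
      by (metis W.minus_eq_zero_iff)
  qed
  have "t \<in> tcl t" using t a_rcos_self by (simp add: tensor_class_def del: FS_simps)
  then have "(THE w. \<forall>s\<in>tcl t. w = ?l s) = ?l t"
    by (intro the_equality) (auto dest: const)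
  then show ?thesis
    unfolding tensor_lift_def lin_ext_def .
qed

lemma tensor_lift_hom:
  assumes W: "kalg W" and \<beta>: "bilinear A B W \<beta>"
  shows "tensor_lift W \<beta> \<in> lin_hom TP W"
    and "a \<in> carrier A \<Longrightarrow> b \<in> carrier B \<Longrightarrow> tensor_lift W \<beta> (pt a b) = \<beta> a b"
proof -
  interpret W: kalg W by fact
  let ?l = "lin_ext W (\<lambda>p. \<beta> (fst p) (snd p))"
  note b1 = lin_homD[OF \<beta>[unfolded bilinear_def, THEN conjunct1, rule_format]]
  note h = lin_homD[OF alg_homD(2)[OF tcl_hom]]
  show "tensor_lift W \<beta> \<in> lin_hom TP W"
  proof (rule lin_homI)
    fix X assume "X \<in> carrier TP"
    then obtain s where s: "s \<in> carrier FS" "X = tcl s" by (auto simp only: TP_carrier)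
    then show "tensor_lift W \<beta> X \<in> carrier W"
      using b1(1) by (auto simp add: tensor_lift_tcl[OF W \<beta>] simp del: FS_simps intro!: W.lin_ext_closed) auto
    show "tensor_lift W \<beta> (c \<odot>\<^bsub>TP\<^esub> X) = c \<odot>\<^bsub>W\<^esub> tensor_lift W \<beta> X" for c
      unfolding s(2) h(3)[OF s(1), symmetric]
      using s keys_pm_scale[of c s] b1(1)
      by (subst (1 2) tensor_lift_tcl[OF W \<beta>]) (auto intro!: W.lin_ext_scale)
    fix Y assume "Y \<in> carrier TP"
    then obtain t where t: "t \<in> carrier FS" "Y = tcl t" by (auto simp only: TP_carrier)
    show "tensor_lift W \<beta> (X \<oplus>\<^bsub>TP\<^esub> Y) = tensor_lift W \<beta> X \<oplus>\<^bsub>W\<^esub> tensor_lift W \<beta> Y"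
      unfolding s(2) t(2) h(2)[OF s(1) t(1), symmetric]
      using s t keys_add[of s t] b1(1)
      by (subst (1 2 3) tensor_lift_tcl[OF W \<beta>]) (auto intro!: W.lin_ext_add)
  qed
  show "tensor_lift W \<beta> (pt a b) = \<beta> a b" if "a \<in> carrier A" "b \<in> carrier B"
    unfolding pure_tensor_def
    by (subst tensor_lift_tcl[OF W \<beta>]) (use that b1(1) in auto)
qed

lemma TP_alg_homI:
  assumes W: "kalg W" and f: "f \<in> lin_hom TP W" and "f (pt \<one>\<^bsub>A\<^esub> \<one>\<^bsub>B\<^esub>) = \<one>\<^bsub>W\<^esub>"
    and mult: "\<And>a b c d. a \<in> carrier A \<Longrightarrow> b \<in> carrier B \<Longrightarrow> c \<in> carrier A \<Longrightarrow> d \<in> carrier B \<Longrightarrow>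
      f (pt (a \<otimes>\<^bsub>A\<^esub> c) (b \<otimes>\<^bsub>B\<^esub> d)) = f (pt a b) \<otimes>\<^bsub>W\<^esub> f (pt c d)"
  shows "f \<in> alg_hom TP W"
proof (rule alg_homI[OF f])
  interpret W: kalg W by fact
  interpret T: kalg TP by (rule TP_kalg)
  note f_simps = lin_homD[OF f] lin_hom_zero[OF TP_kalg W f]
  fix X Y assume X: "X \<in> carrier TP" and Y: "Y \<in> carrier TP"
  from X show "f (X \<otimes>\<^bsub>TP\<^esub> Y) = f X \<otimes>\<^bsub>W\<^esub> f Y"
  proof (induction rule: TP_induct)
    case (pure a b)
    from Y show ?case
      by (induction rule: TP_induct)
         (simp_all add: pure pt_mult mult f_simps T.r_distr W.r_distr)
  qed (simp_all add: Y f_simps T.l_distr W.l_distr)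
qed (simp add: TP_one assms)

end

lemma tensorI: "kalg A \<Longrightarrow> kalg B \<Longrightarrow> tensor A B"
  by (simp add: tensor_def)

lemma bilinearI:
  assumes "\<And>b. b \<in> carrier B \<Longrightarrow> (\<lambda>a. \<beta> a b) \<in> lin_hom A W" "\<And>a. a \<in> carrier A \<Longrightarrow> \<beta> a \<in> lin_hom B W"
  shows "bilinear A B W \<beta>"
  using assms by (simp add: bilinear_def)

lemma tensor_map_bilinear:
  assumes "kalg A" "kalg B" "kalg C" "kalg D" and f: "f \<in> lin_hom A C" and g: "g \<in> lin_hom B D"
  shows "bilinear A B (tensor_product C D) (\<lambda>a b. pure_tensor C D (f a) (g b))"
proof -
  interpret CD: tensor C D using assms by (simp add: tensorI)
  show ?thesis
    by (rule bilinearI)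
       (simp_all add: lin_homD[OF f] lin_homD[OF g] lin_hom_comp[OF f CD.pt_lin_left]
          lin_hom_comp[OF g CD.pt_lin_right])
qed

lemma tensor_map_hom:
  assumes "kalg A" "kalg B" "kalg C" "kalg D" and f: "f \<in> lin_hom A C" and g: "g \<in> lin_hom B D"
  shows "tensor_map C D f g \<in> lin_hom (tensor_product A B) (tensor_product C D)"
    and "a \<in> carrier A \<Longrightarrow> b \<in> carrier B \<Longrightarrow>
      tensor_map C D f g (pure_tensor A B a b) = pure_tensor C D (f a) (g b)"
proof -
  interpret AB: tensor A B using assms by (simp add: tensorI)
  interpret CD: tensor C D using assms by (simp add: tensorI)
  show "tensor_map C D f g \<in> lin_hom (tensor_product A B) (tensor_product C D)"
    "a \<in> carrier A \<Longrightarrow> b \<in> carrier B \<Longrightarrow>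
      tensor_map C D f g (pure_tensor A B a b) = pure_tensor C D (f a) (g b)"
    unfolding tensor_map_def
    using AB.tensor_lift_hom[OF CD.TP_kalg tensor_map_bilinear[OF assms]] by auto
qed

lemma tensor_map_alg_hom:
  assumes "kalg A" "kalg B" "kalg C" "kalg D" and f: "f \<in> alg_hom A C" and g: "g \<in> alg_hom B D"
  shows "tensor_map C D f g \<in> alg_hom (tensor_product A B) (tensor_product C D)"
proof -
  interpret AB: tensor A B using assms by (simp add: tensorI)
  interpret CD: tensor C D using assms by (simp add: tensorI)
  note tm = tensor_map_hom[OF assms(1-4) alg_homD(2)[OF f] alg_homD(2)[OF g]]
  show ?thesis
    by (rule AB.TP_alg_homI[OF CD.TP_kalg tm(1)])
       (simp_all add: tm(2) alg_homD[OF f] alg_homD[OF g] CD.TP_one CD.pt_mult)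
qed

lemma tensor_assoc_hom:
  assumes "kalg A" "kalg B" "kalg C"
  shows "tensor_assoc A B C \<in> alg_hom (tensor_product (tensor_product A B) C) (tensor_product A (tensor_product B C))"
    and "a \<in> carrier A \<Longrightarrow> b \<in> carrier B \<Longrightarrow> c \<in> carrier C \<Longrightarrow>
      tensor_assoc A B C (pure_tensor (tensor_product A B) C (pure_tensor A B a b) c)
      = pure_tensor A (tensor_product B C) a (pure_tensor B C b c)"
proof -
  interpret AB: tensor A B using assms by (simp add: tensorI)
  interpret BC: tensor B C using assms by (simp add: tensorI)
  interpret A_BC: tensor A "tensor_product B C" using assms BC.TP_kalg by (simp add: tensorI)
  interpret AB_C: tensor "tensor_product A B" C using assms AB.TP_kalg by (simp add: tensorI)
  interpret W: kalg "tensor_product A (tensor_product B C)" by (rule A_BC.TP_kalg)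
  let ?W = "tensor_product A (tensor_product B C)"
  let ?\<beta> = "\<lambda>c a b. pure_tensor A (tensor_product B C) a (pure_tensor B C b c)"
  let ?g = "\<lambda>u c. tensor_lift ?W (?\<beta> c) u"
  have bil: "bilinear A B ?W (?\<beta> c)" if "c \<in> carrier C" for c
    by (rule bilinearI)
       (use that in \<open>simp_all add: A_BC.pt_lin_left lin_hom_comp[OF BC.pt_lin_left A_BC.pt_lin_right]\<close>)
  note g = AB.tensor_lift_hom[OF A_BC.TP_kalg bil]
  \<comment> \<open>Linearity in the third variable is hidden inside the inner lift, which is only
    known on pure tensors; hence an induction over the tensor \<open>u\<close>.\<close>
  have gc: "?g u \<in> lin_hom C ?W" if "u \<in> carrier (tensor_product A B)" for u
    using that
  proof (induction rule: AB.TP_induct)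
    case zero
    have z: "?g \<zero>\<^bsub>tensor_product A B\<^esub> c = \<zero>\<^bsub>?W\<^esub>" if "c \<in> carrier C" for c
      by (rule lin_hom_zero[OF AB.TP_kalg A_BC.TP_kalg g(1)[OF that]])
    show ?case by (rule lin_homI) (simp_all add: z)
  next
    case (add X Y)
    have e: "?g (X \<oplus>\<^bsub>tensor_product A B\<^esub> Y) c = ?g X c \<oplus>\<^bsub>?W\<^esub> ?g Y c" if "c \<in> carrier C" for c
      by (rule lin_homD(2)[OF g(1)[OF that]]) (use add in auto)
    show ?case
      by (rule lin_homI) (simp_all add: e lin_homD[OF add(3)] lin_homD[OF add(4)] W.a_ac W.smult_add_right)
  next
    case (pure a b)
    have "(\<lambda>c. ?\<beta> c a b) \<in> lin_hom C ?W"
      using pure by (simp add: lin_hom_comp[OF BC.pt_lin_right A_BC.pt_lin_right])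
    then show ?case
      by (rule lin_hom_cong[OF assms(3)]) (simp add: g(2) pure)
  qed
  have bil2: "bilinear (tensor_product A B) C ?W ?g"
    by (rule bilinearI) (simp_all add: g(1) gc)
  note ta = AB_C.tensor_lift_hom[OF A_BC.TP_kalg bil2, folded tensor_assoc_def]
  show val: "tensor_assoc A B C (pure_tensor (tensor_product A B) C (pure_tensor A B a b) c)
      = pure_tensor A (tensor_product B C) a (pure_tensor B C b c)"
    if "a \<in> carrier A" "b \<in> carrier B" "c \<in> carrier C" for a b c
    using that by (simp add: ta(2) g(2))
  show "tensor_assoc A B C \<in> alg_hom (tensor_product (tensor_product A B) C) ?W"
  proof (rule AB_C.TP_alg_homI[OF A_BC.TP_kalg ta(1)])
    show "tensor_assoc A B C (pure_tensor (tensor_product A B) C \<one>\<^bsub>tensor_product A B\<^esub> \<one>\<^bsub>C\<^esub>) = \<one>\<^bsub>?W\<^esub>"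
      by (simp add: AB.TP_one val A_BC.TP_one BC.TP_one)
  next
    fix U c V d assume U: "U \<in> carrier (tensor_product A B)" and V: "V \<in> carrier (tensor_product A B)"
      and cd: "c \<in> carrier C" "d \<in> carrier C"
    let ?p = "pure_tensor (tensor_product A B) C"
    note simps = AB_C.A.l_distr AB_C.A.r_distr AB_C.pt_bilinear lin_homD[OF ta(1)] W.l_distr W.r_distr cd
      lin_hom_zero[OF AB.TP_kalg AB_C.TP_kalg AB_C.pt_lin_left] lin_hom_zero[OF AB_C.TP_kalg A_BC.TP_kalg ta(1)]
    from U show "tensor_assoc A B C (?p (U \<otimes>\<^bsub>tensor_product A B\<^esub> V) (c \<otimes>\<^bsub>C\<^esub> d))
       = tensor_assoc A B C (?p U c) \<otimes>\<^bsub>?W\<^esub> tensor_assoc A B C (?p V d)"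
    proof (induction rule: AB.TP_induct)
      case (pure a b)
      from V show ?case
      proof (induction rule: AB.TP_induct)
        case (pure a' b')
        then show ?case using \<open>a \<in> _\<close> \<open>b \<in> _\<close> cd
          by (simp add: AB.pt_mult val A_BC.pt_mult BC.pt_mult)
      qed (use pure in \<open>simp_all add: simps\<close>)
    qed (use V in \<open>simp_all add: simps\<close>)
  qed
qed

section \<open>Hopf algebras given by generators\<close>

text \<open>Closure under left multiplication by single generators already yields all words, and the
  resulting induction removes one generator from the left end. This is the form in which products
  are analysed in the Hopf axioms.\<close>

inductive_set alg_span :: "('k::field, 'a, 'm) module_scheme \<Rightarrow> 'a set \<Rightarrow> 'a set" for A X where
  one: "\<one>\<^bsub>A\<^esub> \<in> alg_span A X"
| add: "u \<in> alg_span A X \<Longrightarrow> v \<in> alg_span A X \<Longrightarrow> u \<oplus>\<^bsub>A\<^esub> v \<in> alg_span A X"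
| smult: "u \<in> alg_span A X \<Longrightarrow> c \<odot>\<^bsub>A\<^esub> u \<in> alg_span A X"
| mult: "x \<in> X \<Longrightarrow> u \<in> alg_span A X \<Longrightarrow> x \<otimes>\<^bsub>A\<^esub> u \<in> alg_span A X"

lemma alg_span_closed:
  assumes "kalg A" "X \<subseteq> carrier A" "u \<in> alg_span A X"
  shows "u \<in> carrier A"
proof -
  interpret kalg A by fact
  show ?thesis using assms(3) by induction (use assms(2) in auto)
qed

lemma alg_span_induct [consumes 4, case_names one add smult mult]:
  assumes "kalg A" "X \<subseteq> carrier A" "carrier A \<subseteq> alg_span A X" "u \<in> carrier A" and "P \<one>\<^bsub>A\<^esub>"
    and "\<And>u v. u \<in> carrier A \<Longrightarrow> v \<in> carrier A \<Longrightarrow> P u \<Longrightarrow> P v \<Longrightarrow> P (u \<oplus>\<^bsub>A\<^esub> v)"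
    and "\<And>c u. u \<in> carrier A \<Longrightarrow> P u \<Longrightarrow> P (c \<odot>\<^bsub>A\<^esub> u)"
    and "\<And>x u. x \<in> X \<Longrightarrow> u \<in> carrier A \<Longrightarrow> P u \<Longrightarrow> P (x \<otimes>\<^bsub>A\<^esub> u)"
  shows "P u"
proof -
  have "u \<in> alg_span A X" using assms by auto
  then show ?thesis
    by induction (use assms alg_span_closed[OF assms(1,2)] in auto)
qed

lemma alg_hom_eq_on_generators:
  assumes "kalg A" "X \<subseteq> carrier A" "carrier A \<subseteq> alg_span A X" "f \<in> alg_hom A B" "g \<in> alg_hom A B"
    and "\<And>x. x \<in> X \<Longrightarrow> f x = g x" "u \<in> carrier A"
  shows "f u = g u"
  using assms(1-3,7)
  by (induction rule: alg_span_induct)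
     (use assms(2,6) in \<open>auto simp: alg_homD[OF assms(4)] alg_homD[OF assms(5)]
        lin_homD[OF alg_homD(2)[OF assms(4)]] lin_homD[OF alg_homD(2)[OF assms(5)]] subset_iff\<close>)

lemma base_algebra_simps [simp]:
  "carrier base_algebra = UNIV" "mult base_algebra = (*)" "one base_algebra = 1"
  "zero base_algebra = 0" "add base_algebra = (+)" "smult base_algebra = (*)"
  by (simp_all add: base_algebra_def)

text \<open>Coassociativity and the counit axioms compare algebra maps, so they may be tested on
  generators. The antipode axioms do not compare algebra maps; they are carried from
  \<open>x\<close> and \<open>u\<close> to \<open>x \<otimes> u\<close> by the sandwich arguments
  \<open>mu_mult\<close> and \<open>nu_mult\<close> below, which use that \<open>S\<close> reverses
  products.\<close>

lemma hopf_algebra_by_generators: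
  fixes H :: "('k::field, 'a, 'm) coalg_scheme"
  assumes H: "kalg H" and X: "X \<subseteq> carrier H" and gen: "carrier H \<subseteq> alg_span H X"
    and comult: "comult H \<in> alg_hom H (tensor_product H H)"
    and counit: "counit H \<in> alg_hom H base_algebra"
    and coassoc: "\<And>x. x \<in> X \<Longrightarrow>
        tensor_assoc H H H (tensor_map (tensor_product H H) H (comult H) id (comult H x)) =
        tensor_map H (tensor_product H H) id (comult H) (comult H x)"
    and counit_left: "\<And>x. x \<in> X \<Longrightarrow> tensor_lift H (\<lambda>a b. counit H a \<odot>\<^bsub>H\<^esub> b) (comult H x) = x"
    and counit_right: "\<And>x. x \<in> X \<Longrightarrow> tensor_lift H (\<lambda>a b. counit H b \<odot>\<^bsub>H\<^esub> a) (comult H x) = x"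
    and S: "S \<in> lin_hom H H" "S \<one>\<^bsub>H\<^esub> = \<one>\<^bsub>H\<^esub>"
      "\<And>x h. x \<in> X \<Longrightarrow> h \<in> carrier H \<Longrightarrow> S (x \<otimes>\<^bsub>H\<^esub> h) = S h \<otimes>\<^bsub>H\<^esub> S x"
    and antipode_left: "\<And>x. x \<in> X \<Longrightarrow> tensor_lift H (\<lambda>a b. S a \<otimes>\<^bsub>H\<^esub> b) (comult H x) = counit H x \<odot>\<^bsub>H\<^esub> \<one>\<^bsub>H\<^esub>"
    and antipode_right: "\<And>x. x \<in> X \<Longrightarrow> tensor_lift H (\<lambda>a b. a \<otimes>\<^bsub>H\<^esub> S b) (comult H x) = counit H x \<odot>\<^bsub>H\<^esub> \<one>\<^bsub>H\<^esub>"
  shows "hopf_algebra H"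
proof -
  interpret H: kalg H by fact
  interpret HH: tensor H H using H by (simp add: tensorI)
  interpret T: kalg "tensor_product H H" by (rule HH.TP_kalg)
  note [simp] = lin_homD[OF S(1)] lin_homD[OF alg_homD(2)[OF counit], simplified] alg_homD(3,4)[OF counit, simplified]
  note D = lin_homD[OF alg_homD(2)[OF comult]] alg_homD(3,4)[OF comult]
  have id: "id \<in> alg_hom H H" by (rule alg_homI, rule lin_homI) auto
  note ind = alg_span_induct[OF H X gen, consumes 1, case_names one add smult mult]
  have anti: "S (g \<otimes>\<^bsub>H\<^esub> h) = S h \<otimes>\<^bsub>H\<^esub> S g" if "g \<in> carrier H" "h \<in> carrier H" for g h
    using that(1)
  proof (induction rule: ind)
    case (mult x u)
    have x: "x \<in> carrier H" using X mult by auto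
    with mult that show ?case by (simp add: H.m_assoc S(3))
  qed (use that S in \<open>simp_all add: H.l_distr H.r_distr H.smult_mult_left H.smult_mult_right\<close>)
  have co: "tensor_assoc H H H (tensor_map (tensor_product H H) H (comult H) id (comult H h)) =
        tensor_map H (tensor_product H H) id (comult H) (comult H h)" if "h \<in> carrier H" for h
    by (rule alg_hom_eq_on_generators[OF H X gen _ _ coassoc that])
       (use H HH.TP_kalg in \<open>auto intro!: alg_hom_comp[OF alg_hom_comp[OF comult tensor_map_alg_hom] tensor_assoc_hom(1)]
          alg_hom_comp[OF comult tensor_map_alg_hom] comult id\<close>)
  have cl_bil: "bilinear H H H (\<lambda>a b. counit H a \<odot>\<^bsub>H\<^esub> b)" "bilinear H H H (\<lambda>a b. counit H b \<odot>\<^bsub>H\<^esub> a)"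
    by (rule bilinearI; rule lin_homI;
        simp add: H.smult_add_left H.smult_add_right H.smult_smult mult.commute)+
  note cl = HH.tensor_lift_hom[OF H cl_bil(1)] and cr = HH.tensor_lift_hom[OF H cl_bil(2)]
  have cl_alg: "tensor_lift H (\<lambda>a b. counit H a \<odot>\<^bsub>H\<^esub> b) \<in> alg_hom (tensor_product H H) H"
    by (rule HH.TP_alg_homI[OF H cl(1)])
       (simp_all add: cl(2) H.smult_mult_left H.smult_mult_right H.smult_smult mult.commute)
  have cr_alg: "tensor_lift H (\<lambda>a b. counit H b \<odot>\<^bsub>H\<^esub> a) \<in> alg_hom (tensor_product H H) H"
    by (rule HH.TP_alg_homI[OF H cr(1)])
       (simp_all add: cr(2) H.smult_mult_left H.smult_mult_right H.smult_smult mult.commute)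
  have cu: "tensor_lift H (\<lambda>a b. counit H a \<odot>\<^bsub>H\<^esub> b) (comult H h) = h"
    "tensor_lift H (\<lambda>a b. counit H b \<odot>\<^bsub>H\<^esub> a) (comult H h) = h" if "h \<in> carrier H" for h
    using alg_hom_eq_on_generators[OF H X gen alg_hom_comp[OF comult cl_alg] id _ that]
      alg_hom_eq_on_generators[OF H X gen alg_hom_comp[OF comult cr_alg] id _ that]
      counit_left counit_right by auto
  have s_bil: "bilinear H H H (\<lambda>a b. S a \<otimes>\<^bsub>H\<^esub> b)" "bilinear H H H (\<lambda>a b. a \<otimes>\<^bsub>H\<^esub> S b)"
    by (rule bilinearI; rule lin_homI;
        simp add: H.l_distr H.r_distr H.smult_mult_left H.smult_mult_right)+
  note sl = HH.tensor_lift_hom[OF H s_bil(1)] and sr = HH.tensor_lift_hom[OF H s_bil(2)]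
  define \<mu> where "\<mu> = tensor_lift H (\<lambda>a b. S a \<otimes>\<^bsub>H\<^esub> b)"
  define \<nu> where "\<nu> = tensor_lift H (\<lambda>a b. a \<otimes>\<^bsub>H\<^esub> S b)"
  note mu = sl[folded \<mu>_def] and nu = sr[folded \<nu>_def]
  note mu' [simp] = lin_homD[OF mu(1)] lin_hom_zero[OF HH.TP_kalg H mu(1)] mu(2)
  note nu' [simp] = lin_homD[OF nu(1)] lin_hom_zero[OF HH.TP_kalg H nu(1)] nu(2)
  note dist = H.l_distr H.r_distr H.smult_mult_left H.smult_mult_right T.l_distr T.r_distr
    T.smult_mult_left T.smult_mult_right H.smult_add_right H.smult_smult
  \<comment> \<open>For \<open>V\<close> the pure tensor of \<open>c\<close> and \<open>d\<close>,
    multiplying out gives \<open>\<mu>\<close> of the product as \<open>S c\<close>, then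
    \<open>\<mu> U\<close>, then \<open>d\<close>. If the inner value is a scalar, it moves
    out.\<close>
  have mu_mult: "\<mu> (U \<otimes>\<^bsub>tensor_product H H\<^esub> V) = e \<odot>\<^bsub>H\<^esub> \<mu> V"
    if "U \<in> carrier (tensor_product H H)" "\<mu> U = e \<odot>\<^bsub>H\<^esub> \<one>\<^bsub>H\<^esub>" "V \<in> carrier (tensor_product H H)" for U V e
    using that(3)
  proof (induction rule: HH.TP_induct)
    case (pure c d)
    have "\<mu> (U \<otimes>\<^bsub>tensor_product H H\<^esub> pure_tensor H H c d) = S c \<otimes>\<^bsub>H\<^esub> \<mu> U \<otimes>\<^bsub>H\<^esub> d"
      using that(1)
      by (induction rule: HH.TP_induct)
         (use pure in \<open>simp_all add: dist HH.pt_mult anti H.m_assoc\<close>)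
    then show ?case using pure that(2) by (simp add: dist)
  qed (use that(1) in \<open>simp_all add: dist\<close>)
  \<comment> \<open>The mirror image: here the value of the right factor is caught between
    \<open>c\<close> and \<open>S d\<close>, so it is the right factor that must evaluate to a
    scalar.\<close>
  have nu_mult: "\<nu> (U \<otimes>\<^bsub>tensor_product H H\<^esub> V) = e \<odot>\<^bsub>H\<^esub> \<nu> U"
    if "U \<in> carrier (tensor_product H H)" "\<nu> V = e \<odot>\<^bsub>H\<^esub> \<one>\<^bsub>H\<^esub>" "V \<in> carrier (tensor_product H H)" for U V e
    using that(1)
  proof (induction rule: HH.TP_induct)
    case (pure c d)
    have "\<nu> (pure_tensor H H c d \<otimes>\<^bsub>tensor_product H H\<^esub> V) = c \<otimes>\<^bsub>H\<^esub> \<nu> V \<otimes>\<^bsub>H\<^esub> S d"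
      using that(3)
      by (induction rule: HH.TP_induct)
         (use pure in \<open>simp_all add: dist HH.pt_mult anti H.m_assoc\<close>)
    then show ?case using pure that(2) by (simp add: dist)
  qed (use that(3) in \<open>simp_all add: dist\<close>)
  have an: "\<mu> (comult H h) = counit H h \<odot>\<^bsub>H\<^esub> \<one>\<^bsub>H\<^esub> \<and> \<nu> (comult H h) = counit H h \<odot>\<^bsub>H\<^esub> \<one>\<^bsub>H\<^esub>"
    if "h \<in> carrier H" for h
    using that
  proof (induction rule: ind)
    case one
    show ?case using S by (simp add: D HH.TP_one)
  next
    case (mult x u)
    have x: "x \<in> carrier H" using X mult by auto
    have "\<mu> (comult H (x \<otimes>\<^bsub>H\<^esub> u)) = counit H x \<odot>\<^bsub>H\<^esub> \<mu> (comult H u)"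
      using x mult antipode_left[OF mult(1)] by (simp add: D mu_mult \<mu>_def[symmetric])
    moreover have "\<nu> (comult H (x \<otimes>\<^bsub>H\<^esub> u)) = counit H u \<odot>\<^bsub>H\<^esub> \<nu> (comult H x)"
      using x mult by (simp add: D nu_mult)
    moreover have "\<nu> (comult H x) = counit H x \<odot>\<^bsub>H\<^esub> \<one>\<^bsub>H\<^esub>"
      using antipode_right[OF mult(1)] by (simp add: \<nu>_def)
    ultimately show ?case using x mult by (simp add: H.smult_smult mult.commute)
  qed (simp_all add: D H.smult_add_left H.smult_smult)
  show ?thesis
    unfolding hopf_algebra_def
    using H.k_algebra comult counit co cu an S(1) unfolding \<mu>_def \<nu>_def by blast
qed

declare One_nat_def [simp del]

section \<open>The free algebra on words\<close>

text \<open>Words form a monoid under concatenation, so the library's convolution product makes the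
  free vector space on words a ring, and this product is the one of \<^const>\<open>tensor_alg\<close>.\<close>

instantiation list :: (type) monoid_add
begin
definition zero_list_def: "0 = []"
definition plus_list_def: "u + v = u @ v"
instance by standard (auto simp: zero_list_def plus_list_def)
end

lemma single_Nil_one: "Poly_Mapping.single [] 1 = (1 :: 'a list \<Rightarrow>\<^sub>0 'k::field)"
  by (metis single_one zero_list_def)

lemma single_mult_words [simp]:
  "Poly_Mapping.single u c * Poly_Mapping.single v d = (Poly_Mapping.single (u @ v) (c * d) :: 'a list \<Rightarrow>\<^sub>0 'k::field)"
  by (simp add: mult_single plus_list_def)

lemma pm_scale_eq_mult: "pm_scale c f = Poly_Mapping.single [] c * (f :: 'a list \<Rightarrow>\<^sub>0 'k::field)"
  by (simp add: pm_scale_def mult_map_scale_conv_mult zero_list_def)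

lemma pm_linear_mult_left: "pm_linear (\<lambda>f. f * (g :: 'a list \<Rightarrow>\<^sub>0 'k::field))"
  by (simp add: pm_linear_def pm_scale_eq_mult algebra_simps)

lemma single_Nil_commute: "Poly_Mapping.single [] c * f = f * (Poly_Mapping.single [] c :: 'a list \<Rightarrow>\<^sub>0 'k::field)"
proof -
  have *: "pm_scale c f = f * Poly_Mapping.single [] c"
    by (rule pm_linear_eqI[where \<phi>="pm_scale c" and \<psi>="\<lambda>f. f * Poly_Mapping.single [] c"])
       (simp_all add: pm_linear_mult_left pm_linear_scale[OF pm_linear_id])
  then show ?thesis by (simp add: pm_scale_eq_mult)
qed

lemma pm_scale_mult_left: "pm_scale c f * g = pm_scale c (f * (g :: 'a list \<Rightarrow>\<^sub>0 'k::field))"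
  by (simp add: pm_scale_eq_mult mult.assoc)

lemma pm_scale_mult_right: "f * pm_scale c g = pm_scale c (f * (g :: 'a list \<Rightarrow>\<^sub>0 'k::field))"
  by (simp add: pm_scale_eq_mult single_Nil_commute[of c] mult.assoc)

lemma pm_linear_mult_right: "pm_linear (\<lambda>g. f * (g :: 'a list \<Rightarrow>\<^sub>0 'k::field))"
  by (simp add: pm_linear_def pm_scale_mult_right algebra_simps)

lemma bilin_ext_append: "bilin_ext (\<lambda>u v. Poly_Mapping.single (u @ v) 1) f g = f * (g :: 'a list \<Rightarrow>\<^sub>0 'k::field)"
proof (rule pm_linear_eqI[where \<phi>="\<lambda>f. bilin_ext (\<lambda>u v. Poly_Mapping.single (u @ v) 1) f g" and \<psi>="\<lambda>f. f * g"])
  fix u assume "u \<in> Poly_Mapping.keys f"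
  show "bilin_ext (\<lambda>u v. Poly_Mapping.single (u @ v) 1) (Poly_Mapping.single u 1) g = Poly_Mapping.single u 1 * g"
    by (rule pm_linear_eqI[where \<phi>="\<lambda>g. bilin_ext (\<lambda>u v. Poly_Mapping.single (u @ v) 1) (Poly_Mapping.single u 1) g"
          and \<psi>="\<lambda>g. Poly_Mapping.single u 1 * g"])
       (simp_all add: pm_linear_bilin_ext_right pm_linear_mult_right)
qed (simp_all add: pm_linear_bilin_ext_left pm_linear_mult_left)

lemma bilin_ext_append': "bilin_ext (\<lambda>u v. Poly_Mapping.single (u @ v) 1) = ((*) :: ('a list \<Rightarrow>\<^sub>0 'k::field) \<Rightarrow> _)"
  by (intro ext bilin_ext_append)

lemma lookup_mult_Nil: "Poly_Mapping.lookup (f * g) [] = Poly_Mapping.lookup f [] * Poly_Mapping.lookup (g :: 'a list \<Rightarrow>\<^sub>0 'k::field) []"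
proof -
  \<comment> \<open>The scalar identity is wrapped into multiples of the empty word, because the
    linearity principle compares maps with values in finitely supported functions.\<close>
  have a: "Poly_Mapping.single [] (Poly_Mapping.lookup (f * g) []) = (Poly_Mapping.single [] (Poly_Mapping.lookup f [] * Poly_Mapping.lookup g []) :: 'a list \<Rightarrow>\<^sub>0 'k)"
  proof (rule pm_linear_eqI[where \<phi>="\<lambda>f. Poly_Mapping.single [] (Poly_Mapping.lookup (f * g) [])"
        and \<psi>="\<lambda>f. Poly_Mapping.single [] (Poly_Mapping.lookup f [] * Poly_Mapping.lookup g [])"])
    fix u assume "u \<in> Poly_Mapping.keys f"
    show "Poly_Mapping.single [] (Poly_Mapping.lookup (Poly_Mapping.single u 1 * g) []) =
      (Poly_Mapping.single [] (Poly_Mapping.lookup (Poly_Mapping.single u 1) [] * Poly_Mapping.lookup g []) :: 'a list \<Rightarrow>\<^sub>0 'k)"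
      by (rule pm_linear_eqI[where \<phi>="\<lambda>g. Poly_Mapping.single [] (Poly_Mapping.lookup (Poly_Mapping.single u 1 * g) [])"
          and \<psi>="\<lambda>g. Poly_Mapping.single [] (Poly_Mapping.lookup (Poly_Mapping.single u 1) [] * Poly_Mapping.lookup g [])"])
         (auto simp: lookup_single when_def pm_linear_def pm_scale_mult_right lookup_add single_add algebra_simps)
  qed (simp_all add: pm_linear_def pm_scale_mult_left lookup_add single_add algebra_simps)
  then show ?thesis by (metis lookup_single_eq)
qed

text \<open>Multiplies every word by a weight that depends on its multidegree only. One operator
  thus serves for characters of the grading, for braiding scalars and, with 0-1 weights, for
  projections to homogeneous components.\<close>

definition wscale :: "('a multiset \<Rightarrow> 'k) \<Rightarrow> ('a list \<Rightarrow>\<^sub>0 'k) \<Rightarrow> ('a list \<Rightarrow>\<^sub>0 'k::field)" where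
  "wscale s = pm_lift (\<lambda>w. Poly_Mapping.single w (s (mset w)))"

lemma pm_linear_wscale: "pm_linear (wscale s)"
  unfolding wscale_def by (rule pm_linear_pm_lift)

lemmas wscale_linear = pm_linearD[OF pm_linear_wscale]

lemma wscale_single [simp]: "wscale s (Poly_Mapping.single w c) = Poly_Mapping.single w (c * s (mset w))"
  by (simp add: wscale_def)

lemma lookup_wscale [simp]: "Poly_Mapping.lookup (wscale s f) w = s (mset w) * Poly_Mapping.lookup f w"
proof -
  have "Poly_Mapping.lookup (wscale s f) w = (\<Sum>v\<in>Poly_Mapping.keys f. if v = w then s (mset w) * Poly_Mapping.lookup f w else 0)"
    unfolding wscale_def lookup_pm_lift by (rule sum.cong) (auto simp: lookup_single when_def)
  then show ?thesis by (auto simp: not_in_keys_iff_lookup_eq_zero)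
qed

lemma keys_wscale: "Poly_Mapping.keys (wscale s f) \<subseteq> Poly_Mapping.keys f"
  by (metis in_keys_iff lookup_wscale mult_zero_right subsetI)

lemma wscale_wscale: "wscale s (wscale s' f) = wscale (\<lambda>M. s M * s' M) f"
  by (rule poly_mapping_eqI) simp

lemma wscale_const: "(\<And>w. w \<in> Poly_Mapping.keys f \<Longrightarrow> s (mset w) = c) \<Longrightarrow> wscale s f = pm_scale c f"
  by (rule poly_mapping_eqI) (metis in_keys_iff lookup_pm_scale lookup_wscale mult_zero_right)

text \<open>The zero tensor has every degree, so statements about degrees carry nonvanishing as a
  separate hypothesis.\<close>

definition has_degree :: "'a multiset \<Rightarrow> ('a list \<Rightarrow>\<^sub>0 'k::field) \<Rightarrow> bool" where
  "has_degree M f \<longleftrightarrow> (\<forall>w\<in>Poly_Mapping.keys f. mset w = M)"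

lemma wscale_has_degree: "has_degree M f \<Longrightarrow> wscale s f = pm_scale (s M) f"
  by (rule wscale_const) (simp add: has_degree_def)

lemma has_degree_simps [simp]:
  fixes f g :: "'a list \<Rightarrow>\<^sub>0 'k::field"
  shows "has_degree M 0" "has_degree M f \<Longrightarrow> has_degree M (pm_scale c f)" "has_degree M f \<Longrightarrow> has_degree M (- f)"
  "has_degree M f \<Longrightarrow> has_degree M g \<Longrightarrow> has_degree M (f + g)"
  "has_degree M f \<Longrightarrow> has_degree M g \<Longrightarrow> has_degree M (f - g)"
  "mset w = M \<Longrightarrow> has_degree M (Poly_Mapping.single w c)"
  "M = {#} \<Longrightarrow> has_degree M (1 :: 'a list \<Rightarrow>\<^sub>0 'k::field)"
proof -
  show add: "has_degree M (f + g)" if "has_degree M f" "has_degree M g" for f g :: "'a list \<Rightarrow>\<^sub>0 'k"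
    using that keys_add[of f g] by (auto simp: has_degree_def)
  show "has_degree M f \<Longrightarrow> has_degree M g \<Longrightarrow> has_degree M (f - g)"
    using add[of f "- g"] by (simp add: has_degree_def)
  show "has_degree M f \<Longrightarrow> has_degree M (pm_scale c f)"
    using keys_pm_scale[of c f] by (auto simp: has_degree_def)
  show "has_degree M (1 :: 'a list \<Rightarrow>\<^sub>0 'k::field)" if "M = {#}"
    using that unfolding single_Nil_one[symmetric] by (simp add: has_degree_def)
qed (auto simp: has_degree_def)

lemma keys_mult_words: "w \<in> Poly_Mapping.keys (f * g) \<Longrightarrow>
    \<exists>u v. w = u @ v \<and> u \<in> Poly_Mapping.keys f \<and> v \<in> Poly_Mapping.keys (g :: 'a list \<Rightarrow>\<^sub>0 'k::field)"
  using keys_mult[of f g] by (auto simp: plus_list_def)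

lemma has_degree_mult: "has_degree M f \<Longrightarrow> has_degree M' g \<Longrightarrow> has_degree (M + M') (f * g)"
  by (auto simp: has_degree_def dest!: keys_mult_words)

lemma has_degree_empty: "has_degree {#} f \<Longrightarrow> f = Poly_Mapping.single [] (Poly_Mapping.lookup f [])"
  by (rule poly_mapping_eqI) (auto simp: has_degree_def lookup_single when_def not_in_keys_iff_lookup_eq_zero[symmetric])

definition words_in :: "'a set \<Rightarrow> ('a list \<Rightarrow>\<^sub>0 'k::field) set" where
  "words_in S = {f. Poly_Mapping.keys f \<subseteq> lists S}"

lemma words_in_simps [simp]:
  fixes f g :: "'a list \<Rightarrow>\<^sub>0 'k::field"
  shows "0 \<in> words_in S" "f \<in> words_in S \<Longrightarrow> pm_scale c f \<in> words_in S" "f \<in> words_in S \<Longrightarrow> - f \<in> words_in S"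
  "f \<in> words_in S \<Longrightarrow> g \<in> words_in S \<Longrightarrow> f + g \<in> words_in S"
  "f \<in> words_in S \<Longrightarrow> g \<in> words_in S \<Longrightarrow> f - g \<in> words_in S"
  "f \<in> words_in S \<Longrightarrow> g \<in> words_in S \<Longrightarrow> f * g \<in> words_in S"
  "set w \<subseteq> S \<Longrightarrow> Poly_Mapping.single w c \<in> words_in S"
  "(1 :: 'a list \<Rightarrow>\<^sub>0 'k::field) \<in> words_in S"
  "f \<in> words_in S \<Longrightarrow> wscale s f \<in> words_in S"
proof -
  show add: "f + g \<in> words_in S" if "f \<in> words_in S" "g \<in> words_in S" for f g :: "'a list \<Rightarrow>\<^sub>0 'k"
    using that keys_add[of f g] by (auto simp: words_in_def)
  show "f \<in> words_in S \<Longrightarrow> g \<in> words_in S \<Longrightarrow> f - g \<in> words_in S"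
    using add[of f "- g"] by (simp add: words_in_def)
  show "f \<in> words_in S \<Longrightarrow> pm_scale c f \<in> words_in S"
    using keys_pm_scale[of c f] by (auto simp: words_in_def)
  show "(1 :: 'a list \<Rightarrow>\<^sub>0 'k::field) \<in> words_in S" unfolding single_Nil_one[symmetric] by (simp add: words_in_def)
  show "f \<in> words_in S \<Longrightarrow> wscale s f \<in> words_in S"
    using keys_wscale[of s f] by (auto simp: words_in_def)
  show "f \<in> words_in S \<Longrightarrow> g \<in> words_in S \<Longrightarrow> f * g \<in> words_in S"
    by (auto simp: words_in_def lists_eq_set subset_iff dest!: keys_mult_words)
qed (auto simp: words_in_def)

lemma words_in_sum: "(\<And>i. i \<in> I \<Longrightarrow> f i \<in> words_in S) \<Longrightarrow> sum f I \<in> words_in S"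
  by (induction I rule: infinite_finite_induct) auto

lemma words_in_pm_lift: "(\<And>p. p \<in> Poly_Mapping.keys t \<Longrightarrow> \<phi> p \<in> words_in S) \<Longrightarrow> pm_lift \<phi> t \<in> words_in S"
  unfolding pm_lift_def by (rule words_in_sum) auto

lemma pm_eq_zeroI: "(\<And>v. v \<notin> Poly_Mapping.keys f) \<Longrightarrow> f = 0"
  by (rule poly_mapping_eqI) (simp add: not_in_keys_iff_lookup_eq_zero)

section \<open>Skew derivations and the radical\<close>

locale braiding =
  fixes Q :: "nat \<Rightarrow> nat \<Rightarrow> 'k::field" and r :: nat
begin

text \<open>\<open>chl i M\<close> is the scalar for braiding a monomial of degree \<open>M\<close>
  past \<open>x i\<close>; \<open>chr i M\<close> is the scalar for braiding \<open>x i\<close> past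
  such a monomial.\<close>

definition chl :: "nat \<Rightarrow> nat multiset \<Rightarrow> 'k" where "chl i M = (\<Prod>k\<in>#M. Q k i)"
definition chr :: "nat \<Rightarrow> nat multiset \<Rightarrow> 'k" where "chr i M = (\<Prod>k\<in>#M. Q i k)"

lemma chl_simps [simp]: "chl i {#} = 1" "chl i (add_mset k M) = Q k i * chl i M" "chl i (M + M') = chl i M * chl i M'"
  and chr_simps [simp]: "chr i {#} = 1" "chr i (add_mset k M) = Q i k * chr i M" "chr i (M + M') = chr i M * chr i M'"
  by (simp_all add: chl_def chr_def)

abbreviation x :: "nat \<Rightarrow> nat list \<Rightarrow>\<^sub>0 'k" where "x i \<equiv> Poly_Mapping.single [i] 1"
abbreviation wd :: "nat list \<Rightarrow> nat list \<Rightarrow>\<^sub>0 'k" where "wd w \<equiv> Poly_Mapping.single w 1"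
abbreviation T :: "(nat list \<Rightarrow>\<^sub>0 'k) set" where "T \<equiv> words_in {1..r}"

text \<open>With \<open>\<Delta>\<close> the braided coproduct, \<open>\<Delta> f = 1 \<otimes> f + \<Sum>\<^sub>i x\<^sub>i \<otimes> lder i f + \<dots>\<close> and
  \<open>\<Delta> f = f \<otimes> 1 + \<Sum>\<^sub>i rder i f \<otimes> x\<^sub>i + \<dots>\<close>.\<close>

primrec lder_word :: "nat \<Rightarrow> nat list \<Rightarrow> nat list \<Rightarrow>\<^sub>0 'k" where
  "lder_word i [] = 0"
| "lder_word i (k # w) = (if k = i then wd w else 0) + pm_scale (Q k i) (x k * lder_word i w)"

primrec rder_word :: "nat \<Rightarrow> nat list \<Rightarrow> nat list \<Rightarrow>\<^sub>0 'k" where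
  "rder_word i [] = 0"
| "rder_word i (k # w) = x k * rder_word i w + (if k = i then pm_scale (chr i (mset w)) (wd w) else 0)"

definition lder :: "nat \<Rightarrow> (nat list \<Rightarrow>\<^sub>0 'k) \<Rightarrow> (nat list \<Rightarrow>\<^sub>0 'k)" where "lder i = pm_lift (lder_word i)"
definition rder :: "nat \<Rightarrow> (nat list \<Rightarrow>\<^sub>0 'k) \<Rightarrow> (nat list \<Rightarrow>\<^sub>0 'k)" where "rder i = pm_lift (rder_word i)"

lemma pm_linear_lder: "pm_linear (lder i)" and pm_linear_rder: "pm_linear (rder i)"
  by (simp_all add: lder_def rder_def pm_linear_pm_lift)

lemmas lder_linear = pm_linearD[OF pm_linear_lder]
lemmas rder_linear = pm_linearD[OF pm_linear_rder]

lemma lder_single [simp]: "lder i (Poly_Mapping.single w c) = pm_scale c (lder_word i w)"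
  and rder_single [simp]: "rder i (Poly_Mapping.single w c) = pm_scale c (rder_word i w)"
  by (simp_all add: lder_def rder_def)

lemma bilinear_eqI:
  assumes "\<And>g. pm_linear (\<lambda>f. \<phi> f g)" "\<And>f. pm_linear (\<phi> f)" "\<And>g. pm_linear (\<lambda>f. \<psi> f g)" "\<And>f. pm_linear (\<psi> f)"
    and "\<And>u v. u \<in> Poly_Mapping.keys f \<Longrightarrow> v \<in> Poly_Mapping.keys g \<Longrightarrow> \<phi> (Poly_Mapping.single u 1) (Poly_Mapping.single v 1) = \<psi> (Poly_Mapping.single u 1) (Poly_Mapping.single v 1)"
  shows "\<phi> f g = \<psi> f g"
proof (rule pm_linear_eqI[where \<phi>="\<lambda>f. \<phi> f g" and \<psi>="\<lambda>f. \<psi> f g"])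
  fix u assume u: "u \<in> Poly_Mapping.keys f"
  show "\<phi> (Poly_Mapping.single u 1) g = \<psi> (Poly_Mapping.single u 1) g"
    by (rule pm_linear_eqI[where \<phi>="\<phi> (Poly_Mapping.single u 1)" and \<psi>="\<psi> (Poly_Mapping.single u 1)"])
       (use assms u in auto)
qed (use assms in auto)

lemma lder_word_append:
  "lder_word i (u @ v) = lder_word i u * wd v + pm_scale (chl i (mset u)) (wd u * lder_word i v)"
proof (induction u)
  case Nil
  then show ?case by (simp add: single_Nil_one)
next
  case (Cons k u)
  have *: "x k * (wd u * lder_word i v) = wd (k # u) * lder_word i v"
    by (subst mult.assoc[symmetric]) (simp only: single_mult_words append.simps mult_1)
  show ?case
    by (simp only: append_Cons lder_word.simps Cons distrib_left distrib_right pm_scale_add pm_scale_mult_left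
        pm_scale_mult_right * mset.simps mset_append chl_simps pm_scale_scale mult.assoc, cases "k = i")
       (simp_all only: if_True if_False single_mult_words mult_zero_left mult_1 mult_1_right add_0 add_0_right add.assoc
          simp_thms mult.commute)
qed

lemma rder_word_append:
  "rder_word i (u @ v) = wd u * rder_word i v + pm_scale (chr i (mset v)) (rder_word i u * wd v)"
proof (induction u)
  case Nil
  then show ?case by (simp add: single_Nil_one)
next
  case (Cons k u)
  have *: "x k * (wd u * rder_word i v) = wd (k # u) * rder_word i v"
    by (subst mult.assoc[symmetric]) (simp only: single_mult_words append.simps mult_1)
  show ?case
    by (simp only: append_Cons rder_word.simps Cons distrib_left distrib_right pm_scale_add pm_scale_mult_left
        pm_scale_mult_right * mset.simps mset_append chr_simps pm_scale_scale mult.assoc, cases "k = i")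
       (simp_all only: if_True if_False single_mult_words mult_zero_left mult_1 mult_1_right add_0 add_0_right add.assoc
          simp_thms pm_scale_mult_left pm_scale_simps(1) pm_scale_scale mult.commute[of "chr i (mset u)" "chr i (mset v)"])
qed

lemma lder_mult: "lder i (f * g) = lder i f * g + wscale (chl i) f * lder i g"
proof (rule bilinear_eqI[where \<phi>="\<lambda>f g. lder i (f * g)" and \<psi>="\<lambda>f g. lder i f * g + wscale (chl i) f * lder i g"])
  fix u v
  show "lder i (wd u * wd v) = lder i (wd u) * wd v + wscale (chl i) (wd u) * lder i (wd v)"
    using pm_scale_mult_left[of "chl i (mset u)" "wd u" "lder_word i v"]
    by (simp only: single_mult_words lder_single lder_word_append pm_scale_simps mult_1 wscale_single
        pm_scale_single mult_1_right)
qed (rule pm_linear_add pm_linear_comp[OF pm_linear_lder pm_linear_mult_left]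
      pm_linear_comp[OF pm_linear_lder pm_linear_mult_right] pm_linear_comp[OF pm_linear_mult_left pm_linear_lder]
      pm_linear_comp[OF pm_linear_mult_left pm_linear_wscale] pm_linear_comp[OF pm_linear_mult_right pm_linear_lder]
      pm_linear_mult_right)+

lemma rder_mult: "rder i (f * g) = f * rder i g + rder i f * wscale (chr i) g"
proof (rule bilinear_eqI[where \<phi>="\<lambda>f g. rder i (f * g)" and \<psi>="\<lambda>f g. f * rder i g + rder i f * wscale (chr i) g"])
  fix u v
  show "rder i (wd u * wd v) = wd u * rder i (wd v) + rder i (wd u) * wscale (chr i) (wd v)"
    using pm_scale_mult_right[of "rder_word i u" "chr i (mset v)" "wd v"]
    by (simp only: single_mult_words rder_single rder_word_append pm_scale_simps mult_1 wscale_single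
        pm_scale_single mult_1_right)
qed (rule pm_linear_add pm_linear_comp[OF pm_linear_rder pm_linear_mult_left]
      pm_linear_comp[OF pm_linear_rder pm_linear_mult_right] pm_linear_comp[OF pm_linear_mult_left pm_linear_rder]
      pm_linear_comp[OF pm_linear_mult_right pm_linear_wscale] pm_linear_comp[OF pm_linear_mult_right pm_linear_rder]
      pm_linear_mult_left)+

lemma lder_gen_mult: "lder i (x j * f) = (if i = j then f else 0) + pm_scale (Q j i) (x j * lder i f)"
  by (auto simp: lder_mult single_Nil_one pm_scale_mult_left[symmetric])

lemma rder_gen_mult: "rder i (x j * f) = x j * rder i f + (if i = j then wscale (chr i) f else 0)"
  by (auto simp: rder_mult single_Nil_one)

lemma rder_mult_gen: "rder i (f * x j) = (if i = j then f else 0) + pm_scale (Q i j) (rder i f * x j)"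
proof -
  have "wscale (chr i) (x j) = pm_scale (Q i j) (x j)" by simp
  then show ?thesis by (auto simp: rder_mult single_Nil_one pm_scale_mult_right simp del: wscale_single pm_scale_single)
qed

lemma lder_gen [simp]: "lder_word i [j] = (if i = j then 1 else 0)"
  and rder_gen [simp]: "rder_word i [j] = (if i = j then 1 else 0)"
  by (auto simp: single_Nil_one)

lemma lder_one [simp]: "lder i 1 = 0" and rder_one [simp]: "rder i 1 = 0"
  unfolding single_Nil_one[symmetric] by (simp_all del: single_one)

lemma keys_lder_word: "v \<in> Poly_Mapping.keys (lder_word i w) \<Longrightarrow> add_mset i (mset v) = mset w"
proof (induction w arbitrary: v)
  case (Cons k w)
  then consider "k = i" "v = w" | "v \<in> Poly_Mapping.keys (x k * lder_word i w)"
    using keys_add[of "if k = i then wd w else 0" "pm_scale (Q k i) (x k * lder_word i w)"]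
      keys_pm_scale[of "Q k i" "x k * lder_word i w"] by (auto split: if_splits)
  then show ?case
    by cases (use Cons.IH in \<open>auto dest!: keys_mult_words\<close>)
qed auto

lemma keys_rder_word: "v \<in> Poly_Mapping.keys (rder_word i w) \<Longrightarrow> add_mset i (mset v) = mset w"
proof (induction w arbitrary: v)
  case (Cons k w)
  then consider "k = i" "v \<in> Poly_Mapping.keys (pm_scale (chr i (mset w)) (wd w))" | "v \<in> Poly_Mapping.keys (x k * rder_word i w)"
    using keys_add[of "x k * rder_word i w" "if k = i then pm_scale (chr i (mset w)) (wd w) else 0"]
    by (auto split: if_splits)
  then show ?case
    by cases (use Cons.IH keys_pm_scale in \<open>auto dest!: keys_mult_words split: if_splits\<close>)
qed auto

lemma keys_lder: "v \<in> Poly_Mapping.keys (lder i f) \<Longrightarrow> \<exists>w\<in>Poly_Mapping.keys f. add_mset i (mset v) = mset w"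
proof -
  assume v: "v \<in> Poly_Mapping.keys (lder i f)"
  have "Poly_Mapping.keys (lder i f) \<subseteq> {v. \<exists>w\<in>Poly_Mapping.keys f. add_mset i (mset v) = mset w}"
    unfolding lder_def by (rule keys_pm_lift[OF subset_refl]) (use keys_lder_word in blast)
  then show ?thesis using v by blast
qed

lemma keys_rder: "v \<in> Poly_Mapping.keys (rder i f) \<Longrightarrow> \<exists>w\<in>Poly_Mapping.keys f. add_mset i (mset v) = mset w"
proof -
  assume v: "v \<in> Poly_Mapping.keys (rder i f)"
  have "Poly_Mapping.keys (rder i f) \<subseteq> {v. \<exists>w\<in>Poly_Mapping.keys f. add_mset i (mset v) = mset w}"
    unfolding rder_def by (rule keys_pm_lift[OF subset_refl]) (use keys_rder_word in blast)
  then show ?thesis using v by blast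
qed

lemma set_eq_of_add_mset: "add_mset i (mset v) = mset w \<Longrightarrow> set v \<subseteq> set w \<and> i \<in> set w"
  by (metis set_mset_mset set_mset_add_mset_insert insertI1 subset_insertI)

lemma lder_in [simp]: "f \<in> words_in S \<Longrightarrow> lder i f \<in> words_in S"
  and rder_in [simp]: "f \<in> words_in S \<Longrightarrow> rder i f \<in> words_in S"
  unfolding words_in_def
  by (auto dest!: keys_lder keys_rder set_eq_of_add_mset)

lemma lder_outside:
  assumes f: "f \<in> words_in S" and i: "i \<notin> S"
  shows "lder i f = 0"
proof (rule pm_eq_zeroI)
  fix v
  show "v \<notin> Poly_Mapping.keys (lder i f)"
  proof
    assume "v \<in> Poly_Mapping.keys (lder i f)"
    from keys_lder[OF this] obtain w where w: "w \<in> Poly_Mapping.keys f" "add_mset i (mset v) = mset w"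
      by blast
    then show False using f i set_eq_of_add_mset[OF w(2)] by (auto simp: words_in_def lists_eq_set)
  qed
qed

lemma rder_outside:
  assumes f: "f \<in> words_in S" and i: "i \<notin> S"
  shows "rder i f = 0"
proof (rule pm_eq_zeroI)
  fix v
  show "v \<notin> Poly_Mapping.keys (rder i f)"
  proof
    assume "v \<in> Poly_Mapping.keys (rder i f)"
    from keys_rder[OF this] obtain w where w: "w \<in> Poly_Mapping.keys f" "add_mset i (mset v) = mset w"
      by blast
    then show False using f i set_eq_of_add_mset[OF w(2)] by (auto simp: words_in_def lists_eq_set)
  qed
qed

text \<open>A derivation by \<open>i\<close> lowers the degree by \<open>i\<close>; a weight read
  before it is therefore read after it with \<open>i\<close> put back.\<close>

lemma lder_wscale: "lder i (wscale s f) = wscale (\<lambda>M. s (add_mset i M)) (lder i f)"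
proof (rule pm_linear_eqI[where \<phi>="\<lambda>f. lder i (wscale s f)" and \<psi>="\<lambda>f. wscale (\<lambda>M. s (add_mset i M)) (lder i f)"])
  fix w
  have "wscale (\<lambda>M. s (add_mset i M)) (lder_word i w) = pm_scale (s (mset w)) (lder_word i w)"
    by (rule wscale_const) (simp add: keys_lder_word)
  then show "lder i (wscale s (wd w)) = wscale (\<lambda>M. s (add_mset i M)) (lder i (wd w))" by simp
qed (simp_all add: pm_linear_def lder_linear wscale_linear)

lemma rder_wscale: "rder i (wscale s f) = wscale (\<lambda>M. s (add_mset i M)) (rder i f)"
proof (rule pm_linear_eqI[where \<phi>="\<lambda>f. rder i (wscale s f)" and \<psi>="\<lambda>f. wscale (\<lambda>M. s (add_mset i M)) (rder i f)"])
  fix w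
  have "wscale (\<lambda>M. s (add_mset i M)) (rder_word i w) = pm_scale (s (mset w)) (rder_word i w)"
    by (rule wscale_const) (simp add: keys_rder_word)
  then show "rder i (wscale s (wd w)) = wscale (\<lambda>M. s (add_mset i M)) (rder i (wd w))" by simp
qed (simp_all add: pm_linear_def rder_linear wscale_linear)

text \<open>Removing the letter \<open>i\<close> from \<open>w\<close> removes one factor
  \<open>Q j i\<close> from \<open>chr j\<close>; the scalar on the left restores it.\<close>

lemma wscale_chr_lder_word:
  "pm_scale (Q j i) (wscale (chr j) (lder_word i w)) = pm_scale (chr j (mset w)) (lder_word i w)"
proof (rule poly_mapping_eqI)
  fix v
  show "Poly_Mapping.lookup (pm_scale (Q j i) (wscale (chr j) (lder_word i w))) v
    = Poly_Mapping.lookup (pm_scale (chr j (mset w)) (lder_word i w)) v"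
  proof (cases "v \<in> Poly_Mapping.keys (lder_word i w)")
    case True
    then show ?thesis using keys_lder_word[OF True, symmetric] by (simp add: mult.assoc)
  qed (simp add: not_in_keys_iff_lookup_eq_zero)
qed

text \<open>An instance of coassociativity: one derivation strips a letter off the left end of the
  coproduct, the other off the right end, and the order does not matter. The braiding scalars match
  by \<open>wscale_chr_lder_word\<close>.\<close>

lemma lder_rder_word: "lder i (rder_word j w) = rder j (lder_word i w)"
proof (induction w)
  case (Cons k w)
  have l: "lder i (rder_word j (k # w)) = (if i = k then rder_word j w else 0)
     + pm_scale (Q k i) (x k * lder i (rder_word j w)) + (if k = j then pm_scale (chr j (mset w)) (lder_word i w) else 0)"
    by (simp add: lder_linear lder_gen_mult)
  have "rder j (x k * lder_word i w) = x k * rder j (lder_word i w) + (if k = j then wscale (chr j) (lder_word i w) else 0)"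
    by (auto simp: rder_gen_mult)
  then have "rder j (lder_word i (k # w)) = (if i = k then rder_word j w else 0)
     + pm_scale (Q k i) (x k * rder j (lder_word i w)) + (if k = j then pm_scale (Q k i) (wscale (chr j) (lder_word i w)) else 0)"
    by (simp add: rder_linear pm_scale_add add.assoc)
  then show ?case using wscale_chr_lder_word[of j i w] unfolding l Cons by simp
qed (simp add: lder_linear rder_linear)

lemma lder_rder: "lder i (rder j f) = rder j (lder i f)"
  by (rule pm_linear_eqI[where \<phi>="\<lambda>f. lder i (rder j f)" and \<psi>="\<lambda>f. rder j (lder i f)"])
     (simp_all add: pm_linear_def lder_linear rder_linear lder_rder_word)

end

interpretation pm: vector_space "pm_scale :: 'k::field \<Rightarrow> ('a \<Rightarrow>\<^sub>0 'k) \<Rightarrow> _"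
  by unfold_locales (simp_all add: pm_scale_add pm_scale_add_left)

text \<open>A linear map with kernel exactly \<open>R\<close> that is the identity modulo
  \<open>R\<close>: extend a basis of \<open>R\<close> to the whole space and kill the part in
  \<open>R\<close>. It replaces a basis of the tensor algebra adapted to the radical.\<close>

lemma exists_projection:
  fixes R :: "('a \<Rightarrow>\<^sub>0 'k::field) set"
  assumes "pm.subspace R"
  shows "\<exists>\<pi>. pm_linear \<pi> \<and> (\<forall>f. f - \<pi> f \<in> R) \<and> (\<forall>f\<in>R. \<pi> f = 0)"
proof -
  interpret vector_space_pair "pm_scale :: 'k \<Rightarrow> ('a \<Rightarrow>\<^sub>0 'k) \<Rightarrow> _" "pm_scale :: 'k \<Rightarrow> ('a \<Rightarrow>\<^sub>0 'k) \<Rightarrow> _" ..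
  obtain B where B: "B \<subseteq> R" "pm.independent B" "R \<subseteq> pm.span B"
    using pm.basis_exists[of R] by metis
  define C where "C = pm.extend_basis B"
  have C: "B \<subseteq> C" "pm.independent C" "pm.span C = UNIV"
    using pm.extend_basis_superset[OF B(2)] pm.independent_extend_basis[OF B(2)] pm.span_extend_basis[OF B(2)]
    by (auto simp: C_def)
  define \<pi> where "\<pi> = construct C (\<lambda>c. if c \<in> B then 0 else c)"
  have lin: "Vector_Spaces.linear pm_scale pm_scale \<pi>"
    unfolding \<pi>_def by (rule linear_construct[OF C(2)])
  then interpret l: Vector_Spaces.linear "pm_scale :: 'k \<Rightarrow> ('a \<Rightarrow>\<^sub>0 'k) \<Rightarrow> _" pm_scale \<pi> .
  have \<pi>: "\<pi> c = (if c \<in> B then 0 else c)" if "c \<in> C" for c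
    unfolding \<pi>_def using construct_basis[OF C(2) that] by simp
  have "f - \<pi> f \<in> R" for f
  proof -
    have "f \<in> pm.span C" using C by simp
    then show ?thesis
    proof (induction rule: pm.span_induct_alt)
      case base
      then show ?case using assms by (simp add: l.zero pm.subspace_0)
    next
      case (step c x y)
      have "x - \<pi> x \<in> R" using step B assms by (auto simp: \<pi> pm.subspace_0)
      then have "pm_scale c (x - \<pi> x) + (y - \<pi> y) \<in> R"
        using step assms by (simp add: pm.subspace_add pm.subspace_scale)
      then show ?case by (simp add: l.add l.scale pm_scale_diff algebra_simps)
    qed
  qed
  moreover have "\<pi> f = 0" if "f \<in> R" for f
  proof -
    have "f \<in> pm.span B" using that B by auto
    then show ?thesis
      by (induction rule: pm.span_induct_alt) (use C \<pi> in \<open>auto simp: l.zero l.add l.scale\<close>)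
  qed
  moreover have "pm_linear \<pi>" by (simp add: pm_linear_def l.add l.scale)
  ultimately show ?thesis by blast
qed

lemma tensor_alg_simps [simp]:
  "carrier (tensor_alg r) = words_in {1..r}"
  "mult (tensor_alg r) = (*)" "one (tensor_alg r) = (1 :: nat list \<Rightarrow>\<^sub>0 'k)" "zero (tensor_alg r) = 0"
  "add (tensor_alg r) = (+)" "smult (tensor_alg r :: ('k::field, nat list \<Rightarrow>\<^sub>0 'k) module) = pm_scale"
  by (simp_all add: tensor_alg_def bilin_ext_append' words_in_def single_Nil_one)

lemma tensor_alg_kalg: "kalg (tensor_alg r :: ('k::field, nat list \<Rightarrow>\<^sub>0 'k) module)"
  unfolding tensor_alg_def by (rule kalg_basis_algebra) auto

context braiding
begin

section \<open>Iterated left derivations and the radical\<close>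

primrec lders :: "nat list \<Rightarrow> (nat list \<Rightarrow>\<^sub>0 'k) \<Rightarrow> (nat list \<Rightarrow>\<^sub>0 'k)" where
  "lders [] f = f"
| "lders (i # u) f = lders u (lder i f)"

lemma lders_append: "lders (u @ v) f = lders v (lders u f)"
  by (induction u arbitrary: f) auto

lemma pm_linear_lders: "pm_linear (lders u)"
  by (induction u) (simp_all add: pm_linear_id pm_linear_comp[OF _ pm_linear_lder] pm_linear_def lder_linear)

lemmas lders_linear = pm_linearD[OF pm_linear_lders]

lemma lders_in [simp]: "f \<in> words_in S \<Longrightarrow> lders u f \<in> words_in S"
  by (induction u arbitrary: f) auto

lemma lders_rder: "lders u (rder j f) = rder j (lders u f)"
  by (induction u arbitrary: f) (auto simp: lder_rder)

lemma lders_wscale: "lders u (wscale s f) = wscale (\<lambda>M. s (M + mset u)) (lders u f)"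
  by (induction u arbitrary: f s) (auto simp: lder_wscale)

definition rad :: "(nat list \<Rightarrow>\<^sub>0 'k) set" where
  "rad = {f \<in> T. \<forall>u. Poly_Mapping.lookup (lders u f) [] = 0}"

lemma radD: "f \<in> rad \<Longrightarrow> f \<in> T" "f \<in> rad \<Longrightarrow> Poly_Mapping.lookup (lders u f) [] = 0"
  by (auto simp: rad_def)

lemma rad_const: "f \<in> rad \<Longrightarrow> Poly_Mapping.lookup f [] = 0"
  using radD(2)[of f "[]"] by simp

lemma rad_simps [simp]:
  "0 \<in> rad" "f \<in> rad \<Longrightarrow> g \<in> rad \<Longrightarrow> f + g \<in> rad" "f \<in> rad \<Longrightarrow> g \<in> rad \<Longrightarrow> f - g \<in> rad"
  "f \<in> rad \<Longrightarrow> - f \<in> rad" "f \<in> rad \<Longrightarrow> pm_scale c f \<in> rad"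
  by (auto simp: rad_def lders_linear lookup_add lookup_minus)

lemma rad_sum: "(\<And>i. i \<in> I \<Longrightarrow> f i \<in> rad) \<Longrightarrow> sum f I \<in> rad"
  by (induction I rule: infinite_finite_induct) auto

lemma rad_subspace: "pm.subspace rad"
  by (simp add: pm.subspace_def)

lemma rad_pm_lift: "(\<And>p. p \<in> Poly_Mapping.keys t \<Longrightarrow> \<phi> p \<in> rad) \<Longrightarrow> pm_lift \<phi> t \<in> rad"
  unfolding pm_lift_def by (rule rad_sum) auto

lemma rad_lder: "f \<in> rad \<Longrightarrow> lder i f \<in> rad"
  using radD(2)[of f "i # _"] by (auto simp: rad_def)

lemma rad_lders: "f \<in> rad \<Longrightarrow> lders u f \<in> rad"
  by (induction u arbitrary: f) (auto simp: rad_lder)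

lemma rad_wscale: "f \<in> rad \<Longrightarrow> wscale s f \<in> rad"
  by (auto simp: rad_def lders_wscale)

text \<open>The constant term of a derivative only sees the coefficient of the one-letter word
  \<open>[j]\<close>, where left and right derivations agree.\<close>

lemma lookup_rder_Nil: "Poly_Mapping.lookup (rder j f) [] = Poly_Mapping.lookup (lder j f) []"
proof -
  have w: "Poly_Mapping.lookup (rder_word j w) [] = Poly_Mapping.lookup (lder_word j w) []" for w
    by (cases w) (auto simp: lookup_add lookup_mult_Nil lookup_single when_def)
  show ?thesis by (simp add: rder_def lder_def lookup_pm_lift w)
qed

text \<open>The radical is defined through left derivations, but a right one may be moved outside
  the whole chain and there be exchanged for a left one, since only a constant term is read
  off.\<close>

lemma rad_rder:
  assumes "f \<in> rad" shows "rder j f \<in> rad"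
proof -
  have "Poly_Mapping.lookup (lders u (rder j f)) [] = Poly_Mapping.lookup (lders (u @ [j]) f) []" for u
    by (simp add: lders_rder lookup_rder_Nil lders_append)
  then show ?thesis using assms by (simp add: rad_def)
qed

text \<open>The last letter of a chain of left derivations can be turned into a right derivation and
  moved to the front of the chain, so the chain acts on \<open>rder j f\<close>. This is the
  criterion on which the relations between the root vectors rest.\<close>

lemma rad_rdersI:
  assumes "f \<in> T" "Poly_Mapping.lookup f [] = 0" "\<And>i. i \<in> {1..r} \<Longrightarrow> rder i f \<in> rad"
  shows "f \<in> rad"
proof -
  have r: "rder i f \<in> rad" for i
    using assms(3) rder_outside[OF assms(1)] by (cases "i \<in> {1..r}") auto
  have "Poly_Mapping.lookup (lders u f) [] = 0" for u
  proof (cases u rule: rev_cases)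
    case (snoc v j)
    then have "Poly_Mapping.lookup (lders u f) [] = Poly_Mapping.lookup (lders v (rder j f)) []"
      by (simp add: lders_append lders_rder lookup_rder_Nil)
    then show ?thesis using radD(2)[OF r] by simp
  qed (use assms in simp)
  then show ?thesis using assms by (simp add: rad_def)
qed

lemma rad_gen_mult:
  assumes "f \<in> rad" "j \<in> {1..r}" shows "x j * f \<in> rad"
proof -
  have "Poly_Mapping.lookup (lders u (x j * f)) [] = 0" if "f \<in> rad" for u f
    using that
  proof (induction u arbitrary: f)
    case (Cons i u)
    then have "Poly_Mapping.lookup (lders u (x j * lder i f)) [] = 0" by (simp add: rad_lder)
    with Cons show ?case
      by (auto simp: lder_gen_mult lders_linear lookup_add radD)
  qed (simp add: lookup_mult_Nil rad_const)
  then show ?thesis using assms by (simp add: rad_def)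
qed

lemma rad_word_mult: "f \<in> rad \<Longrightarrow> set w \<subseteq> {1..r} \<Longrightarrow> wd w * f \<in> rad"
proof (induction w)
  case (Cons k w)
  have "wd (k # w) * f = x k * (wd w * f)" by (simp add: mult.assoc[symmetric])
  with Cons show ?case by (simp only:) (rule rad_gen_mult, auto)
qed (simp add: single_Nil_one)

lemma rad_mult_left: "f \<in> rad \<Longrightarrow> g \<in> T \<Longrightarrow> g * f \<in> rad"
proof -
  assume f: "f \<in> rad" and g: "g \<in> T"
  have "g * f = pm_lift (\<lambda>w. wd w * f) g" by (rule pm_linear_eq_pm_lift[OF pm_linear_mult_left])
  also have "\<dots> \<in> rad" by (rule rad_pm_lift, rule rad_word_mult[OF f]) (use g in \<open>auto simp: words_in_def lists_eq_set\<close>)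
  finally show ?thesis .
qed

text \<open>By the Leibniz rule a derivative of the product is a sum of two products whose left
  factors are again in the radical. Both factors change, so the induction over the chain varies
  both.\<close>

lemma rad_mult_right: "f \<in> rad \<Longrightarrow> g \<in> T \<Longrightarrow> f * g \<in> rad"
proof -
  have "Poly_Mapping.lookup (lders u (f * g)) [] = 0" if "f \<in> rad" "g \<in> T" for u f g
    using that
  proof (induction u arbitrary: f g)
    case (Cons i u)
    then show ?case
      by (simp add: lder_mult lders_linear lookup_add rad_lder rad_wscale)
  qed (simp add: lookup_mult_Nil rad_const)
  then show "f \<in> rad \<Longrightarrow> g \<in> T \<Longrightarrow> f * g \<in> rad" by (simp add: rad_def)
qed

lemma rad_ideal: "ideal rad (tensor_alg r)"
proof -
  interpret F: kalg "tensor_alg r :: ('k, nat list \<Rightarrow>\<^sub>0 'k) module" by (rule tensor_alg_kalg)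
  have neg: "\<ominus>\<^bsub>tensor_alg r\<^esub> f = - f" if "f \<in> T" for f
    using F.smult_minus_one[of f] that by simp
  show ?thesis
  proof (rule idealI)
    show "subgroup rad (add_monoid (tensor_alg r))"
    proof (rule F.add.subgroupI)
      show "rad \<noteq> {}" using rad_simps(1) by blast
      fix a assume a: "a \<in> rad"
      then show "\<ominus>\<^bsub>tensor_alg r\<^esub> a \<in> rad" using neg[of a] radD(1)[OF a] by simp
    qed (auto simp: radD)
  qed (auto simp: rad_mult_left rad_mult_right F.ring_axioms)
qed

subsection \<open>The radical is a coideal\<close>

abbreviation bmult where "bmult \<equiv> bilin_ext (braided_mult_words Q)"
abbreviation tens :: "(nat list \<Rightarrow>\<^sub>0 'k) \<Rightarrow> (nat list \<Rightarrow>\<^sub>0 'k) \<Rightarrow> ((nat list \<times> nat list) \<Rightarrow>\<^sub>0 'k)" where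
  "tens \<equiv> bilin_ext (\<lambda>u v. Poly_Mapping.single (u, v) 1)"

text \<open>Left multiplication in the braided square by a letter in the first, respectively the
  second, tensor leg. In the second case the letter has to pass the first leg, whence the
  scalar.\<close>

abbreviation gen_left :: "nat \<Rightarrow> ((nat list \<times> nat list) \<Rightarrow>\<^sub>0 'k) \<Rightarrow> ((nat list \<times> nat list) \<Rightarrow>\<^sub>0 'k)" where
  "gen_left k \<equiv> pm_lift (\<lambda>(u, v). Poly_Mapping.single (k # u, v) 1)"
abbreviation gen_right :: "nat \<Rightarrow> ((nat list \<times> nat list) \<Rightarrow>\<^sub>0 'k) \<Rightarrow> ((nat list \<times> nat list) \<Rightarrow>\<^sub>0 'k)" where
  "gen_right k \<equiv> pm_lift (\<lambda>(u, v). Poly_Mapping.single (u, k # v) (chr k (mset u)))"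

lemma braid_scalar_gen: "braid_scalar Q [k] u = chr k (mset u)"
  by (simp add: braid_scalar_def chr_def flip: prod_mset_prod_list mset_map)

lemma word_comult_Cons: "word_comult Q (k # w) = gen_left k (word_comult Q w) + gen_right k (word_comult Q w)"
proof -
  have "bmult (Poly_Mapping.single ([k], []) 1) Y = gen_left k Y" for Y
    by (rule pm_linear_eqI[where \<phi>="bmult (Poly_Mapping.single ([k], []) 1)" and \<psi>="gen_left k"])
       (auto simp: pm_linear_bilin_ext_right pm_linear_pm_lift braided_mult_words_def braid_scalar_def)
  moreover have "bmult (Poly_Mapping.single ([], [k]) 1) Y = gen_right k Y" for Y
    by (rule pm_linear_eqI[where \<phi>="bmult (Poly_Mapping.single ([], [k]) 1)" and \<psi>="gen_right k"])
       (auto simp: pm_linear_bilin_ext_right pm_linear_pm_lift braided_mult_words_def braid_scalar_gen)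
  ultimately show ?thesis by (simp add: bilin_ext_linear_left)
qed

lemma braided_comult_eq: "braided_comult Q = pm_lift (word_comult Q)"
  by (intro ext) (simp add: braided_comult_def pm_lift_def)

lemma keys_word_comult: "(u, v) \<in> Poly_Mapping.keys (word_comult Q w) \<Longrightarrow> mset w = mset u + mset v"
proof (induction w arbitrary: u v)
  case (Cons k w)
  let ?S = "Poly_Mapping.keys (word_comult Q w)"
  have "Poly_Mapping.keys (gen_left k (word_comult Q w)) \<subseteq> {(k # u, v) | u v. (u, v) \<in> ?S}"
    by (rule keys_pm_lift[OF subset_refl]) auto
  moreover have "Poly_Mapping.keys (gen_right k (word_comult Q w)) \<subseteq> {(u, k # v) | u v. (u, v) \<in> ?S}"
    by (rule keys_pm_lift[OF subset_refl]) (auto split: if_splits)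
  moreover have "(u, v) \<in> Poly_Mapping.keys (gen_left k (word_comult Q w)) \<union> Poly_Mapping.keys (gen_right k (word_comult Q w))"
    using Cons.prems unfolding word_comult_Cons by (rule subsetD[OF keys_add])
  ultimately have "(u, v) \<in> {(k # u, v) | u v. (u, v) \<in> ?S} \<or> (u, v) \<in> {(u, k # v) | u v. (u, v) \<in> ?S}"
    by (elim UnE) (rule disjI1, erule (1) subsetD, rule disjI2, erule (1) subsetD)
  then show ?case using Cons.IH by auto
qed auto

text \<open>Contracts the first tensor leg with one of the functionals that define the
  radical.\<close>

definition eval_left :: "nat list \<Rightarrow> ((nat list \<times> nat list) \<Rightarrow>\<^sub>0 'k) \<Rightarrow> (nat list \<Rightarrow>\<^sub>0 'k)" where
  "eval_left u = pm_lift (\<lambda>(a, b). pm_scale (Poly_Mapping.lookup (lders u (wd a)) []) (wd b))"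

lemma eval_left_Cons: "eval_left (i # u) X = eval_left u (pm_lift (\<lambda>(a, b). tens (lder_word i a) (wd b)) X)"
proof -
  have "eval_left u (tens g (wd b)) = pm_scale (Poly_Mapping.lookup (lders u g) []) (wd b)" for g b
    by (rule pm_linear_eqI[where \<phi>="\<lambda>g. eval_left u (tens g (wd b))"
          and \<psi>="\<lambda>g. pm_scale (Poly_Mapping.lookup (lders u g) []) (wd b)"])
       (auto simp: eval_left_def pm_linear_def bilin_ext_linear_left pm_lift_linear lders_linear lookup_add
          single_add distrib_right mult.assoc)
  then show ?thesis
    unfolding eval_left_def
    by (subst pm_lift_pm_lift) (auto simp: eval_left_def split_def intro!: pm_lift_cong)
qed

text \<open>Coassociativity once more: taking the coproduct of a left derivative is the same as
  applying that derivation to the first leg of the coproduct.\<close>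

lemma lder_comult: "pm_lift (\<lambda>(a, b). tens (lder_word i a) (wd b)) (word_comult Q w) = pm_lift (word_comult Q) (lder_word i w)"
proof (induction w)
  case (Cons k w)
  let ?d = "pm_lift (\<lambda>(a, b). tens (lder_word i a) (wd b)) :: ((nat list \<times> nat list) \<Rightarrow>\<^sub>0 'k) \<Rightarrow> _"
  have gl: "gen_left k (tens g (wd b)) = tens (x k * g) (wd b)" for k g b
    by (rule pm_linear_eqI[where \<phi>="\<lambda>g. gen_left k (tens g (wd b))" and \<psi>="\<lambda>g. tens (x k * g) (wd b)"])
       (auto simp: pm_linear_def bilin_ext_linear_left pm_lift_linear distrib_left pm_scale_mult_right)
  have gr: "gen_right k (tens g (wd b)) = tens (wscale (chr k) g) (wd (k # b))" for k g b
    by (rule pm_linear_eqI[where \<phi>="\<lambda>g. gen_right k (tens g (wd b))" and \<psi>="\<lambda>g. tens (wscale (chr k) g) (wd (k # b))"])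
       (auto simp: pm_linear_def bilin_ext_linear_left pm_lift_linear wscale_linear)
  have l: "?d (gen_left k Y) = (if k = i then Y else 0) + pm_scale (Q k i) (gen_left k (?d Y))" for Y
    by (rule pm_linear_eqI[where \<phi>="\<lambda>Y. ?d (gen_left k Y)" and \<psi>="\<lambda>Y. (if k = i then Y else 0) + pm_scale (Q k i) (gen_left k (?d Y))"])
       (auto simp: pm_linear_def pm_lift_linear pm_scale_add gl bilin_ext_linear_left algebra_simps)
  have r: "?d (gen_right k Y) = pm_scale (Q k i) (gen_right k (?d Y))" for Y
  proof (rule pm_linear_eqI[where \<phi>="\<lambda>Y. ?d (gen_right k Y)" and \<psi>="\<lambda>Y. pm_scale (Q k i) (gen_right k (?d Y))"])
    fix p :: "nat list \<times> nat list"
    obtain a b where p: "p = (a, b)" by (cases p)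
    show "?d (gen_right k (Poly_Mapping.single p 1)) = pm_scale (Q k i) (gen_right k (?d (Poly_Mapping.single p 1)))"
      using wscale_chr_lder_word[of k i a]
      by (simp add: p gr bilin_ext_linear_left(2)[symmetric])
  qed (auto simp: pm_linear_def pm_lift_linear pm_scale_add algebra_simps)
  have c: "pm_lift (word_comult Q) (x k * f) = gen_left k (pm_lift (word_comult Q) f) + gen_right k (pm_lift (word_comult Q) f)" for f
    by (rule pm_linear_eqI[where \<phi>="\<lambda>f. pm_lift (word_comult Q) (x k * f)" and \<psi>="\<lambda>f. gen_left k (pm_lift (word_comult Q) f) + gen_right k (pm_lift (word_comult Q) f)"])
       (auto simp: pm_linear_def pm_lift_linear pm_scale_add pm_scale_mult_right algebra_simps word_comult_Cons simp del: word_comult.simps(2))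
  show ?case
    unfolding word_comult_Cons
    by (simp add: pm_lift_linear l r c Cons pm_scale_add)
qed (simp add: bilin_ext_linear_left)

text \<open>For the empty chain this is the counit axiom; each further derivation is moved from the
  first leg to the argument by \<open>lder_comult\<close>.\<close>

lemma eval_left_comult_word: "eval_left u (pm_lift (word_comult Q) f) = lders u f"
proof (induction u arbitrary: f)
  case Nil
  have l: "eval_left [] (gen_left k Y) = 0" for k Y
    by (rule pm_linear_eqI[where \<phi>="\<lambda>Y. eval_left [] (gen_left k Y)" and \<psi>="\<lambda>Y. 0"])
       (auto simp: eval_left_def pm_linear_def pm_lift_linear lookup_single when_def)
  have r: "eval_left [] (gen_right k Y) = x k * eval_left [] Y" for k Y
    by (rule pm_linear_eqI[where \<phi>="\<lambda>Y. eval_left [] (gen_right k Y)" and \<psi>="\<lambda>Y. x k * eval_left [] Y"])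
       (auto simp: eval_left_def pm_linear_def pm_lift_linear lookup_single when_def algebra_simps pm_scale_mult_right)
  have "eval_left [] (word_comult Q w) = wd w" for w
  proof (induction w)
    case (Cons k w)
    have "eval_left [] (word_comult Q (k # w)) = eval_left [] (gen_left k (word_comult Q w)) + eval_left [] (gen_right k (word_comult Q w))"
      unfolding word_comult_Cons by (simp add: eval_left_def pm_lift_linear)
    then show ?case by (simp add: l r Cons del: word_comult.simps)
  qed (simp add: eval_left_def)
  then have "pm_lift (\<lambda>w. eval_left [] (word_comult Q w)) f = f" by simp
  then show ?case unfolding eval_left_def pm_lift_pm_lift by simp
next
  case (Cons i u)
  have "eval_left (i # u) (pm_lift (word_comult Q) f)
      = eval_left u (pm_lift (\<lambda>w. pm_lift (word_comult Q) (lder_word i w)) f)"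
    unfolding eval_left_Cons pm_lift_pm_lift lder_comult ..
  also have "\<dots> = eval_left u (pm_lift (word_comult Q) (lder i f))"
    unfolding lder_def pm_lift_pm_lift ..
  finally show ?case by (simp add: Cons)
qed

end

context braiding
begin

lemma tens_span_closed:
  fixes I :: "(nat list \<Rightarrow>\<^sub>0 'k) set"
  defines "G \<equiv> {tens g h | g h. g \<in> I \<and> h \<in> carrier (tensor_alg r)} \<union> {tens h g | g h. g \<in> I \<and> h \<in> carrier (tensor_alg r)}"
  assumes "I \<subseteq> T"
  shows "G \<subseteq> carrier (braided_square Q r)"
proof -
  have "Poly_Mapping.keys (tens g h) \<subseteq> lists {1..r} \<times> lists {1..r}" if "g \<in> T" "h \<in> T" for g h
    by (rule keys_bilin_ext[of g "lists {1..r}" h "lists {1..r}"]) (use that in \<open>auto simp: words_in_def\<close>)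
  then have "tens g h \<in> carrier (braided_square Q r)" if "g \<in> T" "h \<in> T" for g h
    using that by (simp add: braided_square_def)
  then show ?thesis using assms(2) unfolding G_def tensor_alg_simps by blast
qed

lemma keys_braided_comult:
  assumes "f \<in> T" shows "Poly_Mapping.keys (braided_comult Q f) \<subseteq> lists {1..r} \<times> lists {1..r}"
  unfolding braided_comult_eq
proof (rule keys_pm_lift[OF subset_refl])
  fix w assume "w \<in> Poly_Mapping.keys f"
  then have w: "set w \<subseteq> {1..r}" using assms by (auto simp: words_in_def lists_eq_set)
  show "Poly_Mapping.keys (word_comult Q w) \<subseteq> lists {1..r} \<times> lists {1..r}"
  proof
    fix p assume "p \<in> Poly_Mapping.keys (word_comult Q w)"
    moreover obtain u v where "p = (u, v)" by (cases p)
    ultimately have "set w = set u \<union> set v" "p = (u, v)"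
      using keys_word_comult[of u v w] by (metis set_mset_mset set_mset_union, simp)
    then show "p \<in> lists {1..r} \<times> lists {1..r}" using w by (auto simp: lists_eq_set)
  qed
qed

text \<open>An element of the tensor square lies in the span of products with one leg in
  \<open>rad\<close> once the projection modulo \<open>rad\<close>, applied to both legs, kills it.
  Contracting the first leg of the coproduct of \<open>f\<close> gives iterated derivatives of
  \<open>f\<close>, which lie in \<open>rad\<close>; that both projected legs vanish is deduced from
  this coordinate by coordinate.\<close>

lemma rad_coideal:
  assumes "f \<in> rad"
  shows "braided_comult Q f \<in> LinearCombinations.module.span class_ring (braided_square Q r)
        ({tens g h | g h. g \<in> rad \<and> h \<in> carrier (tensor_alg r)} \<union>
         {tens h g | g h. g \<in> rad \<and> h \<in> carrier (tensor_alg r)})" (is "_ \<in> ?span")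
proof -
  define X where "X = braided_comult Q f"
  obtain \<pi> where \<pi>: "pm_linear \<pi>" "\<And>f. f - \<pi> f \<in> rad" "\<And>f. f \<in> rad \<Longrightarrow> \<pi> f = 0"
    using exists_projection[OF rad_subspace] by blast
  note pl = pm_linearD[OF \<pi>(1)]
  have \<pi>T: "\<pi> g \<in> T" if "g \<in> T" for g
    using words_in_simps(5)[OF that radD(1)[OF \<pi>(2)[of g]]] by simp
  have key: "eval_left u X \<in> rad" for u
    using assms by (simp add: X_def braided_comult_eq eval_left_comult_word rad_lders)
  \<comment> \<open>\<open>Z b\<close> is what remains in the first leg after the second leg is
    projected and its coordinate at the word \<open>b\<close> is taken. Its defining functionals are
    the \<open>b\<close>-coordinates of projected derivatives of \<open>f\<close>, so they vanish
    and \<open>Z b\<close> is in the radical.\<close>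
  define Z where "Z b = pm_lift (\<lambda>(u, v). pm_scale (Poly_Mapping.lookup (\<pi> (wd v)) b) (wd u)) X" for b
  have ZT: "Z b \<in> T" for b
    unfolding Z_def using keys_braided_comult[of f] assms
    by (intro words_in_pm_lift) (auto simp: X_def radD lists_eq_set)
  have "Poly_Mapping.lookup (lders u (Z b)) [] = Poly_Mapping.lookup (\<pi> (eval_left u X)) b" for u b
    unfolding Z_def eval_left_def pm_lift_linear_comp[OF \<pi>(1)] pm_lift_linear_comp[OF pm_linear_lders]
    by (auto simp: lookup_pm_lift pl(2) lders_linear(2) split_def mult.commute simp del: pm_scale_single intro!: sum.cong)
  then have "Z b \<in> rad" for b using ZT \<pi>(3)[OF key] by (simp add: rad_def)
  then have Z0: "\<pi> (Z b) = 0" for b by (rule \<pi>(3))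
  \<comment> \<open>The coordinate at \<open>(a, b)\<close> of the doubly projected coproduct is the
    \<open>a\<close>-coordinate of \<open>\<pi> (Z b)\<close>, which is zero.\<close>
  have X0: "pm_lift (\<lambda>(u, v). tens (\<pi> (wd u)) (\<pi> (wd v))) X = 0"
  proof (rule poly_mapping_eqI)
    fix p :: "nat list \<times> nat list"
    obtain a b where p: "p = (a, b)" by (cases p)
    have tl: "Poly_Mapping.lookup (tens g h) (a, b) = Poly_Mapping.lookup g a * Poly_Mapping.lookup h b" for g h :: "nat list \<Rightarrow>\<^sub>0 'k"
    proof -
      have "(Poly_Mapping.single () (Poly_Mapping.lookup (tens g h) (a, b)) :: unit \<Rightarrow>\<^sub>0 'k) = Poly_Mapping.single () (Poly_Mapping.lookup g a * Poly_Mapping.lookup h b)"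
        by (rule bilinear_eqI[where \<phi>="\<lambda>g h. Poly_Mapping.single () (Poly_Mapping.lookup (tens g h) (a, b))"
             and \<psi>="\<lambda>g h. Poly_Mapping.single () (Poly_Mapping.lookup g a * Poly_Mapping.lookup h b)"])
           (auto simp: pm_linear_def bilin_ext_linear_left bilin_ext_linear_right lookup_add single_add distrib_left
             distrib_right mult.assoc mult.left_commute lookup_single when_def)
      then show ?thesis by (metis lookup_single_eq)
    qed
    have "Poly_Mapping.lookup (pm_lift (\<lambda>(u, v). tens (\<pi> (wd u)) (\<pi> (wd v))) X) p = Poly_Mapping.lookup (\<pi> (Z b)) a"
      unfolding Z_def pm_lift_linear_comp[OF \<pi>(1)] p
      by (auto simp: lookup_pm_lift pl(2) tl split_def mult.commute simp del: pm_scale_single intro!: sum.cong)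
    then show "Poly_Mapping.lookup (pm_lift (\<lambda>(u, v). tens (\<pi> (wd u)) (\<pi> (wd v))) X) p = Poly_Mapping.lookup 0 p"
      by (simp add: Z0)
  qed
  have "rad \<subseteq> T" using radD(1) by blast
  note span = span_closed[OF basis_algebra_module[of "lists {1..r} \<times> lists {1..r}" "braided_mult_words Q" "([], [])", folded braided_square_def]
      tens_span_closed[OF this]]
  have bs: "add (braided_square Q r) = (+)" "smult (braided_square Q r) = pm_scale" "zero (braided_square Q r) = 0"
    by (simp_all add: braided_square_def)
  define S where "S = LinearCombinations.module.span class_ring (braided_square Q r)
        ({tens g h | g h. g \<in> rad \<and> h \<in> carrier (tensor_alg r)} \<union>
         {tens h g | g h. g \<in> rad \<and> h \<in> carrier (tensor_alg r)})"
  note span = span[unfolded bs, folded S_def]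
  have span_sum: "sum h A \<in> S" if "\<And>i. i \<in> A \<Longrightarrow> h i \<in> S" for h and A :: "(nat list \<times> nat list) set"
    using that by (induction A rule: infinite_finite_induct) (simp_all add: span(2,3))
  \<comment> \<open>The difference telescopes: first change the left leg into its projection, then
    the right one. Each change is a tensor with one leg in the radical.\<close>
  have summand: "Poly_Mapping.single (u, v) 1 - tens (\<pi> (wd u)) (\<pi> (wd v)) \<in> S" if "(u, v) \<in> Poly_Mapping.keys X" for u v
  proof -
    have uv: "wd u \<in> T" "wd v \<in> T" using that keys_braided_comult[of f] assms by (auto simp: X_def radD lists_eq_set)
    have "tens (wd u - \<pi> (wd u)) (wd v) \<in> S"
      by (rule span(1)) (use \<pi>(2) uv in auto)
    moreover have "tens (\<pi> (wd u)) (wd v - \<pi> (wd v)) \<in> S"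
      by (rule span(1), rule UnI2, rule CollectI, rule exI[of _ "wd v - \<pi> (wd v)"], rule exI[of _ "\<pi> (wd u)"])
         (use \<pi>(2) \<pi>T uv in simp)
    ultimately have "tens (wd u - \<pi> (wd u)) (wd v) + tens (\<pi> (wd u)) (wd v - \<pi> (wd v)) \<in> S" by (rule span(3))
    then show ?thesis by (simp add: bilin_ext_linear_left bilin_ext_linear_right)
  qed
  have "X = X - pm_lift (\<lambda>(u, v). tens (\<pi> (wd u)) (\<pi> (wd v))) X" by (simp add: X0)
  also have "\<dots> = (\<Sum>p\<in>Poly_Mapping.keys X. pm_scale (Poly_Mapping.lookup X p) (Poly_Mapping.single p 1 - tens (\<pi> (wd (fst p))) (\<pi> (wd (snd p)))))"
    by (subst (1) pm_expand[of X]) (simp add: pm_lift_def split_def pm_scale_diff sum_subtractf)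
  also have "\<dots> \<in> S"
    by (rule span_sum, rule span(4)) (use summand in auto)
  finally show ?thesis by (simp only: X_def S_def)
qed

lemma homogeneous_part_eq_wscale: "homogeneous_part m f = wscale (\<lambda>M. if size M = m then 1 else 0) f"
proof (rule poly_mapping_eqI)
  fix w
  have "Poly_Mapping.lookup (homogeneous_part m f) w
    = (\<Sum>v\<in>{w \<in> Poly_Mapping.keys f. length w = m}. if v = w then Poly_Mapping.lookup f w else 0)"
    unfolding homogeneous_part_def lookup_sum by (rule sum.cong) (auto simp: lookup_single when_def)
  then show "Poly_Mapping.lookup (homogeneous_part m f) w = Poly_Mapping.lookup (wscale (\<lambda>M. if size M = m then 1 else 0) f) w"
    by (auto simp: not_in_keys_iff_lookup_eq_zero)
qed

lemma rad_length:
  assumes "f \<in> rad" "w \<in> Poly_Mapping.keys f" shows "2 \<le> length w"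
proof (rule ccontr)
  assume "\<not> 2 \<le> length w"
  then consider "w = []" | i where "w = [i]" by (cases w; cases "tl w") auto
  then show False
  proof cases
    case 1
    then show ?thesis using assms rad_const by auto
  next
    case (2 i)
    have "Poly_Mapping.lookup (lder_word i v) [] = (if v = [i] then 1 else 0)" for v
      by (cases v) (auto simp: lookup_add lookup_mult_Nil lookup_single when_def)
    then have "Poly_Mapping.lookup (lder i f) [] = (\<Sum>v\<in>Poly_Mapping.keys f. if v = [i] then Poly_Mapping.lookup f [i] else 0)"
      unfolding lder_def lookup_pm_lift by (intro sum.cong) auto
    then have "Poly_Mapping.lookup (lder i f) [] = Poly_Mapping.lookup f [i]"
      using assms(2) 2 by simp
    then show ?thesis using rad_const[OF rad_lder[OF assms(1)], of i] assms(2) 2 by auto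
  qed
qed

lemma rad_graded_hopf_ideal: "rad \<in> graded_hopf_ideals Q r"
  unfolding graded_hopf_ideals_def
  using rad_ideal rad_length rad_coideal rad_wscale by (auto simp: homogeneous_part_eq_wscale)

text \<open>Contract the first leg of the coproduct with the coordinate of the word
  \<open>[i]\<close>. Tensors with first leg in \<open>I\<close> die, as \<open>I\<close> has no
  words of length one, and those with second leg in \<open>I\<close> land in \<open>I\<close>. So
  \<open>I\<close> is stable under all left derivations, and it has no constant terms.\<close>

lemma graded_hopf_ideal_subset_rad:
  assumes "I \<in> graded_hopf_ideals Q r"
  shows "I \<subseteq> rad"
proof -
  have I: "ideal I (tensor_alg r)" and len: "\<And>f w. f \<in> I \<Longrightarrow> w \<in> Poly_Mapping.keys f \<Longrightarrow> 2 \<le> length w"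
    and co: "\<And>f. f \<in> I \<Longrightarrow> braided_comult Q f \<in> LinearCombinations.module.span class_ring (braided_square Q r)
        ({tens g h | g h. g \<in> I \<and> h \<in> carrier (tensor_alg r)} \<union>
         {tens h g | g h. g \<in> I \<and> h \<in> carrier (tensor_alg r)})"
    using assms by (auto simp: graded_hopf_ideals_def)
  interpret kalg_ideal "tensor_alg r" I by (simp add: kalg_ideal_def tensor_alg_kalg I)
  have IT: "I \<subseteq> T" using a_subset by simp
  have I_add: "f + g \<in> I" if "f \<in> I" "g \<in> I" for f g using that a_closed by simp
  have I_scale: "pm_scale c f \<in> I" if "f \<in> I" for c f using smult_ideal[OF that] by simp
  have I0: "0 \<in> I" using zero_closed additive_subgroup.zero_closed[OF additive_subgroup_axioms] by simp
  have "lder i f \<in> I" if f: "f \<in> I" for i f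
  proof -
    \<comment> \<open>The coordinate functional of the word \<open>[i]\<close>; it agrees with
      \<open>eval_left [i]\<close>, so on a coproduct it computes \<open>lder i\<close>.\<close>
    define p :: "((nat list \<times> nat list) \<Rightarrow>\<^sub>0 'k) \<Rightarrow> (nat list \<Rightarrow>\<^sub>0 'k)" where
      "p = pm_lift (\<lambda>(a, b). pm_scale (Poly_Mapping.lookup (wd a) [i]) (wd b))"
    have p_tens: "p (tens g h) = pm_scale (Poly_Mapping.lookup g [i]) h" for g h
      by (rule bilinear_eqI[where \<phi>="\<lambda>g h. p (tens g h)" and \<psi>="\<lambda>g h. pm_scale (Poly_Mapping.lookup g [i]) h"])
         (auto simp: p_def pm_linear_def bilin_ext_linear_left bilin_ext_linear_right pm_lift_linear lookup_add
            pm_scale_add pm_scale_add_left mult.commute)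
    have p_eq: "p = eval_left [i]"
    proof -
      have "Poly_Mapping.lookup (wd a) [i] = Poly_Mapping.lookup (lder_word i a) []" for a :: "nat list"
        by (cases a) (auto simp: lookup_add lookup_mult_Nil lookup_single when_def)
      then show ?thesis by (simp add: p_def eval_left_def)
    qed
    have "p (braided_comult Q f) \<in> I"
    proof (rule span_induct(1)[OF basis_algebra_module[of "lists {1..r} \<times> lists {1..r}" "braided_mult_words Q" "([], [])", folded braided_square_def]
          co[OF f] tens_span_closed[OF IT]])
      fix Y assume "Y \<in> {tens g h | g h. g \<in> I \<and> h \<in> carrier (tensor_alg r)} \<union>
         {tens h g | g h. g \<in> I \<and> h \<in> carrier (tensor_alg r)}"
      then consider g h where "g \<in> I" "Y = tens g h" | g h where "g \<in> I" "Y = tens h g" by auto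
      then show "p Y \<in> I"
      proof cases
        case (1 g h)
        then have "[i] \<notin> Poly_Mapping.keys g" using len[of g "[i]"] by auto
        then have "Poly_Mapping.lookup g [i] = 0" by (simp add: not_in_keys_iff_lookup_eq_zero)
        with 1 show ?thesis by (simp add: p_tens I0)
      qed (simp add: p_tens I_scale)
    qed (auto simp: braided_square_def p_def pm_lift_linear I_add I_scale I0)
    then show ?thesis
      by (simp add: p_eq braided_comult_eq eval_left_comult_word)
  qed
  then have l: "lders u f \<in> I" if "f \<in> I" for u f using that by (induction u arbitrary: f) auto
  show ?thesis
  proof
    fix f assume "f \<in> I"
    then have "[] \<notin> Poly_Mapping.keys (lders u f)" for u using len[OF l, of f "[]"] by auto
    then have "Poly_Mapping.lookup (lders u f) [] = 0" for u by (simp add: not_in_keys_iff_lookup_eq_zero)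
    then show "f \<in> rad" using \<open>f \<in> I\<close> IT by (auto simp: rad_def)
  qed
qed

lemma nichols_ideal_eq_rad: "nichols_ideal Q r = rad"
proof -
  interpret F: kalg "tensor_alg r :: ('k, nat list \<Rightarrow>\<^sub>0 'k) module" by (rule tensor_alg_kalg)
  have sub: "\<Union> (graded_hopf_ideals Q r) \<subseteq> rad" using graded_hopf_ideal_subset_rad by blast
  then have U: "\<Union> (graded_hopf_ideals Q r) \<subseteq> carrier (tensor_alg r)" using radD(1) by auto
  show ?thesis
  proof
    show "nichols_ideal Q r \<subseteq> rad"
    proof
      fix f assume "f \<in> nichols_ideal Q r"
      then show "f \<in> rad"
        unfolding nichols_ideal_def
        by (rule span_induct(1)[OF F.kmodule _ U]) (use sub in auto)
    qed
    show "rad \<subseteq> nichols_ideal Q r"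
      unfolding nichols_ideal_def using span_closed(1)[OF F.kmodule U] rad_graded_hopf_ideal by auto
  qed
qed

subsection \<open>The braided antipode\<close>

text \<open>The scalar of the braided antipode, which sends a letter to its negative and reverses
  words: a sign for the length, times \<open>Q i j\<close> for every pair of positions with
  \<open>i\<close> before \<open>j\<close>.\<close>

primrec cocycle :: "nat list \<Rightarrow> 'k" where
  "cocycle [] = 1"
| "cocycle (k # w) = - (chr k (mset w) * cocycle w)"

definition antip :: "(nat list \<Rightarrow>\<^sub>0 'k) \<Rightarrow> (nat list \<Rightarrow>\<^sub>0 'k)" where
  "antip = pm_lift (\<lambda>w. Poly_Mapping.single (rev w) (cocycle w))"

lemma pm_linear_antip: "pm_linear antip"
  unfolding antip_def by (rule pm_linear_pm_lift)

lemmas antip_linear = pm_linearD[OF pm_linear_antip]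

lemma antip_single [simp]: "antip (Poly_Mapping.single w c) = Poly_Mapping.single (rev w) (c * cocycle w)"
  by (simp add: antip_def)

lemma antip_gen_mult: "antip (x k * f) = - (antip (wscale (chr k) f) * x k)"
  by (rule pm_linear_eqI[where \<phi>="\<lambda>f. antip (x k * f)" and \<psi>="\<lambda>f. - (antip (wscale (chr k) f) * x k)"])
     (auto simp: pm_linear_def antip_linear wscale_linear pm_scale_mult_left pm_scale_mult_right pm_scale_uminus
       distrib_left distrib_right single_uminus mult.commute)

lemma antip_in: "f \<in> words_in S \<Longrightarrow> antip f \<in> words_in S"
  unfolding antip_def by (rule words_in_pm_lift) (auto simp: words_in_def lists_eq_set)

text \<open>Reversal exchanges the two ends of a word, so a left derivation after the antipode is a
  right derivation before it. The factor \<open>Q i i\<close> is kept on the left so that nothing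
  has to be inverted.\<close>

lemma lder_antip_word: "pm_scale (Q i i) (lder i (antip (wd w))) = pm_scale (- chl i (mset w)) (antip (rder_word i w))"
proof (induction w)
  case (Cons k w)
  define A where "A = antip (wd w)"
  define c where "c = chr k (mset w)"
  note IH = Cons[folded A_def]
  have a: "antip (wd (k # w)) = - pm_scale c (A * x k)"
    by (simp add: A_def c_def single_uminus)
  have deg: "wscale s A = pm_scale (s (mset w)) A" for s by (simp add: A_def mult.commute)
  have l: "lder i (A * x k) = lder i A * x k + (if k = i then pm_scale (chl i (mset w)) A else 0)"
    by (auto simp: lder_mult deg single_Nil_one)
  have ws: "pm_scale (Q k i) (wscale (chr k) (rder_word i w)) = pm_scale c (rder_word i w)"
  proof (rule poly_mapping_eqI)
    fix v
    show "Poly_Mapping.lookup (pm_scale (Q k i) (wscale (chr k) (rder_word i w))) v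
      = Poly_Mapping.lookup (pm_scale c (rder_word i w)) v"
    proof (cases "v \<in> Poly_Mapping.keys (rder_word i w)")
      case True
      then show ?thesis using keys_rder_word[OF True, symmetric] by (simp add: mult.assoc c_def)
    qed (simp add: not_in_keys_iff_lookup_eq_zero)
  qed
  have "pm_scale (Q k i) (antip (x k * rder_word i w)) = - (antip (pm_scale (Q k i) (wscale (chr k) (rder_word i w))) * x k)"
    by (simp only: antip_gen_mult antip_linear pm_scale_mult_left pm_scale_uminus)
  then have r: "pm_scale (Q k i) (antip (x k * rder_word i w)) = - pm_scale c (antip (rder_word i w) * x k)"
    by (simp only: ws antip_linear pm_scale_mult_left)
  have rw: "antip (rder_word i (k # w)) = antip (x k * rder_word i w) + (if k = i then pm_scale c A else 0)"
  proof (cases "k = i")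
    case True
    then have "rder_word i (k # w) = x k * rder_word i w + pm_scale c (wd w)" by (simp add: c_def)
    then show ?thesis using True by (simp only: antip_linear A_def simp_thms if_True)
  qed simp
  have "pm_scale (Q i i) (lder i (antip (wd (k # w)))) = - pm_scale c (pm_scale (Q i i) (lder i A) * x k)
       - (if k = i then pm_scale (c * Q i i * chl i (mset w)) A else 0)"
    unfolding a by (auto simp: lder_linear l pm_scale_add pm_scale_diff pm_scale_uminus pm_scale_mult_left ac_simps)
  also have "\<dots> = pm_scale (- chl i (mset w)) (- pm_scale c (antip (rder_word i w) * x k))
       - (if k = i then pm_scale (c * Q i i * chl i (mset w)) A else 0)"
    unfolding IH by (simp add: pm_scale_uminus pm_scale_mult_left mult.commute)
  also have "\<dots> = pm_scale (- chl i (mset (k # w))) (antip (rder_word i (k # w)))"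
    unfolding rw r[symmetric] by (auto simp: pm_scale_add pm_scale_diff pm_scale_uminus ac_simps simp del: rder_word.simps)
  finally show ?case .
qed (simp add: antip_linear lder_linear)

lemma lder_antip: "pm_scale (Q i i) (lder i (antip f)) = antip (rder i (wscale (\<lambda>M. - chl i M) f))"
proof (rule pm_linear_eqI[where \<phi>="\<lambda>f. pm_scale (Q i i) (lder i (antip f))" and \<psi>="\<lambda>f. antip (rder i (wscale (\<lambda>M. - chl i M) f))"])
  fix w
  show "pm_scale (Q i i) (lder i (antip (wd w))) = antip (rder i (wscale (\<lambda>M. - chl i M) (wd w)))"
    unfolding lder_antip_word by (simp add: antip_linear)
qed (auto simp: pm_linear_def lder_linear rder_linear wscale_linear antip_linear pm_scale_add mult.commute)

text \<open>Along a chain of derivations, \<open>lder_antip\<close> replaces each left derivation of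
  \<open>antip f\<close> by a right derivation of a rescaled \<open>f\<close>, and
  \<open>rad\<close> is stable under both operations. Letters outside \<open>{1..r}\<close> give
  zero.\<close>

lemma rad_antip:
  assumes nz: "\<And>i. i \<in> {1..r} \<Longrightarrow> Q i i \<noteq> 0" and "f \<in> rad"
  shows "antip f \<in> rad"
proof -
  have "Poly_Mapping.lookup (lders u (antip f)) [] = 0" if "f \<in> rad" for u f
    using that
  proof (induction u arbitrary: f)
    case Nil
    have "Poly_Mapping.lookup (antip f) [] = (\<Sum>w\<in>Poly_Mapping.keys f. 0)"
      unfolding antip_def lookup_pm_lift
      by (rule sum.cong) (use Nil rad_const in \<open>auto simp: lookup_single when_def\<close>)
    then show ?case by simp
  next
    case (Cons i u)
    show ?case
    proof (cases "i \<in> {1..r}")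
      case True
      have "pm_scale (Q i i) (lder i (antip f)) = antip (rder i (wscale (\<lambda>M. - chl i M) f))" by (rule lder_antip)
      then have "Poly_Mapping.lookup (lders u (pm_scale (Q i i) (lder i (antip f)))) [] = 0"
        using Cons by (simp add: rad_rder rad_wscale)
      then show ?thesis using nz[OF True] by (simp add: lders_linear)
    next
      case False
      then show ?thesis using lder_outside[OF antip_in[OF radD(1)[OF Cons.prems]] False] by (simp add: lders_linear)
    qed
  qed
  then show ?thesis using assms antip_in[OF radD(1)[OF assms(2)]] by (auto simp add: rad_def)
qed

end

section \<open>The socle of a Nichols algebra\<close>

context braiding
begin

text \<open>Equality in the Nichols algebra, expressed on representatives so that calculations stay
  in the free algebra.\<close>

definition eqv :: "(nat list \<Rightarrow>\<^sub>0 'k) \<Rightarrow> (nat list \<Rightarrow>\<^sub>0 'k) \<Rightarrow> bool" (infix "\<doteq>" 50) where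
  "f \<doteq> g \<longleftrightarrow> f - g \<in> rad"

lemma eqv_refl [simp]: "f \<doteq> f" by (simp add: eqv_def)

lemma eqv_sym: "f \<doteq> g \<Longrightarrow> g \<doteq> f"
  unfolding eqv_def using rad_simps(4)[of "f - g"] by simp

lemma eqv_trans [trans]: "f \<doteq> g \<Longrightarrow> g \<doteq> h \<Longrightarrow> f \<doteq> h"
  unfolding eqv_def using rad_simps(2)[of "f - g" "g - h"] by simp

lemma eqv_zero_iff: "f \<doteq> 0 \<longleftrightarrow> f \<in> rad" by (simp add: eqv_def)

lemma eqv_add: "f \<doteq> f' \<Longrightarrow> g \<doteq> g' \<Longrightarrow> f + g \<doteq> f' + g'"
  unfolding eqv_def using rad_simps(2)[of "f - f'" "g - g'"] by (simp add: algebra_simps)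

lemma eqv_diff: "f \<doteq> f' \<Longrightarrow> g \<doteq> g' \<Longrightarrow> f - g \<doteq> f' - g'"
  unfolding eqv_def using rad_simps(3)[of "f - f'" "g - g'"] by (simp add: algebra_simps)

lemma eqv_scale: "f \<doteq> g \<Longrightarrow> pm_scale c f \<doteq> pm_scale c g"
  unfolding eqv_def using rad_simps(5)[of "f - g" c] by (simp add: pm_scale_diff)

lemma eqv_mult_left: "f \<doteq> g \<Longrightarrow> h \<in> T \<Longrightarrow> h * f \<doteq> h * g"
  unfolding eqv_def using rad_mult_left[of "f - g" h] by (simp add: right_diff_distrib)

lemma eqv_mult_right: "f \<doteq> g \<Longrightarrow> h \<in> T \<Longrightarrow> f * h \<doteq> g * h"
  unfolding eqv_def using rad_mult_right[of "f - g" h] by (simp add: left_diff_distrib)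

lemma eqv_rad: "f \<doteq> g \<Longrightarrow> f \<in> rad \<longleftrightarrow> g \<in> rad"
  by (metis eqv_sym eqv_trans eqv_zero_iff)

lemma eqv_lder: "f \<doteq> g \<Longrightarrow> lder i f \<doteq> lder i g"
  unfolding eqv_def by (metis lder_linear(4) rad_lder)

lemma eqv_wscale: "f \<doteq> g \<Longrightarrow> wscale s f \<doteq> wscale s g"
  unfolding eqv_def by (metis wscale_linear(4) rad_wscale)

lemma eqv_pm_lift: "(\<And>u. u \<in> Poly_Mapping.keys c \<Longrightarrow> \<phi> u \<doteq> \<psi> u) \<Longrightarrow> pm_lift \<phi> c \<doteq> pm_lift \<psi> c"
proof -
  assume a: "\<And>u. u \<in> Poly_Mapping.keys c \<Longrightarrow> \<phi> u \<doteq> \<psi> u"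
  have "pm_lift \<phi> c - pm_lift \<psi> c = pm_lift (\<lambda>u. \<phi> u - \<psi> u) c"
    by (simp add: pm_lift_def pm_scale_diff sum_subtractf)
  moreover have "pm_lift (\<lambda>u. \<phi> u - \<psi> u) c \<in> rad"
    by (rule rad_pm_lift) (use a in \<open>simp add: eqv_def\<close>)
  ultimately show ?thesis by (simp add: eqv_def)
qed

lemma keys_lders: "w \<in> Poly_Mapping.keys (lders u f) \<Longrightarrow> \<exists>v\<in>Poly_Mapping.keys f. mset v = mset w + mset u"
proof (induction u arbitrary: f)
  case (Cons i u)
  then obtain v where "v \<in> Poly_Mapping.keys (lder i f)" "mset v = mset w + mset u" by auto
  then show ?case using keys_lder[of v i f] by auto
qed auto

lemma lders_eq_zero:
  assumes "has_degree d t" "\<not> mset u \<subseteq># d" shows "lders u t = 0"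
proof (rule pm_eq_zeroI)
  fix w show "w \<notin> Poly_Mapping.keys (lders u t)"
    using keys_lders[of w u t] assms by (auto simp: has_degree_def)
qed

lemma has_degree_lders:
  assumes "has_degree d t" shows "has_degree (d - mset u) (lders u t)"
  using keys_lders[of _ u t] assms unfolding has_degree_def by fastforce

definition ind :: "nat multiset \<Rightarrow> nat multiset \<Rightarrow> 'k" where "ind M M' = (if M' = M then 1 else 0)"

lemma has_degree_ind: "has_degree M (wscale (ind M) f)"
  unfolding has_degree_def by (metis in_keys_iff ind_def lookup_wscale mult_zero_left)

lemma wscale_ind: "has_degree M' f \<Longrightarrow> wscale (ind M) f = (if M = M' then f else 0)"
  by (auto simp: wscale_has_degree ind_def)

definition right_socle :: "(nat list \<Rightarrow>\<^sub>0 'k) \<Rightarrow> bool" where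
  "right_socle t \<longleftrightarrow> t \<in> T \<and> (\<forall>i\<in>{1..r}. t * x i \<in> rad)"

definition left_socle :: "(nat list \<Rightarrow>\<^sub>0 'k) \<Rightarrow> bool" where
  "left_socle t \<longleftrightarrow> t \<in> T \<and> (\<forall>i\<in>{1..r}. x i * t \<in> rad)"

text \<open>The span of all \<open>lders u t\<close> is a right ideal, because \<open>lder i (f * x j)\<close> differs from
  \<open>lder i f * x j\<close> by a multiple of \<open>f\<close>; it contains a nonzero constant, so it is everything.\<close>

lemma socle_span:
  assumes t: "right_socle t" "has_degree d t" "t \<notin> rad" and f: "f \<in> T"
  shows "\<exists>c. f \<doteq> pm_lift (\<lambda>u. lders u t) c"
proof -
  define V where "V = {f \<in> T. \<exists>c. f \<doteq> pm_lift (\<lambda>u. lders u t) c}"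
  have tT: "t \<in> T" using t by (simp add: right_socle_def)
  have VI: "f \<in> T \<Longrightarrow> f \<doteq> pm_lift (\<lambda>u. lders u t) c \<Longrightarrow> f \<in> V" for f c by (auto simp: V_def)
  have V_base: "lders u t \<in> V" for u
    by (rule VI[of _ "Poly_Mapping.single u 1"]) (simp_all add: tT)
  have V_add: "f + g \<in> V" if "f \<in> V" "g \<in> V" for f g
    using that by (auto simp: V_def) (metis eqv_add pm_lift_add)
  have V_scale: "pm_scale c f \<in> V" if "f \<in> V" for c f
    using that by (auto simp: V_def) (metis eqv_scale pm_lift_scale)
  have V_eqv: "f \<in> V" if "g \<in> V" "f \<doteq> g" "f \<in> T" for f g
    using that by (auto simp: V_def dest: eqv_trans)
  have V0: "0 \<in> V" using V_scale[OF V_base, of 0] by simp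
  have V_sum: "pm_lift \<phi> c \<in> V" if "\<And>u. \<phi> u \<in> V" for \<phi> and c :: "nat list \<Rightarrow>\<^sub>0 'k"
  proof -
    have "sum h A \<in> V" if "\<And>u. h u \<in> V" for h and A :: "nat list set"
      using that by (induction A rule: infinite_finite_induct) (auto simp: V0 V_add)
    then show ?thesis using that by (simp add: pm_lift_def V_scale)
  qed
  have V_lder: "lder i f \<in> V" if "f \<in> V" for i f
  proof -
    obtain c where c: "f \<in> T" "f \<doteq> pm_lift (\<lambda>u. lders u t) c" using \<open>f \<in> V\<close> by (auto simp: V_def)
    have "lder i (pm_lift (\<lambda>u. lders u t) c) = pm_lift (\<lambda>u. lders (u @ [i]) t) c"
      by (simp add: pm_lift_linear_comp[OF pm_linear_lder] lders_append)
    moreover have "\<dots> \<in> V" by (rule V_sum) (rule V_base)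
    ultimately show ?thesis using V_eqv[OF _ eqv_lder[OF c(2), of i]] c by simp
  qed
  \<comment> \<open>The word grows at its end because the last derivation of a chain is the
    outermost one; the Leibniz rule is applied to exactly that one.\<close>
  have V_gen0: "lders u t * x j \<in> V" if j: "j \<in> {1..r}" for u j
  proof (induction u rule: rev_induct)
    case Nil
    have "t * x j \<doteq> 0" using t j by (simp add: right_socle_def eqv_zero_iff)
    then show ?case using V_eqv[OF V0] tT j by simp
  next
    case (snoc i u)
    define c where "c = chl i (d - mset u)"
    have "lder i (lders u t * x j) = lders (u @ [i]) t * x j + (if i = j then pm_scale c (lders u t) else 0)"
      by (simp add: lder_mult lders_append wscale_has_degree[OF has_degree_lders[OF t(2)]] c_def single_Nil_one)
    then have "lders (u @ [i]) t * x j = lder i (lders u t * x j) + (if i = j then pm_scale (- c) (lders u t) else 0)"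
      by (simp add: pm_scale_uminus)
    moreover have "(if i = j then pm_scale (- c) (lders u t) else 0) \<in> V"
      by (cases "i = j") (simp_all only: if_True if_False simp_thms V_scale[OF V_base] V0)
    ultimately show ?case using V_add[OF V_lder[OF snoc]] by (simp only:)
  qed
  have V_gen: "f * x j \<in> V" if "f \<in> V" "j \<in> {1..r}" for f j
  proof -
    obtain c where c: "f \<in> T" "f \<doteq> pm_lift (\<lambda>u. lders u t) c" using \<open>f \<in> V\<close> by (auto simp: V_def)
    have "pm_lift (\<lambda>u. lders u t) c * x j = pm_lift (\<lambda>u. lders u t * x j) c"
      by (rule pm_lift_linear_comp[OF pm_linear_mult_left])
    moreover have "\<dots> \<in> V" by (rule V_sum) (rule V_gen0[OF that(2)])
    ultimately show ?thesis using V_eqv[OF _ eqv_mult_right[OF c(2), of "x j"]] c that by simp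
  qed
  \<comment> \<open>Since \<open>t\<close> is not in the radical, some chain \<open>u\<close> gives
    a nonzero constant term. By homogeneity \<open>u\<close> then uses up the whole degree
    \<open>d\<close>, so the derivative equals this constant and can be normalised to 1.\<close>
  have V_one: "1 \<in> V"
  proof -
    obtain u where u: "Poly_Mapping.lookup (lders u t) [] \<noteq> 0" using t tT by (auto simp: rad_def)
    then have "[] \<in> Poly_Mapping.keys (lders u t)" unfolding in_keys_iff .
    then have "mset u = d" using keys_lders[of "[]" u t] t(2) by (auto simp: has_degree_def)
    then have "lders u t = Poly_Mapping.single [] (Poly_Mapping.lookup (lders u t) [])"
      using has_degree_empty has_degree_lders[OF t(2), of u] by simp
    then have "pm_scale (1 / Poly_Mapping.lookup (lders u t) []) (lders u t) = 1"
      using u by (metis pm_scale_single divide_self_if mult.commute single_Nil_one times_divide_eq_right mult_1_right)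
    then show ?thesis using V_scale[OF V_base] by metis
  qed
  have V_word: "wd w \<in> V" if "set w \<subseteq> {1..r}" for w
    using that
  proof (induction w rule: rev_induct)
    case (snoc j w)
    then have "wd w * x j \<in> V" by (intro V_gen) auto
    then show ?case by simp
  qed (simp add: single_Nil_one V_one)
  have "pm_lift (\<lambda>w. if set w \<subseteq> {1..r} then wd w else 0) f \<in> V"
    by (rule V_sum) (auto simp: V_word V0)
  also have "pm_lift (\<lambda>w. if set w \<subseteq> {1..r} then wd w else 0) f = pm_lift wd f"
    by (rule pm_lift_cong) (use f in \<open>auto simp: words_in_def lists_eq_set\<close>)
  finally show ?thesis by (simp add: V_def)
qed

text \<open>Write \<open>f\<close> through the derivatives of \<open>t\<close> and project to its
  degree. The derivative along \<open>u\<close> has degree \<open>d - mset u\<close>, so only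
  degrees below \<open>d\<close> are reached, and degree \<open>d\<close> itself only by the empty
  chain.\<close>

lemma socle_degree:
  assumes t: "right_socle t" "has_degree d t" "t \<notin> rad" and f: "f \<in> T" "has_degree M f" "f \<notin> rad"
  shows "M \<subseteq># d" "M = d \<Longrightarrow> \<exists>c. f \<doteq> pm_scale c t"
proof -
  obtain c where c: "f \<doteq> pm_lift (\<lambda>u. lders u t) c" using socle_span[OF t f(1)] by auto
  have "wscale (ind M) f \<doteq> wscale (ind M) (pm_lift (\<lambda>u. lders u t) c)" by (rule eqv_wscale[OF c])
  then have e: "f \<doteq> pm_lift (\<lambda>u. wscale (ind M) (lders u t)) c"
    by (simp add: wscale_ind[OF f(2)] pm_lift_linear_comp[OF pm_linear_wscale])
  show "M \<subseteq># d"
  proof (rule ccontr)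
    assume M: "\<not> M \<subseteq># d"
    have "wscale (ind M) (lders u t) = 0" for u
      using M wscale_ind[OF has_degree_lders[OF t(2)], of M u] by auto
    then show False using e f(3) by (simp add: eqv_zero_iff)
  qed
  show "\<exists>c. f \<doteq> pm_scale c t" if "M = d"
  proof -
    have "wscale (ind M) (lders u t) = (if u = [] then t else 0)" for u
    proof (cases "mset u \<subseteq># d")
      case True
      then have "M = d - mset u \<longleftrightarrow> u = []" using that
        by (metis cancel_comm_monoid_add_class.diff_cancel diff_empty mset_zero_iff subset_mset.diff_diff_right subset_mset.le_imp_diff_is_add add.right_neutral diff_zero subset_mset.add_diff_inverse add_cancel_right_right)
      then show ?thesis using wscale_ind[OF has_degree_lders[OF t(2)], of M u] by auto
    next
      case False
      then show ?thesis using lders_eq_zero[OF t(2) False] by (auto simp: wscale_linear)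
    qed
    then have "f \<doteq> pm_lift (\<lambda>u. if u = [] then t else 0) c" using e by simp
    also have "pm_lift (\<lambda>u. if u = [] then t else 0) c = pm_scale (Poly_Mapping.lookup c []) t"
    proof -
      have "pm_lift (\<lambda>u. if u = [] then t else 0) c = (\<Sum>u\<in>Poly_Mapping.keys c. if u = [] then pm_scale (Poly_Mapping.lookup c []) t else 0)"
        unfolding pm_lift_def by (rule sum.cong) auto
      then show ?thesis by (auto simp: not_in_keys_iff_lookup_eq_zero)
    qed
    finally show ?thesis by blast
  qed
qed

lemma right_socle_ind:
  assumes "right_socle y" shows "right_socle (wscale (ind M) y)"
proof -
  have "wscale (ind M) y * x i = wscale (ind (add_mset i M)) (y * x i)" for i
    by (rule pm_linear_eqI[where \<phi>="\<lambda>y. wscale (ind M) y * x i" and \<psi>="\<lambda>y. wscale (ind (add_mset i M)) (y * x i)"])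
       (auto simp: pm_linear_def wscale_linear distrib_right pm_scale_mult_left ind_def)
  then show ?thesis using assms by (simp add: right_socle_def rad_wscale)
qed

lemma left_socle_ind:
  assumes "left_socle y" shows "left_socle (wscale (ind M) y)"
proof -
  have "x i * wscale (ind M) y = wscale (ind (add_mset i M)) (x i * y)" for i
    by (rule pm_linear_eqI[where \<phi>="\<lambda>y. x i * wscale (ind M) y" and \<psi>="\<lambda>y. wscale (ind (add_mset i M)) (x i * y)"])
       (auto simp: pm_linear_def wscale_linear distrib_left pm_scale_mult_right ind_def)
  then show ?thesis using assms by (simp add: left_socle_def rad_wscale)
qed

text \<open>Only the finitely many degrees of words occurring in \<open>y\<close> contribute, so the
  difference is a finite sum of elements of the radical.\<close>

lemma socle_decompose:
  assumes "\<And>M. M \<noteq> d \<Longrightarrow> wscale (ind M) y \<in> rad"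
  shows "y \<doteq> wscale (ind d) y"
proof -
  have "y - wscale (ind d) y = (\<Sum>M\<in>mset ` Poly_Mapping.keys y. wscale (ind M) (y - wscale (ind d) y))"
  proof (rule poly_mapping_eqI)
    fix w
    have "(\<Sum>M\<in>mset ` Poly_Mapping.keys y. ind M (mset w) * (Poly_Mapping.lookup y w - ind d (mset w) * Poly_Mapping.lookup y w))
        = (\<Sum>M\<in>mset ` Poly_Mapping.keys y. if M = mset w then Poly_Mapping.lookup y w - ind d (mset w) * Poly_Mapping.lookup y w else 0)"
      by (rule sum.cong) (auto simp: ind_def)
    also have "\<dots> = Poly_Mapping.lookup y w - ind d (mset w) * Poly_Mapping.lookup y w"
      by (cases "w \<in> Poly_Mapping.keys y") (auto simp: not_in_keys_iff_lookup_eq_zero)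
    finally show "Poly_Mapping.lookup (y - wscale (ind d) y) w = Poly_Mapping.lookup (\<Sum>M\<in>mset ` Poly_Mapping.keys y. wscale (ind M) (y - wscale (ind d) y)) w"
      by (simp add: lookup_sum lookup_minus)
  qed
  also have "\<dots> \<in> rad"
  proof (rule rad_sum)
    fix M
    show "wscale (ind M) (y - wscale (ind d) y) \<in> rad"
    proof (cases "M = d")
      case True
      have "wscale (ind d) (y - wscale (ind d) y) = 0"
        by (rule poly_mapping_eqI) (simp add: lookup_minus ind_def)
      then show ?thesis using True by simp
    next
      case False
      have "wscale (ind M) (y - wscale (ind d) y) = wscale (ind M) y"
        by (rule poly_mapping_eqI) (use False in \<open>auto simp add: lookup_minus ind_def\<close>)
      then show ?thesis using assms[OF False] by simp
    qed
  qed
  finally show ?thesis by (simp add: eqv_def)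
qed

text \<open>Homogeneous components of an element of the right socle are again in it. For a nonzero
  component of degree \<open>M\<close>, \<open>socle_degree\<close> applies with either of the two
  elements in the role of \<open>t\<close>, which gives \<open>M = d\<close>.\<close>

lemma right_socle_unique:
  assumes t: "right_socle t" "has_degree d t" "t \<notin> rad" and y: "right_socle y"
  shows "\<exists>c. y \<doteq> pm_scale c t"
proof -
  have tT: "t \<in> T" and yT: "y \<in> T" using t y by (simp_all add: right_socle_def)
  have "wscale (ind M) y \<in> rad" if "M \<noteq> d" for M
  proof (rule ccontr)
    assume nr: "wscale (ind M) y \<notin> rad"
    have "d \<subseteq># M" by (rule socle_degree(1)[OF right_socle_ind[OF y] has_degree_ind nr tT t(2,3)])
    moreover have "M \<subseteq># d" by (rule socle_degree(1)[OF t words_in_simps(9)[OF yT] has_degree_ind nr])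
    ultimately show False using that by auto
  qed
  then have e: "y \<doteq> wscale (ind d) y" by (rule socle_decompose)
  show ?thesis
  proof (cases "wscale (ind d) y \<in> rad")
    case True
    then have "y \<doteq> pm_scale 0 t" using e by (metis eqv_trans eqv_zero_iff pm_scale_simps(2))
    then show ?thesis by blast
  next
    case False
    then show ?thesis using socle_degree(2)[OF t words_in_simps(9)[OF yT] has_degree_ind False refl] e eqv_trans by blast
  qed
qed

lemma antip_wscale: "antip (wscale s f) = wscale s (antip f)"
  by (rule pm_linear_eqI[where \<phi>="\<lambda>f. antip (wscale s f)" and \<psi>="\<lambda>f. wscale s (antip f)"])
     (auto simp: pm_linear_def antip_linear wscale_linear mult.commute)

lemma chl_nonzero:
  assumes "\<And>i j. i \<in> {1..r} \<Longrightarrow> j \<in> {1..r} \<Longrightarrow> Q i j \<noteq> 0" "i \<in> {1..r}" "set_mset M \<subseteq> {1..r}"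
  shows "chl i M \<noteq> 0" "chr i M \<noteq> 0"
  using assms(3) by (induction M) (use assms in auto)

text \<open>The converse of \<open>rad_antip\<close>: in \<open>lder_antip\<close> the scalars on
  degrees are products of entries of \<open>Q\<close>, hence invertible, so the right derivatives of
  \<open>f\<close> inherit the hypothesis.\<close>

lemma rad_antipD:
  assumes nz: "\<And>i j. i \<in> {1..r} \<Longrightarrow> j \<in> {1..r} \<Longrightarrow> Q i j \<noteq> 0" and "antip f \<in> rad" "f \<in> T"
  shows "f \<in> rad"
proof -
  have "Poly_Mapping.lookup (lders u f) [] = 0" if "antip f \<in> rad" "f \<in> T" for u f
    using that
  proof (induction u arbitrary: f rule: rev_induct)
    case Nil
    have "Poly_Mapping.lookup (antip f) [] = (\<Sum>w\<in>Poly_Mapping.keys f. if w = [] then Poly_Mapping.lookup f [] else 0)"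
      unfolding antip_def lookup_pm_lift by (rule sum.cong) (auto simp: lookup_single when_def)
    then have "Poly_Mapping.lookup (antip f) [] = Poly_Mapping.lookup f []"
      by (auto simp: not_in_keys_iff_lookup_eq_zero)
    then show ?case using rad_const[OF Nil(1)] by simp
  next
    case (snoc j u)
    have eq: "Poly_Mapping.lookup (lders (u @ [j]) f) [] = Poly_Mapping.lookup (lders u (rder j f)) []"
      by (simp add: lders_append lders_rder lookup_rder_Nil)
    show ?case
    proof (cases "j \<in> {1..r}")
      case True
      define s where "s = (\<lambda>M. - chl j (add_mset j M))"
      have "antip (wscale s (rder j f)) = pm_scale (Q j j) (lder j (antip f))"
        unfolding lder_antip rder_wscale s_def ..
      then have "wscale s (antip (rder j f)) \<in> rad"
        using snoc.prems by (simp add: antip_wscale[symmetric] rad_lder)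
      then have "wscale (\<lambda>M. inverse (s M)) (wscale s (antip (rder j f))) \<in> rad" by (rule rad_wscale)
      also have "wscale (\<lambda>M. inverse (s M)) (wscale s (antip (rder j f))) = pm_scale 1 (antip (rder j f))"
        unfolding wscale_wscale
      proof (rule wscale_const)
        fix w assume "w \<in> Poly_Mapping.keys (antip (rder j f))"
        then have "set w \<subseteq> {1..r}"
          using antip_in[OF rder_in[OF snoc.prems(2), of j]] by (auto simp: words_in_def lists_eq_set)
        then have "chl j (add_mset j (mset w)) \<noteq> 0" using True by (intro chl_nonzero(1)[OF nz]) auto
        then show "inverse (s (mset w)) * s (mset w) = 1"
          unfolding s_def by (intro left_inverse) (simp only: neg_equal_0_iff_equal not_False_eq_True)
      qed
      finally show ?thesis unfolding eq using snoc by simp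
    next
      case False
      then show ?thesis unfolding eq using rder_outside[OF snoc.prems(2) False] by (simp add: lders_linear)
    qed
  qed
  then show ?thesis using assms by (auto simp add: rad_def)
qed

text \<open>The antipode exchanges the two socles. It is applied to homogeneous components, because
  there the twist by \<open>chr i\<close> in \<open>antip_gen_mult\<close> is a single nonzero
  scalar.\<close>

lemma left_socle_unique:
  assumes nz: "\<And>i j. i \<in> {1..r} \<Longrightarrow> j \<in> {1..r} \<Longrightarrow> Q i j \<noteq> 0"
    and t: "right_socle t" "has_degree d t" "t \<notin> rad" and y: "left_socle y"
  shows "\<exists>c. y \<doteq> pm_scale c t"
proof -
  have tT: "t \<in> T" and yT: "y \<in> T" using t y by (simp_all add: right_socle_def left_socle_def)
  have rs: "right_socle (antip (wscale (ind M) y))" for M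
  proof (cases "set_mset M \<subseteq> {1..r}")
    case True
    have "antip (wscale (ind M) y) * x i \<in> rad" if i: "i \<in> {1..r}" for i
    proof -
      have "x i * wscale (ind M) y \<in> rad" using left_socle_ind[OF y] i by (simp add: left_socle_def)
      then have "antip (x i * wscale (ind M) y) \<in> rad" using rad_antip nz by simp
      moreover have "antip (x i * wscale (ind M) y) = pm_scale (- chr i M) (antip (wscale (ind M) y) * x i)"
        unfolding antip_gen_mult wscale_has_degree[OF has_degree_ind] antip_linear(2) pm_scale_mult_left
        by (rule pm_scale_uminus(1)[symmetric])
      ultimately have "pm_scale (- chr i M) (antip (wscale (ind M) y) * x i) \<in> rad" by (simp only:)
      then have "pm_scale (inverse (- chr i M)) (pm_scale (- chr i M) (antip (wscale (ind M) y) * x i)) \<in> rad"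
        by (rule rad_simps(5))
      moreover have "inverse (- chr i M) * - chr i M = 1"
        by (rule left_inverse) (use chl_nonzero(2)[OF nz i True] in simp)
      ultimately show ?thesis by (simp only: pm_scale_scale pm_scale_simps)
    qed
    then show ?thesis using yT by (simp add: right_socle_def antip_in)
  next
    case False
    have "wscale (ind M) y = 0"
    proof (rule pm_eq_zeroI)
      fix w show "w \<notin> Poly_Mapping.keys (wscale (ind M) y)"
      proof
        assume w: "w \<in> Poly_Mapping.keys (wscale (ind M) y)"
        have "mset w = M" using w has_degree_ind[of M y] by (simp add: has_degree_def)
        moreover have "set w \<subseteq> {1..r}"
          using w words_in_simps(9)[OF yT, of "ind M"] unfolding words_in_def lists_eq_set by blast
        ultimately show False using False by (metis set_mset_mset)
      qed
    qed
    then show ?thesis by (simp add: antip_linear right_socle_def)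
  qed
  have hd: "has_degree M (antip (wscale (ind M) y))" for M
    unfolding antip_wscale by (rule has_degree_ind)
  have "wscale (ind M) y \<in> rad" if "M \<noteq> d" for M
  proof (rule ccontr)
    assume nr: "wscale (ind M) y \<notin> rad"
    have "antip (wscale (ind M) y) \<notin> rad"
    proof
      assume a: "antip (wscale (ind M) y) \<in> rad"
      have "wscale (ind M) y \<in> rad" by (rule rad_antipD[OF nz a words_in_simps(9)[OF yT]])
      with nr show False ..
    qed
    then have "d \<subseteq># M" by (rule socle_degree(1)[OF rs hd _ tT t(2,3)])
    moreover have "M \<subseteq># d" by (rule socle_degree(1)[OF t words_in_simps(9)[OF yT] has_degree_ind nr])
    ultimately show False using that by auto
  qed
  then have e: "y \<doteq> wscale (ind d) y" by (rule socle_decompose)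
  show ?thesis
  proof (cases "wscale (ind d) y \<in> rad")
    case True
    then have "y \<doteq> pm_scale 0 t" using e by (metis eqv_trans eqv_zero_iff pm_scale_simps(2))
    then show ?thesis by blast
  next
    case False
    then show ?thesis using socle_degree(2)[OF t words_in_simps(9)[OF yT] has_degree_ind False refl] e eqv_trans by blast
  qed
qed

text \<open>\<open>x i * t\<close> would be a nonzero element whose degree exceeds \<open>d\<close>,
  the largest degree that occurs.\<close>

lemma right_socle_is_left_socle:
  assumes t: "right_socle t" "has_degree d t" "t \<notin> rad"
  shows "left_socle t"
proof -
  have tT: "t \<in> T" using t by (simp_all add: right_socle_def)
  have "x i * t \<in> rad" if i: "i \<in> {1..r}" for i
  proof (rule ccontr)
    assume nr: "x i * t \<notin> rad"
    have "has_degree ({#i#} + d) (x i * t)" by (rule has_degree_mult) (use t in auto)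
    from socle_degree(1)[OF t _ this nr] have "{#i#} + d \<subseteq># d" using tT i by simp
    then show False using mset_subset_eq_exists_conv by fastforce
  qed
  then show ?thesis using tT by (simp add: left_socle_def)
qed

end

section \<open>Root vectors and the top of the Nichols algebra in super-type A\<close>

declare single_Nil_one [simp]

definition qint :: "nat \<Rightarrow> 'k::field \<Rightarrow> 'k" where "qint n p = (\<Sum>s<n. p ^ s)"

lemma qint_Suc: "qint (Suc n) p = qint n p + p ^ n" by (simp add: qint_def)

text \<open>Every letter \<open>k > l\<close> occurring in the inner root vector has
  \<open>Q k l = 1\<close>, so the ordinary commutator is the commutator for the inverse braiding.
  The last letter \<open>m\<close> comes first as an argument because the constructions below keep
  it fixed.\<close>

function rootv :: "nat \<Rightarrow> nat \<Rightarrow> (nat list \<Rightarrow>\<^sub>0 'k::field)" where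
  "rootv m l = (if l < m then Poly_Mapping.single [l] 1 * rootv m (Suc l) - rootv m (Suc l) * Poly_Mapping.single [l] 1
     else Poly_Mapping.single [m] 1)"
  by auto
termination by (relation "measure (\<lambda>(m, l). m - l)") auto

declare rootv.simps [simp del]

lemma has_degree_power: "has_degree M f \<Longrightarrow> has_degree (repeat_mset a M) (f ^ a)"
  by (induction a) (simp_all add: has_degree_mult)

lemma words_in_power: "f \<in> words_in S \<Longrightarrow> f ^ a \<in> words_in S"
  by (induction a) simp_all

lemma words_in_mono: "S \<subseteq> S' \<Longrightarrow> f \<in> words_in S \<Longrightarrow> f \<in> words_in S'"
  unfolding words_in_def using lists_mono[of S S'] by auto

text \<open>The properties of super-type A from which the top element is built. The two Cartan
  conditions say that a generator has self-braiding \<open>-1\<close> or is tied to the edge by an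
  inverse; \<open>balanced\<close> says that the double braiding of \<open>x (Suc i)\<close> with
  the root vector on three letters centred there is trivial; \<open>nn l m\<close> is the least
  exponent whose q-integer at the self-braiding of the root vector vanishes.\<close>

locale type_A_braiding = braiding Q r for Q :: "nat \<Rightarrow> nat \<Rightarrow> 'k::field" and r +
  fixes nn :: "nat \<Rightarrow> nat \<Rightarrow> nat"
  assumes nonzero: "\<And>i j. i \<in> {1..r} \<Longrightarrow> j \<in> {1..r} \<Longrightarrow> Q i j \<noteq> 0"
    and trivial: "\<And>i j. i \<in> {1..r} \<Longrightarrow> j \<in> {1..r} \<Longrightarrow> j \<noteq> i \<Longrightarrow> j \<noteq> Suc i \<Longrightarrow> Q i j = 1"
    and cartan_up: "\<And>i. 1 \<le> i \<Longrightarrow> i < r \<Longrightarrow> (1 + Q i i) * (1 - Q i i * Q i (Suc i)) = 0"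
    and cartan_down: "\<And>i. 1 \<le> i \<Longrightarrow> i < r \<Longrightarrow> (1 + Q (Suc i) (Suc i)) * (1 - Q (Suc i) (Suc i) * Q i (Suc i)) = 0"
    and balanced: "\<And>i. 1 \<le> i \<Longrightarrow> Suc i < r \<Longrightarrow> Q i (Suc i) * (Q (Suc i) (Suc i))\<^sup>2 * Q (Suc i) (Suc (Suc i)) = 1"
    and linked: "\<And>i. 1 \<le> i \<Longrightarrow> i < r \<Longrightarrow> Q i (Suc i) \<noteq> 1"
    and nn_pos: "\<And>l m. 1 \<le> l \<Longrightarrow> l \<le> m \<Longrightarrow> m \<le> r \<Longrightarrow> 0 < nn l m"
    and nn_zero: "\<And>l m. 1 \<le> l \<Longrightarrow> l \<le> m \<Longrightarrow> m \<le> r \<Longrightarrow>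
        qint (nn l m) ((\<Prod>i=l..m. Q i i) * (\<Prod>i=l..<m. Q i (Suc i))) = 0"
    and nn_minimal: "\<And>l m a. 1 \<le> l \<Longrightarrow> l \<le> m \<Longrightarrow> m \<le> r \<Longrightarrow> 0 < a \<Longrightarrow> a < nn l m \<Longrightarrow>
        qint a ((\<Prod>i=l..m. Q i i) * (\<Prod>i=l..<m. Q i (Suc i))) \<noteq> 0"
begin

section \<open>Commutation up to a scalar, modulo the radical\<close>

definition skew_comm :: "'k \<Rightarrow> (nat list \<Rightarrow>\<^sub>0 'k) \<Rightarrow> (nat list \<Rightarrow>\<^sub>0 'k) \<Rightarrow> bool" where
  "skew_comm c f g \<longleftrightarrow> f * g \<doteq> pm_scale c (g * f)"

lemma skew_comm_mult_left:
  assumes "skew_comm c f h" "skew_comm d g h" "f \<in> T" "g \<in> T" "h \<in> T"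
  shows "skew_comm (c * d) (f * g) h"
proof -
  have "f * (g * h) \<doteq> f * pm_scale d (h * g)"
    using assms by (intro eqv_mult_left) (simp_all add: skew_comm_def)
  also have "f * pm_scale d (h * g) = pm_scale d ((f * h) * g)"
    by (simp add: pm_scale_mult_right mult.assoc)
  also have "\<dots> \<doteq> pm_scale d (pm_scale c (h * f) * g)"
    using assms by (intro eqv_scale eqv_mult_right) (simp_all add: skew_comm_def)
  finally show ?thesis by (simp add: skew_comm_def mult.assoc pm_scale_mult_left mult.commute)
qed

lemma skew_comm_mult_right:
  assumes "skew_comm c h f" "skew_comm d h g" "f \<in> T" "g \<in> T" "h \<in> T"
  shows "skew_comm (c * d) h (f * g)"
proof -
  have "(h * f) * g \<doteq> pm_scale c (f * h) * g"
    using assms by (intro eqv_mult_right) (simp_all add: skew_comm_def)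
  also have "pm_scale c (f * h) * g = pm_scale c (f * (h * g))"
    by (simp add: pm_scale_mult_left mult.assoc)
  also have "\<dots> \<doteq> pm_scale c (f * pm_scale d (g * h))"
    using assms by (intro eqv_scale eqv_mult_left) (simp_all add: skew_comm_def)
  finally show ?thesis by (simp add: skew_comm_def mult.assoc pm_scale_mult_right)
qed

lemma skew_comm_diff_left: "skew_comm c f h \<Longrightarrow> skew_comm c g h \<Longrightarrow> skew_comm c (f - g) h"
  unfolding skew_comm_def left_diff_distrib right_diff_distrib pm_scale_diff by (rule eqv_diff)

lemma skew_comm_diff_right: "skew_comm c h f \<Longrightarrow> skew_comm c h g \<Longrightarrow> skew_comm c h (f - g)"
  unfolding skew_comm_def left_diff_distrib right_diff_distrib pm_scale_diff by (rule eqv_diff)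

lemma skew_comm_one: "skew_comm 1 1 f" "skew_comm 1 f 1"
  by (simp_all add: skew_comm_def)

lemma skew_comm_power_left:
  assumes "skew_comm c f g" "f \<in> T" "g \<in> T" shows "skew_comm (c ^ a) (f ^ a) g"
proof (induction a)
  case (Suc a)
  then show ?case using skew_comm_mult_left[OF assms(1) Suc] assms by (simp add: words_in_power)
qed (simp add: skew_comm_one)

lemma skew_comm_power_right:
  assumes "skew_comm c g f" "f \<in> T" "g \<in> T" shows "skew_comm (c ^ a) g (f ^ a)"
proof (induction a)
  case (Suc a)
  then show ?case using skew_comm_mult_right[OF assms(1) Suc] assms by (simp add: words_in_power)
qed (simp add: skew_comm_one)

section \<open>Degrees and self-braidings of root vectors\<close>

definition deg :: "nat \<Rightarrow> nat \<Rightarrow> nat multiset" where "deg m l = mset_set {l..m}"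

lemma deg_step: "l < m \<Longrightarrow> deg m l = add_mset l (deg m (Suc l))"
proof -
  assume "l < m"
  then have "{l..m} = insert l {Suc l..m}" by auto
  then show ?thesis by (simp add: deg_def)
qed

lemma chl_deg: "i < l \<Longrightarrow> 1 \<le> i \<Longrightarrow> m \<le> r \<Longrightarrow> chl i (deg m l) = 1"
  unfolding chl_def deg_def by (auto simp: prod_unfold_prod_mset[symmetric] trivial intro!: prod.neutral)

lemma chr_deg:
  assumes "1 \<le> i" "i \<le> r" "1 \<le> l" "m \<le> r"
  shows "chr i (deg m l) = (if l \<le> i \<and> i \<le> m then Q i i else 1) * (if l \<le> Suc i \<and> Suc i \<le> m then Q i (Suc i) else 1)"
proof -
  have "chr i (deg m l) = (\<Prod>k\<in>{l..m}. Q i k)"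
    by (simp add: chr_def deg_def prod_unfold_prod_mset)
  also have "\<dots> = (\<Prod>k\<in>{l..m}. (if k = i then Q i i else 1) * (if k = Suc i then Q i (Suc i) else 1))"
    by (rule prod.cong) (use assms trivial in auto)
  also have "\<dots> = (if l \<le> i \<and> i \<le> m then Q i i else 1) * (if l \<le> Suc i \<and> Suc i \<le> m then Q i (Suc i) else 1)"
    by (simp add: prod.distrib)
  finally show ?thesis .
qed

text \<open>The self-braiding of the root vector on \<open>{l..m}\<close>: in the product of
  \<open>Q i j\<close> over all \<open>i\<close> and \<open>j\<close> in the interval, the factors
  other than these are 1 by \<open>trivial\<close>.\<close>

abbreviation chi :: "nat \<Rightarrow> nat \<Rightarrow> 'k" where "chi l m \<equiv> (\<Prod>i=l..m. Q i i) * (\<Prod>i=l..<m. Q i (Suc i))"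

lemma chi_step: "l < m \<Longrightarrow> chi l m = Q l l * Q l (Suc l) * chi (Suc l) m"
  by (simp add: prod.atLeast_Suc_atMost prod.atLeast_Suc_lessThan)

section \<open>Root vectors with a fixed last letter and their relations\<close>

context
  fixes m :: nat
  assumes m: "1 \<le> m" "m \<le> r"
begin

abbreviation "Y \<equiv> (rootv m :: nat \<Rightarrow> (nat list \<Rightarrow>\<^sub>0 'k))"

lemma Y_top: "Y m = x m" by (simp add: rootv.simps[of m m])

lemma Y_step: "l < m \<Longrightarrow> Y l = x l * Y (Suc l) - Y (Suc l) * x l" by (subst rootv.simps) simp

lemma Y_words: "l \<le> m \<Longrightarrow> Y l \<in> words_in {l..m}"
proof (induction l rule: inc_induct)
  case (step n)
  then have "Y (Suc n) \<in> words_in {n..m}" by (intro words_in_mono[OF _ step.IH]) auto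
  with step show ?case by (simp add: Y_step)
qed (simp add: Y_top)

lemma Y_T [simp]: "1 \<le> l \<Longrightarrow> l \<le> m \<Longrightarrow> Y l \<in> T"
  by (rule words_in_mono[OF _ Y_words]) (use m in auto)

lemma x_T [simp]: "1 \<le> i \<Longrightarrow> i \<le> m \<Longrightarrow> x i \<in> T"
  using m by simp

lemma Y_degree: "l \<le> m \<Longrightarrow> has_degree (deg m l) (Y l)"
proof (induction l rule: inc_induct)
  case (step n)
  have "has_degree ({#n#} + deg m (Suc n)) (x n * Y (Suc n))" "has_degree (deg m (Suc n) + {#n#}) (Y (Suc n) * x n)"
    by (rule has_degree_mult; use step in simp)+
  with step show ?case by (simp add: Y_step deg_step)
qed (simp add: Y_top deg_def)

lemma x_comm: "1 \<le> i \<Longrightarrow> i + 2 \<le> j \<Longrightarrow> j \<le> m \<Longrightarrow> skew_comm 1 (x i) (x j)"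
  unfolding skew_comm_def eqv_def
  by (rule rad_rdersI)
     (use m trivial in \<open>auto simp: lookup_minus lookup_mult_Nil lookup_single when_def rder_linear rder_mult_gen
        simp del: single_mult_words\<close>)

lemma x_comm_Y: "l \<le> m \<Longrightarrow> 1 \<le> i \<Longrightarrow> i + 2 \<le> l \<Longrightarrow> skew_comm 1 (x i) (Y l)"
proof (induction l rule: inc_induct)
  case base
  then show ?case using x_comm[of i m] by (simp add: Y_top)
next
  case (step n)
  have c: "skew_comm 1 (x i) (Y (Suc n))" "skew_comm 1 (x i) (x n)" using step x_comm[of i n] by auto
  have "skew_comm (1 * 1) (x i) (x n * Y (Suc n))" "skew_comm (1 * 1) (x i) (Y (Suc n) * x n)"
    by (rule skew_comm_mult_right; use c step m in simp)+
  then show ?case using step skew_comm_diff_right by (simp add: Y_step)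
qed

text \<open>Coefficient and value of the one surviving right derivative of \<open>Y l\<close>. With
  value 1 for both at \<open>l = m\<close>, the single letter needs no separate treatment.\<close>

definition kap :: "nat \<Rightarrow> 'k" where "kap l = (if l < m then Q l (Suc l) - 1 else 1)"
definition Y' :: "nat \<Rightarrow> (nat list \<Rightarrow>\<^sub>0 'k)" where "Y' l = (if l < m then Y (Suc l) else 1)"

lemma kap_nonzero: "1 \<le> l \<Longrightarrow> l \<le> m \<Longrightarrow> kap l \<noteq> 0"
  using linked m by (auto simp: kap_def)

lemma Y'_T [simp]: "1 \<le> l \<Longrightarrow> l \<le> m \<Longrightarrow> Y' l \<in> T" by (simp add: Y'_def)

text \<open>The derivation by \<open>l\<close> meets the braiding scalar in only one of the two
  terms of the commutator, which leaves \<open>Q l (Suc l) - 1\<close>. The derivation by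
  \<open>Suc l\<close> leaves the commutator of \<open>x l\<close> with letters not adjacent to it,
  which vanishes modulo \<open>rad\<close>.\<close>

lemma rder_Y: "l \<le> m \<Longrightarrow> 1 \<le> l \<Longrightarrow> 1 \<le> i \<Longrightarrow> i \<le> r \<Longrightarrow> rder i (Y l) \<doteq> (if i = l then pm_scale (kap l) (Y' l) else 0)"
proof (induction l rule: inc_induct)
  case base
  then show ?case by (simp add: Y_top kap_def Y'_def)
next
  case (step n)
  let ?z = "rder i (Y (Suc n))"
  have IH: "?z \<doteq> (if i = Suc n then pm_scale (kap (Suc n)) (Y' (Suc n)) else 0)"
    using step by simp
  have e: "rder i (Y n) = x n * ?z + (if i = n then wscale (chr i) (Y (Suc n)) - Y (Suc n) else 0) - pm_scale (Q i n) (?z * x n)"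
    using step by (auto simp: Y_step rder_linear rder_gen_mult rder_mult_gen)
  show ?case
  proof (cases "i = n")
    case True
    have z: "?z = 0" by (rule rder_outside[OF Y_words]) (use step True in auto)
    have "chr n (deg m (Suc n)) = Q n (Suc n)"
      using step m by (subst chr_deg) auto
    then have "rder i (Y n) = pm_scale (kap n) (Y' n)"
      unfolding e z using True step
      by (simp add: wscale_has_degree[OF Y_degree] kap_def Y'_def pm_scale_diff_left)
    then show ?thesis using True by simp
  next
    case False
    show ?thesis
    proof (cases "i = Suc n")
      case True
      have q: "Q i n = 1" using True step m by (intro trivial) auto
      have "x n * ?z - ?z * x n \<doteq> x n * pm_scale (kap i) (Y' i) - pm_scale (kap i) (Y' i) * x n"
        using IH True step by (intro eqv_diff eqv_mult_left eqv_mult_right) auto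
      also have "x n * pm_scale (kap i) (Y' i) - pm_scale (kap i) (Y' i) * x n = pm_scale (kap i) (x n * Y' i - Y' i * x n)"
        by (simp add: pm_scale_mult_left pm_scale_mult_right pm_scale_diff)
      also have "\<dots> \<doteq> pm_scale (kap i) 0"
      proof (rule eqv_scale)
        show "x n * Y' i - Y' i * x n \<doteq> 0"
          using x_comm_Y[of "Suc i" n] True step by (auto simp: Y'_def skew_comm_def eqv_def)
      qed
      finally show ?thesis unfolding e q using False by simp
    next
      case F: False
      then have "?z \<doteq> 0" using IH by simp
      then have "x n * ?z - pm_scale (Q i n) (?z * x n) \<doteq> x n * 0 - pm_scale (Q i n) (0 * x n)"
        using step by (intro eqv_diff eqv_mult_left eqv_mult_right eqv_scale) auto
      then show ?thesis unfolding e using False by simp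
    qed
  qed
qed

text \<open>Zero in the free algebra itself, not only modulo \<open>rad\<close>: letters above
  \<open>i\<close> braid trivially past \<open>x i\<close>, so the two terms of the commutator
  cancel. The exact form is what later lets derivations pass whole products.\<close>

lemma lder_Y: "l \<le> m \<Longrightarrow> 1 \<le> l \<Longrightarrow> 1 \<le> i \<Longrightarrow> i < m \<Longrightarrow> lder i (Y l) = 0"
proof (induction l rule: inc_induct)
  case base
  then show ?case by (simp add: Y_top)
next
  case (step n)
  have z: "lder i (Y (Suc n)) = 0" using step by simp
  have "lder i (Y n) = (if i = n then Y (Suc n) - wscale (chl i) (Y (Suc n)) else 0)"
    using step z by (auto simp: Y_step lder_linear lder_gen_mult lder_mult single_Nil_one)
  also have "\<dots> = 0"
    using step m by (auto simp: wscale_has_degree[OF Y_degree] chl_deg)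
  finally show ?case .
qed

text \<open>Right derivations decide: the one by \<open>l\<close> turns the claim into hypothesis
  \<open>c\<close>; for \<open>i \<noteq> l\<close> the one by \<open>i\<close> forces the scalar to
  be \<open>chr i (deg m l)\<close>; the others give zero on both sides.\<close>

lemma x_Y_relation:
  assumes i: "l \<le> i" "i \<le> m" and l: "1 \<le> l"
    and c: "pm_scale (kap l) (x i * Y' l) + (if i = l then pm_scale (chr i (deg m l)) (Y l) else 0)
        \<doteq> pm_scale c ((if i = l then Y l else 0) + pm_scale (kap l * Q l i) (Y' l * x i))"
    and c': "i \<noteq> l \<Longrightarrow> c = chr i (deg m l)"
  shows "skew_comm c (x i) (Y l)"
  unfolding skew_comm_def eqv_def
proof (rule rad_rdersI)
  have iT: "x i \<in> T" "Y l \<in> T" "Y' l \<in> T" using i l m by auto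
  then show "x i * Y l - pm_scale c (Y l * x i) \<in> T" by simp
  show "Poly_Mapping.lookup (x i * Y l - pm_scale c (Y l * x i)) [] = 0"
    by (simp add: lookup_minus lookup_mult_Nil lookup_single when_def)
  fix k assume k: "k \<in> {1..r}"
  let ?z = "rder k (Y l)"
  have z: "?z \<doteq> (if k = l then pm_scale (kap l) (Y' l) else 0)" using rder_Y[of l k] i l k by simp
  have e: "rder k (x i * Y l - pm_scale c (Y l * x i)) = x i * ?z + (if k = i then pm_scale (chr i (deg m l)) (Y l) else 0)
     - pm_scale c ((if k = i then Y l else 0) + pm_scale (Q k i) (?z * x i))"
    using i l by (simp add: rder_linear rder_gen_mult rder_mult_gen wscale_has_degree[OF Y_degree])
  have "rder k (x i * Y l - pm_scale c (Y l * x i)) \<doteq> 0"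
  proof (cases "k = l")
    case True
    have "rder k (x i * Y l - pm_scale c (Y l * x i)) \<doteq> x i * pm_scale (kap l) (Y' l) + (if k = i then pm_scale (chr i (deg m l)) (Y l) else 0)
     - pm_scale c ((if k = i then Y l else 0) + pm_scale (Q k i) (pm_scale (kap l) (Y' l) * x i))"
      unfolding e using z True iT by (intro eqv_diff eqv_add eqv_mult_left eqv_mult_right eqv_scale) auto
    also have "\<dots> = (pm_scale (kap l) (x i * Y' l) + (if i = l then pm_scale (chr i (deg m l)) (Y l) else 0))
        - pm_scale c ((if i = l then Y l else 0) + pm_scale (kap l * Q l i) (Y' l * x i))"
      using True by (auto simp: pm_scale_mult_left pm_scale_mult_right mult.commute)
    also have "\<dots> \<doteq> 0" using c by (simp add: eqv_def)
    finally show ?thesis .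
  next
    case False
    have "rder k (x i * Y l - pm_scale c (Y l * x i)) \<doteq> x i * 0 + (if k = i then pm_scale (chr i (deg m l)) (Y l) else 0)
     - pm_scale c ((if k = i then Y l else 0) + pm_scale (Q k i) (0 * x i))"
      unfolding e using z False iT by (intro eqv_diff eqv_add eqv_mult_left eqv_mult_right eqv_scale) auto
    then show ?thesis using c' False by (auto split: if_splits)
  qed
  then show "rder k (x i * Y l - pm_scale c (Y l * x i)) \<in> rad" by (simp add: eqv_def)
qed

lemma x_Y_same: assumes "1 \<le> l" "l < m" shows "skew_comm (1 / Q l l) (x l) (Y l)"
proof (rule x_Y_relation)
  have q: "Q l l \<noteq> 0" using nonzero assms m by simp
  have "chr l (deg m l) = Q l l * Q l (Suc l)" using assms m by (subst chr_deg) auto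
  \<comment> \<open>The upper Cartan condition at \<open>l\<close>, divided by
    \<open>Q l l\<close>.\<close>
  moreover have "kap l + Q l l * Q l (Suc l) = 1 / Q l l"
    using cartan_up[of l] q assms m by (simp add: kap_def field_simps) algebra
  moreover have "pm_scale (kap l) (x l * Y' l) = pm_scale (kap l) (Y l) + pm_scale (kap l) (Y' l * x l)"
    using assms by (simp add: Y_step Y'_def flip: pm_scale_add)
  ultimately have "pm_scale (kap l) (x l * Y' l) + pm_scale (chr l (deg m l)) (Y l)
     = pm_scale (1 / Q l l) (Y l + pm_scale (kap l * Q l l) (Y' l * x l))"
    using q by (simp add: pm_scale_add add.commute add.left_commute flip: pm_scale_add_left)
  then show "pm_scale (kap l) (x l * Y' l) + (if l = l then pm_scale (chr l (deg m l)) (Y l) else 0)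
        \<doteq> pm_scale (1 / Q l l) ((if l = l then Y l else 0) + pm_scale (kap l * Q l l) (Y' l * x l))"
    by simp
qed (use assms in auto)

lemma x_square: assumes "1 \<le> i" "i \<le> r" "Q i i = - 1" shows "x i * x i \<in> rad"
proof (rule rad_rdersI)
  fix k
  show "rder k (x i * x i) \<in> rad"
    using assms by (cases "k = i") (simp_all add: rder_gen_mult pm_scale_uminus single_uminus del: single_mult_words)
qed (use assms in \<open>auto simp: lookup_single when_def\<close>)

lemma eqv_scale_scale: "f \<doteq> pm_scale (c * q) g \<Longrightarrow> pm_scale k f \<doteq> pm_scale c (pm_scale (k * q) g)"
  using eqv_scale[of f "pm_scale (c * q) g" k] by (simp add: ac_simps)

text \<open>The scalar does not depend on \<open>l\<close>, so the induction is on the distance of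
  \<open>l\<close> from \<open>i\<close>. When \<open>l\<close> is at least two below
  \<open>i\<close>, \<open>Q l i = 1\<close> and the relation passes from \<open>Y (Suc l)\<close>
  to \<open>Y l\<close>. The substance is in the adjacent case.\<close>

lemma x_Y_above:
  assumes "i \<le> m" shows "l < i \<Longrightarrow> 1 \<le> l \<Longrightarrow> skew_comm (Q i i * (if i < m then Q i (Suc i) else 1)) (x i) (Y l)"
proof (induction "i - Suc l" arbitrary: l)
  case (Suc n)
  let ?c = "Q i i * (if i < m then Q i (Suc i) else 1)"
  have c: "?c = chr i (deg m l)" using assms Suc m by (subst chr_deg) auto
  have "Q l i = 1" using Suc m assms by (intro trivial) auto
  moreover have "skew_comm ?c (x i) (Y' l)" using Suc assms by (auto simp: Y'_def)
  ultimately have "x i * Y' l \<doteq> pm_scale (?c * Q l i) (Y' l * x i)"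
    by (simp only: skew_comm_def mult_1_right)
  then have "pm_scale (kap l) (x i * Y' l) \<doteq> pm_scale ?c (pm_scale (kap l * Q l i) (Y' l * x i))"
    by (rule eqv_scale_scale)
  then show ?case
    using Suc assms c by (intro x_Y_relation) (auto simp del: pm_scale_scale)
next
  case 0
  let ?c = "Q i i * (if i < m then Q i (Suc i) else 1)"
  have c: "?c = chr i (deg m l)" using assms 0 m by (subst chr_deg) auto
  have i: "i = Suc l" using 0 by simp
  have q: "Q i i \<noteq> 0" using nonzero i assms m by simp
  have "x i * Y' l \<doteq> pm_scale (?c * Q l i) (Y' l * x i)"
  proof (cases "i < m")
    case True
    \<comment> \<open>This is \<open>balanced\<close>: it makes the required scalar agree with the
      one at which \<open>x i\<close> commutes with its own \<open>Y i\<close>.\<close>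
    have "?c * Q l i = 1 / Q i i" using balanced[of l] True i 0 m q
      by (simp add: field_simps power2_eq_square)
    moreover have "Y' l = Y i" using True i by (simp add: Y'_def)
    ultimately show ?thesis using x_Y_same[of i] True i by (simp add: skew_comm_def)
  next
    case False
    then have "i = m" using assms by simp
    then have Y': "Y' l = x i" using i by (simp add: Y'_def Y_top)
    \<comment> \<open>At the right end of the interval the claim compares \<open>x i * x i\<close>
      with a multiple of itself: by the lower Cartan condition, either the square vanishes or the
      scalar is 1.\<close>
    have "(1 + Q i i) * (1 - Q i i * Q l i) = 0" using cartan_down[of l] i 0 m assms by simp
    then consider "Q i i = - 1" | "Q i i * Q l i = 1" by (auto simp: add_eq_0_iff)
    then show ?thesis
    proof cases
      case 1
      then have s: "x i * x i \<in> rad" using i assms m by (intro x_square) auto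
      then have "x i * x i \<doteq> 0" by (simp only: eqv_zero_iff)
      moreover have "0 \<doteq> pm_scale (?c * Q l i) (x i * x i)"
        by (rule eqv_sym) (simp only: eqv_zero_iff rad_simps(5)[OF s])
      ultimately show ?thesis unfolding Y' by (rule eqv_trans)
    next
      case 2
      then show ?thesis unfolding Y' using \<open>i = m\<close> by simp
    qed
  qed
  then have "pm_scale (kap l) (x i * Y' l) \<doteq> pm_scale ?c (pm_scale (kap l * Q l i) (Y' l * x i))"
    by (rule eqv_scale_scale)
  then show ?case
    using 0 assms i c by (intro x_Y_relation) (auto simp del: pm_scale_scale)
qed

text \<open>\<open>x n\<close> and \<open>Y (Suc n)\<close> both commute with \<open>Y l\<close> up
  to scalars, so both terms of their commutator do, with the product scalar; the scalars multiply up
  to \<open>chi\<close>.\<close>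

lemma Y_Y: "i \<le> m \<Longrightarrow> l < i \<Longrightarrow> 1 \<le> l \<Longrightarrow> skew_comm (chi i m) (Y i) (Y l)"
proof (induction i rule: inc_induct)
  case base
  then show ?case using x_Y_above[of m l] by (simp add: Y_top)
next
  case (step n)
  have c: "skew_comm (chi (Suc n) m) (Y (Suc n)) (Y l)" "skew_comm (Q n n * Q n (Suc n)) (x n) (Y l)"
    using step x_Y_above[of n l] by auto
  have "skew_comm (Q n n * Q n (Suc n) * chi (Suc n) m) (x n * Y (Suc n)) (Y l)"
    "skew_comm (chi (Suc n) m * (Q n n * Q n (Suc n))) (Y (Suc n) * x n) (Y l)"
    by (rule skew_comm_mult_left; use c step in simp)+
  then have "skew_comm (chi n m) (x n * Y (Suc n) - Y (Suc n) * x n) (Y l)"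
    using step by (intro skew_comm_diff_left) (simp_all add: chi_step mult.commute)
  then show ?case using step by (simp add: Y_step)
qed

section \<open>Powers of root vectors and the product over a fixed last letter\<close>

lemma chr_chi: "1 \<le> l \<Longrightarrow> l \<le> m \<Longrightarrow> chr l (deg m l) * (if l < m then chi (Suc l) m else 1) = chi l m"
  using m by (subst chr_deg) (auto simp: chi_step)

lemma Y'_Y: "1 \<le> l \<Longrightarrow> l \<le> m \<Longrightarrow> skew_comm (if l < m then chi (Suc l) m else 1) (Y' l) (Y l)"
  using Y_Y[of "Suc l" l] by (auto simp: Y'_def skew_comm_one)

lemma chr_power: "wscale (chr i) (Y l ^ a) = pm_scale (chr i (deg m l) ^ a) (Y l ^ a)" if "l \<le> m"
proof -
  have "chr i (repeat_mset a M) = chr i M ^ a" for M by (induction a) simp_all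
  then show ?thesis by (simp add: wscale_has_degree[OF has_degree_power[OF Y_degree[OF that]]])
qed

text \<open>Differentiating one factor leaves \<open>Y'\<close>, which is moved to the right end.
  For each factor passed, the Leibniz twist and the commutation scalar combine to
  \<open>chi l m\<close>, so the coefficients form a geometric progression and sum to a
  q-integer.\<close>

lemma rder_Y_power:
  assumes l: "1 \<le> l" "l \<le> m"
  shows "rder l (Y l ^ Suc a) \<doteq> pm_scale (kap l * qint (Suc a) (chi l m)) (Y l ^ a * Y' l)"
proof (induction a)
  case 0
  then show ?case using rder_Y[of l l] l m by (simp add: qint_def)
next
  case (Suc a)
  let ?p = "chi l m" and ?q = "chr l (deg m l)" and ?p' = "if l < m then chi (Suc l) m else 1"
  have T: "Y l \<in> T" "Y' l \<in> T" "Y l ^ Suc a \<in> T" using l by (simp_all add: words_in_power del: power_Suc)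
  have c: "skew_comm (?p' ^ Suc a) (Y' l) (Y l ^ Suc a)"
    by (rule skew_comm_power_right[OF Y'_Y]) (use l in auto)
  have h1: "Y l * pm_scale A (Y l ^ a * Y' l) = pm_scale A (Y l ^ Suc a * Y' l)" for A
    by (simp only: pm_scale_mult_right power_Suc mult.assoc)
  have h2: "pm_scale A f * pm_scale B g = pm_scale (A * B) (f * g)" for A B and f g :: "nat list \<Rightarrow>\<^sub>0 'k"
    by (simp only: pm_scale_mult_left pm_scale_mult_right pm_scale_scale mult.commute)
  have "rder l (Y l ^ Suc (Suc a)) = Y l * rder l (Y l ^ Suc a) + rder l (Y l) * pm_scale (?q ^ Suc a) (Y l ^ Suc a)"
    using l by (subst power_Suc, subst rder_mult) (simp only: chr_power)
  also have "\<dots> \<doteq> Y l * pm_scale (kap l * qint (Suc a) ?p) (Y l ^ a * Y' l)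
      + pm_scale (kap l) (Y' l) * pm_scale (?q ^ Suc a) (Y l ^ Suc a)"
    using rder_Y[of l l] l m T by (intro eqv_add eqv_mult_left[OF Suc] eqv_mult_right) auto
  also have "\<dots> = pm_scale (kap l * qint (Suc a) ?p) (Y l ^ Suc a * Y' l) + pm_scale (kap l * ?q ^ Suc a) (Y' l * Y l ^ Suc a)"
    by (simp only: h1 h2)
  also have "\<dots> \<doteq> pm_scale (kap l * qint (Suc a) ?p) (Y l ^ Suc a * Y' l)
      + pm_scale (kap l * ?q ^ Suc a) (pm_scale (?p' ^ Suc a) (Y l ^ Suc a * Y' l))"
    using c unfolding skew_comm_def by (intro eqv_add eqv_scale) auto
  also have "\<dots> = pm_scale (kap l * qint (Suc a) ?p + kap l * (?q * ?p') ^ Suc a) (Y l ^ Suc a * Y' l)"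
    by (simp only: pm_scale_scale pm_scale_add_left power_mult_distrib mult.assoc)
  also have "kap l * qint (Suc a) ?p + kap l * (?q * ?p') ^ Suc a = kap l * qint (Suc (Suc a)) ?p"
    unfolding chr_chi[OF l] by (simp only: qint_Suc[of "Suc a"] distrib_left)
  finally show ?case .
qed

lemma rder_Y_power_other:
  assumes l: "1 \<le> l" "l \<le> m" and i: "i \<in> {1..r}" "i \<noteq> l"
  shows "rder i (Y l ^ a) \<in> rad"
proof (induction a)
  case (Suc a)
  have "rder i (Y l) \<in> rad" using rder_Y[of l i] l i by (simp add: eqv_zero_iff)
  then show ?case using Suc l by (simp add: rder_mult rad_mult_left rad_mult_right words_in_power)
qed simp

lemma lookup_Y: "l \<le> m \<Longrightarrow> Poly_Mapping.lookup (Y l) [] = 0"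
proof -
  assume l: "l \<le> m"
  have "[] \<notin> Poly_Mapping.keys (Y l)"
    using Y_degree[OF l] l by (auto simp: has_degree_def deg_def mset_set_empty_iff)
  then show ?thesis by (simp add: not_in_keys_iff_lookup_eq_zero)
qed

text \<open>At the exponent \<open>nn l m\<close> the q-integer in the derivative by
  \<open>l\<close> vanishes; the derivatives by other letters are in the radical for every
  exponent.\<close>

lemma Y_nilpotent:
  assumes l: "1 \<le> l" "l \<le> m" shows "Y l ^ nn l m \<in> rad"
proof (rule rad_rdersI)
  obtain a where a: "nn l m = Suc a" using nn_pos[of l m] l m by (cases "nn l m") auto
  show "Y l ^ nn l m \<in> T" using l by (simp add: words_in_power)
  show "Poly_Mapping.lookup (Y l ^ nn l m) [] = 0" using lookup_Y l by (simp add: a lookup_mult_Nil)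
  fix i assume i: "i \<in> {1..r}"
  show "rder i (Y l ^ nn l m) \<in> rad"
  proof (cases "i = l")
    case True
    have "rder l (Y l ^ nn l m) \<doteq> 0"
      using rder_Y_power[OF l, of a] nn_zero[of l m] l m unfolding a by simp
    then show ?thesis using True by (simp add: eqv_zero_iff)
  qed (use rder_Y_power_other l i in auto)
qed

text \<open>The part of the top element belonging to intervals that end in \<open>m\<close>, cut off
  at left endpoints up to \<open>l\<close>. The cut-off makes room for inductions that remove the
  last factor.\<close>

primrec ytop :: "nat \<Rightarrow> (nat list \<Rightarrow>\<^sub>0 'k)" where
  "ytop 0 = 1"
| "ytop (Suc l) = ytop l * Y (Suc l) ^ (nn (Suc l) m - 1)"

lemma ytop_T [simp]: "l \<le> m \<Longrightarrow> ytop l \<in> T"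
  by (induction l) (auto simp: words_in_power)

lemma ytop_words: "l \<le> m \<Longrightarrow> ytop l \<in> words_in {1..m}"
proof (induction l)
  case (Suc l)
  have "Y (Suc l) \<in> words_in {1..m}" by (rule words_in_mono[OF _ Y_words]) (use Suc in auto)
  then show ?case using Suc by (auto simp: words_in_power)
qed simp

lemma ytop_degree: "l \<le> m \<Longrightarrow> has_degree (\<Sum>j\<in>{1..l}. repeat_mset (nn j m - 1) (deg m j)) (ytop l)"
proof (induction l)
  case (Suc l)
  have "has_degree ((\<Sum>j\<in>{1..l}. repeat_mset (nn j m - 1) (deg m j)) + repeat_mset (nn (Suc l) m - 1) (deg m (Suc l))) (ytop (Suc l))"
    unfolding ytop.simps by (rule has_degree_mult) (use Suc in \<open>auto intro!: has_degree_power Y_degree\<close>)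
  then show ?case by (simp add: sum.cl_ivl_Suc)
qed simp

text \<open>\<open>Y j\<close> is moved left past the powers with larger left endpoint until it
  reaches its own power and completes it to the vanishing exponent.\<close>

lemma ytop_Y: "j \<le> l \<Longrightarrow> 1 \<le> j \<Longrightarrow> l \<le> m \<Longrightarrow> ytop l * Y j \<in> rad"
proof (induction l)
  case (Suc l)
  let ?a = "nn (Suc l) m - 1"
  show ?case
  proof (cases "j = Suc l")
    case True
    have "ytop (Suc l) * Y j = ytop l * Y j ^ nn j m"
      using nn_pos[of j m] True Suc m by (simp add: mult.assoc power_Suc2[symmetric] del: power_Suc)
    then show ?thesis using Y_nilpotent[of j] Suc by (simp add: rad_mult_left)
  next
    case False
    have T: "Y (Suc l) ^ ?a \<in> T" "Y j \<in> T" "ytop l \<in> T" using Suc by (simp_all add: words_in_power)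
    have "skew_comm (chi (Suc l) m ^ ?a) (Y (Suc l) ^ ?a) (Y j)"
      by (rule skew_comm_power_left[OF Y_Y]) (use Suc False in auto)
    then have "ytop l * (Y (Suc l) ^ ?a * Y j) \<doteq> ytop l * pm_scale (chi (Suc l) m ^ ?a) (Y j * Y (Suc l) ^ ?a)"
      unfolding skew_comm_def by (rule eqv_mult_left) (rule T(3))
    also have "\<dots> = pm_scale (chi (Suc l) m ^ ?a) ((ytop l * Y j) * Y (Suc l) ^ ?a)"
      by (simp only: pm_scale_mult_right mult.assoc)
    also have "\<dots> \<doteq> 0"
      unfolding eqv_zero_iff
      by (rule rad_simps(5), rule rad_mult_right[OF _ T(1)], rule Suc.IH) (use Suc.prems False in auto)
    finally show ?thesis by (simp add: eqv_zero_iff mult.assoc)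
  qed
qed simp

lemma rder_ytop: "l < i \<Longrightarrow> i \<in> {1..r} \<Longrightarrow> l \<le> m \<Longrightarrow> rder i (ytop l) \<in> rad"
proof (induction l)
  case (Suc l)
  have "rder i (Y (Suc l) ^ (nn (Suc l) m - 1)) \<in> rad" using rder_Y_power_other[of "Suc l" i] Suc by auto
  then show ?case using Suc by (simp add: rder_mult rad_mult_left rad_mult_right words_in_power)
qed simp

text \<open>Peeling off a right factor \<open>Y l\<close>: the derivations \<open>rder l, ..., rder m\<close> turn it successively
  into \<open>Y (l + 1), ..., Y m\<close> and finally into \<open>1\<close>.\<close>

lemma rad_peel:
  "l \<le> m \<Longrightarrow> 1 \<le> l \<Longrightarrow> g \<in> T \<Longrightarrow> (\<And>i. l \<le> i \<Longrightarrow> i \<le> m \<Longrightarrow> rder i g \<in> rad) \<Longrightarrow> g * Y l \<in> rad \<Longrightarrow> g \<in> rad"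
proof (induction l rule: inc_induct)
  case base
  have "rder m (g * Y m) \<in> rad" by (rule rad_rder[OF base(4)])
  moreover have "rder m (g * Y m) = g + pm_scale (Q m m) (rder m g * x m)"
    by (simp add: Y_top rder_mult_gen)
  moreover have "pm_scale (Q m m) (rder m g * x m) \<in> rad"
    using base m by (intro rad_simps(5) rad_mult_right) auto
  ultimately show ?case using rad_simps(3)[of "rder m (g * Y m)" "pm_scale (Q m m) (rder m g * x m)"] by simp
next
  case (step n)
  have T: "Y n \<in> T" "Y (Suc n) \<in> T" using step by auto
  have "rder n (g * Y n) \<in> rad" by (rule rad_rder[OF step(7)])
  moreover have "rder n (g * Y n) = g * rder n (Y n) + rder n g * wscale (chr n) (Y n)" by (rule rder_mult)
  moreover have "rder n g * wscale (chr n) (Y n) \<in> rad"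
    using step T by (intro rad_mult_right) auto
  ultimately have "g * rder n (Y n) \<in> rad"
    using rad_simps(3)[of "rder n (g * Y n)" "rder n g * wscale (chr n) (Y n)"] by simp
  moreover have "g * rder n (Y n) \<doteq> g * pm_scale (kap n) (Y (Suc n))"
    using rder_Y[of n n] step m by (intro eqv_mult_left) (auto simp: Y'_def)
  ultimately have "g * pm_scale (kap n) (Y (Suc n)) \<in> rad" using eqv_rad by blast
  then have "pm_scale (inverse (kap n)) (pm_scale (kap n) (g * Y (Suc n))) \<in> rad"
    unfolding pm_scale_mult_right by (rule rad_simps(5))
  then have "g * Y (Suc n) \<in> rad" using kap_nonzero[of n] step by simp
  then show ?case using step by auto
qed

text \<open>The exponent of the last root vector is raised one step at a time. If the next power
  landed in the radical, so would its derivative by the first letter, a nonzero multiple of the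
  previous product times \<open>Y'\<close>; and \<open>rad_peel\<close> removes
  \<open>Y'\<close>.\<close>

lemma ytop_not_rad: "l \<le> m \<Longrightarrow> ytop l \<notin> rad"
proof (induction l)
  case 0
  show ?case using rad_const[of 1] by (auto simp: lookup_one zero_list_def)
next
  case (Suc l)
  let ?l = "Suc l"
  have "ytop l * Y ?l ^ b \<notin> rad" if "b < nn ?l m" for b
    using that
  proof (induction b)
    case 0
    then show ?case using Suc by simp
  next
    case (Suc b)
    let ?g = "ytop l * Y ?l ^ b"
    have T: "ytop l \<in> T" "Y ?l ^ b \<in> T" "Y' ?l \<in> T" "?g \<in> T" "Y ?l ^ Suc b \<in> T"
      using \<open>Suc l \<le> m\<close> by (simp_all add: words_in_power del: power_Suc)
    show ?case
    proof
      assume "ytop l * Y ?l ^ Suc b \<in> rad"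
      then have "rder ?l (ytop l * Y ?l ^ Suc b) \<in> rad" by (rule rad_rder)
      moreover have "rder ?l (ytop l) * wscale (chr ?l) (Y ?l ^ Suc b) \<in> rad"
        using rder_ytop[of l ?l] \<open>Suc l \<le> m\<close> m T by (intro rad_mult_right) auto
      ultimately have "ytop l * rder ?l (Y ?l ^ Suc b) \<in> rad"
        using rad_simps(3)[of "rder ?l (ytop l * Y ?l ^ Suc b)" "rder ?l (ytop l) * wscale (chr ?l) (Y ?l ^ Suc b)"]
        by (simp add: rder_mult del: power_Suc)
      moreover have "ytop l * rder ?l (Y ?l ^ Suc b) \<doteq> ytop l * pm_scale (kap ?l * qint (Suc b) (chi ?l m)) (Y ?l ^ b * Y' ?l)"
        by (rule eqv_mult_left[OF rder_Y_power]) (use \<open>Suc l \<le> m\<close> T in auto)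
      ultimately have "pm_scale (kap ?l * qint (Suc b) (chi ?l m)) (?g * Y' ?l) \<in> rad"
        using eqv_rad by (simp add: pm_scale_mult_right mult.assoc)
      then have "pm_scale (inverse (kap ?l * qint (Suc b) (chi ?l m))) (pm_scale (kap ?l * qint (Suc b) (chi ?l m)) (?g * Y' ?l)) \<in> rad"
        by (rule rad_simps(5))
      \<comment> \<open>Minimality of \<open>nn\<close> enters here: below that exponent the
        q-integer is invertible.\<close>
      moreover have "kap ?l * qint (Suc b) (chi ?l m) \<noteq> 0"
        using kap_nonzero[of ?l] nn_minimal[of ?l m "Suc b"] \<open>Suc l \<le> m\<close> m Suc.prems by simp
      ultimately have g: "?g * Y' ?l \<in> rad" by (simp only: pm_scale_scale left_inverse pm_scale_simps simp_thms)
      have "?g \<in> rad"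
      proof (cases "?l < m")
        case True
        show ?thesis
        proof (rule rad_peel[of "Suc ?l"])
          fix i assume i: "Suc ?l \<le> i" "i \<le> m"
          have "rder i (ytop l) \<in> rad" "rder i (Y ?l ^ b) \<in> rad"
            using rder_ytop[of l i] rder_Y_power_other[of ?l i b] i True m by auto
          then show "rder i ?g \<in> rad" using T by (simp add: rder_mult rad_mult_left rad_mult_right)
        qed (use True T g in \<open>auto simp: Y'_def\<close>)
      next
        case False
        then show ?thesis using g by (simp add: Y'_def)
      qed
      then show False using Suc by simp
    qed
  qed
  then show ?case using nn_pos[of ?l m] Suc m by simp
qed

lemma lder_ytop: "1 \<le> i \<Longrightarrow> i < m \<Longrightarrow> l \<le> m \<Longrightarrow> lder i (ytop l) = 0"
proof (induction l)
  case (Suc l)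
  have "lder i (Y (Suc l) ^ a) = 0" for a
    using lder_Y[of "Suc l" i] Suc by (induction a) (simp_all add: lder_mult)
  then show ?case using Suc by (simp add: lder_mult)
qed simp

text \<open>A straightening rule: moving \<open>x i\<close> to the right past \<open>Y j\<close>
  costs a scalar, and only for \<open>j = Suc i\<close> an extra term, which by construction of the
  commutator is again a root vector with the same last letter.\<close>

lemma x_Y: "1 \<le> i \<Longrightarrow> i < m \<Longrightarrow> 1 \<le> j \<Longrightarrow> j \<le> m \<Longrightarrow> \<exists>c. x i * Y j \<doteq> pm_scale c (Y j * x i) + (if j = Suc i then Y i else 0)"
proof -
  assume a: "1 \<le> i" "i < m" "1 \<le> j" "j \<le> m"
  consider "i + 2 \<le> j" | "j = Suc i" | "i = j" | "j < i" by linarith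
  then show ?thesis
  proof cases
    case 1 then show ?thesis using x_comm_Y[of j i] a by (intro exI[of _ 1]) (simp add: skew_comm_def)
  next
    case 2 then show ?thesis using a by (intro exI[of _ 1]) (simp add: Y_step[of i])
  next
    case 3 then show ?thesis using x_Y_same[of i] a by (intro exI[of _ "1 / Q i i"]) (simp add: skew_comm_def)
  next
    case 4 then show ?thesis using x_Y_above[of i j] a by (auto simp: skew_comm_def)
  qed
qed

text \<open>Straightening moves the letters of \<open>w\<close> to the right of the root vector and
  creates only root vectors ending in \<open>m\<close>, all of which the full product annihilates
  from its right.\<close>

lemma ytop_word_Y: "set w \<subseteq> {1..<m} \<Longrightarrow> 1 \<le> j \<Longrightarrow> j \<le> m \<Longrightarrow> ytop m * wd w * Y j \<in> rad"
proof (induction w arbitrary: j rule: rev_induct)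
  case Nil
  then show ?case using ytop_Y[of j m] by simp
next
  case (snoc i w)
  have i: "1 \<le> i" "i < m" using snoc by auto
  obtain c where c: "x i * Y j \<doteq> pm_scale c (Y j * x i) + (if j = Suc i then Y i else 0)"
    using x_Y[OF i snoc.prems(2,3)] by blast
  have "set w \<subseteq> {1..r}" using snoc.prems(1) m by fastforce
  then have T: "ytop m * wd w \<in> T" by (intro words_in_simps(6,7) ytop_T) auto
  have r: "ytop m * wd w * Y j \<in> rad" "ytop m * wd w * Y i \<in> rad" using snoc i by auto
  have "wd (w @ [i]) = wd w * x i" by simp
  then have "ytop m * wd (w @ [i]) * Y j = ytop m * wd w * (x i * Y j)"
    by (simp only: mult.assoc)
  also have "\<dots> \<doteq> ytop m * wd w * (pm_scale c (Y j * x i) + (if j = Suc i then Y i else 0))"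
    by (rule eqv_mult_left[OF c T])
  also have "\<dots> = pm_scale c (ytop m * wd w * Y j * x i) + (if j = Suc i then ytop m * wd w * Y i else 0)"
    by (simp add: distrib_left pm_scale_mult_right mult.assoc)
  also have "\<dots> \<doteq> 0"
    unfolding eqv_zero_iff using r i m by (auto intro!: rad_simps rad_mult_right)
  finally show ?case by (simp add: eqv_zero_iff)
qed

end

declare ytop.simps [simp del]

end

section \<open>The top element\<close>

context type_A_braiding
begin

primrec topel :: "nat \<Rightarrow> (nat list \<Rightarrow>\<^sub>0 'k)" where
  "topel 0 = 1"
| "topel (Suc m) = ytop (Suc m) (Suc m) * topel m"

lemma topel_words: "m \<le> r \<Longrightarrow> topel m \<in> words_in {1..m}"
proof (induction m)
  case (Suc m)
  have "topel m \<in> words_in {1..Suc m}" by (rule words_in_mono[OF _ Suc.IH]) (use Suc in auto)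
  then show ?case using ytop_words[of "Suc m" "Suc m"] Suc by simp
qed simp

lemma topel_T: "m \<le> r \<Longrightarrow> topel m \<in> T"
  by (rule words_in_mono[OF _ topel_words]) auto

lemma topel_degree: "m \<le> r \<Longrightarrow> has_degree (\<Sum>k\<in>{1..m}. \<Sum>j\<in>{1..k}. repeat_mset (nn j k - 1) (deg k j)) (topel m)"
proof (induction m)
  case (Suc m)
  have "has_degree ((\<Sum>j\<in>{1..Suc m}. repeat_mset (nn j (Suc m) - 1) (deg (Suc m) j)) +
     (\<Sum>k\<in>{1..m}. \<Sum>j\<in>{1..k}. repeat_mset (nn j k - 1) (deg k j))) (topel (Suc m))"
    unfolding topel.simps by (rule has_degree_mult[OF ytop_degree]) (use Suc in auto)
  then show ?case by (simp add: sum.cl_ivl_Suc add.commute)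
qed simp

text \<open>Left derivations by letters up to \<open>m\<close> kill the new left factor exactly, so
  up to nonzero scalars they act on \<open>topel m\<close> alone. A chain reducing
  \<open>topel m\<close> to a nonzero constant therefore turns the product into a nonzero multiple
  of the left factor, which is not in the radical.\<close>

lemma topel_not_rad: "m \<le> r \<Longrightarrow> topel m \<notin> rad"
proof (induction m)
  case 0
  show ?case using rad_const[of 1] by (auto simp: lookup_one zero_list_def)
next
  case (Suc m)
  let ?K = "ytop (Suc m) (Suc m)"
  obtain d where d: "has_degree d ?K" by (rule that) (rule ytop_degree, use Suc in auto)
  have KT: "?K \<in> T" by (rule ytop_T) (use Suc in auto)
  have topT: "topel m \<in> T" using topel_T Suc by simp
  \<comment> \<open>Zero has every degree; only a word occurring in \<open>?K\<close> shows that the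
    letters of \<open>d\<close> are in range, which makes the scalars \<open>chl i d\<close>
    nonzero.\<close>
  have K0: "set_mset d \<subseteq> {1..r}" if "?K \<noteq> 0"
  proof -
    have "Poly_Mapping.keys ?K \<noteq> {}" using that by simp
    then obtain w where w: "w \<in> Poly_Mapping.keys ?K" by blast
    then have "mset w = d" using d unfolding has_degree_def by blast
    moreover have "set w \<subseteq> {1..r}" using w KT unfolding words_in_def lists_eq_set by blast
    ultimately show ?thesis by (metis set_mset_mset)
  qed
  have l: "\<exists>c. c \<noteq> 0 \<and> lders u (?K * f) = pm_scale c (?K * lders u f)" if "set u \<subseteq> {1..m}" "?K \<noteq> 0" for u f
    using that(1)
  proof (induction u arbitrary: f)
    case Nil
    then show ?case by (intro exI[of _ 1]) simp
  next
    case (Cons i u)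
    have "lder i ?K = 0" by (rule lder_ytop) (use Cons.prems Suc.prems in auto)
    then have "lder i (?K * f) = pm_scale (chl i d) (?K * lder i f)"
      by (simp add: lder_mult wscale_has_degree[OF d] pm_scale_mult_left)
    moreover obtain c where "c \<noteq> 0" "lders u (?K * lder i f) = pm_scale c (?K * lders u (lder i f))"
      using Cons.IH[of "lder i f"] Cons.prems by auto
    moreover have "chl i d \<noteq> 0" by (rule chl_nonzero(1)[OF nonzero _ K0[OF that(2)]]) (use Cons.prems Suc.prems in auto)
    ultimately show ?case by (intro exI[of _ "chl i d * c"]) (simp add: lders_linear)
  qed
  show ?case
  proof
    assume rad: "topel (Suc m) \<in> rad"
    obtain u where u: "Poly_Mapping.lookup (lders u (topel m)) [] \<noteq> 0"
      using Suc topT by (auto simp: rad_def)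
    then have k: "[] \<in> Poly_Mapping.keys (lders u (topel m))" unfolding in_keys_iff .
    obtain e where e: "has_degree e (topel m)" by (rule that) (rule topel_degree, use Suc in auto)
    obtain v where v: "v \<in> Poly_Mapping.keys (topel m)" "mset v = mset u" using keys_lders[OF k] by auto
    have "topel m \<in> words_in {1..m}" by (rule topel_words) (use Suc in simp)
    then have "set v \<subseteq> {1..m}" using v(1) unfolding words_in_def lists_eq_set by blast
    then have su: "set u \<subseteq> {1..m}" using v(2) by (metis set_mset_mset)
    have "e = mset u" using v e by (auto simp: has_degree_def)
    then have "lders u (topel m) = Poly_Mapping.single [] (Poly_Mapping.lookup (lders u (topel m)) [])"
      using has_degree_empty has_degree_lders[OF e, of u] by simp
    then obtain b where b: "b \<noteq> 0" "lders u (topel m) = Poly_Mapping.single [] b" using u by metis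
    have nr: "?K \<notin> rad" using ytop_not_rad[of "Suc m" "Suc m"] Suc by simp
    then have "?K \<noteq> 0" by auto
    from l[OF su this, of "topel m"] obtain c where c: "c \<noteq> 0" "lders u (topel (Suc m)) = pm_scale c (?K * lders u (topel m))"
      by auto
    have "lders u (topel (Suc m)) = pm_scale (c * b) ?K"
      unfolding c b(2) by (simp add: single_Nil_commute[symmetric] flip: pm_scale_eq_mult)
    then have "pm_scale (c * b) ?K \<in> rad" using rad_lders[OF rad, of u] by simp
    then have "pm_scale (inverse (c * b)) (pm_scale (c * b) ?K) \<in> rad" by (rule rad_simps(5))
    moreover have "inverse (c * b) * (c * b) = 1" by (rule left_inverse) (use b(1) c(1) in simp)
    ultimately show False using nr unfolding pm_scale_scale by (simp only: pm_scale_simps)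
  qed
qed

text \<open>Letters up to \<open>m\<close> are absorbed by the right factor \<open>topel m\<close>.
  The new letter is the root vector \<open>Y (Suc m)\<close> of length one and is absorbed by the
  left factor, across all words of \<open>topel m\<close>, by \<open>ytop_word_Y\<close>.\<close>

lemma topel_gen: "m \<le> r \<Longrightarrow> 1 \<le> i \<Longrightarrow> i \<le> m \<Longrightarrow> topel m * x i \<in> rad"
proof (induction m)
  case (Suc m)
  let ?K = "ytop (Suc m) (Suc m)"
  have KT: "?K \<in> T" by (rule ytop_T) (use Suc in auto)
  show ?case
  proof (cases "i = Suc m")
    case False
    then show ?thesis using Suc KT by (simp add: mult.assoc rad_mult_left)
  next
    case True
    have "?K * topel m * x i = pm_lift (\<lambda>w. ?K * wd w * x i) (topel m)"
      by (rule pm_linear_eq_pm_lift) (rule pm_linear_comp[OF pm_linear_mult_left pm_linear_mult_right])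
    also have "\<dots> \<in> rad"
    proof (rule rad_pm_lift)
      fix w assume "w \<in> Poly_Mapping.keys (topel m)"
      moreover have "topel m \<in> words_in {1..m}" by (rule topel_words) (use Suc in simp)
      ultimately have "set w \<subseteq> {1..m}" unfolding words_in_def lists_eq_set by blast
      then have "set w \<subseteq> {1..<Suc m}" by (simp add: atLeastLessThanSuc_atLeastAtMost)
      from ytop_word_Y[OF _ _ this, of "Suc m"] show "?K * wd w * x i \<in> rad"
        using Suc True Y_top[of "Suc m"] by simp
    qed
    finally show ?thesis by simp
  qed
qed simp

theorem topel_right_socle: "right_socle (topel r)" "topel r \<notin> rad"
  "has_degree (\<Sum>k\<in>{1..r}. \<Sum>j\<in>{1..k}. repeat_mset (nn j k - 1) (deg k j)) (topel r)"
  using topel_T[OF order.refl] topel_gen[OF order.refl] topel_not_rad[OF order.refl] topel_degree[OF order.refl]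
  by (simp_all add: right_socle_def del: inverse_mult_distrib)

end

section \<open>The bosonization as an algebra\<close>

locale bosonized = braiding Q r for Q :: "nat \<Rightarrow> nat \<Rightarrow> 'k::field" and r +
  fixes N :: nat
  assumes N_pos: "0 < N"
    and root_of_unity: "\<And>i j. i \<in> {1..r} \<Longrightarrow> j \<in> {1..r} \<Longrightarrow> Q i j ^ N = 1"
begin

lemma Q_nonzero: "i \<in> {1..r} \<Longrightarrow> j \<in> {1..r} \<Longrightarrow> Q i j \<noteq> 0"
  using root_of_unity[of i j] N_pos by (auto simp: power_0_left)

section \<open>The group of degrees and its characters\<close>

lemma Lam_carrier: "carrier (Lam N r) = {1..r} \<rightarrow>\<^sub>E {0..<int N}"
  using N_pos by (simp add: Lam_def carrier_integer_mod_group)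

lemma Lam_simps:
  "\<one>\<^bsub>Lam N r\<^esub> = (\<lambda>k\<in>{1..r}. 0)"
  "a \<otimes>\<^bsub>Lam N r\<^esub> b = (\<lambda>k\<in>{1..r}. (a k + b k) mod int N)"
  by (simp_all add: Lam_def)

lemma Lam_comm_group: "comm_group (Lam N r)"
proof -
  have "group (Lam N r)" by (simp add: Lam_def)
  then interpret group "Lam N r" .
  show ?thesis by unfold_locales (auto simp: Lam_simps add.commute)
qed

sublocale L: comm_group "Lam N r" by (rule Lam_comm_group)

abbreviation Lc :: "(nat \<Rightarrow> int) set" where "Lc \<equiv> carrier (Lam N r)"
abbreviation ladd (infixl "\<boxplus>" 65) where "a \<boxplus> b \<equiv> a \<otimes>\<^bsub>Lam N r\<^esub> b"
abbreviation lzero ("\<zero>\<^sub>L") where "\<zero>\<^sub>L \<equiv> \<one>\<^bsub>Lam N r\<^esub>"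
abbreviation lneg ("\<ominus>\<^sub>L _" [81] 80) where "\<ominus>\<^sub>L a \<equiv> inv\<^bsub>Lam N r\<^esub> a"
abbreviation dg where "dg \<equiv> word_degree N r"

lemma finite_Lc [simp, intro]: "finite Lc"
  by (simp add: Lam_carrier finite_PiE)

lemma dg_in [simp, intro]: "dg w \<in> Lc"
  using N_pos by (auto simp: Lam_carrier word_degree_def)

lemma dg_append [simp]: "dg (u @ v) = dg u \<boxplus> dg v"
  by (auto simp: word_degree_def Lam_simps mod_simps)

lemma dg_Nil [simp]: "dg [] = \<zero>\<^sub>L"
  by (auto simp: word_degree_def Lam_simps)

lemma dg_Cons: "NO_MATCH [] w \<Longrightarrow> dg (i # w) = dg [i] \<boxplus> dg w"
  using dg_append[of "[i]" w] by simp

lemma dg_mset: "mset u = mset v \<Longrightarrow> dg u = dg v"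
  by (auto simp: word_degree_def fun_eq_iff simp flip: count_mset)

text \<open>The reduced degree as a function of the multiset of letters, the form in which
  \<open>wscale\<close> can use it; \<open>gmm\<close> below does the same for characters.\<close>

definition dgm :: "nat multiset \<Rightarrow> nat \<Rightarrow> int" where
  "dgm M = (\<lambda>k\<in>{1..r}. int (count M k) mod int N)"

lemma dgm_mset [simp]: "dgm (mset w) = dg w"
  by (simp add: dgm_def word_degree_def fun_eq_iff count_mset)

abbreviation gm where "gm \<equiv> gamma_word Q r"

lemma gm_Nil [simp]: "gm [] a = 1"
  and gm_append [simp]: "gm (u @ v) a = gm u a * gm v a"
  by (simp_all add: gamma_word_def)

lemma gm_Cons: "NO_MATCH [] w \<Longrightarrow> gm (i # w) a = gm [i] a * gm w a"
  by (simp add: gamma_word_def)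

lemma power_mod_root: assumes "z ^ N = (1::'k)" shows "z ^ (m mod N) = z ^ m"
proof -
  have "z ^ m = z ^ (N * (m div N) + m mod N)" by simp
  also have "\<dots> = z ^ (m mod N)" unfolding power_add power_mult assms by simp
  finally show ?thesis by simp
qed

lemma gm_gen_add [simp]: assumes "i \<in> {1..r}" "a \<in> Lc" "b \<in> Lc"
  shows "gm [i] (a \<boxplus> b) = gm [i] a * gm [i] b"
proof -
  have "Q i k ^ nat ((a k + b k) mod int N) = Q i k ^ nat (a k) * Q i k ^ nat (b k)" if k: "k \<in> {1..r}" for k
  proof -
    have "0 \<le> a k" "0 \<le> b k" using assms k by (auto simp: Lam_carrier PiE_iff)
    then show ?thesis
      by (simp add: nat_mod_distrib nat_add_distrib power_mod_root[OF root_of_unity[OF assms(1) k]] power_add)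
  qed
  then show ?thesis by (simp add: gamma_word_def Lam_simps prod.distrib)
qed

lemma gm_one [simp]: "gm w \<zero>\<^sub>L = 1"
  by (induction w) (simp_all add: gamma_word_def Lam_simps)

text \<open>The bridge between group and braiding: the character of \<open>x i\<close> at the degree
  of a word is the braiding scalar. Reducing degrees modulo \<open>N\<close> is harmless because the
  entries of \<open>Q\<close> are \<open>N\<close>-th roots of unity.\<close>

lemma gm_gen_dg [simp]: assumes "i \<in> {1..r}" "set w \<subseteq> {1..r}" shows "gm [i] (dg w) = chr i (mset w)"
  using assms(2)
proof (induction w)
  case (Cons j w)
  have "Q i k ^ nat (int (count_list [j] k) mod int N) = (if k = j then Q i j else 1)" if k: "k \<in> {1..r}" for k
  proof -
    have "nat (int c mod int N) = c mod N" for c by (metis nat_int zmod_int)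
    then have "Q i k ^ nat (int (count_list [j] k) mod int N) = Q i k ^ count_list [j] k"
      using power_mod_root[OF root_of_unity[OF assms(1) k]] by metis
    then show ?thesis by simp
  qed
  then have "gm [i] (dg [j]) = Q i j"
    using Cons.prems by (simp add: gamma_word_def word_degree_def)
  then show ?case using Cons assms by (simp add: dg_Cons gm_gen_add del: gm_append)
qed simp

lemma gm_gen_inverse: "i \<in> {1..r} \<Longrightarrow> a \<in> Lc \<Longrightarrow> gm [i] a * gm [i] (\<ominus>\<^sub>L a) = 1"
  using gm_gen_add[of i a "\<ominus>\<^sub>L a"] by (simp del: gm_gen_add)

definition gmm :: "(nat \<Rightarrow> int) \<Rightarrow> nat multiset \<Rightarrow> 'k" where
  "gmm a M = (\<Prod>i\<in>#M. \<Prod>k\<in>{1..r}. Q i k ^ nat (a k))"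

lemma gmm_mset [simp]: "gmm a (mset w) = gm w a"
  by (simp add: gmm_def gamma_word_def flip: mset_map prod_mset_prod_list)

section \<open>The Nichols algebra through representatives\<close>

abbreviation "TA \<equiv> (tensor_alg r :: ('k, nat list \<Rightarrow>\<^sub>0 'k) module)"
abbreviation "B \<equiv> nichols_algebra Q r"

sublocale I: kalg_ideal "tensor_alg r :: ('k, nat list \<Rightarrow>\<^sub>0 'k) module" rad
  using tensor_alg_kalg rad_ideal by (simp add: kalg_ideal_def)

definition cl :: "(nat list \<Rightarrow>\<^sub>0 'k) \<Rightarrow> (nat list \<Rightarrow>\<^sub>0 'k) set" where "cl f = rad +>\<^bsub>TA\<^esub> f"

lemma B_eq: "B = quotient_algebra TA rad"
  by (simp add: nichols_algebra_def nichols_ideal_eq_rad)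

sublocale B: kalg "nichols_algebra Q r" unfolding B_eq by (rule I.quotient_kalg)

lemma TA_minus: "f \<in> T \<Longrightarrow> g \<in> T \<Longrightarrow> f \<ominus>\<^bsub>TA\<^esub> g = f - g"
proof -
  assume fg: "f \<in> T" "g \<in> T"
  have "\<ominus>\<^bsub>TA\<^esub> g = - g" by (rule I.minus_equality) (use fg in simp_all)
  then show ?thesis by (simp add: a_minus_def)
qed

lemma cl_eq_iff: "f \<in> T \<Longrightarrow> g \<in> T \<Longrightarrow> cl f = cl g \<longleftrightarrow> f \<doteq> g"
  using I.coset_eq_iff[of f g] by (simp add: cl_def TA_minus eqv_def)

lemma cl_cong: "f \<doteq> g \<Longrightarrow> f \<in> T \<Longrightarrow> g \<in> T \<Longrightarrow> cl f = cl g"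
  by (simp add: cl_eq_iff)

lemma B_simps:
  "carrier B = cl ` T" "f \<in> T \<Longrightarrow> cl f \<in> carrier B" "\<zero>\<^bsub>B\<^esub> = cl 0" "\<one>\<^bsub>B\<^esub> = cl 1"
  "f \<in> T \<Longrightarrow> g \<in> T \<Longrightarrow> cl f \<oplus>\<^bsub>B\<^esub> cl g = cl (f + g)"
  "f \<in> T \<Longrightarrow> g \<in> T \<Longrightarrow> cl f \<otimes>\<^bsub>B\<^esub> cl g = cl (f * g)"
  "f \<in> T \<Longrightarrow> c \<odot>\<^bsub>B\<^esub> cl f = cl (pm_scale c f)"
  "monomial Q r w = cl (wd w)"
  using I.coset_carrier I.coset_closed[of f] I.coset_zero I.coset_add[of f g] I.coset_mult[of f g] I.coset_smult[of f c]
  by (simp_all del: quotient_algebra_simps add: quotient_algebra_simps(3) B_eq cl_def monomial_def nichols_ideal_eq_rad)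

lemma rep_cl: "f \<in> T \<Longrightarrow> rep (cl f) \<in> T" "f \<in> T \<Longrightarrow> rep (cl f) \<doteq> f"
proof -
  assume f: "f \<in> T"
  have "f \<in> cl f" using I.mem_coset_iff[of f f] f by (simp add: cl_def TA_minus)
  then have "rep (cl f) \<in> cl f" unfolding rep_def by (rule someI)
  then show "rep (cl f) \<in> T" "rep (cl f) \<doteq> f"
    using I.mem_coset_iff[of f "rep (cl f)"] f by (auto simp: cl_def TA_minus eqv_def)
qed

section \<open>Products in the bosonization\<close>

abbreviation "H \<equiv> bosonization Q r N"

text \<open>The product on representatives: the component at \<open>j\<close> of
  \<open>fam f\<close> times \<open>fam g\<close> is \<open>act f j (g j)\<close>. Behind each word
  of the right factor only one component of the left factor survives, the one shifted by the degree
  of that word.\<close>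

definition act :: "((nat \<Rightarrow> int) \<Rightarrow> (nat list \<Rightarrow>\<^sub>0 'k)) \<Rightarrow> (nat \<Rightarrow> int) \<Rightarrow> (nat list \<Rightarrow>\<^sub>0 'k) \<Rightarrow> (nat list \<Rightarrow>\<^sub>0 'k)" where
  "act f j = pm_lift (\<lambda>w. f (j \<boxplus> dg w) * wd w)"

text \<open>Elements of the bosonization are written through representatives in the tensor algebra: \<open>fam f\<close>
  is \<open>\<Sum>\<^sub>j [f j] \<delta>\<^sub>j\<close>.\<close>

definition fam :: "((nat \<Rightarrow> int) \<Rightarrow> (nat list \<Rightarrow>\<^sub>0 'k)) \<Rightarrow> (nat \<Rightarrow> int) \<Rightarrow> (nat list \<Rightarrow>\<^sub>0 'k) set" where
  "fam f = (\<lambda>j\<in>Lc. cl (f j))"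

abbreviation Tfam where "Tfam f \<equiv> (\<forall>j\<in>Lc. f j \<in> T)"

lemma pm_linear_act: "pm_linear (act f j)" unfolding act_def by (rule pm_linear_pm_lift)
lemmas act_linear = pm_linearD[OF pm_linear_act]

lemma act_single [simp]: "act f j (wd w) = f (j \<boxplus> dg w) * wd w"
  by (simp add: act_def)

lemma act_in [simp]: "Tfam f \<Longrightarrow> j \<in> Lc \<Longrightarrow> h \<in> T \<Longrightarrow> act f j h \<in> T"
  unfolding act_def
proof (rule words_in_pm_lift)
  fix w assume a: "Tfam f" "j \<in> Lc" "h \<in> T" "w \<in> Poly_Mapping.keys h"
  then have "set w \<subseteq> {1..r}" unfolding words_in_def lists_eq_set by blast
  then show "f (j \<boxplus> dg w) * wd w \<in> T" using a by (intro words_in_simps(6,7)) auto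
qed

text \<open>Grouping the words of \<open>h\<close> by reduced degree turns the action into ordinary
  multiplications of homogeneous pieces. This shows that it respects the radical.\<close>

lemma act_eq_sum: assumes "j \<in> Lc"
  shows "act f j h = (\<Sum>c\<in>Lc. f (j \<boxplus> c) * wscale (\<lambda>M. if dgm M = c then 1 else 0) h)"
proof (rule pm_linear_eqI[OF pm_linear_act, where \<psi>="\<lambda>h. \<Sum>c\<in>Lc. f (j \<boxplus> c) * wscale (\<lambda>M. if dgm M = c then 1 else 0) h"])
  show "pm_linear (\<lambda>h. \<Sum>c\<in>Lc. f (j \<boxplus> c) * wscale (\<lambda>M. if dgm M = c then 1 else 0) h)"
    by (simp add: pm_linear_def wscale_linear distrib_left sum.distrib pm_scale_mult_right pm_scale_sum)
  fix w
  have "f (j \<boxplus> c) * wscale (\<lambda>M. if dgm M = c then 1 else 0) (wd w) = (if c = dg w then f (j \<boxplus> dg w) * wd w else 0)" for c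
    by auto
  then show "act f j (wd w) = (\<Sum>c\<in>Lc. f (j \<boxplus> c) * wscale (\<lambda>M. if dgm M = c then 1 else 0) (wd w))"
    by simp
qed

lemma act_rad: "Tfam f \<Longrightarrow> j \<in> Lc \<Longrightarrow> h \<in> rad \<Longrightarrow> act f j h \<in> rad"
  unfolding act_eq_sum by (intro rad_sum rad_mult_left rad_wscale) auto

lemma act_cong: "Tfam f \<Longrightarrow> j \<in> Lc \<Longrightarrow> h \<doteq> h' \<Longrightarrow> act f j h \<doteq> act f j h'"
  unfolding eqv_def by (simp add: act_rad flip: act_linear(4))

lemma act_assoc: assumes "j \<in> Lc" shows "act (\<lambda>j. act f j (g j)) j h = act f j (act g j h)"
proof (rule pm_linear_eqI[OF pm_linear_act pm_linear_comp[OF pm_linear_act pm_linear_act]])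
  fix w
  let ?k = "g (j \<boxplus> dg w)"
  have "act f (j \<boxplus> dg w) k * wd w = act f j (k * wd w)" for k
    by (rule pm_linear_eqI[OF pm_linear_comp[OF pm_linear_mult_left pm_linear_act] pm_linear_comp[OF pm_linear_act pm_linear_mult_left]])
       (use assms in \<open>simp add: L.m_ac mult.assoc\<close>)
  then show "act (\<lambda>j. act f j (g j)) j (wd w) = act f j (act g j (wd w))" by simp
qed

lemma H_eq: "carrier H = Lc \<rightarrow>\<^sub>E carrier B"
  "mult H = mult (bosonization_algebra Q r N)" "add H = add (bosonization_algebra Q r N)"
  "one H = one (bosonization_algebra Q r N)" "zero H = zero (bosonization_algebra Q r N)"
  "smult H = smult (bosonization_algebra Q r N)"
  by (simp_all add: bosonization_def bosonization_algebra_def Let_def module.extend_def)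

lemma fam_apply [simp]: "j \<in> Lc \<Longrightarrow> fam f j = cl (f j)" by (simp add: fam_def)

lemma fam_closed: "Tfam f \<Longrightarrow> fam f \<in> carrier H" by (auto simp: H_eq fam_def B_simps)

lemma fam_cases: assumes "F \<in> carrier H" obtains f where "Tfam f" "F = fam f"
proof
  have F: "F j \<in> cl ` T" if "j \<in> Lc" for j using assms that by (auto simp: H_eq B_simps(1) PiE_iff)
  show "Tfam (\<lambda>j. rep (F j))"
  proof
    fix j assume "j \<in> Lc"
    then obtain g where "g \<in> T" "F j = cl g" using F by blast
    then show "rep (F j) \<in> T" by (simp add: rep_cl)
  qed
  show "F = fam (\<lambda>j. rep (F j))"
  proof
    fix j
    show "F j = fam (\<lambda>j. rep (F j)) j"
    proof (cases "j \<in> Lc")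
      case True
      then obtain g where "g \<in> T" "F j = cl g" using F by blast
      then show ?thesis using True by (simp add: rep_cl cl_eq_iff eqv_sym)
    next
      case False
      then show ?thesis using assms by (auto simp: fam_def H_eq PiE_iff extensional_def)
    qed
  qed
qed

lemma fam_cong: "Tfam f \<Longrightarrow> Tfam g \<Longrightarrow> (\<And>j. j \<in> Lc \<Longrightarrow> f j \<doteq> g j) \<Longrightarrow> fam f = fam g"
  unfolding fam_def by (rule restrict_ext) (simp add: cl_eq_iff)

lemma fam_eqD: "fam f = fam g \<Longrightarrow> Tfam f \<Longrightarrow> Tfam g \<Longrightarrow> j \<in> Lc \<Longrightarrow> f j \<doteq> g j"
  by (metis fam_apply cl_eq_iff)

lemma fam_simps:
  "\<zero>\<^bsub>H\<^esub> = fam (\<lambda>_. 0)" "\<one>\<^bsub>H\<^esub> = fam (\<lambda>_. 1)"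
  "Tfam f \<Longrightarrow> Tfam g \<Longrightarrow> fam f \<oplus>\<^bsub>H\<^esub> fam g = fam (\<lambda>j. f j + g j)"
  "Tfam f \<Longrightarrow> c \<odot>\<^bsub>H\<^esub> fam f = fam (\<lambda>j. pm_scale c (f j))"
  by (auto simp: H_eq bosonization_algebra_def Let_def fam_def B_simps intro!: restrict_ext)

text \<open>The product of the record is computed from a chosen representative of the right factor;
  \<open>act_cong\<close> shows that any representative gives the same class.\<close>

lemma fam_mult: assumes f: "Tfam f" and g: "Tfam g"
  shows "fam f \<otimes>\<^bsub>H\<^esub> fam g = fam (\<lambda>j. act f j (g j))"
proof -
  have "lin_ext B (\<lambda>w. fam f (j \<boxplus> dg w) \<otimes>\<^bsub>B\<^esub> monomial Q r w) (rep (cl (g j))) = cl (act f j (g j))" if j: "j \<in> Lc" for j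
  proof -
    let ?h = "rep (cl (g j))"
    have hT: "?h \<in> T" and h: "?h \<doteq> g j" using rep_cl[of "g j"] g j by auto
    have wT: "wd w \<in> T" if "w \<in> Poly_Mapping.keys ?h" for w
      using hT that by (auto simp: words_in_def lists_eq_set)
    have fw: "f (j \<boxplus> dg w) * wd w \<in> words_in {1..r}" if "w \<in> Poly_Mapping.keys ?h" for w
      using f j wT[OF that] by simp
    have "cl \<in> lin_hom TA B" by (rule lin_homI) (simp_all add: B_simps)
    from lin_hom_lin_ext[OF tensor_alg_kalg B.kalg_axioms this, of ?h "\<lambda>w. f (j \<boxplus> dg w) * wd w"]
    have "cl (lin_ext TA (\<lambda>w. f (j \<boxplus> dg w) * wd w) ?h) = lin_ext B (\<lambda>w. cl (f (j \<boxplus> dg w) * wd w)) ?h"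
      using fw by simp
    also have "lin_ext TA (\<lambda>w. f (j \<boxplus> dg w) * wd w) ?h = act f j ?h"
      unfolding tensor_alg_def act_def using fw by (intro lin_ext_basis_algebra) (auto simp: words_in_def)
    also have "lin_ext B (\<lambda>w. cl (f (j \<boxplus> dg w) * wd w)) ?h = lin_ext B (\<lambda>w. fam f (j \<boxplus> dg w) \<otimes>\<^bsub>B\<^esub> monomial Q r w) ?h"
      by (rule B.lin_ext_cong) (use f j wT in \<open>auto simp: B_simps\<close>)
    finally show ?thesis using cl_cong[OF act_cong[OF f j h]] f g j hT by simp
  qed
  then show ?thesis
    unfolding fam_def[of "\<lambda>j. act f j (g j)"]
    by (simp add: H_eq bosonization_algebra_def Let_def lin_ext_def cong: restrict_cong)
qed

lemma H_kalg: "kalg H"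
proof
  note s = fam_simps fam_mult
  have "abelian_group H"
  proof (rule abelian_groupI)
    fix X assume "X \<in> carrier H"
    then obtain f where f: "Tfam f" "X = fam f" by (rule fam_cases)
    show "\<exists>Y\<in>carrier H. Y \<oplus>\<^bsub>H\<^esub> X = \<zero>\<^bsub>H\<^esub>"
      by (rule bexI[of _ "fam (\<lambda>j. - f j)"]) (use f in \<open>auto simp: s intro!: fam_closed\<close>)
  qed (auto elim!: fam_cases simp: s fam_closed ac_simps)
  moreover have "act (\<lambda>_. 1) j h = h" for j h by (simp add: act_def)
  moreover have "act f j 1 = f j" if "j \<in> Lc" for f j
    using act_single[of f j "[]"] that by simp
  moreover have "act (\<lambda>j. f j + g j) j h = act f j h + act g j h" for f g j h
    by (simp add: act_def distrib_right pm_lift_fun_add)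
  moreover have "act (\<lambda>j. pm_scale c (f j)) j h = pm_scale c (act f j h)" for f c j h
    by (simp add: act_def pm_scale_mult_left pm_lift_fun_scale)
  ultimately have *: "abelian_group H" "\<And>j h. act (\<lambda>_. 1) j h = h" "\<And>f j. j \<in> Lc \<Longrightarrow> act f j 1 = f j"
     "\<And>f g j h. act (\<lambda>j. f j + g j) j h = act f j h + act g j h"
     "\<And>c f j h. act (\<lambda>j. pm_scale c (f j)) j h = pm_scale c (act f j h)" by blast+
  note c = fam_cong[OF _ _ eqv_def[THEN iffD2]]
  have "ring H"
  proof (intro ringI monoidI)
    fix X Y Z assume XYZ: "X \<in> carrier H" "Y \<in> carrier H" "Z \<in> carrier H"
    obtain f where f: "Tfam f" "X = fam f" using XYZ(1) by (rule fam_cases)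
    obtain g where g: "Tfam g" "Y = fam g" using XYZ(2) by (rule fam_cases)
    obtain h where h: "Tfam h" "Z = fam h" using XYZ(3) by (rule fam_cases)
    show "X \<otimes>\<^bsub>H\<^esub> Y \<otimes>\<^bsub>H\<^esub> Z = X \<otimes>\<^bsub>H\<^esub> (Y \<otimes>\<^bsub>H\<^esub> Z)"
      using f g h by (auto simp: s act_assoc intro!: c)
    show "(X \<oplus>\<^bsub>H\<^esub> Y) \<otimes>\<^bsub>H\<^esub> Z = X \<otimes>\<^bsub>H\<^esub> Z \<oplus>\<^bsub>H\<^esub> Y \<otimes>\<^bsub>H\<^esub> Z"
      "Z \<otimes>\<^bsub>H\<^esub> (X \<oplus>\<^bsub>H\<^esub> Y) = Z \<otimes>\<^bsub>H\<^esub> X \<oplus>\<^bsub>H\<^esub> Z \<otimes>\<^bsub>H\<^esub> Y"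
      using f g h by (simp_all add: s *(4) act_linear)
  next
    fix X Y assume XY: "X \<in> carrier H" "Y \<in> carrier H"
    obtain f where f: "Tfam f" "X = fam f" using XY(1) by (rule fam_cases)
    obtain g where g: "Tfam g" "Y = fam g" using XY(2) by (rule fam_cases)
    show "X \<otimes>\<^bsub>H\<^esub> Y \<in> carrier H" using f g by (simp add: s fam_closed)
    show "\<one>\<^bsub>H\<^esub> \<otimes>\<^bsub>H\<^esub> X = X" "X \<otimes>\<^bsub>H\<^esub> \<one>\<^bsub>H\<^esub> = X" using f by (auto simp: s *(2,3) intro!: c)
  qed (auto simp: *(1) s fam_closed)
  then show "k_algebra H"
  proof (rule k_algebraI)
    fix X Y c d assume XY: "X \<in> carrier H" "Y \<in> carrier H"
    obtain f where f: "Tfam f" "X = fam f" using XY(1) by (rule fam_cases)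
    obtain g where g: "Tfam g" "Y = fam g" using XY(2) by (rule fam_cases)
    show "c \<odot>\<^bsub>H\<^esub> (X \<oplus>\<^bsub>H\<^esub> Y) = c \<odot>\<^bsub>H\<^esub> X \<oplus>\<^bsub>H\<^esub> c \<odot>\<^bsub>H\<^esub> Y"
      "(c \<odot>\<^bsub>H\<^esub> X) \<otimes>\<^bsub>H\<^esub> Y = c \<odot>\<^bsub>H\<^esub> (X \<otimes>\<^bsub>H\<^esub> Y)" "X \<otimes>\<^bsub>H\<^esub> (c \<odot>\<^bsub>H\<^esub> Y) = c \<odot>\<^bsub>H\<^esub> (X \<otimes>\<^bsub>H\<^esub> Y)"
      using f g by (simp_all add: s *(5) pm_scale_add act_linear)
  qed (auto elim!: fam_cases simp: s fam_closed pm_scale_add_left)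
qed

end

section \<open>The coproduct of the bosonization\<close>

text \<open>Transfers the evaluation of a linear map to formal combinations of a spanning family.
  The family may be linearly dependent: \<open>m\<close> is just one choice of expansion for each
  image.\<close>

lemma linear_lin_ext:
  assumes "kalg A" "kalg W" "f \<in> lin_hom A W" "\<And>s. s \<in> Poly_Mapping.keys X \<Longrightarrow> \<phi> s \<in> carrier A"
    and eq: "\<And>s. s \<in> Poly_Mapping.keys X \<Longrightarrow> f (\<phi> s) = lin_ext W \<chi> (m s)"
    and cl: "\<And>s p. s \<in> Poly_Mapping.keys X \<Longrightarrow> p \<in> Poly_Mapping.keys (m s) \<Longrightarrow> \<chi> p \<in> carrier W"
  shows "f (lin_ext A \<phi> X) = lin_ext W \<chi> (pm_lift m X)"
proof -
  interpret W: kalg W by fact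
  have "f (lin_ext A \<phi> X) = lin_ext W (\<lambda>s. f (\<phi> s)) X" by (rule lin_hom_lin_ext) fact+
  also have "\<dots> = lin_ext W (\<lambda>s. lin_ext W \<chi> (m s)) X"
    by (rule W.lin_ext_cong) (use eq cl in \<open>auto intro!: W.lin_ext_closed\<close>)
  also have "\<dots> = lin_ext W \<chi> (pm_lift m X)" by (rule W.lin_ext_pm_lift[symmetric]) (rule cl)
  finally show ?thesis .
qed

lemma bilinear_lin_ext:
  assumes A: "kalg A" and B: "kalg B" and W: "kalg W" and \<beta>: "bilinear A B W \<beta>"
    and \<phi>: "\<And>s. s \<in> Poly_Mapping.keys X \<Longrightarrow> \<phi> s \<in> carrier A"
    and \<psi>: "\<And>t. t \<in> Poly_Mapping.keys Y \<Longrightarrow> \<psi> t \<in> carrier B"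
    and eq: "\<And>s t. s \<in> Poly_Mapping.keys X \<Longrightarrow> t \<in> Poly_Mapping.keys Y \<Longrightarrow> \<beta> (\<phi> s) (\<psi> t) = lin_ext W \<chi> (m s t)"
    and cl: "\<And>s t p. s \<in> Poly_Mapping.keys X \<Longrightarrow> t \<in> Poly_Mapping.keys Y \<Longrightarrow> p \<in> Poly_Mapping.keys (m s t) \<Longrightarrow> \<chi> p \<in> carrier W"
  shows "\<beta> (lin_ext A \<phi> X) (lin_ext B \<psi> Y) = lin_ext W \<chi> (bilin_ext m X Y)"
  unfolding bilin_ext_eq_pm_lift
proof (rule linear_lin_ext[OF A W _ \<phi>])
  interpret B: kalg B by fact
  show "(\<lambda>a. \<beta> a (lin_ext B \<psi> Y)) \<in> lin_hom A W"
    using \<beta> \<psi> by (simp add: bilinear_def B.lin_ext_closed)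
  fix s assume s: "s \<in> Poly_Mapping.keys X"
  show "\<beta> (\<phi> s) (lin_ext B \<psi> Y) = lin_ext W \<chi> (pm_lift (m s) Y)"
    by (rule linear_lin_ext[OF B W]) (use \<beta> \<phi> \<psi> s eq cl in \<open>auto simp: bilinear_def\<close>)
  fix p assume "p \<in> Poly_Mapping.keys (pm_lift (m s) Y)"
  moreover have "Poly_Mapping.keys (pm_lift (m s) Y) \<subseteq> (\<Union>t\<in>Poly_Mapping.keys Y. Poly_Mapping.keys (m s t))"
    by (rule keys_pm_lift[OF order.refl]) auto
  ultimately show "\<chi> p \<in> carrier W" using cl s by auto
qed

context bosonized
begin

section \<open>A spanning family, and formal combinations of it\<close>

sublocale H: kalg "bosonization Q r N" by (rule H_kalg)
sublocale HH: tensor "bosonization Q r N" "bosonization Q r N" by unfold_locales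
sublocale HT: kalg "tensor_product (bosonization Q r N) (bosonization Q r N)" by (rule HH.TP_kalg)

definition W :: "(nat list \<times> (nat \<Rightarrow> int)) set" where "W = lists {1..r} \<times> Lc"

lemma W_iff [simp]: "(w, a) \<in> W \<longleftrightarrow> set w \<subseteq> {1..r} \<and> a \<in> Lc"
  by (auto simp: W_def lists_eq_set)

definition E :: "nat list \<times> (nat \<Rightarrow> int) \<Rightarrow> (nat \<Rightarrow> int) \<Rightarrow> (nat list \<Rightarrow>\<^sub>0 'k) set" where
  "E = (\<lambda>(w, a). fam (\<lambda>j. if j = a then wd w else 0))"

lemma E_closed [simp, intro]: "s \<in> W \<Longrightarrow> E s \<in> carrier H"
  unfolding E_def by (cases s) (auto intro!: fam_closed)

lemma times_delta_monomial: "times_delta Q r N (monomial Q r w) a = E (w, a)"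
  by (auto simp: times_delta_def E_def fam_def B_simps intro!: restrict_ext)

abbreviation EL where "EL \<equiv> lin_ext H E"

lemma fam_finsum: "finite S \<Longrightarrow> (\<And>s. s \<in> S \<Longrightarrow> Tfam (f s)) \<Longrightarrow> (\<Oplus>\<^bsub>H\<^esub>s\<in>S. fam (f s)) = fam (\<lambda>j. \<Sum>s\<in>S. f s j)"
proof (induction S rule: finite_induct)
  case (insert s S)
  have "(\<lambda>s. fam (f s)) \<in> S \<rightarrow> carrier H" "fam (f s) \<in> carrier H" using insert by (auto intro!: fam_closed)
  then show ?case using insert by (simp add: fam_simps words_in_sum)
qed (simp add: fam_simps)

lemma EL_eq: assumes "Poly_Mapping.keys X \<subseteq> W"
  shows "EL X = fam (\<lambda>j. pm_lift (\<lambda>(w, a). if j = a then wd w else 0) X)"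
proof -
  have w: "Tfam (\<lambda>j. if j = snd s then wd (fst s) else 0)" if "s \<in> Poly_Mapping.keys X" for s
    using assms that by (cases s) auto
  have "EL X = (\<Oplus>\<^bsub>H\<^esub>s\<in>Poly_Mapping.keys X. fam (\<lambda>j. pm_scale (Poly_Mapping.lookup X s) (if j = snd s then wd (fst s) else 0)))"
    unfolding lin_ext_def
    by (rule H.finsum_cong') (use w in \<open>auto simp: E_def split_def fam_simps simp del: pm_scale_single intro!: fam_closed\<close>)
  also have "\<dots> = fam (\<lambda>j. \<Sum>s\<in>Poly_Mapping.keys X. pm_scale (Poly_Mapping.lookup X s) (if j = snd s then wd (fst s) else 0))"
    by (rule fam_finsum) (use w in \<open>auto simp del: pm_scale_single\<close>)
  finally show ?thesis by (simp add: pm_lift_def split_def)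
qed

lemma EL_single [simp]: "s \<in> W \<Longrightarrow> EL (Poly_Mapping.single s c) = c \<odot>\<^bsub>H\<^esub> E s" by simp

lemma fam_eq_EL: assumes "Tfam f"
  shows "fam f = EL (\<Sum>a\<in>Lc. pm_lift (\<lambda>w. Poly_Mapping.single (w, a) 1) (f a))"
    and "Poly_Mapping.keys (\<Sum>a\<in>Lc. pm_lift (\<lambda>w. Poly_Mapping.single (w, a) (1::'k)) (f a)) \<subseteq> W"
proof -
  show k: "Poly_Mapping.keys (\<Sum>a\<in>Lc. pm_lift (\<lambda>w. Poly_Mapping.single (w, a) (1::'k)) (f a)) \<subseteq> W"
    by (rule keys_sum_subset, rule keys_pm_lift[of _ "lists {1..r}"])
       (use assms in \<open>auto simp: words_in_def lists_eq_set\<close>)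
  have "pm_lift (\<lambda>(w, a). if j = a then wd w else 0) (\<Sum>a\<in>Lc. pm_lift (\<lambda>w. Poly_Mapping.single (w, a) 1) (f a)) = f j"
    if j: "j \<in> Lc" for j
  proof -
    have "pm_lift (\<lambda>(w, a). if j = a then wd w else 0) (pm_lift (\<lambda>w. Poly_Mapping.single (w, a) 1) (f a)) = (if j = a then f j else 0)" for a
      unfolding pm_lift_pm_lift by auto
    then show ?thesis using j by (simp add: pm_lift_linear)
  qed
  then show "fam f = EL (\<Sum>a\<in>Lc. pm_lift (\<lambda>w. Poly_Mapping.single (w, a) 1) (f a))"
    unfolding EL_eq[OF k] fam_def by (intro restrict_ext) simp
qed

lemma H_cases: assumes "F \<in> carrier H" obtains X where "Poly_Mapping.keys X \<subseteq> W" "F = EL X"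
  using assms by (elim fam_cases) (use fam_eq_EL in blast)

lemma H_hom_eqI:
  assumes "kalg V" "f \<in> lin_hom H V" "g \<in> lin_hom H V" "F \<in> carrier H" "\<And>s. s \<in> W \<Longrightarrow> f (E s) = g (E s)"
  shows "f F = g F"
proof -
  interpret V: kalg V by fact
  obtain X where X: "Poly_Mapping.keys X \<subseteq> W" "F = EL X" using assms(4) by (rule H_cases)
  then have E: "p \<in> Poly_Mapping.keys X \<Longrightarrow> E p \<in> carrier H" for p by auto
  have "lin_ext V (\<lambda>p. f (E p)) X = lin_ext V (\<lambda>p. g (E p)) X"
    by (rule V.lin_ext_cong) (use X E assms in \<open>auto simp: lin_homD\<close>)
  then show ?thesis
    using lin_hom_lin_ext[OF H_kalg assms(1,2), of X E] lin_hom_lin_ext[OF H_kalg assms(1,3), of X E] X E by simp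
qed

definition mm :: "nat list \<times> (nat \<Rightarrow> int) \<Rightarrow> nat list \<times> (nat \<Rightarrow> int) \<Rightarrow> ((nat list \<times> (nat \<Rightarrow> int)) \<Rightarrow>\<^sub>0 'k)" where
  "mm s t = (if snd s = snd t \<boxplus> dg (fst t) then Poly_Mapping.single (fst s @ fst t, snd t) 1 else 0)"

lemma mm_simp: "mm (u, a) (v, b) = (if a = b \<boxplus> dg v then Poly_Mapping.single (u @ v, b) 1 else 0)"
  by (simp add: mm_def)

lemma keys_mm: "s \<in> W \<Longrightarrow> t \<in> W \<Longrightarrow> Poly_Mapping.keys (mm s t) \<subseteq> W"
  by (cases s; cases t) (auto simp: mm_simp)

lemma E_mult: assumes "s \<in> W" "t \<in> W" shows "E s \<otimes>\<^bsub>H\<^esub> E t = EL (mm s t)"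
proof -
  obtain u a v b where st: "s = (u, a)" "t = (v, b)" by (cases s; cases t)
  have "act (\<lambda>j. if j = a then wd u else 0) j (if j = b then wd v else 0) =
      (if a = b \<boxplus> dg v then (if j = b then wd (u @ v) else 0) else 0)" for j
    by (auto simp: act_linear)
  then have "E s \<otimes>\<^bsub>H\<^esub> E t = (if a = b \<boxplus> dg v then E (u @ v, b) else \<zero>\<^bsub>H\<^esub>)"
    using assms by (simp add: st E_def fam_mult fam_simps)
  then show ?thesis using assms by (auto simp: st mm_simp)
qed

abbreviation "TP \<equiv> tensor_product H H"
abbreviation "ptt \<equiv> pure_tensor H H"
abbreviation EE where "EE \<equiv> lin_ext TP (\<lambda>p. ptt (E (fst p)) (E (snd p)))"
abbreviation tn where "tn \<equiv> bilin_ext (\<lambda>s t. Poly_Mapping.single (s, t) 1)"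

lemma EE_closed: "Poly_Mapping.keys X \<subseteq> W \<times> W \<Longrightarrow> EE X \<in> carrier TP"
  by (rule HT.lin_ext_closed) auto

lemma EE_add: "Poly_Mapping.keys X \<subseteq> W \<times> W \<Longrightarrow> Poly_Mapping.keys Y \<subseteq> W \<times> W \<Longrightarrow> EE (X + Y) = EE X \<oplus>\<^bsub>TP\<^esub> EE Y"
  by (rule HT.lin_ext_add) auto

lemma EE_scale: "Poly_Mapping.keys X \<subseteq> W \<times> W \<Longrightarrow> EE (pm_scale c X) = c \<odot>\<^bsub>TP\<^esub> EE X"
  by (rule HT.lin_ext_scale) auto

lemma pt_EL: assumes "Poly_Mapping.keys X \<subseteq> W" "Poly_Mapping.keys Y \<subseteq> W"
  shows "ptt (EL X) (EL Y) = EE (tn X Y)"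
proof (rule bilinear_lin_ext[OF H_kalg H_kalg HH.TP_kalg HH.pt_is_bilinear])
  fix s t assume "s \<in> Poly_Mapping.keys X" "t \<in> Poly_Mapping.keys Y"
  then have st: "s \<in> W" "t \<in> W" using assms by blast+
  then show "ptt (E s) (E t) = EE (Poly_Mapping.single (s, t) 1)" by simp
  fix p assume "p \<in> Poly_Mapping.keys (Poly_Mapping.single (s, t) (1::'k))"
  then show "ptt (E (fst p)) (E (snd p)) \<in> carrier TP" using st by simp
qed (use assms in blast)+

definition mm2 where "mm2 p p' = tn (mm (fst p) (fst p')) (mm (snd p) (snd p'))"

lemma keys_mm2: "p \<in> W \<times> W \<Longrightarrow> p' \<in> W \<times> W \<Longrightarrow> Poly_Mapping.keys (mm2 p p') \<subseteq> W \<times> W"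
  unfolding mm2_def by (rule keys_bilin_ext[of _ W _ W]) (simp_all add: keys_mm mem_Times_iff)

lemma mult_bilinear: "kalg A \<Longrightarrow> bilinear A A A (mult A)"
proof (rule bilinearI)
  assume "kalg A"
  then interpret kalg A .
  show "b \<in> carrier A \<Longrightarrow> (\<lambda>a. a \<otimes>\<^bsub>A\<^esub> b) \<in> lin_hom A A" "b \<in> carrier A \<Longrightarrow> mult A b \<in> lin_hom A A" for b
    by (rule lin_homI; simp add: l_distr r_distr smult_mult_left smult_mult_right)+
qed

lemma EL_mult: assumes "Poly_Mapping.keys X \<subseteq> W" "Poly_Mapping.keys Y \<subseteq> W"
  shows "EL X \<otimes>\<^bsub>H\<^esub> EL Y = EL (bilin_ext mm X Y)"
  by (rule bilinear_lin_ext[OF H_kalg H_kalg H_kalg mult_bilinear[OF H_kalg]])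
     (use assms keys_mm in \<open>blast intro!: E_mult E_closed\<close>)+

lemma EE_mult: assumes "Poly_Mapping.keys X \<subseteq> W \<times> W" "Poly_Mapping.keys Y \<subseteq> W \<times> W"
  shows "EE X \<otimes>\<^bsub>TP\<^esub> EE Y = EE (bilin_ext mm2 X Y)"
proof (rule bilinear_lin_ext[OF HH.TP_kalg HH.TP_kalg HH.TP_kalg mult_bilinear[OF HH.TP_kalg]])
  fix p p' q assume p: "p \<in> Poly_Mapping.keys X" "p' \<in> Poly_Mapping.keys Y"
  then have W: "p \<in> W \<times> W" "p' \<in> W \<times> W" using assms by auto
  then show "ptt (E (fst p)) (E (snd p)) \<otimes>\<^bsub>TP\<^esub> ptt (E (fst p')) (E (snd p')) = EE (mm2 p p')"
    by (simp add: mm2_def HH.pt_mult E_mult pt_EL keys_mm mem_Times_iff)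
  show "q \<in> Poly_Mapping.keys (mm2 p p') \<Longrightarrow> ptt (E (fst q)) (E (snd q)) \<in> carrier TP"
    using subsetD[OF keys_mm2[OF W], of q] by (simp add: mem_Times_iff)
next
  show "ptt (E (fst p)) (E (snd p)) \<in> carrier TP" if "p \<in> Poly_Mapping.keys X" for p
    using subsetD[OF assms(1) that] by (simp add: mem_Times_iff)
  show "ptt (E (fst p)) (E (snd p)) \<in> carrier TP" if "p \<in> Poly_Mapping.keys Y" for p
    using subsetD[OF assms(2) that] by (simp add: mem_Times_iff)
qed

text \<open>Turns a braided coproduct into its summand at \<open>\<delta>\<close> of
  \<open>a\<close> and \<open>b\<close>; the scalar is the value at \<open>a\<close> of the
  character attached to the second leg.\<close>

definition lam :: "(nat \<Rightarrow> int) \<Rightarrow> (nat \<Rightarrow> int) \<Rightarrow> ((nat list \<times> nat list) \<Rightarrow>\<^sub>0 'k) \<Rightarrow> _" where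
  "lam a b = pm_lift (\<lambda>(u, v). Poly_Mapping.single ((u, a), (v, b)) (gm v a))"

lemma lam_linear: "pm_linear (lam a b)" unfolding lam_def by (rule pm_linear_pm_lift)

lemma keys_lam: "a \<in> Lc \<Longrightarrow> b \<in> Lc \<Longrightarrow> Poly_Mapping.keys Z \<subseteq> lists {1..r} \<times> lists {1..r} \<Longrightarrow> Poly_Mapping.keys (lam a b Z) \<subseteq> W \<times> W"
  unfolding lam_def by (rule keys_pm_lift) (auto simp: lists_eq_set split: if_splits)

text \<open>By the coideal property the coproduct of \<open>f\<close> is a combination of tensors
  with one leg in \<open>rad\<close>, and such a leg becomes zero in the bosonization.\<close>

lemma EE_lam_rad: assumes "f \<in> rad" "a \<in> Lc" "b \<in> Lc"
  shows "EE (lam a b (braided_comult Q f)) = \<zero>\<^bsub>TP\<^esub>"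
proof -
  have fz: "fam (\<lambda>j. if j = c then g else 0) = \<zero>\<^bsub>H\<^esub>" if "g \<in> rad" for g c
    unfolding fam_simps using that by (intro fam_cong) (auto simp: radD(1) eqv_zero_iff)
  have fe: "EL (pm_lift (\<lambda>w. Poly_Mapping.single (w, c) 1) g) = fam (\<lambda>j. if j = c then g else 0)"
    and fk: "Poly_Mapping.keys (pm_lift (\<lambda>w. Poly_Mapping.single (w, c) (1::'k)) g) \<subseteq> W" if "g \<in> T" "c \<in> Lc" for g c
  proof -
    show k: "Poly_Mapping.keys (pm_lift (\<lambda>w. Poly_Mapping.single (w, c) (1::'k)) g) \<subseteq> W"
      by (rule keys_pm_lift[of _ "lists {1..r}"]) (use that in \<open>auto simp: words_in_def lists_eq_set\<close>)
    have "(\<lambda>j. pm_lift (\<lambda>(w, a). if j = a then wd w else 0) (pm_lift (\<lambda>w. Poly_Mapping.single (w, c) 1) g)) = (\<lambda>j. if j = c then g else 0)"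
    proof
      fix j
      show "pm_lift (\<lambda>(w, a). if j = a then wd w else 0) (pm_lift (\<lambda>w. Poly_Mapping.single (w, c) 1) g) = (if j = c then g else 0)"
        by (cases "j = c") (simp_all add: pm_lift_pm_lift)
    qed
    then show "EL (pm_lift (\<lambda>w. Poly_Mapping.single (w, c) 1) g) = fam (\<lambda>j. if j = c then g else 0)"
      by (simp add: EL_eq[OF k])
  qed
  \<comment> \<open>The character scalar depends on the second leg only through its degree, so it
    acts as a \<open>wscale\<close> on that leg, and the radical is stable under this.\<close>
  have t: "lam a b (tens g h) = tn (pm_lift (\<lambda>w. Poly_Mapping.single (w, a) 1) g) (pm_lift (\<lambda>w. Poly_Mapping.single (w, b) 1) (wscale (gmm a) h))" for g h
    by (rule bilinear_eqI[where \<phi>="\<lambda>g h. lam a b (tens g h)" and \<psi>="\<lambda>g h. tn (pm_lift (\<lambda>w. Poly_Mapping.single (w, a) 1) g) (pm_lift (\<lambda>w. Poly_Mapping.single (w, b) 1) (wscale (gmm a) h))"])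
       (simp_all add: pm_linear_def bilin_ext_linear_left bilin_ext_linear_right pm_lift_linear wscale_linear pm_linearD[OF lam_linear], simp add: lam_def)
  have e: "EE (lam a b (tens g h)) = ptt (fam (\<lambda>j. if j = a then g else 0)) (fam (\<lambda>j. if j = b then wscale (gmm a) h else 0))"
    if "g \<in> T" "h \<in> T" for g h
    unfolding t using that assms by (simp add: pt_EL[symmetric] fk fe)
  have pz: "ptt \<zero>\<^bsub>H\<^esub> F = \<zero>\<^bsub>TP\<^esub>" "ptt F \<zero>\<^bsub>H\<^esub> = \<zero>\<^bsub>TP\<^esub>" if "F \<in> carrier H" for F
    by (rule lin_hom_zero[OF H_kalg HH.TP_kalg HH.pt_lin_left[OF that]], rule lin_hom_zero[OF H_kalg HH.TP_kalg HH.pt_lin_right[OF that]])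
  have fc: "fam (\<lambda>j. if j = c then g else 0) \<in> carrier H" if "g \<in> T" for g c using that by (auto intro!: fam_closed)
  have sub: "rad \<subseteq> T" using radD(1) by blast
  have bs: "carrier (braided_square Q r) = {f. Poly_Mapping.keys f \<subseteq> lists {1..r} \<times> lists {1..r}}"
     "add (braided_square Q r) = (+)" "smult (braided_square Q r) = pm_scale" "zero (braided_square Q r) = 0"
    by (simp_all add: braided_square_def)
  note ind = span_induct[OF basis_algebra_module[of "lists {1..r} \<times> lists {1..r}" "braided_mult_words Q" "([], [])", folded braided_square_def] rad_coideal[OF assms(1)] tens_span_closed[OF sub],
       where P="\<lambda>Z. EE (lam a b Z) = \<zero>\<^bsub>TP\<^esub>", unfolded bs]
  show ?thesis
  proof (rule ind)
    fix Z assume "Z \<in> {tens g h | g h. g \<in> rad \<and> h \<in> carrier (tensor_alg r)} \<union> {tens h g | g h. g \<in> rad \<and> h \<in> carrier (tensor_alg r)}"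
    then consider g h where "g \<in> rad" "h \<in> T" "Z = tens g h" | g h where "g \<in> rad" "h \<in> T" "Z = tens h g" by auto
    then show "EE (lam a b Z) = \<zero>\<^bsub>TP\<^esub>"
      by cases (simp_all add: e radD(1) fz rad_wscale pz fc)
  next
    fix Z Z' c assume "Z \<in> {f. Poly_Mapping.keys f \<subseteq> lists {1..r} \<times> lists {1..r}}"
      and Z: "EE (lam a b Z) = \<zero>\<^bsub>TP\<^esub>"
    then have k: "Poly_Mapping.keys (lam a b Z) \<subseteq> W \<times> W" using assms by (intro keys_lam) auto
    show "EE (lam a b (pm_scale c Z)) = \<zero>\<^bsub>TP\<^esub>"
      using k Z by (simp add: pm_linearD[OF lam_linear] EE_scale)
    assume "Z' \<in> {f. Poly_Mapping.keys f \<subseteq> lists {1..r} \<times> lists {1..r}}"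
      and Z': "EE (lam a b Z') = \<zero>\<^bsub>TP\<^esub>"
    then have k': "Poly_Mapping.keys (lam a b Z') \<subseteq> W \<times> W" using assms by (intro keys_lam) auto
    show "EE (lam a b (Z + Z')) = \<zero>\<^bsub>TP\<^esub>"
      using k k' Z Z' by (simp add: pm_linearD[OF lam_linear] EE_add)
  qed (simp add: pm_linearD[OF lam_linear])
qed

text \<open>The coproduct, product and antipode are computed on formal combinations of the spanning set
  \<open>E (w, a) = [w] \<delta>\<^sub>a\<close>, where \<open>mm\<close> is the product, \<open>cw\<close> the coproduct and \<open>sS\<close> the antipode.\<close>

definition cof :: "((nat \<Rightarrow> int) \<Rightarrow> (nat list \<Rightarrow>\<^sub>0 'k)) \<Rightarrow> _" where
  "cof f = (\<Sum>a\<in>Lc. \<Sum>b\<in>Lc. lam a b (braided_comult Q (f (a \<boxplus> b))))"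

lemma keys_cof: "Tfam f \<Longrightarrow> Poly_Mapping.keys (cof f) \<subseteq> W \<times> W"
  unfolding cof_def by (intro keys_sum_subset keys_lam keys_braided_comult) auto

lemma cof_linear: "cof (\<lambda>j. f j + g j) = cof f + cof g" "cof (\<lambda>j. pm_scale c (f j)) = pm_scale c (cof f)"
  "cof (\<lambda>j. f j - g j) = cof f - cof g"
  by (simp_all add: cof_def braided_comult_eq pm_lift_linear pm_linearD[OF lam_linear] sum.distrib sum_subtractf pm_scale_sum)

lemma EE_sum: "(\<And>i. i \<in> I \<Longrightarrow> Poly_Mapping.keys (X i) \<subseteq> W \<times> W) \<Longrightarrow> EE (sum X I) = (\<Oplus>\<^bsub>TP\<^esub>i\<in>I. EE (X i))"
proof (rule HT.lin_ext_sum)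
  fix i p assume "\<And>i. i \<in> I \<Longrightarrow> Poly_Mapping.keys (X i) \<subseteq> W \<times> W" "i \<in> I" "p \<in> Poly_Mapping.keys (X i)"
  then have "p \<in> W \<times> W" by blast
  then show "ptt (E (fst p)) (E (snd p)) \<in> carrier TP" by (simp add: mem_Times_iff)
qed

text \<open>The coproduct in the record is computed from arbitrarily chosen representatives; this
  frees it from the choice.\<close>

lemma EE_cof_cong: assumes f: "Tfam f" and g: "Tfam g" and fg: "\<And>j. j \<in> Lc \<Longrightarrow> f j \<doteq> g j"
  shows "EE (cof f) = EE (cof g)"
proof -
  have d: "f j - g j \<in> rad" if "j \<in> Lc" for j using fg[OF that] by (simp add: eqv_def)
  have k: "Poly_Mapping.keys (lam a b (braided_comult Q (f (a \<boxplus> b) - g (a \<boxplus> b)))) \<subseteq> W \<times> W" if "a \<in> Lc" "b \<in> Lc" for a b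
    using f g that by (intro keys_lam keys_braided_comult) auto
  have z: "(\<Oplus>\<^bsub>TP\<^esub>a\<in>Lc. g a) = \<zero>\<^bsub>TP\<^esub>" if "\<And>a. a \<in> Lc \<Longrightarrow> g a = \<zero>\<^bsub>TP\<^esub>" for g
    by (rule HT.add.finprod_one_eqI[OF that])
  have "EE (cof (\<lambda>j. f j - g j)) = \<zero>\<^bsub>TP\<^esub>"
    unfolding cof_def
    by (subst EE_sum, intro keys_sum_subset k, assumption+, rule z, subst EE_sum, rule k, assumption+, rule z)
       (simp add: EE_lam_rad d)
  moreover have "EE (cof g + cof (\<lambda>j. f j - g j)) = EE (cof g) \<oplus>\<^bsub>TP\<^esub> EE (cof (\<lambda>j. f j - g j))"
    using f g by (intro EE_add keys_cof) auto
  ultimately show ?thesis using EE_closed[OF keys_cof[OF g]] by (simp add: cof_linear)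
qed

lemma comult_fam: assumes f: "Tfam f" shows "comult H (fam f) = EE (cof f)"
proof -
  let ?f = "\<lambda>j. rep (fam f j)"
  have rT: "?f j \<in> T" "?f j \<doteq> f j" if "j \<in> Lc" for j using f that rep_cl[of "f j"] by auto
  let ?\<iota> = "\<lambda>p. Poly_Mapping.single (E (fst p), E (snd p)) 1 :: _ \<Rightarrow>\<^sub>0 'k"
  have k: "Poly_Mapping.keys (cof ?f) \<subseteq> W \<times> W" by (rule keys_cof) (use rT in auto)
  let ?A = "bosonization_algebra Q r N"
  \<comment> \<open>The coproduct is defined as a class over the bare algebra, while the Hopf axioms
    use the extended record. Both have the same operations, hence the same relations and
    classes.\<close>
  have c: "carrier ?A = carrier H" "mult ?A = mult H" "one ?A = one H" "add ?A = add H" "smult ?A = smult H"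
    by (simp_all add: H_eq bosonization_algebra_def Let_def)
  have tc: "tensor_class ?A ?A t = tensor_class H H t" for t
    by (simp add: tensor_class_def bilinearity_relations_def formal_sums_def c)
  have "comult H (fam f) = tensor_class ?A ?A (\<Sum>a\<in>Lc. \<Sum>b\<in>Lc.
      let D = braided_comult Q (rep (fam f (a \<boxplus> b))) in
              \<Sum>(u, v)\<in>Poly_Mapping.keys D.
                Poly_Mapping.single
                  (times_delta Q r N (monomial Q r u) a, times_delta Q r N (monomial Q r v) b)
                  (Poly_Mapping.lookup D (u, v) * gamma_word Q r v a))"
    by (simp only: bosonization_def Let_def module.extend_def coalg.fields_def coalg.simps)
  also have "\<dots> = tensor_class H H (pm_lift ?\<iota> (cof ?f))"
    unfolding tc cof_def pm_lift_linear lam_def pm_lift_pm_lift Let_def pm_lift_def[of _ "braided_comult _ _"]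
    by (simp add: split_def times_delta_monomial)
  also have "\<dots> = lin_ext TP (\<lambda>p. ptt (fst p) (snd p)) (pm_lift ?\<iota> (cof ?f))"
  proof (rule HH.tcl_lin_ext)
    have "Poly_Mapping.keys (pm_lift ?\<iota> (cof ?f)) \<subseteq> carrier H \<times> carrier H"
      by (rule keys_pm_lift[OF k]) (simp add: mem_Times_iff)
    then show "pm_lift ?\<iota> (cof ?f) \<in> carrier HH.FS" by simp
  qed
  also have "\<dots> = EE (cof ?f)"
  proof (rule linear_lin_ext[OF HH.TP_kalg HH.TP_kalg, where f="\<lambda>x. x" and \<phi>="\<lambda>p. ptt (E (fst p)) (E (snd p))" and X="cof ?f" and \<chi>="\<lambda>p. ptt (fst p) (snd p)" and m="?\<iota>", symmetric])
    fix p assume "p \<in> Poly_Mapping.keys (cof ?f)"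
    then have p: "p \<in> W \<times> W" using k by blast
    then show c: "ptt (E (fst p)) (E (snd p)) \<in> carrier TP" by (simp add: mem_Times_iff)
    then show "ptt (E (fst p)) (E (snd p)) = lin_ext TP (\<lambda>p. ptt (fst p) (snd p)) (?\<iota> p)" by simp
    fix q assume "q \<in> Poly_Mapping.keys (?\<iota> p)"
    then show "ptt (fst q) (snd q) \<in> carrier TP" using c by simp
  qed (rule lin_homI, simp_all)
  also have "\<dots> = EE (cof f)" by (rule EE_cof_cong) (use rT f in auto)
  finally show ?thesis .
qed

lemma comult_lin_hom: "comult H \<in> lin_hom H TP"
proof (rule lin_homI)
  fix F G c assume "F \<in> carrier H"
  then obtain f where f: "Tfam f" "F = fam f" by (rule fam_cases)
  show "comult H F \<in> carrier TP" using f by (simp add: comult_fam EE_closed keys_cof)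
  show "comult H (c \<odot>\<^bsub>H\<^esub> F) = c \<odot>\<^bsub>TP\<^esub> comult H F"
    using f by (simp add: comult_fam fam_simps cof_linear EE_scale keys_cof)
  assume "G \<in> carrier H"
  then obtain g where g: "Tfam g" "G = fam g" by (rule fam_cases)
  show "comult H (F \<oplus>\<^bsub>H\<^esub> G) = comult H F \<oplus>\<^bsub>TP\<^esub> comult H G"
    using f g by (simp add: comult_fam fam_simps cof_linear EE_add keys_cof)
qed

definition cw where
  "cw s = (\<Sum>a\<in>Lc. \<Sum>b\<in>Lc. if a \<boxplus> b = snd s then lam a b (word_comult Q (fst s)) else 0)"

lemma cof_E: "cof (\<lambda>j. if j = snd s then wd (fst s) else 0) = cw s"
  unfolding cof_def cw_def braided_comult_eq
  by (intro sum.cong refl) (auto simp: pm_linearD[OF lam_linear])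

lemma comult_E: "s \<in> W \<Longrightarrow> comult H (E s) = EE (cw s)"
proof -
  assume "s \<in> W"
  then have T: "Tfam (\<lambda>j. if j = snd s then wd (fst s) else 0)" by (cases s) auto
  have "E s = fam (\<lambda>j. if j = snd s then wd (fst s) else 0)" by (simp add: E_def split_def)
  then show ?thesis by (simp only: comult_fam[OF T] cof_E)
qed

lemma cw_keys: assumes "((u, a), (v, b)) \<in> Poly_Mapping.keys (cw (w, j))"
  shows "a \<in> Lc" "b \<in> Lc" "a \<boxplus> b = j" "mset w = mset u + mset v"
proof -
  let ?S = "{((u, a), (v, b)) | u a v b. a \<in> Lc \<and> b \<in> Lc \<and> a \<boxplus> b = j \<and> mset w = mset u + mset v}"
  have "Poly_Mapping.keys (lam a b (word_comult Q w)) \<subseteq> ?S" if "a \<in> Lc" "b \<in> Lc" "a \<boxplus> b = j" for a b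
    unfolding lam_def using that
    by (intro keys_pm_lift[OF order.refl]) (auto dest!: keys_word_comult split: if_splits)
  then have "Poly_Mapping.keys (cw (w, j)) \<subseteq> ?S"
    unfolding cw_def by (intro keys_sum_subset) simp
  with assms have "((u, a), (v, b)) \<in> ?S" by (rule subsetD[rotated])
  then show "a \<in> Lc" "b \<in> Lc" "a \<boxplus> b = j" "mset w = mset u + mset v" by auto
qed

lemma mset_split_set: "mset w = mset u + mset v \<Longrightarrow> set u \<union> set v = set w"
  by (metis set_mset_mset set_mset_union)

lemma keys_cw: "s \<in> W \<Longrightarrow> Poly_Mapping.keys (cw s) \<subseteq> W \<times> W"
proof
  fix p assume s: "s \<in> W" and p: "p \<in> Poly_Mapping.keys (cw s)"
  obtain u a v b w j where e: "p = ((u, a), (v, b))" "s = (w, j)" by (metis surj_pair)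
  note c = cw_keys[OF p[unfolded e]]
  show "p \<in> W \<times> W" using mset_split_set[OF c(4)] s c by (auto simp: e)
qed

section \<open>Multiplicativity of the coproduct\<close>

lemma double_delta: assumes "a0 \<in> Lc" "b0 \<in> Lc"
  shows "(\<Sum>a\<in>Lc. \<Sum>b\<in>Lc. if a \<boxplus> b = j then (if a = a0 \<and> b = b0 then F a b else 0) else 0)
     = (if a0 \<boxplus> b0 = j then F a0 b0 else (0 :: 'x::comm_monoid_add))"
proof -
  have "(\<Sum>a\<in>Lc. \<Sum>b\<in>Lc. if a \<boxplus> b = j then (if a = a0 \<and> b = b0 then F a b else 0) else 0)
    = (\<Sum>a\<in>Lc. if a = a0 then (\<Sum>b\<in>Lc. if b = b0 then (if a0 \<boxplus> b0 = j then F a0 b0 else 0) else 0) else 0)"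
    by (intro sum.cong refl) (auto intro!: sum.cong sum.neutral)
  then show ?thesis using assms by simp
qed

lemma cw_Nil: "cw ([], j) = (\<Sum>a\<in>Lc. \<Sum>b\<in>Lc. if a \<boxplus> b = j then Poly_Mapping.single (([], a), ([], b)) 1 else 0)"
  unfolding cw_def lam_def by (intro sum.cong refl) simp

lemma cw_gen: "cw ([i], j) = (\<Sum>a\<in>Lc. \<Sum>b\<in>Lc. if a \<boxplus> b = j then
    Poly_Mapping.single (([i], a), ([], b)) 1 + Poly_Mapping.single (([], a), ([i], b)) (gm [i] a) else 0)"
  unfolding cw_def lam_def fst_conv word_comult_Cons by (intro sum.cong refl) (simp add: pm_lift_linear)

lemma mm2_simp: "mm2 ((u, a), (v, b)) ((u', a'), (v', b')) =
   (if a = a' \<boxplus> dg u' \<and> b = b' \<boxplus> dg v' then Poly_Mapping.single ((u @ u', a'), (v @ v', b')) 1 else 0)"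
  by (simp add: mm2_def mm_simp bilin_ext_linear_left bilin_ext_linear_right)

lemma cw_mult_Nil: assumes "c \<in> Lc" "b \<in> Lc"
  shows "bilin_ext mm2 (cw ([], j)) (Poly_Mapping.single ((u, c), (v, b)) 1)
    = (if (c \<boxplus> dg u) \<boxplus> (b \<boxplus> dg v) = j then Poly_Mapping.single ((u, c), (v, b)) 1 else 0)"
proof -
  have "bilin_ext mm2 (cw ([], j)) (Poly_Mapping.single ((u, c), (v, b)) 1) =
    (\<Sum>a'\<in>Lc. \<Sum>b'\<in>Lc. if a' \<boxplus> b' = j then (if a' = c \<boxplus> dg u \<and> b' = b \<boxplus> dg v then
       Poly_Mapping.single ((u, c), (v, b)) 1 else 0) else 0)"
    unfolding cw_Nil bilin_ext_linear_left by (intro sum.cong refl) (simp add: mm2_simp bilin_ext_linear_left)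
  then show ?thesis using assms by (simp add: double_delta)
qed

text \<open>Left multiplication of a pair by the coproduct of \<open>x i\<close>. The character has
  to pass the word of the first leg, so it is evaluated at the index of that leg shifted by the
  degree of the word.\<close>

definition wop where
  "wop i p = Poly_Mapping.single ((i # fst (fst p), snd (fst p)), snd p) 1 +
     Poly_Mapping.single (fst p, (i # fst (snd p), snd (snd p))) (gm [i] (snd (fst p) \<boxplus> dg (fst (fst p))))"

lemma cw_mult_gen: assumes "c \<in> Lc" "b \<in> Lc"
  shows "bilin_ext mm2 (cw ([i], j)) (Poly_Mapping.single ((u, c), (v, b)) 1)
    = (if (c \<boxplus> dg u) \<boxplus> (b \<boxplus> dg v) = j then wop i ((u, c), (v, b)) else 0)"
proof -
  have "bilin_ext mm2 (cw ([i], j)) (Poly_Mapping.single ((u, c), (v, b)) 1) =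
    (\<Sum>a'\<in>Lc. \<Sum>b'\<in>Lc. if a' \<boxplus> b' = j then (if a' = c \<boxplus> dg u \<and> b' = b \<boxplus> dg v then
       wop i ((u, c), (v, b)) else 0) else 0)"
    unfolding cw_gen bilin_ext_linear_left
    by (intro sum.cong refl) (auto simp: mm2_simp bilin_ext_linear_left wop_def)
  then show ?thesis using assms by (simp add: double_delta)
qed

lemma cw_Cons: assumes "i \<in> {1..r}" "set w \<subseteq> {1..r}"
  shows "cw (i # w, j) = pm_lift (wop i) (cw (w, j))"
proof -
  have "lam a b (word_comult Q (i # w)) = pm_lift (wop i) (lam a b (word_comult Q w))" if "a \<in> Lc" "b \<in> Lc" for a b
    unfolding word_comult_Cons lam_def pm_lift_linear pm_lift_pm_lift pm_lift_fun_add[symmetric]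
  proof (rule pm_lift_cong)
    fix p assume p: "p \<in> Poly_Mapping.keys (word_comult Q w)"
    obtain u v where uv: "p = (u, v)" by (cases p)
    have "set u \<subseteq> {1..r}" using keys_word_comult[OF p[unfolded uv]] mset_split_set assms(2) by blast
    then show "pm_lift (\<lambda>(u, v). Poly_Mapping.single ((u, a), (v, b)) (gm v a)) (case p of (u, v) \<Rightarrow> Poly_Mapping.single (i # u, v) 1) +
        pm_lift (\<lambda>(u, v). Poly_Mapping.single ((u, a), (v, b)) (gm v a)) (case p of (u, v) \<Rightarrow> Poly_Mapping.single (u, i # v) (chr i (mset u))) =
        pm_lift (wop i) (case p of (u, v) \<Rightarrow> Poly_Mapping.single ((u, a), (v, b)) (gm v a))"
      using assms that by (simp add: uv wop_def pm_scale_add gm_Cons[of v] ac_simps)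
  qed
  then show ?thesis
    unfolding cw_def pm_lift_linear by (intro sum.cong refl) simp
qed

text \<open>Only a word of length at most one is needed on the left, by induction over generators;
  there the recursive definition of \<open>word_comult\<close> is itself the claim, apart from the
  matching of indices.\<close>

lemma cw_mult: assumes x: "set g \<subseteq> {1..r}" "length g \<le> 1" "a \<in> Lc" and y: "y \<in> W"
  shows "pm_lift cw (mm (g, a) y) = bilin_ext mm2 (cw (g, a)) (cw y)"
proof -
  obtain w j where y': "y = (w, j)" by (cases y)
  have wj: "set w \<subseteq> {1..r}" "j \<in> Lc" using y by (auto simp: y')
  let ?op = "case g of [] \<Rightarrow> (\<lambda>p. Poly_Mapping.single p 1) | i # _ \<Rightarrow> wop i"
  have "bilin_ext mm2 (cw (g, a)) (cw y) = pm_lift (\<lambda>p. bilin_ext mm2 (cw (g, a)) (Poly_Mapping.single p 1)) (cw y)"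
    by (rule pm_linear_eq_pm_lift[OF pm_linear_bilin_ext_right])
  also have "\<dots> = pm_lift (\<lambda>p. if a = j \<boxplus> dg w then ?op p else 0) (cw y)"
  proof (rule pm_lift_cong)
    fix p assume p: "p \<in> Poly_Mapping.keys (cw y)"
    obtain u c v b where e: "p = ((u, c), (v, b))" by (metis surj_pair)
    note c = cw_keys[OF p[unfolded e y']]
    \<comment> \<open>Every term in the coproduct of \<open>y\<close> has the same total degree, so
      whether the generator meets it depends on \<open>y\<close> alone.\<close>
    have "(c \<boxplus> dg u) \<boxplus> (b \<boxplus> dg v) = (c \<boxplus> b) \<boxplus> (dg u \<boxplus> dg v)" using c(1,2) by (simp add: L.m_ac)
    also have "dg u \<boxplus> dg v = dg w" using dg_mset[of w "u @ v"] c by simp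
    finally have d: "(c \<boxplus> dg u) \<boxplus> (b \<boxplus> dg v) = j \<boxplus> dg w" using c by simp
    show "bilin_ext mm2 (cw (g, a)) (Poly_Mapping.single p 1) = (if a = j \<boxplus> dg w then ?op p else 0)"
    proof (cases g)
      case Nil
      then show ?thesis using cw_mult_Nil[OF c(1,2), of a u v] by (auto simp: e d)
    next
      case (Cons i g')
      then have "g = [i]" using x by (simp add: One_nat_def)
      then show ?thesis using cw_mult_gen[OF c(1,2), of i a u v] by (auto simp: e d)
    qed
  qed
  also have "\<dots> = (if a = j \<boxplus> dg w then pm_lift ?op (cw y) else 0)" by simp
  also have "pm_lift ?op (cw y) = cw (g @ w, j)"
  proof (cases g)
    case (Cons i g')
    then have "g = [i]" using x by (simp add: One_nat_def)
    then show ?thesis using cw_Cons[of i w j] x wj by (simp add: y')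
  qed (simp add: y')
  finally show ?thesis by (simp add: y' mm_simp)
qed

text \<open>The elements \<open>\<delta>\<close> at \<open>a\<close> and \<open>x i\<close> times
  \<open>\<delta>\<close> at \<open>a\<close>, treated uniformly as words of length at most
  one.\<close>

definition gens where "gens = {E (w, a) | w a. set w \<subseteq> {1..r} \<and> length w \<le> 1 \<and> a \<in> Lc}"

lemma gens_closed: "gens \<subseteq> carrier H" by (auto simp: gens_def)

lemma gens_span: "carrier H \<subseteq> alg_span H gens"
proof -
  have "E (w, a) \<in> alg_span H gens" if "set w \<subseteq> {1..r}" "a \<in> Lc" for w a
    using that(1)
  proof (induction w)
    case Nil
    have "E ([], a) \<otimes>\<^bsub>H\<^esub> \<one>\<^bsub>H\<^esub> \<in> alg_span H gens"
      by (rule alg_span.mult[OF _ alg_span.one]) (use that in \<open>auto simp: gens_def intro!: exI[of _ "[]"]\<close>)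
    then show ?case using that by simp
  next
    case (Cons i w)
    \<comment> \<open>The index of the left factor is chosen so that it matches after passing
      \<open>w\<close>; any other index would give the product zero.\<close>
    have "E ([i], a \<boxplus> dg w) \<otimes>\<^bsub>H\<^esub> E (w, a) \<in> alg_span H gens"
      by (rule alg_span.mult) (use that Cons in \<open>auto simp: gens_def One_nat_def intro!: exI[of _ "[i]"]\<close>)
    then show ?case using that Cons by (simp add: E_mult mm_simp)
  qed
  then have e: "E s \<in> alg_span H gens" if "s \<in> W" for s using that by (cases s) auto
  have z: "\<zero>\<^bsub>H\<^esub> \<in> alg_span H gens" using alg_span.smult[OF alg_span.one[of H gens], of 0] by simp
  have fin: "(\<Oplus>\<^bsub>H\<^esub>s\<in>S. c s \<odot>\<^bsub>H\<^esub> E s) \<in> alg_span H gens" if "finite S" "S \<subseteq> W" for S and c :: "_ \<Rightarrow> 'k"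
    using that
  proof (induction S rule: finite_induct)
    case (insert s S)
    have "(\<Oplus>\<^bsub>H\<^esub>s\<in>insert s S. c s \<odot>\<^bsub>H\<^esub> E s) = c s \<odot>\<^bsub>H\<^esub> E s \<oplus>\<^bsub>H\<^esub> (\<Oplus>\<^bsub>H\<^esub>s\<in>S. c s \<odot>\<^bsub>H\<^esub> E s)"
      by (rule H.finsum_insert) (use insert in auto)
    moreover have "c s \<odot>\<^bsub>H\<^esub> E s \<in> alg_span H gens" using insert by (intro alg_span.smult e) simp
    ultimately show ?case using insert by (simp add: alg_span.add)
  qed (simp add: z)
  have X: "EL X \<in> alg_span H gens" if "Poly_Mapping.keys X \<subseteq> W" for X
    unfolding lin_ext_def by (rule fin[OF finite_keys that])
  show ?thesis
  proof (rule subsetI)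
    fix F assume "F \<in> carrier H"
    then obtain X where "Poly_Mapping.keys X \<subseteq> W" "F = EL X" by (rule H_cases)
    then show "F \<in> alg_span H gens" using X by simp
  qed
qed

lemma comult_mult_gen: assumes "g \<in> gens" "F \<in> carrier H"
  shows "comult H (g \<otimes>\<^bsub>H\<^esub> F) = comult H g \<otimes>\<^bsub>TP\<^esub> comult H F"
proof -
  obtain w a where g: "g = E (w, a)" "set w \<subseteq> {1..r}" "length w \<le> 1" "a \<in> Lc" using assms(1) by (auto simp: gens_def)
  have xc: "g \<in> carrier H" using g by simp
  have xW: "(w, a) \<in> W" using g by simp
  note m = mult_bilinear[unfolded bilinear_def]
  show ?thesis
  proof (rule H_hom_eqI[OF HH.TP_kalg _ _ assms(2), of "\<lambda>F. comult H (g \<otimes>\<^bsub>H\<^esub> F)" "\<lambda>F. comult H g \<otimes>\<^bsub>TP\<^esub> comult H F"])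
    show "(\<lambda>F. comult H (g \<otimes>\<^bsub>H\<^esub> F)) \<in> lin_hom H TP"
      by (rule lin_hom_comp[OF _ comult_lin_hom]) (use m[OF H_kalg] xc in blast)
    show "(\<lambda>F. comult H g \<otimes>\<^bsub>TP\<^esub> comult H F) \<in> lin_hom H TP"
      by (rule lin_hom_comp[OF comult_lin_hom]) (use m[OF HH.TP_kalg] lin_homD(1)[OF comult_lin_hom xc] in blast)
    fix s assume s: "s \<in> W"
    have "comult H (g \<otimes>\<^bsub>H\<^esub> E s) = comult H (EL (mm (w, a) s))" using s g xW by (simp add: E_mult)
    also have "\<dots> = EE (pm_lift cw (mm (w, a) s))"
    proof (rule linear_lin_ext[OF H_kalg HH.TP_kalg comult_lin_hom])
      fix p assume "p \<in> Poly_Mapping.keys (mm (w, a) s)"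
      then have p: "p \<in> W" using keys_mm[OF xW s] by blast
      then show "E p \<in> carrier H" "comult H (E p) = EE (cw p)" by (simp_all add: comult_E)
      fix q assume "q \<in> Poly_Mapping.keys (cw p)"
      then have "q \<in> W \<times> W" using keys_cw[OF p] by blast
      then show "ptt (E (fst q)) (E (snd q)) \<in> carrier TP" by (simp add: mem_Times_iff)
    qed
    also have "\<dots> = comult H g \<otimes>\<^bsub>TP\<^esub> comult H (E s)"
      using s g xW by (simp add: cw_mult comult_E EE_mult keys_cw)
    finally show "comult H (g \<otimes>\<^bsub>H\<^esub> E s) = comult H g \<otimes>\<^bsub>TP\<^esub> comult H (E s)" .
  qed
qed

lemma one_EL: "\<one>\<^bsub>H\<^esub> = EL (\<Sum>a\<in>Lc. Poly_Mapping.single ([], a) 1)"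
  using fam_eq_EL(1)[of "\<lambda>_. 1"] by (simp add: fam_simps flip: single_Nil_one)

lemma keys_one: "Poly_Mapping.keys (\<Sum>a\<in>Lc. Poly_Mapping.single ([] :: nat list, a) (1::'k)) \<subseteq> W"
  by (rule keys_sum_subset) auto

lemma comult_one: "comult H \<one>\<^bsub>H\<^esub> = \<one>\<^bsub>TP\<^esub>"
proof -
  have "comult H \<one>\<^bsub>H\<^esub> = EE (cof (\<lambda>_. 1))" by (simp add: fam_simps comult_fam)
  also have "cof (\<lambda>_. 1) = tn (\<Sum>a\<in>Lc. Poly_Mapping.single ([], a) 1) (\<Sum>a\<in>Lc. Poly_Mapping.single ([], a) 1)"
    unfolding cof_def bilin_ext_linear_left unfolding bilin_ext_linear_right
    by (simp add: braided_comult_eq lam_def flip: single_Nil_one)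
  also have "EE \<dots> = ptt \<one>\<^bsub>H\<^esub> \<one>\<^bsub>H\<^esub>" unfolding one_EL by (rule pt_EL[symmetric]; rule keys_one)
  finally show ?thesis by (simp add: HH.TP_one)
qed

lemma comult_alg_hom: "comult H \<in> alg_hom H TP"
proof (rule alg_homI)
  show "comult H \<in> lin_hom H TP" "comult H \<one>\<^bsub>H\<^esub> = \<one>\<^bsub>TP\<^esub>" by (rule comult_lin_hom, rule comult_one)
  fix F G assume F: "F \<in> carrier H" and G: "G \<in> carrier H"
  note D = lin_homD[OF comult_lin_hom]
  show "comult H (F \<otimes>\<^bsub>H\<^esub> G) = comult H F \<otimes>\<^bsub>TP\<^esub> comult H G"
    using F
  proof (induction rule: alg_span_induct[OF H_kalg gens_closed gens_span, consumes 1, case_names one add smult mult])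
    case (mult g u)
    then have "g \<in> carrier H" using gens_closed by auto
    then show ?case using mult G by (simp add: H.m_assoc comult_mult_gen HT.m_assoc D)
  qed (use G in \<open>simp_all add: comult_one D H.l_distr HT.l_distr H.smult_mult_left HT.smult_mult_left\<close>)
qed

end

section \<open>The bosonization is a Hopf algebra\<close>

context bosonized
begin

section \<open>The counit\<close>

lemma counit_fam: assumes "Tfam f" shows "counit H (fam f) = Poly_Mapping.lookup (f \<zero>\<^sub>L) []"
proof -
  have "f \<zero>\<^sub>L \<in> T" using assms by simp
  then have "rep (cl (f \<zero>\<^sub>L)) - f \<zero>\<^sub>L \<in> rad" using rep_cl(2) by (simp add: eqv_def)
  then have "Poly_Mapping.lookup (rep (cl (f \<zero>\<^sub>L))) [] = Poly_Mapping.lookup (f \<zero>\<^sub>L) []"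
    using rad_const by (force simp: lookup_minus)
  moreover have "counit H (fam f) = Poly_Mapping.lookup (rep (fam f \<zero>\<^sub>L)) []"
    by (simp only: bosonization_def Let_def module.extend_def coalg.fields_def coalg.simps)
  ultimately show ?thesis by simp
qed

lemma lookup_act_Nil: assumes "j \<in> Lc"
  shows "Poly_Mapping.lookup (act f j h) [] = Poly_Mapping.lookup (f j) [] * Poly_Mapping.lookup h []"
proof -
  have "Poly_Mapping.lookup (act f j h) [] = (\<Sum>w\<in>Poly_Mapping.keys h. if w = [] then Poly_Mapping.lookup h [] * Poly_Mapping.lookup (f j) [] else 0)"
    unfolding act_def lookup_pm_lift lookup_mult_Nil by (intro sum.cong refl) (use assms in \<open>auto simp: lookup_single when_def\<close>)
  then show ?thesis by (simp add: not_in_keys_iff_lookup_eq_zero mult.commute)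
qed

lemma counit_alg_hom: "counit H \<in> alg_hom H base_algebra"
proof (rule alg_homI, rule lin_homI)
  fix F c assume "F \<in> carrier H"
  then obtain f where f: "Tfam f" "F = fam f" by (rule fam_cases)
  then show "counit H (c \<odot>\<^bsub>H\<^esub> F) = c \<odot>\<^bsub>base_algebra\<^esub> counit H F"
    by (simp add: fam_simps counit_fam)
next
  fix F G assume FG: "F \<in> carrier H" "G \<in> carrier H"
  obtain f where f: "Tfam f" "F = fam f" using FG(1) by (rule fam_cases)
  obtain g where g: "Tfam g" "G = fam g" using FG(2) by (rule fam_cases)
  from f g show "counit H (F \<oplus>\<^bsub>H\<^esub> G) = counit H F \<oplus>\<^bsub>base_algebra\<^esub> counit H G"
    "counit H (F \<otimes>\<^bsub>H\<^esub> G) = counit H F \<otimes>\<^bsub>base_algebra\<^esub> counit H G"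
    by (simp_all add: fam_simps fam_mult counit_fam lookup_act_Nil lookup_add)
qed (simp_all add: fam_simps counit_fam lookup_one zero_list_def)

definition eps :: "nat list \<times> (nat \<Rightarrow> int) \<Rightarrow> 'k" where
  "eps s = (if fst s = [] \<and> snd s = \<zero>\<^sub>L then 1 else 0)"

lemma counit_E: "s \<in> W \<Longrightarrow> counit H (E s) = eps s"
proof -
  assume "s \<in> W"
  then have T: "Tfam (\<lambda>j. if j = snd s then wd (fst s) else 0)" by (cases s) auto
  have "E s = fam (\<lambda>j. if j = snd s then wd (fst s) else 0)" by (simp add: E_def split_def)
  then show ?thesis by (auto simp: counit_fam[OF T] eps_def lookup_single when_def lookup_one zero_list_def)
qed

lemma gens_cases [consumes 1, case_names unit gen]:
  assumes "g \<in> gens"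
  obtains j where "j \<in> Lc" "g = E ([], j)" | i j where "i \<in> {1..r}" "j \<in> Lc" "g = E ([i], j)"
proof -
  obtain w j where w: "g = E (w, j)" "set w \<subseteq> {1..r}" "length w \<le> 1" "j \<in> Lc" using assms by (auto simp: gens_def)
  show ?thesis
  proof (cases w)
    case (Cons i w')
    then have "w = [i]" using w by (simp add: One_nat_def)
    then show ?thesis using w that(2)[of i j] by simp
  qed (use w that in simp)
qed

lemma tensor_lift_EE:
  assumes \<beta>: "bilinear H H H \<beta>" and X: "Poly_Mapping.keys X \<subseteq> W \<times> W"
    and eq: "\<And>s t. s \<in> W \<Longrightarrow> t \<in> W \<Longrightarrow> \<beta> (E s) (E t) = EL (m s t)"
    and k: "\<And>s t. s \<in> W \<Longrightarrow> t \<in> W \<Longrightarrow> Poly_Mapping.keys (m s t) \<subseteq> W"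
  shows "tensor_lift H \<beta> (EE X) = EL (pm_lift (\<lambda>p. m (fst p) (snd p)) X)"
proof (rule linear_lin_ext[OF HH.TP_kalg H_kalg HH.tensor_lift_hom(1)[OF H_kalg \<beta>]])
  fix p assume "p \<in> Poly_Mapping.keys X"
  then have "p \<in> W \<times> W" using X by blast
  then have p: "fst p \<in> W" "snd p \<in> W" by (simp_all add: mem_Times_iff)
  then show "ptt (E (fst p)) (E (snd p)) \<in> carrier TP" by simp
  show "tensor_lift H \<beta> (ptt (E (fst p)) (E (snd p))) = EL (m (fst p) (snd p))"
    using p by (simp add: HH.tensor_lift_hom(2)[OF H_kalg \<beta>] eq)
  show "q \<in> Poly_Mapping.keys (m (fst p) (snd p)) \<Longrightarrow> E q \<in> carrier H" for q
    using k[OF p] by blast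
qed

lemma pm_lift_if: "pm_lift \<phi> (if P then X else 0) = (if P then pm_lift \<phi> X else 0)" by simp

lemma delta_left: assumes "j \<in> Lc"
  shows "(\<Sum>a\<in>Lc. \<Sum>b\<in>Lc. if a \<boxplus> b = j then (if a = \<zero>\<^sub>L then F b else 0) else 0) = (F j :: 'x::comm_monoid_add)"
proof -
  have "(\<Sum>a\<in>Lc. \<Sum>b\<in>Lc. if a \<boxplus> b = j then (if a = \<zero>\<^sub>L then F b else 0) else 0)
    = (\<Sum>a\<in>Lc. \<Sum>b\<in>Lc. if a \<boxplus> b = j then (if a = \<zero>\<^sub>L \<and> b = j then F b else 0) else 0)"
    by (intro sum.cong refl) auto
  then show ?thesis using assms double_delta[of "\<zero>\<^sub>L" j j "\<lambda>a. F"] by simp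
qed

lemma delta_right: assumes "j \<in> Lc"
  shows "(\<Sum>a\<in>Lc. \<Sum>b\<in>Lc. if a \<boxplus> b = j then (if b = \<zero>\<^sub>L then F a else 0) else 0) = (F j :: 'x::comm_monoid_add)"
proof -
  have "(\<Sum>a\<in>Lc. \<Sum>b\<in>Lc. if a \<boxplus> b = j then (if b = \<zero>\<^sub>L then F a else 0) else 0)
    = (\<Sum>a\<in>Lc. \<Sum>b\<in>Lc. if a \<boxplus> b = j then (if a = j \<and> b = \<zero>\<^sub>L then F a else 0) else 0)"
    by (intro sum.cong refl) auto
  then show ?thesis using assms double_delta[of j "\<zero>\<^sub>L" j "\<lambda>a b. F a"] by simp
qed

lemma counit_bilinear:
  "bilinear H H H (\<lambda>a b. counit H a \<odot>\<^bsub>H\<^esub> b)" "bilinear H H H (\<lambda>a b. counit H b \<odot>\<^bsub>H\<^esub> a)"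
  using lin_homD[OF alg_homD(2)[OF counit_alg_hom]]
  by (auto intro!: bilinearI lin_homI simp: H.smult_add_left H.smult_add_right H.smult_smult mult.commute)

lemma counit_gens:
  assumes "g \<in> gens"
  shows "tensor_lift H (\<lambda>a b. counit H a \<odot>\<^bsub>H\<^esub> b) (comult H g) = g"
    and "tensor_lift H (\<lambda>a b. counit H b \<odot>\<^bsub>H\<^esub> a) (comult H g) = g"
proof -
  have l: "tensor_lift H (\<lambda>a b. counit H a \<odot>\<^bsub>H\<^esub> b) (EE X) = EL (pm_lift (\<lambda>p. Poly_Mapping.single (snd p) (eps (fst p))) X)"
    and r: "tensor_lift H (\<lambda>a b. counit H b \<odot>\<^bsub>H\<^esub> a) (EE X) = EL (pm_lift (\<lambda>p. Poly_Mapping.single (fst p) (eps (snd p))) X)"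
    if "Poly_Mapping.keys X \<subseteq> W \<times> W" for X
    by (rule tensor_lift_EE[OF counit_bilinear(1) that, of "\<lambda>s t. Poly_Mapping.single t (eps s)"]; simp add: counit_E)
       (rule tensor_lift_EE[OF counit_bilinear(2) that, of "\<lambda>s t. Poly_Mapping.single s (eps t)"]; simp add: counit_E)
  from assms have "tensor_lift H (\<lambda>a b. counit H a \<odot>\<^bsub>H\<^esub> b) (comult H g) = g \<and> tensor_lift H (\<lambda>a b. counit H b \<odot>\<^bsub>H\<^esub> a) (comult H g) = g"
  proof (cases rule: gens_cases)
    case (unit j)
    have "pm_lift (\<lambda>p. Poly_Mapping.single (snd p) (eps (fst p))) (cw ([], j)) =
        (\<Sum>a\<in>Lc. \<Sum>b\<in>Lc. if a \<boxplus> b = j then (if a = \<zero>\<^sub>L then Poly_Mapping.single ([], b) 1 else 0) else 0)"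
      "pm_lift (\<lambda>p. Poly_Mapping.single (fst p) (eps (snd p))) (cw ([], j)) =
        (\<Sum>a\<in>Lc. \<Sum>b\<in>Lc. if a \<boxplus> b = j then (if b = \<zero>\<^sub>L then Poly_Mapping.single ([], a) 1 else 0) else 0)"
      unfolding cw_Nil pm_lift_linear by (intro sum.cong refl, simp add: eps_def)+
    then show ?thesis using unit by (simp add: comult_E keys_cw l r delta_left delta_right)
  next
    case (gen i j)
    have "pm_lift (\<lambda>p. Poly_Mapping.single (snd p) (eps (fst p))) (cw ([i], j)) =
        (\<Sum>a\<in>Lc. \<Sum>b\<in>Lc. if a \<boxplus> b = j then (if a = \<zero>\<^sub>L then Poly_Mapping.single ([i], b) 1 else 0) else 0)"
      "pm_lift (\<lambda>p. Poly_Mapping.single (fst p) (eps (snd p))) (cw ([i], j)) =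
        (\<Sum>a\<in>Lc. \<Sum>b\<in>Lc. if a \<boxplus> b = j then (if b = \<zero>\<^sub>L then Poly_Mapping.single ([i], a) 1 else 0) else 0)"
      unfolding cw_gen pm_lift_linear by (intro sum.cong refl, simp add: eps_def pm_lift_linear)+
    then show ?thesis using gen by (simp add: comult_E keys_cw l r delta_left delta_right)
  qed
  then show "tensor_lift H (\<lambda>a b. counit H a \<odot>\<^bsub>H\<^esub> b) (comult H g) = g"
    "tensor_lift H (\<lambda>a b. counit H b \<odot>\<^bsub>H\<^esub> a) (comult H g) = g" by auto
qed

section \<open>Coassociativity\<close>

sublocale HT3: tensor "bosonization Q r N" "tensor_product (bosonization Q r N) (bosonization Q r N)" by unfold_locales
sublocale TH3: tensor "tensor_product (bosonization Q r N) (bosonization Q r N)" "bosonization Q r N" by unfold_locales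

sublocale T3: kalg "tensor_product (bosonization Q r N) (tensor_product (bosonization Q r N) (bosonization Q r N))"
  by (rule HT3.TP_kalg)

abbreviation "TP3 \<equiv> tensor_product H TP"
abbreviation "E3 \<equiv> (\<lambda>p. pure_tensor H TP (E (fst p)) (ptt (E (fst (snd p))) (E (snd (snd p)))))"

lemma coassoc_left:
  assumes X: "Poly_Mapping.keys X \<subseteq> W \<times> W"
  shows "tensor_assoc H H H (tensor_map TP H (comult H) id (EE X)) =
    lin_ext TP3 E3 (pm_lift (\<lambda>p. pm_lift (\<lambda>q. Poly_Mapping.single (fst q, snd q, snd p) 1) (cw (fst p))) X)"
proof -
  have id: "id \<in> lin_hom H H" by (rule lin_homI) simp_all
  note a = tensor_assoc_hom[OF H_kalg H_kalg H_kalg]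
  note m = tensor_map_hom[OF H_kalg H_kalg HH.TP_kalg H_kalg comult_lin_hom id]
  show ?thesis
  proof (rule linear_lin_ext[OF HH.TP_kalg HT3.TP_kalg lin_hom_comp[OF m(1) alg_homD(2)[OF a(1)]]])
    fix p assume "p \<in> Poly_Mapping.keys X"
    then have "p \<in> W \<times> W" using X by blast
    then have p: "fst p \<in> W" "snd p \<in> W" by (simp_all add: mem_Times_iff)
    then show "ptt (E (fst p)) (E (snd p)) \<in> carrier TP" by simp
    have l: "(\<lambda>Z. tensor_assoc H H H (pure_tensor TP H Z (E (snd p)))) \<in> lin_hom TP TP3"
      by (rule lin_hom_comp[OF TH3.pt_lin_left alg_homD(2)[OF a(1)]]) (use p in simp)
    have "tensor_assoc H H H (pure_tensor TP H (EE (cw (fst p))) (E (snd p))) =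
       lin_ext TP3 E3 (pm_lift (\<lambda>q. Poly_Mapping.single (fst q, snd q, snd p) 1) (cw (fst p)))"
    proof (rule linear_lin_ext[OF HH.TP_kalg HT3.TP_kalg l])
      fix q assume "q \<in> Poly_Mapping.keys (cw (fst p))"
      then have "q \<in> W \<times> W" using keys_cw[OF p(1)] by blast
      then have q: "fst q \<in> W" "snd q \<in> W" by (simp_all add: mem_Times_iff)
      then show "ptt (E (fst q)) (E (snd q)) \<in> carrier TP" by simp
      show "tensor_assoc H H H (pure_tensor TP H (ptt (E (fst q)) (E (snd q))) (E (snd p))) =
         lin_ext TP3 E3 (Poly_Mapping.single (fst q, snd q, snd p) 1)"
        using p q by (simp add: a(2))
      show "E3 t \<in> carrier TP3" if "t \<in> Poly_Mapping.keys (Poly_Mapping.single (fst q, snd q, snd p) (1::'k))" for t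
        using that p q by simp
    qed
    then show "tensor_assoc H H H (tensor_map TP H (comult H) id (ptt (E (fst p)) (E (snd p)))) =
       lin_ext TP3 E3 (pm_lift (\<lambda>q. Poly_Mapping.single (fst q, snd q, snd p) 1) (cw (fst p)))"
      unfolding m(2)[OF E_closed[OF p(1)] E_closed[OF p(2)]] comult_E[OF p(1)] id_apply .
    have "Poly_Mapping.keys (pm_lift (\<lambda>q. Poly_Mapping.single (fst q, snd q, snd p) (1::'k)) (cw (fst p))) \<subseteq> W \<times> W \<times> W"
      by (rule keys_pm_lift[OF keys_cw[OF p(1)]]) (use p in \<open>simp add: mem_Times_iff\<close>)
    then show "t \<in> Poly_Mapping.keys (pm_lift (\<lambda>q. Poly_Mapping.single (fst q, snd q, snd p) (1::'k)) (cw (fst p))) \<Longrightarrow> E3 t \<in> carrier TP3" for t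
      using p(1) subsetD[of _ "W \<times> W \<times> W" t] by (simp add: mem_Times_iff)
  qed
qed

lemma coassoc_right:
  assumes X: "Poly_Mapping.keys X \<subseteq> W \<times> W"
  shows "tensor_map H TP id (comult H) (EE X) =
    lin_ext TP3 E3 (pm_lift (\<lambda>p. pm_lift (\<lambda>q. Poly_Mapping.single (fst p, fst q, snd q) 1) (cw (snd p))) X)"
proof -
  have id: "id \<in> lin_hom H H" by (rule lin_homI) simp_all
  note m = tensor_map_hom[OF H_kalg H_kalg H_kalg HH.TP_kalg id comult_lin_hom]
  show ?thesis
  proof (rule linear_lin_ext[OF HH.TP_kalg HT3.TP_kalg m(1)])
    fix p assume "p \<in> Poly_Mapping.keys X"
    then have "p \<in> W \<times> W" using X by blast
    then have p: "fst p \<in> W" "snd p \<in> W" by (simp_all add: mem_Times_iff)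
    then show "ptt (E (fst p)) (E (snd p)) \<in> carrier TP" by simp
    have l: "pure_tensor H TP (E (fst p)) \<in> lin_hom TP TP3"
      by (rule HT3.pt_lin_right) (use p in simp)
    have "pure_tensor H TP (E (fst p)) (EE (cw (snd p))) =
       lin_ext TP3 E3 (pm_lift (\<lambda>q. Poly_Mapping.single (fst p, fst q, snd q) 1) (cw (snd p)))"
    proof (rule linear_lin_ext[OF HH.TP_kalg HT3.TP_kalg l])
      fix q assume "q \<in> Poly_Mapping.keys (cw (snd p))"
      then have "q \<in> W \<times> W" using keys_cw[OF p(2)] by blast
      then have q: "fst q \<in> W" "snd q \<in> W" by (simp_all add: mem_Times_iff)
      then show "ptt (E (fst q)) (E (snd q)) \<in> carrier TP" by simp
      show "pure_tensor H TP (E (fst p)) (ptt (E (fst q)) (E (snd q))) =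
         lin_ext TP3 E3 (Poly_Mapping.single (fst p, fst q, snd q) 1)"
        using p q by simp
      show "E3 t \<in> carrier TP3" if "t \<in> Poly_Mapping.keys (Poly_Mapping.single (fst p, fst q, snd q) (1::'k))" for t
        using that p q by simp
    qed
    then show "tensor_map H TP id (comult H) (ptt (E (fst p)) (E (snd p))) =
       lin_ext TP3 E3 (pm_lift (\<lambda>q. Poly_Mapping.single (fst p, fst q, snd q) 1) (cw (snd p)))"
      unfolding m(2)[OF E_closed[OF p(1)] E_closed[OF p(2)]] comult_E[OF p(2)] id_apply .
    have "Poly_Mapping.keys (pm_lift (\<lambda>q. Poly_Mapping.single (fst p, fst q, snd q) (1::'k)) (cw (snd p))) \<subseteq> W \<times> W \<times> W"
      by (rule keys_pm_lift[OF keys_cw[OF p(2)]]) (use p in \<open>simp add: mem_Times_iff\<close>)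
    then show "t \<in> Poly_Mapping.keys (pm_lift (\<lambda>q. Poly_Mapping.single (fst p, fst q, snd q) (1::'k)) (cw (snd p))) \<Longrightarrow> E3 t \<in> carrier TP3" for t
      using p(1) subsetD[of _ "W \<times> W \<times> W" t] by (simp add: mem_Times_iff)
  qed
qed

lemma sum_swap3: "(\<Sum>b\<in>S. \<Sum>c\<in>S. \<Sum>d\<in>S. F b c d) = (\<Sum>c\<in>S. \<Sum>d\<in>S. \<Sum>b\<in>S. F b c d :: 'x::comm_monoid_add)"
proof -
  have "(\<Sum>b\<in>S. \<Sum>c\<in>S. \<Sum>d\<in>S. F b c d) = (\<Sum>c\<in>S. \<Sum>b\<in>S. \<Sum>d\<in>S. F b c d)" by (rule sum.swap)
  also have "\<dots> = (\<Sum>c\<in>S. \<Sum>d\<in>S. \<Sum>b\<in>S. F b c d)" by (rule sum.cong[OF refl], rule sum.swap)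
  finally show ?thesis .
qed

text \<open>Eliminating the intermediate index writes the iterated sum as one over triples with
  total \<open>j\<close>. \<open>triple_left\<close> does so for the other bracketing, and the two
  become comparable.\<close>

lemma triple_right:
  "(\<Sum>a\<in>Lc. \<Sum>b\<in>Lc. if a \<boxplus> b = j then (\<Sum>c\<in>Lc. \<Sum>d\<in>Lc. if c \<boxplus> d = b then G a c d else 0) else 0) =
   (\<Sum>a\<in>Lc. \<Sum>c\<in>Lc. \<Sum>d\<in>Lc. if a \<boxplus> c \<boxplus> d = j then G a c d else (0 :: 'x::comm_monoid_add))"
proof (rule sum.cong[OF refl])
  fix a assume a: "a \<in> Lc"
  have "(\<Sum>b\<in>Lc. if a \<boxplus> b = j then (\<Sum>c\<in>Lc. \<Sum>d\<in>Lc. if c \<boxplus> d = b then G a c d else 0) else 0) =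
    (\<Sum>b\<in>Lc. \<Sum>c\<in>Lc. \<Sum>d\<in>Lc. if b = c \<boxplus> d then (if a \<boxplus> (c \<boxplus> d) = j then G a c d else 0) else 0)"
    by (rule sum.cong[OF refl]) (auto intro!: sum.cong sum.neutral)
  also have "\<dots> = (\<Sum>c\<in>Lc. \<Sum>d\<in>Lc. if a \<boxplus> (c \<boxplus> d) = j then G a c d else 0)"
    by (subst sum_swap3) simp
  finally show "(\<Sum>b\<in>Lc. if a \<boxplus> b = j then (\<Sum>c\<in>Lc. \<Sum>d\<in>Lc. if c \<boxplus> d = b then G a c d else 0) else 0) =
    (\<Sum>c\<in>Lc. \<Sum>d\<in>Lc. if a \<boxplus> c \<boxplus> d = j then G a c d else 0)"
    using a by (simp add: L.m_assoc cong: sum.cong)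
qed

lemma triple_left:
  "(\<Sum>a\<in>Lc. \<Sum>b\<in>Lc. if a \<boxplus> b = j then (\<Sum>c\<in>Lc. \<Sum>d\<in>Lc. if c \<boxplus> d = a then G c d b else 0) else 0) =
   (\<Sum>c\<in>Lc. \<Sum>d\<in>Lc. \<Sum>b\<in>Lc. if c \<boxplus> d \<boxplus> b = j then G c d b else (0 :: 'x::comm_monoid_add))"
proof -
  have "(\<Sum>a\<in>Lc. if a \<boxplus> b = j then (\<Sum>c\<in>Lc. \<Sum>d\<in>Lc. if c \<boxplus> d = a then G c d b else 0) else 0) =
    (\<Sum>c\<in>Lc. \<Sum>d\<in>Lc. if c \<boxplus> d \<boxplus> b = j then G c d b else 0)" for b
  proof -
    have "(\<Sum>a\<in>Lc. if a \<boxplus> b = j then (\<Sum>c\<in>Lc. \<Sum>d\<in>Lc. if c \<boxplus> d = a then G c d b else 0) else 0) =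
      (\<Sum>a\<in>Lc. \<Sum>c\<in>Lc. \<Sum>d\<in>Lc. if a = c \<boxplus> d then (if c \<boxplus> d \<boxplus> b = j then G c d b else 0) else 0)"
      by (rule sum.cong[OF refl]) (auto intro!: sum.cong sum.neutral)
    then show ?thesis by (simp add: sum_swap3[where F="\<lambda>a c d. if a = c \<boxplus> d then (if c \<boxplus> d \<boxplus> b = j then G c d b else 0) else 0"])
  qed
  then show ?thesis
    by (subst sum.swap, subst sum_swap3[symmetric]) simp
qed

lemma coassoc_gens: assumes "g \<in> gens"
  shows "tensor_assoc H H H (tensor_map TP H (comult H) id (comult H g)) = tensor_map H TP id (comult H) (comult H g)"
  using assms
proof (cases rule: gens_cases)
  case (unit j)
  have "pm_lift (\<lambda>p. pm_lift (\<lambda>q. Poly_Mapping.single (fst q, snd q, snd p) (1::'k)) (cw (fst p))) (cw ([], j)) =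
    pm_lift (\<lambda>p. pm_lift (\<lambda>q. Poly_Mapping.single (fst p, fst q, snd q) 1) (cw (snd p))) (cw ([], j))"
    by (simp add: cw_Nil pm_lift_linear pm_lift_if triple_left triple_right cong: if_cong)
  then show ?thesis using unit by (simp add: comult_E keys_cw coassoc_left coassoc_right)
next
  case (gen i j)
  let ?s = "\<lambda>p q t. Poly_Mapping.single (p, q, t)"
  \<comment> \<open>The three terms of the twofold coproduct of a generator: the letter in the
    first, second or third leg, with the character on all legs before it.\<close>
  define G where "G c d b = ?s ([i], c) ([], d) ([], b) 1 + ?s ([], c) ([i], d) ([], b) (gm [i] c) + ?s ([], c) ([], d) ([i], b) (gm [i] (c \<boxplus> d))" for c d b :: "nat \<Rightarrow> int"
  have l: "pm_lift (\<lambda>q. ?s (fst q) (snd q) ([], b) (1::'k)) (cw ([i], a)) + pm_scale (gm [i] a) (pm_lift (\<lambda>q. ?s (fst q) (snd q) ([i], b) 1) (cw ([], a)))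
    = (\<Sum>c\<in>Lc. \<Sum>d\<in>Lc. if c \<boxplus> d = a then G c d b else 0)" for a b
    unfolding cw_gen cw_Nil pm_lift_linear pm_scale_sum pm_lift_if sum.distrib[symmetric]
    by (intro sum.cong refl) (auto simp: pm_lift_linear G_def)
  have r: "pm_lift (\<lambda>q. ?s ([i], a) (fst q) (snd q) (1::'k)) (cw ([], b)) + pm_scale (gm [i] a) (pm_lift (\<lambda>q. ?s ([], a) (fst q) (snd q) 1) (cw ([i], b)))
    = (\<Sum>c\<in>Lc. \<Sum>d\<in>Lc. if c \<boxplus> d = b then G a c d else 0)" if "a \<in> Lc" for a b
    unfolding cw_gen cw_Nil pm_lift_linear pm_scale_sum pm_lift_if sum.distrib[symmetric]
    using that gen by (intro sum.cong refl) (auto simp: pm_lift_linear pm_scale_add G_def ac_simps)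
  have "pm_lift (\<lambda>p. pm_lift (\<lambda>q. ?s (fst q) (snd q) (snd p) (1::'k)) (cw (fst p))) (cw ([i], j)) =
     (\<Sum>a\<in>Lc. \<Sum>b\<in>Lc. if a \<boxplus> b = j then (\<Sum>c\<in>Lc. \<Sum>d\<in>Lc. if c \<boxplus> d = a then G c d b else 0) else 0)"
    unfolding cw_gen[of i j] pm_lift_linear pm_lift_if by (intro sum.cong refl) (simp add: pm_lift_linear l del: prod.collapse)
  also have "\<dots> = (\<Sum>a\<in>Lc. \<Sum>b\<in>Lc. if a \<boxplus> b = j then (\<Sum>c\<in>Lc. \<Sum>d\<in>Lc. if c \<boxplus> d = b then G a c d else 0) else 0)"
    unfolding triple_left triple_right ..
  also have "\<dots> = pm_lift (\<lambda>p. pm_lift (\<lambda>q. ?s (fst p) (fst q) (snd q) (1::'k)) (cw (snd p))) (cw ([i], j))"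
    unfolding cw_gen[of i j] pm_lift_linear pm_lift_if by (intro sum.cong refl) (simp add: pm_lift_linear r del: prod.collapse)
  finally show ?thesis using gen by (simp add: comult_E keys_cw coassoc_left coassoc_right)
qed

end

section \<open>The antipode\<close>

context bosonized
begin

lemma neg_iff: "a \<in> Lc \<Longrightarrow> b \<in> Lc \<Longrightarrow> a \<boxplus> b = \<zero>\<^sub>L \<longleftrightarrow> b = \<ominus>\<^sub>L a"
  using L.inv_equality[of b a] L.m_comm[of a b] by auto

lemma neg_delta: assumes "j \<in> Lc"
  shows "(\<Sum>a\<in>Lc. \<Sum>b\<in>Lc. if a \<boxplus> b = j then (if b = \<ominus>\<^sub>L a then F a b else 0) else 0)
     = (if j = \<zero>\<^sub>L then \<Sum>a\<in>Lc. F a (\<ominus>\<^sub>L a) else (0 :: 'x::comm_monoid_add))"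
proof -
  have "(\<Sum>b\<in>Lc. if a \<boxplus> b = j then (if b = \<ominus>\<^sub>L a then F a b else 0) else 0) = (if j = \<zero>\<^sub>L then F a (\<ominus>\<^sub>L a) else 0)"
    if a: "a \<in> Lc" for a
  proof -
    have "(\<Sum>b\<in>Lc. if a \<boxplus> b = j then (if b = \<ominus>\<^sub>L a then F a b else 0) else 0) =
      (\<Sum>b\<in>Lc. if b = \<ominus>\<^sub>L a then (if j = \<zero>\<^sub>L then F a (\<ominus>\<^sub>L a) else 0) else 0)"
      by (rule sum.cong[OF refl]) (use a in auto)
    then show ?thesis using a by simp
  qed
  then show ?thesis by simp
qed

text \<open>Since \<open>x i\<close> goes to minus the inverse of its character times
  \<open>x i\<close>, and \<open>\<delta>\<close> at \<open>a\<close> to \<open>\<delta>\<close> at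
  the negative of \<open>a\<close>, reversing a product gives: a word \<open>w\<close> at index
  \<open>a\<close> goes to its braided antipode at the negative of \<open>a\<close> plus the degree
  of \<open>w\<close>, with the character value of \<open>w\<close> at \<open>a\<close> as
  scalar.\<close>

definition Sf :: "((nat \<Rightarrow> int) \<Rightarrow> (nat list \<Rightarrow>\<^sub>0 'k)) \<Rightarrow> (nat \<Rightarrow> int) \<Rightarrow> (nat list \<Rightarrow>\<^sub>0 'k)" where
  "Sf f j = (\<Sum>a\<in>Lc. antip (wscale (\<lambda>M. if a \<boxplus> dgm M \<boxplus> j = \<zero>\<^sub>L then gmm a M else 0) (f a)))"

definition ant :: "((nat \<Rightarrow> int) \<Rightarrow> (nat list \<Rightarrow>\<^sub>0 'k) set) \<Rightarrow> (nat \<Rightarrow> int) \<Rightarrow> (nat list \<Rightarrow>\<^sub>0 'k) set" where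
  "ant F = fam (Sf (\<lambda>a. rep (F a)))"

lemma Sf_in: "Tfam f \<Longrightarrow> Sf f j \<in> T"
  unfolding Sf_def by (intro words_in_sum antip_in words_in_simps(9)) auto

lemma Sf_linear: "Sf (\<lambda>j. f j + g j) = (\<lambda>j. Sf f j + Sf g j)" "Sf (\<lambda>j. pm_scale c (f j)) = (\<lambda>j. pm_scale c (Sf f j))"
  "Sf (\<lambda>j. f j - g j) = (\<lambda>j. Sf f j - Sf g j)"
  by (simp_all add: fun_eq_iff Sf_def wscale_linear antip_linear sum.distrib sum_subtractf pm_scale_sum)

text \<open>Independence of the chosen representatives; this is where the radical must be stable
  under the braided antipode.\<close>

lemma ant_fam: assumes "Tfam f" shows "ant (fam f) = fam (Sf f)"
proof -
  have r: "rep (fam f a) \<in> T" "rep (fam f a) - f a \<in> rad" if "a \<in> Lc" for a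
    using rep_cl[of "f a"] assms that by (auto simp: eqv_def)
  have "Sf (\<lambda>a. rep (fam f a) - f a) j \<in> rad" for j
    unfolding Sf_def by (intro rad_sum rad_antip rad_wscale r) (use Q_nonzero in auto)
  then have "Sf (\<lambda>a. rep (fam f a)) j \<doteq> Sf f j" for j by (simp add: Sf_linear eqv_def)
  then show ?thesis
    unfolding ant_def by (intro fam_cong) (use assms r in \<open>auto simp: Sf_in\<close>)
qed

lemma ant_lin_hom: "ant \<in> lin_hom H H"
proof (rule lin_homI)
  fix F c assume "F \<in> carrier H"
  then obtain f where f: "Tfam f" "F = fam f" by (rule fam_cases)
  then show "ant F \<in> carrier H" "ant (c \<odot>\<^bsub>H\<^esub> F) = c \<odot>\<^bsub>H\<^esub> ant F"
    by (simp_all add: fam_simps ant_fam Sf_linear Sf_in fam_closed)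
next
  fix F G assume FG: "F \<in> carrier H" "G \<in> carrier H"
  obtain f where f: "Tfam f" "F = fam f" using FG(1) by (rule fam_cases)
  obtain g where g: "Tfam g" "G = fam g" using FG(2) by (rule fam_cases)
  from f g show "ant (F \<oplus>\<^bsub>H\<^esub> G) = ant F \<oplus>\<^bsub>H\<^esub> ant G"
    by (simp add: fam_simps ant_fam Sf_linear Sf_in)
qed

lemma ant_one: "ant \<one>\<^bsub>H\<^esub> = \<one>\<^bsub>H\<^esub>"
proof -
  have "Sf (\<lambda>_. 1) j = 1" if j: "j \<in> Lc" for j
  proof -
    have "dgm {#} = \<zero>\<^sub>L" "gmm a {#} = 1" for a using dgm_mset[of "[]"] gmm_mset[of a "[]"] by auto
    then have "Sf (\<lambda>_. 1) j = (\<Sum>a\<in>Lc. if a = \<ominus>\<^sub>L j then 1 else 0)"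
      unfolding Sf_def single_Nil_one[symmetric] using j
      by (intro sum.cong refl) (auto simp: neg_iff[symmetric] L.m_comm zero_list_def antip_linear simp del: single_Nil_one)
    then show ?thesis using j by simp
  qed
  then show ?thesis unfolding fam_simps by (subst ant_fam) (simp_all add: fam_def cong: restrict_cong)
qed

definition sS :: "nat list \<times> (nat \<Rightarrow> int) \<Rightarrow> ((nat list \<times> (nat \<Rightarrow> int)) \<Rightarrow>\<^sub>0 'k)" where
  "sS s = Poly_Mapping.single (rev (fst s), \<ominus>\<^sub>L (snd s \<boxplus> dg (fst s))) (cocycle (fst s) * gm (fst s) (snd s))"

lemma keys_sS: "s \<in> W \<Longrightarrow> Poly_Mapping.keys (sS s) \<subseteq> W"
  by (cases s) (auto simp: sS_def)

lemma ant_E: assumes "s \<in> W" shows "ant (E s) = EL (sS s)"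
proof -
  obtain w a where s: "s = (w, a)" by (cases s)
  have wa: "set w \<subseteq> {1..r}" "a \<in> Lc" using assms by (auto simp: s)
  have T: "Tfam (\<lambda>j. if j = a then wd w else 0)" using wa by auto
  have "Sf (\<lambda>j. if j = a then wd w else 0) j = pm_scale (cocycle w * gm w a) (if j = \<ominus>\<^sub>L (a \<boxplus> dg w) then wd (rev w) else 0)"
    if j: "j \<in> Lc" for j
  proof -
    have "Sf (\<lambda>j. if j = a then wd w else 0) j = (\<Sum>b\<in>Lc. if b = a then
        (if a \<boxplus> dg w \<boxplus> j = \<zero>\<^sub>L then Poly_Mapping.single (rev w) (gm w a * cocycle w) else 0) else 0)"
      unfolding Sf_def by (intro sum.cong refl) (simp add: wscale_linear antip_linear)
    also have "a \<boxplus> dg w \<boxplus> j = \<zero>\<^sub>L \<longleftrightarrow> j = \<ominus>\<^sub>L (a \<boxplus> dg w)" using wa j by (simp add: neg_iff)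
    finally show ?thesis using wa by (simp add: mult.commute)
  qed
  then have "fam (Sf (\<lambda>j. if j = a then wd w else 0)) = fam (\<lambda>j. pm_scale (cocycle w * gm w a) (if j = \<ominus>\<^sub>L (a \<boxplus> dg w) then wd (rev w) else 0))"
    unfolding fam_def by (intro restrict_ext) simp
  also have "\<dots> = (cocycle w * gm w a) \<odot>\<^bsub>H\<^esub> E (rev w, \<ominus>\<^sub>L (a \<boxplus> dg w))"
    unfolding E_def prod.case by (subst fam_simps) (use wa in auto)
  also have "\<dots> = EL (sS s)"
    unfolding s sS_def fst_conv snd_conv by (rule EL_single[symmetric]) (use wa in simp)
  finally show ?thesis unfolding s E_def prod.case using T by (simp add: ant_fam)
qed

lemma sS_Nil: "a \<in> Lc \<Longrightarrow> sS ([], a) = Poly_Mapping.single ([], \<ominus>\<^sub>L a) 1"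
  by (simp add: sS_def)

lemma sS_gen: "sS ([i], a) = Poly_Mapping.single ([i], \<ominus>\<^sub>L (a \<boxplus> dg [i])) (- gm [i] a)"
  by (simp add: sS_def)

lemma neg_add_cancel: "a \<in> Lc \<Longrightarrow> d \<in> Lc \<Longrightarrow> \<ominus>\<^sub>L (a \<boxplus> d) \<boxplus> d = \<ominus>\<^sub>L a"
  by (simp add: L.inv_mult L.m_assoc)

lemma neg_eq_iff: "a \<in> Lc \<Longrightarrow> b \<in> Lc \<Longrightarrow> \<ominus>\<^sub>L a = \<ominus>\<^sub>L b \<longleftrightarrow> a = b"
  by (metis L.inv_inv)

lemma mm_sS: assumes w: "set w \<subseteq> {1..r}" "j \<in> Lc"
  shows "a \<in> Lc \<Longrightarrow> pm_lift sS (mm ([], a) (w, j)) = bilin_ext mm (sS (w, j)) (sS ([], a))"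
    and "a \<in> Lc \<Longrightarrow> i \<in> {1..r} \<Longrightarrow> pm_lift sS (mm ([i], a) (w, j)) = bilin_ext mm (sS (w, j)) (sS ([i], a))"
proof -
  assume a: "a \<in> Lc"
  have "bilin_ext mm (sS (w, j)) (sS ([], a)) = (if a = j \<boxplus> dg w then sS (w, j) else 0)"
  proof -
    have d: "\<ominus>\<^sub>L (j \<boxplus> dg w) = \<ominus>\<^sub>L a \<boxplus> dg [] \<longleftrightarrow> a = j \<boxplus> dg w"
      using a w neg_eq_iff[of "j \<boxplus> dg w" a] by (simp only: dg_Nil L.r_one L.inv_closed L.m_closed dg_in) auto
    show ?thesis
      unfolding sS_Nil[OF a] unfolding sS_def fst_conv snd_conv bilin_ext_single mm_simp d by auto
  qed
  then show "pm_lift sS (mm ([], a) (w, j)) = bilin_ext mm (sS (w, j)) (sS ([], a))" by (simp add: mm_simp)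
  assume i: "i \<in> {1..r}"
  have d: "\<ominus>\<^sub>L (j \<boxplus> dg w) = \<ominus>\<^sub>L (a \<boxplus> dg [i]) \<boxplus> dg [i] \<longleftrightarrow> a = j \<boxplus> dg w"
    using a w by (simp only: neg_add_cancel neg_eq_iff dg_in L.m_closed) auto
  have e: "\<ominus>\<^sub>L (j \<boxplus> dg w \<boxplus> dg [i]) = \<ominus>\<^sub>L (j \<boxplus> dg (i # w))"
    using a w by (subst dg_append[of "[i]" w, simplified]) (simp add: L.m_ac)
  have "bilin_ext mm (sS (w, j)) (sS ([i], a)) = (if a = j \<boxplus> dg w then
      Poly_Mapping.single (rev w @ [i], \<ominus>\<^sub>L (a \<boxplus> dg [i])) (cocycle w * gm w j * - gm [i] a) else 0)"
    unfolding sS_gen unfolding sS_def fst_conv snd_conv bilin_ext_single mm_simp d by (auto simp: single_uminus)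
  also have "\<dots> = (if a = j \<boxplus> dg w then sS (i # w, j) else 0)"
  proof (cases "a = j \<boxplus> dg w")
    case True
    \<comment> \<open>At \<open>a = j\<close> plus the degree of \<open>w\<close>, the character of
      \<open>x i\<close> splits into its value at \<open>j\<close> and
      \<open>chr i (mset w)\<close>, the factor by which \<open>cocycle\<close> grows. The minus
      sign comes from the antipode of a letter.\<close>
    have "cocycle w * gm w j * - gm [i] a = cocycle (i # w) * gm (i # w) j"
      using w i by (simp add: True gm_Cons[of w] ac_simps)
    then show ?thesis unfolding True e by (simp add: sS_def del: cocycle.simps)
  qed simp
  finally show "pm_lift sS (mm ([i], a) (w, j)) = bilin_ext mm (sS (w, j)) (sS ([i], a))" by (simp add: mm_simp)
qed

lemma ant_mult_gen: assumes "g \<in> gens" "F \<in> carrier H"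
  shows "ant (g \<otimes>\<^bsub>H\<^esub> F) = ant F \<otimes>\<^bsub>H\<^esub> ant g"
proof -
  obtain u a where g: "g = E (u, a)" "(u, a) \<in> W"
    and eq: "\<And>s. s \<in> W \<Longrightarrow> pm_lift sS (mm (u, a) s) = bilin_ext mm (sS s) (sS (u, a))"
    using assms(1)
  proof (cases rule: gens_cases)
    case (unit j)
    then show ?thesis using mm_sS(1) by (intro that[of "[]" j]) auto
  next
    case (gen i j)
    then show ?thesis using mm_sS(2) by (intro that[of "[i]" j]) auto
  qed
  have gc: "g \<in> carrier H" using g by simp
  note m = mult_bilinear[OF H_kalg, unfolded bilinear_def]
  show ?thesis
  proof (rule H_hom_eqI[OF H_kalg _ _ assms(2), of "\<lambda>F. ant (g \<otimes>\<^bsub>H\<^esub> F)" "\<lambda>F. ant F \<otimes>\<^bsub>H\<^esub> ant g"])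
    show "(\<lambda>F. ant (g \<otimes>\<^bsub>H\<^esub> F)) \<in> lin_hom H H"
      by (rule lin_hom_comp[OF _ ant_lin_hom]) (use m gc in blast)
    show "(\<lambda>F. ant F \<otimes>\<^bsub>H\<^esub> ant g) \<in> lin_hom H H"
      by (rule lin_hom_comp[OF ant_lin_hom, of "\<lambda>G. G \<otimes>\<^bsub>H\<^esub> ant g"]) (use m lin_homD(1)[OF ant_lin_hom gc] in blast)
    fix s assume s: "s \<in> W"
    have "ant (g \<otimes>\<^bsub>H\<^esub> E s) = ant (EL (mm (u, a) s))" using s g by (simp add: E_mult)
    also have "\<dots> = EL (pm_lift sS (mm (u, a) s))"
    proof (rule linear_lin_ext[OF H_kalg H_kalg ant_lin_hom])
      fix p assume "p \<in> Poly_Mapping.keys (mm (u, a) s)"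
      then have p: "p \<in> W" using keys_mm[OF g(2) s] by blast
      then show "E p \<in> carrier H" "ant (E p) = EL (sS p)" by (simp_all add: ant_E)
      show "q \<in> Poly_Mapping.keys (sS p) \<Longrightarrow> E q \<in> carrier H" for q using keys_sS[OF p] by blast
    qed
    also have "\<dots> = ant (E s) \<otimes>\<^bsub>H\<^esub> ant g"
      using s g by (simp add: eq ant_E EL_mult keys_sS)
    finally show "ant (g \<otimes>\<^bsub>H\<^esub> E s) = ant (E s) \<otimes>\<^bsub>H\<^esub> ant g" .
  qed
qed

lemma ant_bilinear:
  "bilinear H H H (\<lambda>a b. ant a \<otimes>\<^bsub>H\<^esub> b)" "bilinear H H H (\<lambda>a b. a \<otimes>\<^bsub>H\<^esub> ant b)"
  using lin_homD[OF ant_lin_hom]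
  by (auto intro!: bilinearI lin_homI simp: H.l_distr H.r_distr H.smult_mult_left H.smult_mult_right)

lemma smult_one_EL: "c \<odot>\<^bsub>H\<^esub> \<one>\<^bsub>H\<^esub> = EL (pm_scale c (\<Sum>a\<in>Lc. Poly_Mapping.single ([], a) 1))"
  unfolding one_EL by (rule H.lin_ext_scale[symmetric]) (use keys_one in blast)

lemma sum_neg_reindex: "(\<Sum>a\<in>Lc. F (\<ominus>\<^sub>L a)) = (\<Sum>a\<in>Lc. F a :: 'x::comm_monoid_add)"
  by (rule sum.reindex_bij_witness[of _ "\<lambda>a. \<ominus>\<^sub>L a" "\<lambda>a. \<ominus>\<^sub>L a"]) auto

lemma sum_shift_reindex: assumes "d \<in> Lc" shows "(\<Sum>a\<in>Lc. F (a \<boxplus> d)) = (\<Sum>a\<in>Lc. F a :: 'x::comm_monoid_add)"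
  by (rule sum.reindex_bij_witness[of _ "\<lambda>a. a \<boxplus> \<ominus>\<^sub>L d" "\<lambda>a. a \<boxplus> d"]) (use assms in \<open>auto simp: L.m_assoc\<close>)

lemma antipode_gens: assumes "g \<in> gens"
  shows "tensor_lift H (\<lambda>a b. ant a \<otimes>\<^bsub>H\<^esub> b) (comult H g) = counit H g \<odot>\<^bsub>H\<^esub> \<one>\<^bsub>H\<^esub>"
    and "tensor_lift H (\<lambda>a b. a \<otimes>\<^bsub>H\<^esub> ant b) (comult H g) = counit H g \<odot>\<^bsub>H\<^esub> \<one>\<^bsub>H\<^esub>"
proof -
  let ?l = "\<lambda>X. pm_lift (\<lambda>p. bilin_ext mm (sS (fst p)) (Poly_Mapping.single (snd p) 1)) X"
  let ?r = "\<lambda>X. pm_lift (\<lambda>p. bilin_ext mm (Poly_Mapping.single (fst p) 1) (sS (snd p))) X"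
  let ?one = "\<Sum>a\<in>Lc. Poly_Mapping.single ([] :: nat list, a) (1::'k)"
  have l: "tensor_lift H (\<lambda>a b. ant a \<otimes>\<^bsub>H\<^esub> b) (comult H (E s)) = EL (?l (cw s))" if "s \<in> W" for s
    unfolding comult_E[OF that]
  proof (rule tensor_lift_EE[OF ant_bilinear(1) keys_cw[OF that], of "\<lambda>s t. bilin_ext mm (sS s) (Poly_Mapping.single t 1)"])
    fix s t assume st: "s \<in> W" "t \<in> W"
    have "EL (sS s) \<otimes>\<^bsub>H\<^esub> EL (Poly_Mapping.single t 1) = EL (bilin_ext mm (sS s) (Poly_Mapping.single t 1))"
      by (rule EL_mult) (use st in \<open>simp_all add: keys_sS\<close>)
    then show "ant (E s) \<otimes>\<^bsub>H\<^esub> E t = EL (bilin_ext mm (sS s) (Poly_Mapping.single t 1))"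
      using st by (simp add: ant_E)
    show "Poly_Mapping.keys (bilin_ext mm (sS s) (Poly_Mapping.single t 1)) \<subseteq> W"
      by (rule keys_bilin_ext[of _ W _ W]) (use st in \<open>simp_all add: keys_sS keys_mm\<close>)
  qed
  have r: "tensor_lift H (\<lambda>a b. a \<otimes>\<^bsub>H\<^esub> ant b) (comult H (E s)) = EL (?r (cw s))" if "s \<in> W" for s
    unfolding comult_E[OF that]
  proof (rule tensor_lift_EE[OF ant_bilinear(2) keys_cw[OF that], of "\<lambda>s t. bilin_ext mm (Poly_Mapping.single s 1) (sS t)"])
    fix s t assume st: "s \<in> W" "t \<in> W"
    have "EL (Poly_Mapping.single s 1) \<otimes>\<^bsub>H\<^esub> EL (sS t) = EL (bilin_ext mm (Poly_Mapping.single s 1) (sS t))"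
      by (rule EL_mult) (use st in \<open>simp_all add: keys_sS\<close>)
    then show "E s \<otimes>\<^bsub>H\<^esub> ant (E t) = EL (bilin_ext mm (Poly_Mapping.single s 1) (sS t))"
      using st by (simp add: ant_E)
    show "Poly_Mapping.keys (bilin_ext mm (Poly_Mapping.single s 1) (sS t)) \<subseteq> W"
      by (rule keys_bilin_ext[of _ W _ W]) (use st in \<open>simp_all add: keys_sS keys_mm\<close>)
  qed
  have swap: "a = \<ominus>\<^sub>L b \<longleftrightarrow> b = \<ominus>\<^sub>L a" if "a \<in> Lc" "b \<in> Lc" for a b using that by auto
  have ub: "EL (?l (cw s)) = eps s \<odot>\<^bsub>H\<^esub> \<one>\<^bsub>H\<^esub> \<and> EL (?r (cw s)) = eps s \<odot>\<^bsub>H\<^esub> \<one>\<^bsub>H\<^esub>" if "E s = g" "s = ([], j)" "j \<in> Lc" for s j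
  proof -
    have "?l (cw ([], j)) = (\<Sum>a\<in>Lc. \<Sum>b\<in>Lc. if a \<boxplus> b = j then (if b = \<ominus>\<^sub>L a then Poly_Mapping.single ([], b) 1 else 0) else 0)"
      unfolding cw_Nil pm_lift_linear by (intro sum.cong refl) (auto simp: sS_Nil mm_simp)
    also have "\<dots> = pm_scale (eps ([], j)) ?one"
      unfolding neg_delta[OF that(3)] by (simp add: eps_def sum_neg_reindex[of "\<lambda>a. Poly_Mapping.single ([], a) 1"])
    finally have 1: "?l (cw ([], j)) = pm_scale (eps ([], j)) ?one" .
    have "?r (cw ([], j)) = (\<Sum>a\<in>Lc. \<Sum>b\<in>Lc. if a \<boxplus> b = j then (if b = \<ominus>\<^sub>L a then Poly_Mapping.single ([], a) 1 else 0) else 0)"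
      unfolding cw_Nil pm_lift_linear by (intro sum.cong refl) (auto simp: sS_Nil mm_simp)
    also have "\<dots> = pm_scale (eps ([], j)) ?one"
      unfolding neg_delta[OF that(3)] by (simp add: eps_def)
    finally show ?thesis unfolding that(2) 1 smult_one_EL by simp
  qed
  have gb: "EL (?l (cw s)) = eps s \<odot>\<^bsub>H\<^esub> \<one>\<^bsub>H\<^esub> \<and> EL (?r (cw s)) = eps s \<odot>\<^bsub>H\<^esub> \<one>\<^bsub>H\<^esub>"
    if "E s = g" "s = ([i], j)" "i \<in> {1..r}" "j \<in> Lc" for s i j
  proof -
    \<comment> \<open>In this order the two terms of the coproduct cancel for each pair of indices
      separately.\<close>
    have "?l (cw ([i], j)) = (\<Sum>a\<in>Lc. \<Sum>b\<in>Lc. 0)"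
      unfolding cw_gen pm_lift_linear
    proof (intro sum.cong refl)
      fix a b assume ab: "a \<in> Lc" "b \<in> Lc"
      have 1: "\<ominus>\<^sub>L (a \<boxplus> dg [i]) = b \<longleftrightarrow> \<ominus>\<^sub>L a = b \<boxplus> dg [i]"
      proof -
        have n: "\<ominus>\<^sub>L (a \<boxplus> dg [i]) \<boxplus> dg [i] = \<ominus>\<^sub>L a" by (rule neg_add_cancel) (use ab in auto)
        have "\<ominus>\<^sub>L (a \<boxplus> dg [i]) \<boxplus> dg [i] = b \<boxplus> dg [i] \<longleftrightarrow> \<ominus>\<^sub>L (a \<boxplus> dg [i]) = b"
          by (rule L.right_cancel) (use ab in auto)
        then show ?thesis unfolding n by blast
      qed
      have "bilin_ext mm (sS ([i], a)) (Poly_Mapping.single ([], b) 1) = (if \<ominus>\<^sub>L a = b \<boxplus> dg [i] then Poly_Mapping.single ([i], b) (- gm [i] a) else 0)"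
        using ab unfolding sS_gen bilin_ext_single mm_simp by (simp add: 1 single_uminus)
      moreover have "bilin_ext mm (sS ([], a)) (Poly_Mapping.single ([i], b) 1) = (if \<ominus>\<^sub>L a = b \<boxplus> dg [i] then Poly_Mapping.single ([i], b) 1 else 0)"
        using ab by (simp add: sS_Nil mm_simp)
      ultimately show "?l (if a \<boxplus> b = j then Poly_Mapping.single (([i], a), ([], b)) 1 + Poly_Mapping.single (([], a), ([i], b)) (gm [i] a) else 0) = 0"
        by (simp add: pm_lift_linear single_uminus)
    qed
    then have 1: "?l (cw ([i], j)) = 0" by simp
    let ?F = "\<lambda>b. Poly_Mapping.single ([i], b) (1::'k)"
    \<comment> \<open>In this order the two terms sit at indices that differ by the degree of
      \<open>x i\<close>, so they cancel only after reindexing the whole sum.\<close>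
    have "?r (cw ([i], j)) = (\<Sum>a\<in>Lc. \<Sum>b\<in>Lc. if a \<boxplus> b = j then (if b = \<ominus>\<^sub>L a then ?F a - ?F (\<ominus>\<^sub>L (b \<boxplus> dg [i])) else 0) else 0)"
      unfolding cw_gen pm_lift_linear
    proof (intro sum.cong refl)
      fix a b assume ab: "a \<in> Lc" "b \<in> Lc"
      have A: "bilin_ext mm (Poly_Mapping.single ([i], a) 1) (sS ([], b)) = (if b = \<ominus>\<^sub>L a then ?F a else 0)"
        using ab by (auto simp: sS_Nil mm_simp)
      have "bilin_ext mm (Poly_Mapping.single ([], a) 1) (sS ([i], b)) =
          (if a = \<ominus>\<^sub>L (b \<boxplus> dg [i]) \<boxplus> dg [i] then Poly_Mapping.single ([i], \<ominus>\<^sub>L (b \<boxplus> dg [i])) (- gm [i] b) else 0)"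
        using ab unfolding sS_gen bilin_ext_single mm_simp by (simp add: single_uminus)
      also have "a = \<ominus>\<^sub>L (b \<boxplus> dg [i]) \<boxplus> dg [i] \<longleftrightarrow> b = \<ominus>\<^sub>L a" using ab by (simp only: neg_add_cancel dg_in swap)
      finally have B: "bilin_ext mm (Poly_Mapping.single ([], a) 1) (sS ([i], b)) =
          (if b = \<ominus>\<^sub>L a then Poly_Mapping.single ([i], \<ominus>\<^sub>L (b \<boxplus> dg [i])) (- gm [i] b) else 0)" .
      have C: "gm [i] a * gm [i] b = 1" if "b = \<ominus>\<^sub>L a" using that gm_gen_inverse[of i a] \<open>i \<in> {1..r}\<close> ab by simp
      show "?r (if a \<boxplus> b = j then Poly_Mapping.single (([i], a), ([], b)) 1 + Poly_Mapping.single (([], a), ([i], b)) (gm [i] a) else 0) =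
        (if a \<boxplus> b = j then (if b = \<ominus>\<^sub>L a then ?F a - ?F (\<ominus>\<^sub>L (b \<boxplus> dg [i])) else 0) else 0)"
        using C by (auto simp: pm_lift_linear A B single_uminus)
    qed
    also have "\<dots> = 0"
    proof -
      have "(\<Sum>a\<in>Lc. ?F (\<ominus>\<^sub>L (\<ominus>\<^sub>L a \<boxplus> dg [i]))) = (\<Sum>a\<in>Lc. ?F a)"
        using sum_neg_reindex[of "\<lambda>a. ?F (\<ominus>\<^sub>L (a \<boxplus> dg [i]))"] sum_shift_reindex[of "dg [i]" "\<lambda>a. ?F (\<ominus>\<^sub>L a)"] sum_neg_reindex[of ?F] by simp
      then show ?thesis unfolding neg_delta[OF that(4)] by (simp add: sum_subtractf)
    qed
    finally have 2: "?r (cw ([i], j)) = 0" .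
    have "eps s = 0" by (simp add: that(2) eps_def)
    then show ?thesis unfolding that(2) 1 2 by simp
  qed
  have "\<exists>s\<in>W. g = E s \<and> EL (?l (cw s)) = eps s \<odot>\<^bsub>H\<^esub> \<one>\<^bsub>H\<^esub> \<and> EL (?r (cw s)) = eps s \<odot>\<^bsub>H\<^esub> \<one>\<^bsub>H\<^esub>"
    using assms
  proof (cases rule: gens_cases)
    case (unit j)
    then show ?thesis using ub[of "([], j)" j] by (intro bexI[of _ "([], j)"]) simp_all
  next
    case (gen i j)
    then show ?thesis using gb[of "([i], j)" i j] by (intro bexI[of _ "([i], j)"]) simp_all
  qed
  then obtain s where s: "s \<in> W" "g = E s" "EL (?l (cw s)) = eps s \<odot>\<^bsub>H\<^esub> \<one>\<^bsub>H\<^esub>" "EL (?r (cw s)) = eps s \<odot>\<^bsub>H\<^esub> \<one>\<^bsub>H\<^esub>" by blast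
  show "tensor_lift H (\<lambda>a b. ant a \<otimes>\<^bsub>H\<^esub> b) (comult H g) = counit H g \<odot>\<^bsub>H\<^esub> \<one>\<^bsub>H\<^esub>"
    "tensor_lift H (\<lambda>a b. a \<otimes>\<^bsub>H\<^esub> ant b) (comult H g) = counit H g \<odot>\<^bsub>H\<^esub> \<one>\<^bsub>H\<^esub>"
    unfolding s(2) l[OF s(1)] r[OF s(1)] counit_E[OF s(1)] s(3,4) by (rule refl)+
qed

theorem hopf: "hopf_algebra H"
  by (rule hopf_algebra_by_generators[OF H_kalg gens_closed gens_span comult_alg_hom counit_alg_hom
        coassoc_gens counit_gens ant_lin_hom ant_one ant_mult_gen antipode_gens])

end

section \<open>Integrals of the bosonization\<close>

context bosonized
begin

definition dfam :: "(nat list \<Rightarrow>\<^sub>0 'k) \<Rightarrow> (nat \<Rightarrow> int) \<Rightarrow> (nat \<Rightarrow> int) \<Rightarrow> (nat list \<Rightarrow>\<^sub>0 'k) set" where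
  "dfam f a = fam (\<lambda>j. if j = a then f else 0)"

lemma dfam_closed: "f \<in> T \<Longrightarrow> dfam f a \<in> carrier H"
  unfolding dfam_def by (rule fam_closed) simp

lemma dfam_linear:
  "f \<in> T \<Longrightarrow> g \<in> T \<Longrightarrow> dfam (f + g) a = dfam f a \<oplus>\<^bsub>H\<^esub> dfam g a"
  "f \<in> T \<Longrightarrow> dfam (pm_scale c f) a = c \<odot>\<^bsub>H\<^esub> dfam f a"
  "dfam 0 a = \<zero>\<^bsub>H\<^esub>"
proof -
  show "dfam (f + g) a = dfam f a \<oplus>\<^bsub>H\<^esub> dfam g a" if "f \<in> T" "g \<in> T"
    unfolding dfam_def using that by (subst fam_simps(3)) (auto intro!: arg_cong[where f=fam])
  show "dfam (pm_scale c f) a = c \<odot>\<^bsub>H\<^esub> dfam f a" if "f \<in> T"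
    unfolding dfam_def using that by (subst fam_simps(4)) (auto intro!: arg_cong[where f=fam])
  show "dfam 0 a = \<zero>\<^bsub>H\<^esub>" unfolding dfam_def by (simp add: fam_simps)
qed

text \<open>The derivatives of the socle element span the Nichols algebra, and only chains whose
  multiset is contained in \<open>d\<close> give a nonzero derivative: finitely many, to be combined
  with finitely many group elements.\<close>

lemma fin_dim:
  assumes t: "right_socle t" "has_degree d t" "t \<notin> rad"
  shows "vectorspace.fin_dim class_ring H"
proof -
  have tT: "t \<in> T" using t by (simp add: right_socle_def)
  have lT: "lders u t \<in> T" for u using tT by simp
  define U where "U = {u. set u \<subseteq> set_mset d \<and> length u \<le> size d}"
  have finU: "finite U" unfolding U_def by (rule finite_lists_length_le) simp
  define A where "A = (\<lambda>(u, a). dfam (lders u t) a) ` (U \<times> Lc)"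
  have A: "finite A" "A \<subseteq> carrier H" using finU dfam_closed[OF lT] by (auto simp: A_def)
  interpret V: vectorspace class_ring H by (rule H.kvectorspace)
  note span = span_closed[OF H.kmodule A(2)]
  have gen: "dfam (lders u t) a \<in> V.span A" if a: "a \<in> Lc" for u a
  proof (cases "mset u \<subseteq># d")
    case True
    then have "u \<in> U" using set_mset_mono[OF True] size_mset_mono[OF True] by (simp add: U_def)
    then show ?thesis using a by (intro span(1)) (auto simp: A_def)
  next
    case False
    then show ?thesis using span(2) by (simp add: lders_eq_zero[OF t(2)] dfam_linear(3))
  qed
  have lift: "dfam (pm_lift (\<lambda>u. lders u t) c) a \<in> V.span A \<and> pm_lift (\<lambda>u. lders u t) c \<in> T" if a: "a \<in> Lc" for c a
  proof -
    have "dfam (\<Sum>u\<in>S. pm_scale (Poly_Mapping.lookup c u) (lders u t)) a \<in> V.span A \<and> (\<Sum>u\<in>S. pm_scale (Poly_Mapping.lookup c u) (lders u t)) \<in> T"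
      if "finite S" for S
      using that
    proof (induction S rule: finite_induct)
      case empty
      then show ?case using span(2) by (simp add: dfam_linear(3))
    next
      case (insert u S)
      have "dfam (pm_scale (Poly_Mapping.lookup c u) (lders u t)) a \<in> V.span A"
        unfolding dfam_linear(2)[OF lT] by (rule span(4)[OF gen[OF a]])
      moreover have s: "pm_scale (Poly_Mapping.lookup c u) (lders u t) \<in> T" by (rule words_in_simps(2)[OF lT])
      ultimately show ?case
        using insert span(3) unfolding sum.insert[OF insert(1,2)] by (simp only: dfam_linear(1)[OF s] words_in_simps(4)[OF s])
    qed
    from this[OF finite_keys] show ?thesis unfolding pm_lift_def .
  qed
  have "carrier H \<subseteq> V.span A"
  proof (rule subsetI)
    fix F assume "F \<in> carrier H"
    then obtain f where f: "Tfam f" "F = fam f" by (rule fam_cases)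
    have "\<exists>c. f a \<doteq> pm_lift (\<lambda>u. lders u t) c" if "a \<in> Lc" for a
      by (rule socle_span[OF t]) (use f that in simp)
    then obtain c where c: "\<And>a. a \<in> Lc \<Longrightarrow> f a \<doteq> pm_lift (\<lambda>u. lders u t) (c a)" by metis
    let ?g = "\<lambda>a. pm_lift (\<lambda>u. lders u t) (c a)"
    have gT: "?g a \<in> T" if "a \<in> Lc" for a using lift[OF that] by blast
    have "F = fam ?g" unfolding f(2) by (rule fam_cong) (use f gT c in auto)
    also have "\<dots> = fam (\<lambda>j. \<Sum>a\<in>Lc. if j = a then ?g a else 0)" unfolding fam_def by (rule restrict_ext) simp
    also have "\<dots> = (\<Oplus>\<^bsub>H\<^esub>a\<in>Lc. dfam (?g a) a)"
      unfolding dfam_def by (rule fam_finsum[symmetric]) (use gT in auto)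
    finally have F: "F = (\<Oplus>\<^bsub>H\<^esub>a\<in>Lc. dfam (?g a) a)" .
    have "(\<Oplus>\<^bsub>H\<^esub>a\<in>S. dfam (?g a) a) \<in> V.span A" if "finite S" "S \<subseteq> Lc" for S
      using that
    proof (induction S rule: finite_induct)
      case (insert a S)
      have "(\<Oplus>\<^bsub>H\<^esub>a\<in>insert a S. dfam (?g a) a) = dfam (?g a) a \<oplus>\<^bsub>H\<^esub> (\<Oplus>\<^bsub>H\<^esub>a\<in>S. dfam (?g a) a)"
        by (rule H.finsum_insert) (use insert gT dfam_closed in auto)
      moreover have "dfam (?g a) a \<in> V.span A" using insert lift by simp
      ultimately show ?case using insert span(3) by simp
    qed (use span(2) in simp)
    from this[OF finite_Lc order.refl] show "F \<in> V.span A" using F by simp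
  qed
  then have "V.span A = carrier H" using span(5) by (rule equalityI[rotated])
  then show ?thesis unfolding V.fin_dim_def using A by (intro exI[of _ A]) simp
qed

text \<open>A word with at least one letter kills \<open>t\<close> already with its first letter, so
  only the constant term of \<open>f\<close> acts.\<close>

lemma mult_augmentation:
  assumes "\<And>i. i \<in> {1..r} \<Longrightarrow> t * x i \<in> rad" "t \<in> T" "f \<in> T"
  shows "t * f \<doteq> pm_scale (Poly_Mapping.lookup f []) t"
proof -
  have "t * wd w \<doteq> (if w = [] then t else 0)" if w: "w \<in> Poly_Mapping.keys f" for w
  proof (cases w)
    case (Cons i w')
    have "set w \<subseteq> {1..r}" using w assms(3) unfolding words_in_def lists_eq_set by blast
    then have "t * x i \<in> rad" "wd w' \<in> T" using assms(1)[of i] by (auto simp: Cons)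
    then have "t * x i * wd w' \<in> rad" by (rule rad_mult_right)
    then show ?thesis by (simp add: Cons eqv_zero_iff mult.assoc)
  qed simp
  moreover have "wd w \<in> T" if "w \<in> Poly_Mapping.keys f" for w
    using that assms(3) by (auto simp: words_in_def lists_eq_set)
  ultimately have "pm_lift (\<lambda>w. t * wd w) f \<doteq> pm_lift (\<lambda>w. if w = [] then t else 0) f" by (intro eqv_pm_lift) auto
  moreover have "pm_lift (\<lambda>w. t * wd w) f = t * f"
    by (rule pm_linear_eq_pm_lift[OF pm_linear_mult_right, symmetric])
  moreover have "pm_lift (\<lambda>w. if w = [] then t else 0) f = pm_scale (Poly_Mapping.lookup f []) t"
    by (cases "[] \<in> Poly_Mapping.keys f") (simp_all add: pm_lift_def if_distrib[of "pm_scale _"] not_in_keys_iff_lookup_eq_zero cong: if_cong)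
  ultimately show ?thesis by simp
qed

lemma augmentation_mult:
  assumes "\<And>i. i \<in> {1..r} \<Longrightarrow> x i * t \<in> rad" "t \<in> T" "f \<in> T"
  shows "f * t \<doteq> pm_scale (Poly_Mapping.lookup f []) t"
proof -
  have "wd w * t \<doteq> (if w = [] then t else 0)" if w: "w \<in> Poly_Mapping.keys f" for w
  proof (cases w rule: rev_cases)
    case (snoc w' i)
    have s: "set w \<subseteq> {1..r}" using w assms(3) unfolding words_in_def lists_eq_set by blast
    then have "x i * t \<in> rad" "wd w' \<in> T" using assms(1)[of i] by (auto simp: snoc)
    then have "wd w' * (x i * t) \<in> rad" by (rule rad_mult_left)
    moreover have "wd w * t = wd w' * (x i * t)" by (simp add: snoc flip: mult.assoc)
    ultimately show ?thesis by (simp add: snoc eqv_zero_iff)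
  qed simp
  then have "pm_lift (\<lambda>w. wd w * t) f \<doteq> pm_lift (\<lambda>w. if w = [] then t else 0) f" by (intro eqv_pm_lift) auto
  moreover have "pm_lift (\<lambda>w. wd w * t) f = f * t"
    by (rule pm_linear_eq_pm_lift[OF pm_linear_mult_left, symmetric])
  moreover have "pm_lift (\<lambda>w. if w = [] then t else 0) f = pm_scale (Poly_Mapping.lookup f []) t"
    by (cases "[] \<in> Poly_Mapping.keys f") (simp_all add: pm_lift_def if_distrib[of "pm_scale _"] not_in_keys_iff_lookup_eq_zero cong: if_cong)
  ultimately show ?thesis by simp
qed

lemma act_has_degree: "has_degree M h \<Longrightarrow> act f j h = f (j \<boxplus> dgm M) * h"
proof -
  assume h: "has_degree M h"
  have "act f j h = pm_lift (\<lambda>w. f (j \<boxplus> dgm M) * wd w) h"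
    unfolding act_def by (rule pm_lift_cong) (use h in \<open>auto simp: has_degree_def simp flip: dgm_mset\<close>)
  also have "\<dots> = f (j \<boxplus> dgm M) * h" by (rule pm_linear_eq_pm_lift[OF pm_linear_mult_right, symmetric])
  finally show ?thesis .
qed

lemma dgm_in: "dgm M \<in> Lc"
  using N_pos by (auto simp: dgm_def Lam_carrier)

section \<open>Left and right integrals, and when they agree\<close>

context
  fixes t d
  assumes t: "right_socle t" "has_degree d t" "t \<notin> rad"
begin

lemma top_T: "t \<in> T" and top_right: "i \<in> {1..r} \<Longrightarrow> t * x i \<in> rad" and top_left: "i \<in> {1..r} \<Longrightarrow> x i * t \<in> rad"
  using t(1) right_socle_is_left_socle[OF t] by (auto simp: right_socle_def left_socle_def)

text \<open>The integral equation is exploited only for the idempotent at 0, of counit 1, and for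
  the generators \<open>x i\<close>, of counit 0; these already determine the integrals.\<close>

lemma integral_test:
  assumes "\<And>h. h \<in> carrier H \<Longrightarrow> P h" shows "P (E ([], \<zero>\<^sub>L))" "i \<in> {1..r} \<Longrightarrow> P (fam (\<lambda>_. x i))"
  by (rule assms; auto intro!: fam_closed)+

text \<open>The idempotent at 0, multiplied from the right, leaves only the component there; being
  annihilated by the \<open>x i\<close> then puts this component into the right socle, a
  line.\<close>

lemma right_integrals_eq: "right_integrals H = range (\<lambda>c. dfam (pm_scale c t) \<zero>\<^sub>L)"
proof (intro equalityI subsetI)
  fix F assume "F \<in> right_integrals H"
  then have F: "F \<in> carrier H" and int: "\<And>h. h \<in> carrier H \<Longrightarrow> F \<otimes>\<^bsub>H\<^esub> h = counit H h \<odot>\<^bsub>H\<^esub> F" by (auto simp: right_integrals_def)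
  obtain f where f: "Tfam f" "F = fam f" using F by (rule fam_cases)
  have "F \<otimes>\<^bsub>H\<^esub> E ([], \<zero>\<^sub>L) = F"
    using integral_test(1)[of "\<lambda>h. F \<otimes>\<^bsub>H\<^esub> h = counit H h \<odot>\<^bsub>H\<^esub> F", OF int] F by (simp add: counit_E eps_def)
  moreover have "F \<otimes>\<^bsub>H\<^esub> E ([], \<zero>\<^sub>L) = fam (\<lambda>j. if j = \<zero>\<^sub>L then f \<zero>\<^sub>L else 0)"
  proof -
    have "act f j (if j = \<zero>\<^sub>L then wd [] else 0) = (if j = \<zero>\<^sub>L then f \<zero>\<^sub>L else 0)" for j
      using act_single[of f "\<zero>\<^sub>L" "[]"] by (simp add: act_linear)
    then show ?thesis unfolding E_def prod.case f(2) by (subst fam_mult) (use f in auto)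
  qed
  ultimately have F0: "F = dfam (f \<zero>\<^sub>L) \<zero>\<^sub>L" by (simp add: dfam_def)
  have "f \<zero>\<^sub>L * x i \<in> rad" if i: "i \<in> {1..r}" for i
  proof -
    have "F \<otimes>\<^bsub>H\<^esub> fam (\<lambda>_. x i) = counit H (fam (\<lambda>_. x i)) \<odot>\<^bsub>H\<^esub> F"
      using integral_test(2)[of "\<lambda>h. F \<otimes>\<^bsub>H\<^esub> h = counit H h \<odot>\<^bsub>H\<^esub> F", OF int i] .
    moreover have "counit H (fam (\<lambda>_. x i)) = 0" using i by (simp add: counit_fam lookup_single when_def)
    ultimately have "fam (\<lambda>j. act f j (x i)) = fam (\<lambda>_. 0)" using f i F by (simp add: fam_mult fam_simps)
    \<comment> \<open>At the index minus the degree of \<open>x i\<close>, the letter meets the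
      component of \<open>F\<close> at 0.\<close>
    then have "act f (\<ominus>\<^sub>L dg [i]) (x i) \<doteq> 0"
      by (rule fam_eqD) (use f i in auto)
    then show ?thesis by (simp add: eqv_zero_iff)
  qed
  then have "right_socle (f \<zero>\<^sub>L)" using f by (simp add: right_socle_def)
  then obtain c where c: "f \<zero>\<^sub>L \<doteq> pm_scale c t" using right_socle_unique[OF t] by blast
  have "F = dfam (pm_scale c t) \<zero>\<^sub>L" unfolding F0 dfam_def by (rule fam_cong) (use f c top_T in auto)
  then show "F \<in> range (\<lambda>c. dfam (pm_scale c t) \<zero>\<^sub>L)" by blast
next
  fix F assume "F \<in> range (\<lambda>c. dfam (pm_scale c t) \<zero>\<^sub>L)"
  then obtain c where F: "F = dfam (pm_scale c t) \<zero>\<^sub>L" by blast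
  let ?t = "pm_scale c t"
  have tT: "?t \<in> T" using top_T by simp
  have tr: "?t * x i \<in> rad" if "i \<in> {1..r}" for i using top_right[OF that] by (simp add: pm_scale_mult_left)
  have "F \<otimes>\<^bsub>H\<^esub> h = counit H h \<odot>\<^bsub>H\<^esub> F" if h: "h \<in> carrier H" for h
  proof -
    obtain g where g: "Tfam g" "h = fam g" using h by (rule fam_cases)
    let ?f = "\<lambda>j. if j = \<zero>\<^sub>L then ?t else 0"
    have "act ?f j (g j) \<doteq> pm_scale (Poly_Mapping.lookup (g \<zero>\<^sub>L) []) (?f j)" if j: "j \<in> Lc" for j
    proof -
      have "act ?f j (g j) \<doteq> pm_lift (\<lambda>w. if w = [] then ?f j else 0) (g j)"
        unfolding act_def
      proof (rule eqv_pm_lift)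
        fix w assume w: "w \<in> Poly_Mapping.keys (g j)"
        have "set w \<subseteq> {1..r}" using w g j unfolding words_in_def lists_eq_set by blast
        then have "?t * wd w \<doteq> pm_scale (Poly_Mapping.lookup (wd w) []) ?t" by (intro mult_augmentation tr tT) simp_all
        then show "?f (j \<boxplus> dg w) * wd w \<doteq> (if w = [] then ?f j else 0)"
          using j by (auto simp: lookup_single when_def)
      qed
      also have "pm_lift (\<lambda>w. if w = [] then ?f j else 0) (g j) = pm_scale (Poly_Mapping.lookup (g j) []) (?f j)"
        by (cases "[] \<in> Poly_Mapping.keys (g j)") (simp_all add: pm_lift_def if_distrib[of "pm_scale _"] not_in_keys_iff_lookup_eq_zero cong: if_cong)
      also have "\<dots> = pm_scale (Poly_Mapping.lookup (g \<zero>\<^sub>L) []) (?f j)" by simp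
      finally show ?thesis .
    qed
    then have "fam (\<lambda>j. act ?f j (g j)) = fam (\<lambda>j. pm_scale (Poly_Mapping.lookup (g \<zero>\<^sub>L) []) (?f j))"
      by (intro fam_cong) (use g tT in auto)
    then show ?thesis unfolding F g(2) dfam_def counit_fam[OF g(1)]
      by (subst fam_mult) (use g tT in \<open>simp_all add: fam_simps\<close>)
  qed
  then show "F \<in> right_integrals H" using dfam_closed[OF tT] F by (simp add: right_integrals_def)
qed

text \<open>From the left, \<open>x i\<close> meets every component, so all components are multiples
  of \<open>t\<close>. The idempotent at 0 must then pass \<open>t\<close>, whose degree shifts it,
  and this leaves only the component at minus the degree.\<close>

lemma left_integrals_eq:
  shows "left_integrals H = range (\<lambda>c. dfam (pm_scale c t) (\<ominus>\<^sub>L dgm d))"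
proof (intro equalityI subsetI)
  fix F assume "F \<in> left_integrals H"
  then have F: "F \<in> carrier H" and int: "\<And>h. h \<in> carrier H \<Longrightarrow> h \<otimes>\<^bsub>H\<^esub> F = counit H h \<odot>\<^bsub>H\<^esub> F" by (auto simp: left_integrals_def)
  obtain f where f: "Tfam f" "F = fam f" using F by (rule fam_cases)
  let ?e = "\<lambda>j. if j = \<zero>\<^sub>L then wd [] else 0"
  have "E ([], \<zero>\<^sub>L) \<otimes>\<^bsub>H\<^esub> F = F"
    using integral_test(1)[of "\<lambda>h. h \<otimes>\<^bsub>H\<^esub> F = counit H h \<odot>\<^bsub>H\<^esub> F", OF int] F by (simp add: counit_E eps_def)
  then have "fam (\<lambda>j. act ?e j (f j)) = fam f" unfolding E_def prod.case f(2) by (subst (asm) fam_mult) (use f in auto)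
  then have deg: "act ?e j (f j) \<doteq> f j" if "j \<in> Lc" for j by (rule fam_eqD) (use f that in auto)
  have "\<exists>c. f j \<doteq> pm_scale c t" if j: "j \<in> Lc" for j
  proof (rule left_socle_unique[OF Q_nonzero t])
    have "x i * f j \<in> rad" if i: "i \<in> {1..r}" for i
    proof -
      have "fam (\<lambda>_. x i) \<otimes>\<^bsub>H\<^esub> F = counit H (fam (\<lambda>_. x i)) \<odot>\<^bsub>H\<^esub> F"
        using integral_test(2)[of "\<lambda>h. h \<otimes>\<^bsub>H\<^esub> F = counit H h \<odot>\<^bsub>H\<^esub> F", OF int i] .
      moreover have "counit H (fam (\<lambda>_. x i)) = 0" using i by (simp add: counit_fam lookup_single when_def)
      ultimately have "fam (\<lambda>j. act (\<lambda>_. x i) j (f j)) = fam (\<lambda>_. 0)" using f i F by (simp add: fam_mult fam_simps)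
      then have "act (\<lambda>_. x i) j (f j) \<doteq> 0" by (rule fam_eqD) (use f i j in auto)
      moreover have "act (\<lambda>_. x i) j (f j) = x i * f j"
        unfolding act_def by (rule pm_linear_eq_pm_lift[OF pm_linear_mult_right, symmetric])
      ultimately show ?thesis by (simp add: eqv_zero_iff)
    qed
    then show "left_socle (f j)" using f j by (simp add: left_socle_def)
  qed auto
  then obtain c where c: "\<And>j. j \<in> Lc \<Longrightarrow> f j \<doteq> pm_scale (c j) t" by metis
  let ?b = "\<ominus>\<^sub>L dgm d"
  have z: "f j \<doteq> 0" if j: "j \<in> Lc" "j \<noteq> ?b" for j
  proof -
    have "f j \<doteq> act ?e j (f j)" by (rule eqv_sym[OF deg[OF j(1)]])
    also have "\<dots> \<doteq> act ?e j (pm_scale (c j) t)" by (rule act_cong[OF _ j(1) c[OF j(1)]]) simp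
    also have "j \<boxplus> dgm d \<noteq> \<zero>\<^sub>L" using j dgm_in L.inv_equality[of j "dgm d"] by auto
    then have "act ?e j (pm_scale (c j) t) = 0" by (simp add: act_linear act_has_degree[OF t(2)])
    finally show ?thesis .
  qed
  have "F = dfam (pm_scale (c ?b) t) ?b" unfolding f(2) dfam_def
    by (rule fam_cong) (use f c z top_T dgm_in in auto)
  then show "F \<in> range (\<lambda>c. dfam (pm_scale c t) ?b)" by blast
next
  let ?b = "\<ominus>\<^sub>L dgm d"
  fix F assume "F \<in> range (\<lambda>c. dfam (pm_scale c t) ?b)"
  then obtain c where F: "F = dfam (pm_scale c t) ?b" by blast
  let ?t = "pm_scale c t"
  have tT: "?t \<in> T" using top_T by simp
  have td: "has_degree d ?t" using t(2) by simp
  have tr: "x i * ?t \<in> rad" if "i \<in> {1..r}" for i using top_left[OF that] by (simp add: pm_scale_mult_right)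
  have "h \<otimes>\<^bsub>H\<^esub> F = counit H h \<odot>\<^bsub>H\<^esub> F" if h: "h \<in> carrier H" for h
  proof -
    obtain g where g: "Tfam g" "h = fam g" using h by (rule fam_cases)
    let ?f = "\<lambda>j. if j = ?b then ?t else 0"
    have "act g j (?f j) \<doteq> pm_scale (Poly_Mapping.lookup (g \<zero>\<^sub>L) []) (?f j)" if j: "j \<in> Lc" for j
    proof (cases "j = ?b")
      case True
      have "?b \<boxplus> dgm d = \<zero>\<^sub>L" using dgm_in by simp
      then have "act g ?b ?t = g \<zero>\<^sub>L * ?t" by (simp add: act_has_degree[OF td])
      moreover have "g \<zero>\<^sub>L * ?t \<doteq> pm_scale (Poly_Mapping.lookup (g \<zero>\<^sub>L) []) ?t"
        by (rule augmentation_mult[OF tr tT]) (use g in simp_all)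
      ultimately show ?thesis by (simp add: True)
    qed (simp add: act_linear)
    then have "fam (\<lambda>j. act g j (?f j)) = fam (\<lambda>j. pm_scale (Poly_Mapping.lookup (g \<zero>\<^sub>L) []) (?f j))"
      by (intro fam_cong) (use g tT in auto)
    then show ?thesis unfolding F g(2) dfam_def counit_fam[OF g(1)]
      by (subst fam_mult) (use g tT in \<open>simp_all add: fam_simps\<close>)
  qed
  then show "F \<in> left_integrals H" using dfam_closed[OF tT] F by (simp add: left_integrals_def)
qed

text \<open>Both spaces are lines spanned by \<open>t\<close> placed at a single group element;
  since \<open>t\<close> is nonzero, they agree only if the two positions do.\<close>

lemma integrals_eq_iff: "left_integrals H = right_integrals H \<longleftrightarrow> (\<forall>k\<in>{1..r}. int N dvd int (count d k))"
proof -
  have "dgm d = \<zero>\<^sub>L" if eq: "left_integrals H = right_integrals H"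
  proof (rule ccontr)
    assume nz: "dgm d \<noteq> \<zero>\<^sub>L"
    let ?b = "\<ominus>\<^sub>L dgm d"
    have b: "?b \<in> Lc" "?b \<noteq> \<zero>\<^sub>L" using nz dgm_in L.inv_eq_1_iff by auto
    have "dfam (pm_scale 1 t) ?b \<in> range (\<lambda>c. dfam (pm_scale c t) \<zero>\<^sub>L)"
      using eq unfolding left_integrals_eq right_integrals_eq by blast
    then obtain c where "dfam t ?b = dfam (pm_scale c t) \<zero>\<^sub>L" by auto
    then have "(if ?b = ?b then t else 0) \<doteq> (if ?b = \<zero>\<^sub>L then pm_scale c t else 0)"
      unfolding dfam_def by (rule fam_eqD) (use b top_T in auto)
    then show False using b t(3) by (simp add: eqv_zero_iff)
  qed
  moreover have "left_integrals H = right_integrals H" if "dgm d = \<zero>\<^sub>L"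
    unfolding left_integrals_eq right_integrals_eq that by simp
  moreover have "dgm d = \<zero>\<^sub>L \<longleftrightarrow> (\<forall>k\<in>{1..r}. int N dvd int (count d k))"
    unfolding dgm_def Lam_simps by (auto simp: fun_eq_iff restrict_def dvd_eq_mod_eq_0)
  ultimately show ?thesis by blast
qed

end

end

lemma (in bosonized) unimodular_iff:
  assumes "right_socle t" "has_degree d t" "t \<notin> rad"
  shows "unimodular_hopf_algebra H \<longleftrightarrow> (\<forall>k\<in>{1..r}. int N dvd int (count d k))"
  unfolding unimodular_hopf_algebra_def using hopf fin_dim[OF assms] integrals_eq_iff[OF assms] by blast

section \<open>The degree of the top element modulo \<open>N\<close>\<close>

definition parity :: "nat set \<Rightarrow> nat \<Rightarrow> int" where "parity J a = (- 1) ^ card (J \<inter> {1..a})"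

lemma parity_0 [simp]: "parity J 0 = 1" by (simp add: parity_def)

lemma parity_Suc: "parity J (Suc a) = (if Suc a \<in> J then - parity J a else parity J a)"
proof -
  have "J \<inter> {1..Suc a} = (if Suc a \<in> J then insert (Suc a) (J \<inter> {1..a}) else J \<inter> {1..a})"
    using atLeastAtMostSuc_conv[of 1 a] by auto
  then show ?thesis by (simp add: parity_def)
qed

lemma parity_cases: "parity J a = 1 \<or> parity J a = - 1"
  by (simp add: parity_def minus_one_power_iff)

lemma parity_mult: assumes "1 \<le> l" "l \<le> m"
  shows "parity J (l - 1) * parity J m = (- 1) ^ card (J \<inter> {l..m})"
proof -
  have "J \<inter> {1..m} = (J \<inter> {1..l - 1}) \<union> (J \<inter> {l..m})" using assms by auto
  moreover have "(J \<inter> {1..l - 1}) \<inter> (J \<inter> {l..m}) = {}" using assms by auto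
  ultimately have "card (J \<inter> {1..m}) = card (J \<inter> {1..l - 1}) + card (J \<inter> {l..m})"
    by (simp add: card_Un_disjoint)
  then show ?thesis by (simp add: parity_def power_add flip: power_mult_distrib)
qed

definition psum :: "nat set \<Rightarrow> nat \<Rightarrow> int" where "psum J k = (\<Sum>a<k. parity J a)"

text \<open>Modulo \<open>N\<close> the exponent of the root vector on \<open>{l..m}\<close> is
  minus the product of the signs at \<open>l - 1\<close> and \<open>m\<close>: for an odd number of
  points of \<open>J\<close> the signs multiply to \<open>-1\<close> and the exponent is 1,
  otherwise they multiply to 1 and the exponent is \<open>N - 1\<close>. The letter \<open>k\<close>
  occurs in the intervals with \<open>l \<le> k \<le> m\<close>, so the sum splits into a
  product.\<close>

lemma degree_cong:
  fixes N :: nat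
  assumes N: "0 < N" and k: "1 \<le> k" "k \<le> r"
  shows "int N dvd int (count (\<Sum>m\<in>{1..r}. \<Sum>l\<in>{1..m}. repeat_mset ((if odd (card (J \<inter> {l..m})) then 2 else N) - 1) (mset_set {l..m})) k)
      \<longleftrightarrow> int N dvd psum J k * (psum J (Suc r) - psum J k)"
proof -
  let ?n = "\<lambda>l m. (if odd (card (J \<inter> {l..m})) then 2 else N) - 1 :: nat"
  have cnt: "int (?n l m * count (mset_set {l..m}) k) = (if l \<le> k \<and> k \<le> m then
      (if odd (card (J \<inter> {l..m})) then 0 else int N) - parity J (l - 1) * parity J m else 0)" if "1 \<le> l" "l \<le> m" for l m
    using N by (simp add: parity_mult[OF that] of_nat_diff count_mset_set')
  have "int (count (\<Sum>m\<in>{1..r}. \<Sum>l\<in>{1..m}. repeat_mset (?n l m) (mset_set {l..m})) k) =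
     (\<Sum>m\<in>{1..r}. \<Sum>l\<in>{1..m}. int (?n l m * count (mset_set {l..m}) k))"
    by (simp add: count_sum)
  also have "\<dots> = (\<Sum>m\<in>{1..r}. \<Sum>l\<in>{1..m}. if l \<le> k \<and> k \<le> m then
      (if odd (card (J \<inter> {l..m})) then 0 else int N) - parity J (l - 1) * parity J m else 0)"
    by (intro sum.cong refl cnt) auto
  also have "\<dots> = (\<Sum>m\<in>{k..r}. \<Sum>l\<in>{1..k}. (if odd (card (J \<inter> {l..m})) then 0 else int N) - parity J (l - 1) * parity J m)"
  proof -
    have "(\<Sum>l\<in>{1..m}. if l \<le> k \<and> k \<le> m then f l m else 0) = (if k \<le> m then \<Sum>l\<in>{1..k}. f l m else 0)" for m and f :: "nat \<Rightarrow> nat \<Rightarrow> int"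
    proof (cases "k \<le> m")
      case True
      then have "(\<Sum>l\<in>{1..m}. if l \<le> k \<and> k \<le> m then f l m else 0) = (\<Sum>l\<in>{1..k}. f l m)"
        by (intro sum.mono_neutral_cong_right) auto
      then show ?thesis using True by simp
    qed simp
    then have "(\<Sum>m\<in>{1..r}. \<Sum>l\<in>{1..m}. if l \<le> k \<and> k \<le> m then f l m else 0) = (\<Sum>m\<in>{1..r}. if k \<le> m then \<Sum>l\<in>{1..k}. f l m else 0)" for f :: "nat \<Rightarrow> nat \<Rightarrow> int"
      by (intro sum.cong refl)
    also have "(\<Sum>m\<in>{1..r}. if k \<le> m then \<Sum>l\<in>{1..k}. f l m else 0) = (\<Sum>m\<in>{k..r}. \<Sum>l\<in>{1..k}. f l m)" for f :: "nat \<Rightarrow> nat \<Rightarrow> int"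
      using k by (intro sum.mono_neutral_cong_right) auto
    finally show ?thesis .
  qed
  also have "\<dots> = int N * (\<Sum>m\<in>{k..r}. \<Sum>l\<in>{1..k}. if odd (card (J \<inter> {l..m})) then 0 else 1) -
      (\<Sum>l\<in>{1..k}. parity J (l - 1)) * (\<Sum>m\<in>{k..r}. parity J m)"
    unfolding sum_subtractf sum_distrib_left sum_distrib_right
    by (intro arg_cong2[where f="(-)"] sum.cong refl) simp
  \<comment> \<open>The sign attached to the left endpoint \<open>l\<close> is the one at
    \<open>l - 1\<close>, so this sum starts with the sign at 0.\<close>
  also have "(\<Sum>l\<in>{1..k}. parity J (l - 1)) = psum J k"
    by (simp add: psum_def One_nat_def sum.atLeast1_atMost_eq)
  also have "(\<Sum>m\<in>{k..r}. parity J m) = psum J (Suc r) - psum J k"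
    using sum.atLeastLessThan_concat[of 0 k "Suc r" "parity J"] k
    by (simp only: psum_def lessThan_atLeast0 atLeastLessThanSuc_atLeastAtMost) linarith
  finally have *: "int (count (\<Sum>m\<in>{1..r}. \<Sum>l\<in>{1..m}. repeat_mset (?n l m) (mset_set {l..m})) k) =
    int N * (\<Sum>m\<in>{k..r}. \<Sum>l\<in>{1..k}. if odd (card (J \<inter> {l..m})) then 0 else 1) - psum J k * (psum J (Suc r) - psum J k)" .
  show "int N dvd int (count (\<Sum>m\<in>{1..r}. \<Sum>l\<in>{1..m}. repeat_mset (?n l m) (mset_set {l..m})) k)
      \<longleftrightarrow> int N dvd psum J k * (psum J (Suc r) - psum J k)"
    unfolding * by (simp add: dvd_diff_right_iff)
qed

lemma not_dvd_small: "2 < N \<Longrightarrow> int N dvd z \<Longrightarrow> \<bar>z\<bar> \<le> 2 \<Longrightarrow> z = 0"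
  using dvd_imp_le_int[of z "int N"] by (cases "z = 0") auto

lemma degree_condition:
  fixes N :: nat
  assumes N: "2 < N" and r: "2 \<le> r" and J: "J \<subseteq> {1..r}"
  shows "(\<forall>k\<in>{1..r}. int N dvd psum J k * (psum J (Suc r) - psum J k)) \<longleftrightarrow> J = {1..r} \<and> even r"
proof
  assume A: "\<forall>k\<in>{1..r}. int N dvd psum J k * (psum J (Suc r) - psum J k)"
  let ?T = "psum J (Suc r)"
  have p1: "psum J (Suc 0) = 1" by (simp add: psum_def)
  have pS: "psum J (Suc k) = psum J k + parity J k" for k by (simp add: psum_def)
  \<comment> \<open>For \<open>k = 1\<close> the first factor is the sign at 0, which is 1.\<close>
  have T1: "int N dvd ?T - 1" using bspec[OF A, of 1] r by (simp add: One_nat_def p1)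
  have "int N dvd psum J r * parity J r" using bspec[OF A, of r] r by (simp add: pS)
  then have "int N dvd psum J r" using parity_cases[of J r] by auto
  moreover have "psum J r = ?T - parity J r" by (simp add: pS)
  ultimately have Tr: "int N dvd ?T - parity J r" by simp
  \<comment> \<open>The conditions for \<open>k = r\<close> and \<open>k = 1\<close> differ by 1
    minus the last sign, which is 0 or 2; as \<open>N > 2\<close> the last sign is 1.\<close>
  have "int N dvd (?T - parity J r) - (?T - 1)" using Tr T1 by (rule dvd_diff)
  then have "1 - parity J r = 0" using parity_cases[of J r] by (intro not_dvd_small[OF N]) auto
  then have pr: "parity J r = 1" by simp
  \<comment> \<open>As the total is 1 modulo \<open>N\<close>, the condition at \<open>k\<close>
    involves only the partial sum \<open>s\<close> and reads that \<open>N\<close> divides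
    \<open>s\<close> times \<open>1 - s\<close>.\<close>
  have B: "int N dvd psum J k * (1 - psum J k)" if "k \<in> {1..r}" for k
  proof -
    have "psum J k * (1 - psum J k) = psum J k * (?T - psum J k) - psum J k * (?T - 1)" by (simp add: algebra_simps)
    then show ?thesis using bspec[OF A that] T1 by (metis dvd_diff dvd_mult)
  qed
  have alt: "psum J (Suc k) = (if even k then 1 else 0) \<and> parity J k = (- 1) ^ k" if "k < r" for k
    using that
  proof (induction k)
    case (Suc k)
    then have IH: "psum J (Suc k) = (if even k then 1 else 0)" "parity J k = (- 1) ^ k" by auto
    have d: "int N dvd psum J (Suc (Suc k)) * (1 - psum J (Suc (Suc k)))" using B[of "Suc (Suc k)"] Suc by auto
    have ps: "psum J (Suc (Suc k)) = psum J (Suc k) + parity J (Suc k)" by (rule pS)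
    \<comment> \<open>From a partial sum 1 the next is 0 or 2, from 0 it is 1 or -1; so
      \<open>s\<close> times \<open>1 - s\<close> is 0 or -2, and only 0 is divisible by
      \<open>N\<close>.\<close>
    have "psum J (Suc (Suc k)) * (1 - psum J (Suc (Suc k))) = 0"
      using parity_cases[of J "Suc k"] by (intro not_dvd_small[OF N d]) (auto simp: ps IH)
    then have "parity J (Suc k) = (if even k then - 1 else 1)"
      using parity_cases[of J "Suc k"] by (auto simp: ps IH split: if_splits)
    then show ?case by (auto simp: ps IH)
  qed (simp add: p1)
  obtain r' where r': "r = Suc r'" using r by (cases r) auto
  have "int N dvd psum J r" by fact
  then have "psum J r = 0" using alt[of r'] by (intro not_dvd_small[OF N]) (auto simp: r')
  then have er: "even r" using alt[of r'] by (auto simp: r' split: if_splits)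
  \<comment> \<open>The induction stops below \<open>r\<close>; at \<open>r\<close> the sign is 1
    and \<open>r\<close> is even.\<close>
  have par: "parity J k = (- 1) ^ k" if "k \<le> r" for k
    using alt[of k] that pr er by (cases "k = r") auto
  have "k \<in> J" if k: "k \<in> {1..r}" for k
  proof -
    obtain k' where k': "k = Suc k'" using k by (cases k) auto
    then show ?thesis using par[of k] par[of k'] parity_Suc[of J k'] k by (auto split: if_splits)
  qed
  then show "J = {1..r} \<and> even r" using J er by auto
next
  assume A: "J = {1..r} \<and> even r"
  have par: "parity J k = (- 1) ^ k" if "k \<le> r" for k
    using that A by (simp add: parity_def Int_absorb1)
  \<comment> \<open>Alternating signs have partial sums 0 and 1 in turn. For even \<open>r\<close>
    the total is 1, so one of the two factors vanishes at every \<open>k\<close>.\<close>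
  have ps: "psum J k = (if even k then 0 else 1)" if "k \<le> Suc r" for k
    using that
  proof (induction k)
    case (Suc k)
    then show ?case using par[of k] by (simp add: psum_def)
  qed (simp add: psum_def)
  show "\<forall>k\<in>{1..r}. int N dvd psum J k * (psum J (Suc r) - psum J k)"
  proof
    fix k assume "k \<in> {1..r}"
    then show "int N dvd psum J k * (psum J (Suc r) - psum J k)"
      using ps[of k] ps[of "Suc r"] A by (cases "even k") simp_all
  qed
qed

section \<open>Super-type A\<close>

lemma qint_geometric: "(p - 1) * qint n p = p ^ n - (1 :: 'k::field)"
  by (induction n) (simp_all add: qint_def algebra_simps)

text \<open>\<open>q\<close> and its inverse have the same order, and \<open>p - 1\<close> times the
  q-integer is \<open>p ^ n - 1\<close>. The value \<open>-1\<close> is excluded because the order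
  exceeds 2.\<close>

lemma qint_order:
  assumes q: "has_mult_order q N" "2 < N" and p: "p = q \<or> p = inverse q"
  shows "qint N p = 0" "0 < a \<Longrightarrow> a < N \<Longrightarrow> qint a p \<noteq> 0" "p ^ N = 1" "p \<noteq> 1" "p \<noteq> - 1"
proof -
  have q1: "q ^ N = 1" and qm: "\<And>m. 0 < m \<Longrightarrow> m < N \<Longrightarrow> q ^ m \<noteq> 1" using q by (auto simp: has_mult_order_def)
  have pm: "p ^ m \<noteq> 1" if "0 < m" "m < N" for m using qm[OF that] p by (auto simp: power_inverse)
  show pN: "p ^ N = 1" using p q1 by (auto simp: power_inverse)
  show p1: "p \<noteq> 1" using pm[of 1] q(2) by auto
  show "p \<noteq> - 1" using pm[of 2] q(2) by auto
  show "qint N p = 0" using qint_geometric[of p N] pN p1 by auto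
  show "qint a p \<noteq> 0" if "0 < a" "a < N" using qint_geometric[of p a] pm[OF that] by auto
qed

text \<open>Since \<open>Q (Suc i) i = 1\<close>, the edge label \<open>qtilde Q i (Suc i)\<close>
  is the single entry \<open>Q i (Suc i)\<close>, and the super-type conditions become conditions on
  single entries of \<open>Q\<close>.\<close>

lemma super_type_cases:
  fixes Q :: "nat \<Rightarrow> nat \<Rightarrow> 'k::field"
  assumes r: "2 \<le> r" and q: "has_mult_order q N" "2 < N" and J: "J \<subseteq> {1..r}"
    and st: "super_type_A r q J Q"
    and triv: "\<forall>i\<in>{1..r}. \<forall>j\<in>{1..r}. j \<noteq> i \<and> j \<noteq> i + 1 \<longrightarrow> Q i j = 1"
  shows "\<And>i. i \<in> J \<Longrightarrow> Q i i = - 1"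
    and "\<And>i. i \<in> {1..r} \<Longrightarrow> i \<notin> J \<Longrightarrow> Q i i = q \<or> Q i i = inverse q"
    and "\<And>i. 1 \<le> i \<Longrightarrow> i < r \<Longrightarrow> Q i (Suc i) = q \<or> Q i (Suc i) = inverse q"
    and "\<And>i. 1 \<le> i \<Longrightarrow> i < r \<Longrightarrow> i \<notin> J \<Longrightarrow> Q i (Suc i) = inverse (Q i i)"
    and "\<And>i. 1 \<le> i \<Longrightarrow> i < r \<Longrightarrow> Suc i \<notin> J \<Longrightarrow> Q i (Suc i) = inverse (Q (Suc i) (Suc i))"
    and "\<And>i. 1 \<le> i \<Longrightarrow> Suc i < r \<Longrightarrow> Suc i \<in> J \<Longrightarrow> Q i (Suc i) = inverse (Q (Suc i) (Suc (Suc i)))"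
proof -
  obtain r' where r': "r = Suc r'" "1 \<le> r'" using r by (cases r) auto
  have qt: "qtilde Q i (Suc i) = Q i (Suc i)" if "1 \<le> i" "i < r" for i
    using triv that by (simp add: qtilde_def)
  have top: "(Q r r)\<^sup>2 * qtilde Q r' r = q" using st by (simp add: super_type_A_def r')
  have odd: "\<And>i. i \<in> {1..r} \<Longrightarrow> i \<in> J \<Longrightarrow> Q i i = - 1 \<and> (1 < i \<and> i < r \<longrightarrow> qtilde Q (i - 1) i = inverse (qtilde Q i (Suc i)))"
    and even: "\<And>i. i \<in> {1..r} \<Longrightarrow> i \<notin> J \<Longrightarrow> (Q i i = q \<or> Q i i = inverse q) \<and>
        (1 < i \<longrightarrow> qtilde Q (i - 1) i = inverse (Q i i)) \<and> (i < r \<longrightarrow> qtilde Q i (Suc i) = inverse (Q i i))"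
    using st unfolding super_type_A_def Suc_eq_plus1[symmetric] by blast+
  show s1: "Q i i = - 1" if "i \<in> J" for i using odd[of i] that J by auto
  show s2: "Q i i = q \<or> Q i i = inverse q" if "i \<in> {1..r}" "i \<notin> J" for i using even[of i] that by auto
  show s4: "Q i (Suc i) = inverse (Q i i)" if "1 \<le> i" "i < r" "i \<notin> J" for i
    using even[of i] that qt[of i] by auto
  show s5: "Q i (Suc i) = inverse (Q (Suc i) (Suc i))" if "1 \<le> i" "i < r" "Suc i \<notin> J" for i
    using even[of "Suc i"] that qt[of i] by auto
  show s6: "Q i (Suc i) = inverse (Q (Suc i) (Suc (Suc i)))" if "1 \<le> i" "Suc i < r" "Suc i \<in> J" for i
    using odd[of "Suc i"] that qt[of i] qt[of "Suc i"] by auto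
  \<comment> \<open>The condition at the end vertex fixes the last edge: if \<open>r\<close> is in
    \<open>J\<close>, the square of \<open>-1\<close> drops out and the label is \<open>q\<close>;
    otherwise it is the inverse of the diagonal entry.\<close>
  have last: "Q r' r = q \<or> Q r' r = inverse q"
  proof (cases "r \<in> J")
    case True
    then show ?thesis using top s1[of r] qt[of r'] r' by simp
  next
    case False
    then show ?thesis using s5[of r'] s2[of r] r' by auto
  qed
  \<comment> \<open>Going down from the last edge, a vertex in \<open>J\<close> inverts the label,
    and a vertex outside \<open>J\<close> prescribes it as the inverse of its own diagonal
    entry.\<close>
  show s3: "Q i (Suc i) = q \<or> Q i (Suc i) = inverse q" if "1 \<le> i" "i < r" for i
  proof -
    have "i \<le> r'" using that r' by simp
    then have "1 \<le> i \<longrightarrow> Q i (Suc i) = q \<or> Q i (Suc i) = inverse q"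
    proof (induction i rule: inc_induct)
      case base
      then show ?case using last r' by simp
    next
      case (step i)
      show ?case
      proof (cases "Suc i \<in> J")
        case True
        then show ?thesis using step s6[of i] r' by auto
      next
        case False
        then show ?thesis using step s5[of i] s2[of "Suc i"] r' by auto
      qed
    qed
    then show ?thesis using that by simp
  qed
qed

text \<open>Lengthening the interval multiplies the self-braiding by an edge label and a diagonal
  entry. At a vertex outside \<open>J\<close> the two cancel. At a vertex in \<open>J\<close> the
  diagonal entry is \<open>-1\<close>, and the self-braiding changes between \<open>-1\<close> and
  an inverse edge label. The last clause is carried along because this change needs to know which of
  \<open>q\<close> and its inverse occurs.\<close>

lemma super_type_chi:
  fixes Q :: "nat \<Rightarrow> nat \<Rightarrow> 'k::field"
  assumes r: "2 \<le> r" and q: "has_mult_order q N" "2 < N" and J: "J \<subseteq> {1..r}"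
    and st: "super_type_A r q J Q"
    and triv: "\<forall>i\<in>{1..r}. \<forall>j\<in>{1..r}. j \<noteq> i \<and> j \<noteq> i + 1 \<longrightarrow> Q i j = 1"
    and l: "1 \<le> l" "l \<le> m" "m \<le> r"
  defines "chi \<equiv> \<lambda>m. (\<Prod>i=l..m. Q i i) * (\<Prod>i=l..<m. Q i (Suc i))"
  shows "(odd (card (J \<inter> {l..m})) \<longrightarrow> chi m = - 1) \<and>
     (even (card (J \<inter> {l..m})) \<longrightarrow> (chi m = q \<or> chi m = inverse q) \<and> (m < r \<longrightarrow> chi m = inverse (Q m (Suc m))))"
proof -
  note s = super_type_cases[OF r q J st triv]
  have q0: "q \<noteq> 0" using q by (auto simp: has_mult_order_def power_0_left)
  show ?thesis
    using l(2,3)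
  proof (induction m rule: dec_induct)
    case base
    show ?case using s(1)[of l] s(2)[of l] s(4)[of l] l base q0 by (cases "l \<in> J") (auto simp: chi_def)
  next
    case (step m)
    let ?odd = "odd (card (J \<inter> {l..m}))"
    have lm: "1 \<le> m" "m < r" using step l by auto
    have c: "chi (Suc m) = chi m * Q m (Suc m) * Q (Suc m) (Suc m)"
      using step by (simp add: chi_def atLeastLessThanSuc atLeastAtMostSuc_conv mult_ac)
    have IH: "?odd \<longrightarrow> chi m = - 1" "\<not> ?odd \<longrightarrow> chi m = inverse (Q m (Suc m))" "\<not> ?odd \<longrightarrow> chi m = q \<or> chi m = inverse q" using step lm by auto
    have u: "Q m (Suc m) = q \<or> Q m (Suc m) = inverse q" by (rule s(3)[OF lm])
    have u0: "Q m (Suc m) \<noteq> 0" using u q0 by auto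
    have set: "J \<inter> {l..Suc m} = (if Suc m \<in> J then insert (Suc m) (J \<inter> {l..m}) else J \<inter> {l..m})"
      using step by (auto simp: atLeastAtMostSuc_conv)
    show ?case
    proof (cases "Suc m \<in> J")
      case True
      then have o: "odd (card (J \<inter> {l..Suc m})) \<longleftrightarrow> \<not> ?odd" by (simp add: set)
      show ?thesis
      proof (cases ?odd)
        case o': True
        then have "chi (Suc m) = Q m (Suc m)" using IH(1) by (simp add: c s(1)[OF True])
        then show ?thesis using o o' u s(6)[OF lm(1) _ True] by simp
      next
        case o': False
        then have "chi (Suc m) = - 1" using IH(2) u0 by (simp add: c s(1)[OF True])
        then show ?thesis using o o' by simp
      qed
    next
      case False
      have z: "Q m (Suc m) * Q (Suc m) (Suc m) = 1"
        using s(5)[OF lm False] u0 by auto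
      have "chi (Suc m) = chi m" unfolding c mult.assoc z by simp
      moreover have "Q (Suc m) (Suc (Suc m)) = Q m (Suc m)" if "Suc m < r"
        using s(4)[OF _ that False] s(5)[OF lm False] by simp
      ultimately show ?thesis using IH by (auto simp: set False)
    qed
  qed
qed

theorem proposition4p11:
  fixes q :: "'k::{alg_closed_field, field_char_0}"
    and Q :: "nat \<Rightarrow> nat \<Rightarrow> 'k"
    and r n N :: nat
    and J :: "nat set"
  assumes "2 \<le> r"
    and "J \<noteq> {}" and "J \<subseteq> {1..r}"
    and "has_mult_order q N" and "N = 2 * n" and "2 < N"
    and "super_type_A r q J Q"
    and "\<forall>i\<in>{1..r}. \<forall>j\<in>{1..r}. j \<noteq> i \<and> j \<noteq> i + 1 \<longrightarrow> Q i j = 1"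
  shows "(unimodular_hopf_algebra (bosonization Q r N) \<longleftrightarrow>
            (\<forall>i\<in>{1..r}. Q i i = -1) \<and> even r) \<and>
         ((\<forall>i\<in>{1..r}. Q i i = -1) \<longleftrightarrow> J = {1..r})"
proof -
  note q = assms(4,6)
  note s = super_type_cases[OF assms(1) q assms(3,7,8)]
  note chi = super_type_chi[OF assms(1) q assms(3,7,8)]
  note o = qint_order[OF q]
  have q0: "q \<noteq> 0" using q by (auto simp: has_mult_order_def power_0_left)
  have J_iff: "(\<forall>i\<in>{1..r}. Q i i = -1) \<longleftrightarrow> J = {1..r}"
  proof
    assume A: "\<forall>i\<in>{1..r}. Q i i = -1"
    have "i \<in> J" if i: "i \<in> {1..r}" for i
    proof (rule ccontr)
      assume "i \<notin> J"
      from o(5)[OF s(2)[OF i this]] A i show False by blast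
    qed
    then show "J = {1..r}" using assms(3) by blast
  next
    assume "J = {1..r}"
    then show "\<forall>i\<in>{1..r}. Q i i = -1" using s(1) by blast
  qed
  have root: "Q i j ^ N = 1" if ij: "i \<in> {1..r}" "j \<in> {1..r}" for i j
  proof (cases "j = i")
    case e: True
    show ?thesis
    proof (cases "i \<in> J")
      case True
      \<comment> \<open>The evenness of \<open>N\<close> makes \<open>-1\<close> an
        \<open>N\<close>-th root of unity.\<close>
      show ?thesis unfolding e s(1)[OF True] assms(5) by (simp add: power_mult)
    next
      case False
      show ?thesis unfolding e by (rule o(3)[OF s(2)[OF ij(1) False]])
    qed
  next
    case ne: False
    show ?thesis
    proof (cases "j = Suc i")
      case True
      show ?thesis unfolding True by (rule o(3)[OF s(3)]) (use ij True in auto)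
    next
      case False
      then have "Q i j = 1" using assms(8) ij ne by simp
      then show ?thesis by simp
    qed
  qed
  interpret bosonized Q r N by unfold_locales (use assms(6) root in auto)
  \<comment> \<open>By \<open>super_type_chi\<close> these are the multiplicative orders of the
    self-braidings, and so the exponents at which the q-integers first vanish.\<close>
  let ?nn = "\<lambda>l m. if odd (card (J \<inter> {l..m})) then 2 else N"
  have two: "qint 2 (- 1 :: 'k) = 0" "qint 1 (- 1 :: 'k) \<noteq> 0" by (simp_all add: qint_def numeral_2_eq_2 One_nat_def)
  interpret A: type_A_braiding Q r ?nn
  proof unfold_locales
    show "Q i j \<noteq> 0" if "i \<in> {1..r}" "j \<in> {1..r}" for i j by (rule Q_nonzero[OF that])
    show "Q i j = 1" if "i \<in> {1..r}" "j \<in> {1..r}" "j \<noteq> i" "j \<noteq> Suc i" for i j using assms(8) that by simp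
    fix i :: nat assume i: "1 \<le> i"
    show "(1 + Q i i) * (1 - Q i i * Q i (Suc i)) = 0" if ir: "i < r"
    proof (cases "i \<in> J")
      case False
      have "Q i i \<noteq> 0" by (rule Q_nonzero) (use i ir in auto)
      then show ?thesis unfolding s(4)[OF i ir False] by simp
    qed (simp add: s(1))
    show "(1 + Q (Suc i) (Suc i)) * (1 - Q (Suc i) (Suc i) * Q i (Suc i)) = 0" if ir: "i < r"
    proof (cases "Suc i \<in> J")
      case False
      have "Q (Suc i) (Suc i) \<noteq> 0" by (rule Q_nonzero) (use ir in auto)
      then show ?thesis unfolding s(5)[OF i ir False] by simp
    qed (simp add: s(1))
    show "Q i (Suc i) * (Q (Suc i) (Suc i))\<^sup>2 * Q (Suc i) (Suc (Suc i)) = 1" if ir: "Suc i < r"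
    proof (cases "Suc i \<in> J")
      case True
      have "Q (Suc i) (Suc (Suc i)) \<noteq> 0" by (rule Q_nonzero) (use ir in auto)
      then show ?thesis unfolding s(1)[OF True] s(6)[OF i ir True] by simp
    next
      case False
      have "Q (Suc i) (Suc i) \<noteq> 0" by (rule Q_nonzero) (use ir in auto)
      then have one: "inverse (Q (Suc i) (Suc i)) * (Q (Suc i) (Suc i))\<^sup>2 * inverse (Q (Suc i) (Suc i)) = 1"
        by (simp add: power2_eq_square mult.assoc)
      have e: "Q i (Suc i) = inverse (Q (Suc i) (Suc i))" "Q (Suc i) (Suc (Suc i)) = inverse (Q (Suc i) (Suc i))"
        by (rule s(5), use i ir False in simp_all) (rule s(4), use i ir False in simp_all)
      show ?thesis unfolding e by (rule one)
    qed
    show "Q i (Suc i) \<noteq> 1" if "i < r" by (rule o(4)[OF s(3)[OF i that]])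
  next
    fix l m :: nat assume lm: "1 \<le> l" "l \<le> m" "m \<le> r"
    define c where "c = (\<Prod>i=l..m. Q i i) * (\<Prod>i=l..<m. Q i (Suc i))"
    have c: "odd (card (J \<inter> {l..m})) \<Longrightarrow> c = - 1" "\<not> odd (card (J \<inter> {l..m})) \<Longrightarrow> c = q \<or> c = inverse q"
      using chi[OF lm] unfolding c_def by blast+
    show "0 < ?nn l m" using assms(6) by simp
    have "qint (?nn l m) c = 0"
    proof (cases "odd (card (J \<inter> {l..m}))")
      case True
      then show ?thesis using two(1) c(1) by simp
    next
      case False
      then show ?thesis using o(1)[OF c(2)[OF False]] by simp
    qed
    then show "qint (?nn l m) ((\<Prod>i=l..m. Q i i) * (\<Prod>i=l..<m. Q i (Suc i))) = 0" unfolding c_def .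
    fix a :: nat assume a: "0 < a" "a < ?nn l m"
    have "qint a c \<noteq> 0"
    proof (cases "odd (card (J \<inter> {l..m}))")
      case True
      then have "a = 1" using a by simp
      then show ?thesis using two(2) c(1)[OF True] by simp
    next
      case False
      then show ?thesis using o(2)[OF c(2)[OF False] a(1)] a(2) by simp
    qed
    then show "qint a ((\<Prod>i=l..m. Q i i) * (\<Prod>i=l..<m. Q i (Suc i))) \<noteq> 0" unfolding c_def .
  qed
  have "(\<forall>k\<in>{1..r}. int N dvd int (count (\<Sum>m\<in>{1..r}. \<Sum>l\<in>{1..m}. repeat_mset (?nn l m - 1) (mset_set {l..m})) k)) \<longleftrightarrow>
      (\<forall>k\<in>{1..r}. int N dvd psum J k * (psum J (Suc r) - psum J k))"
    by (intro ball_cong refl degree_cong) (use assms(6) in auto)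
  then have "unimodular_hopf_algebra H \<longleftrightarrow> J = {1..r} \<and> even r"
    unfolding unimodular_iff[OF A.topel_right_socle(1,3,2)] A.deg_def degree_condition[OF assms(6,1,3)] .
  then show ?thesis unfolding J_iff by blast
qed

end
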